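(* Assume $K_h^\star\ne\emptyset$; let $p_h^{cr}\in K_h$ be a minimizer of $I_h^{cr}$ over $K_h$ and $\mathbf u_h^{rt}\in K_h^\star$ the maximizer of $D_h^{rt}$ over $K_h^\star$. For $q_h\in K_h$ and $\mathbf v_h\in K_h^\star$ define $\rho_{I,h}^2(q_h):=I_h^{cr}(q_h)-I_h^{cr}(p_h^{cr})$, $\rho_{-D,h}^2(\mathbf v_h):=-D_h^{rt}(\mathbf v_h)+D_h^{rt}(\mathbf u_h^{rt})$, the discrete total error $\rho_{{\rm tot},h}^2(q_h,\mathbf v_h):=\rho_{I,h}^2(q_h)+\rho_{-D,h}^2(\mathbf v_h)$, and the discrete primal-dual gap estimator $\eta_{{\rm gap},h}^2(q_h,\mathbf v_h):=I_h^{cr}(q_h)-D_h^{rt}(\mathbf v_h)$. Then for every $q_h\in K_h$ and every $\mathbf v_h\in K_h^\star$, $$\rho_{{\rm tot},h}^2(q_h,\mathbf v_h)=\eta_{{\rm gap},h}^2(q_h,\mathbf v_h).$$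
   Context: Setting. $\Omega\subset\mathbb R^d$, $d\in\{2,3\}$, is an open, bounded, polyhedral Lipschitz domain with outward unit normal $\mathbf n$; $\partial\Omega=\overline{\Gamma_D}\cup\overline{\Gamma_C}$ with $\Gamma_D,\Gamma_C$ relatively open and disjoint. Data: $f\in L^2(\Omega)$; $p_D\in H^{1/2}(\Gamma_D)$ (restrictions to $\Gamma_D$ of traces of $H^1(\Omega)$ functions); $\mathbf K:\Omega\to\mathbb R^{d\times d}$ measurable, symmetric, with $k_0|\xi|^2\le\xi^T\mathbf K(x)\xi\le k_1|\xi|^2$ for all $x,\xi$ and some $0<k_0<k_1$; $\alpha,\beta\in L^2(\Gamma_C)$ with $\alpha\le\beta$ a.e.; if $\Gamma_D=\emptyset$, then $\int_{\Gamma_C}\alpha\,ds\le\int_\Omega f\,dx\le\int_{\Gamma_C}\beta\,ds$. $(\cdot,\cdot)_\Omega$ and $\langle\cdot,\cdot\rangle_\omega$ denote $L^2$ inner products; $q^+=\max(0,q)$, $q^-=\max(0,-q)$. Mesh. $\mathcal T_h$ is a conforming simplicial triangulation of $\Omega$ with facets $\mathcal S_h$; every boundary facet is contained in exactly one of $\overline{\Gamma_D},\overline{\Gamma_C}$, and $\mathcal S_h^D,\mathcal S_h^C$ are the corresponding sets of boundary facets. $x_S$ is the barycenter of $S$. $\Pi_h$ and $\pi_h$ are the elementwise and facetwise $L^2$-projections onto constants (componentwise for vectors and matrices); $\nabla_h$ is the elementwise gradient. Spaces. $\mathcal{RT}^0(\mathcal T_h)=\{\mathbf v_h\in H(\mathrm{div};\Omega):\mathbf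 v_h|_T\in\mathbb P^0(T)^d\oplus\mathbf x\,\mathbb P^0(T)\ \forall T\in\mathcal T_h\}$ (lowest-order Raviart–Thomas). $\mathcal S^{1,cr}(\mathcal T_h)$ is the Crouzeix–Raviart space of elementwise affine functions continuous at barycenters of interior facets, with basis $\varphi_S$, $\varphi_S(x_{S'})=\delta_{S,S'}$. $\Pi_h^{cr}q=\sum_{S\in\mathcal S_h}\big(\tfrac1{|S|}\int_Sq\,ds\big)\varphi_S$ for $q\in H^1(\Omega)$. Discrete data. $\mathbf K_h=\Pi_h\mathbf K$, $f_h=\Pi_hf$, $\alpha_h=\pi_h\alpha$, $\beta_h=\pi_h\beta$, $p_D^h=\Pi_h^{cr}\widehat p_D$ with $\widehat p_D\in H^1(\Omega)$ any fixed function whose trace on $\Gamma_D$ is $p_D$. Admissible sets and energies. $$K_h^\star=\{\mathbf v_h\in\mathcal{RT}^0(\mathcal T_h):\mathrm{div}\,\mathbf v_h=f_h\text{ in }\Omega,\ \alpha_h\le\mathbf v_h\cdot\mathbf n\le\beta_h\text{ on every }S\in\mathcal S_h^C\},$$ $$K_h=\{q_h\in\mathcal S^{1,cr}(\mathcal T_h):q_h(x_S)=p_D^h(x_S)\ \forall S\in\mathcal S_h^D\},$$ $$D_h^{rt}(\mathbf v_h)=-\tfrac12\|\mathbf K_h^{-1/2}\Pi_h\mathbf v_h\|_{L^2(\Omega)}^2-\langle p_D^h,\mathbf v_h\cdot\mathbf n\rangle_{\Gamma_D}\quad(\mathbf v_h\in K_h^\star),$$ $$I_h^{cr}(q_h)=\tfrac12\|\mathbf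 K_h^{1/2}\nabla_hq_h\|_{L^2(\Omega)}^2-(f_h,\Pi_hq_h)_\Omega+\langle\beta_h,(\pi_hq_h)^+\rangle_{\Gamma_C}-\langle\alpha_h,(\pi_hq_h)^-\rangle_{\Gamma_C}\quad(q_h\in K_h).$$ *)

theory Defs
  imports "HOL-Analysis.Analysis"
begin

section \<open>Polyhedral Lipschitz domains\<close>

text \<open>Near each boundary point the domain is the strict epigraph of a Lipschitz function over
  the hyperplane orthogonal to some unit vector \<open>e\<close>; \<open>y - (y \<bullet> e) *\<^sub>R e\<close> is the projection onto it.\<close>

definition lipschitz_boundary :: "'a::euclidean_space set \<Rightarrow> bool" where
  "lipschitz_boundary \<Omega> \<longleftrightarrow>
     (\<forall>x\<in>frontier \<Omega>. \<exists>e U L g. norm e = 1 \<and> open U \<and> x \<in> U \<and> L-lipschitz_on UNIV (g :: 'a \<Rightarrow> real) \<and>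
        \<Omega> \<inter> U = {y \<in> U. g (y - (y \<bullet> e) *\<^sub>R e) < y \<bullet> e})"

definition polyhedral_lipschitz_domain :: "'a::euclidean_space set \<Rightarrow> bool" where
  "polyhedral_lipschitz_domain \<Omega> \<longleftrightarrow>
     open \<Omega> \<and> connected \<Omega> \<and> \<Omega> \<noteq> {} \<and> bounded \<Omega> \<and> lipschitz_boundary \<Omega> \<and>
     (\<exists>\<P>. finite \<P> \<and> (\<forall>P\<in>\<P>. polytope P) \<and> closure \<Omega> = \<Union>\<P>)"

text \<open>On a polyhedral domain this is well defined at all boundary points outside a null set
  (those where the boundary is locally a hyperplane with the domain on one side).\<close>

definition outward_normal :: "'a::euclidean_space set \<Rightarrow> 'a \<Rightarrow> 'a" where
  "outward_normal \<Omega> x =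
     (THE \<nu>. norm \<nu> = 1 \<and> (\<exists>\<epsilon>>0. \<Omega> \<inter> ball x \<epsilon> = {y \<in> ball x \<epsilon>. (y - x) \<bullet> \<nu> < 0}))"


section \<open>Surface measure on polyhedral surfaces\<close>

text \<open>The \<open>(d - 1)\<close>-dimensional Lebesgue measure on a hyperplane \<open>H\<close>: the measure of \<open>A \<subseteq> H\<close> is the
  volume of the prism of height \<open>1\<close> over \<open>A\<close> (the slab below has thickness \<open>1/2 + 1/2\<close>).\<close>

definition hyperplane_measure :: "'a::euclidean_space set \<Rightarrow> 'a measure" where
  "hyperplane_measure H =
     distr (restrict_space lborel {y. infdist y H \<le> 1/2}) borel (closest_point H)"

definition hyperplanes :: "'a::euclidean_space set set" where
  "hyperplanes = {H. affine H \<and> aff_dim H = int DIM('a) - 1}"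

text \<open>Distinct hyperplanes meet in a null set, so on every finite union of hyperplanes, in
  particular on the boundary of a polyhedral domain and on mesh facets, the sum of all hyperplane
  measures is the usual \<open>(d - 1)\<close>-dimensional surface measure.\<close>

definition surface :: "'a::euclidean_space measure" where
  "surface = completion (measure_of UNIV (sets borel)
     (\<lambda>A. \<integral>\<^sup>+ H. emeasure (hyperplane_measure H) A \<partial>count_space hyperplanes))"


section \<open>Function spaces\<close>

definition L2 :: "'a measure \<Rightarrow> ('a \<Rightarrow> 'b::euclidean_space) \<Rightarrow> bool" where
  "L2 M f \<longleftrightarrow> f \<in> borel_measurable M \<and> integrable M (\<lambda>x. (norm (f x))\<^sup>2)"

definition partial :: "'d \<Rightarrow> (real^'d \<Rightarrow> real) \<Rightarrow> real^'d \<Rightarrow> real" where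
  "partial i f x = frechet_derivative f (at x) (axis i 1)"

definition grad :: "(real^'d \<Rightarrow> real) \<Rightarrow> real^'d \<Rightarrow> real^'d" where
  "grad f x = (\<chi> i. partial i f x)"

primrec iter_partial :: "'d list \<Rightarrow> (real^'d \<Rightarrow> real) \<Rightarrow> real^'d \<Rightarrow> real" where
  "iter_partial [] f = f"
| "iter_partial (i # is) f = partial i (iter_partial is f)"

definition smooth :: "(real^'d \<Rightarrow> real) \<Rightarrow> bool" where
  "smooth f \<longleftrightarrow> (\<forall>is x. iter_partial is f differentiable (at x))"

definition test_function :: "(real^'d) set \<Rightarrow> (real^'d \<Rightarrow> real) \<Rightarrow> bool" where
  "test_function \<Omega> \<phi> \<longleftrightarrow>
     smooth \<phi> \<and> compact (closure {x. \<phi> x \<noteq> 0}) \<and> closure {x. \<phi> x \<noteq> 0} \<subseteq> \<Omega>"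

definition has_weak_grad :: "(real^'d) set \<Rightarrow> (real^'d \<Rightarrow> real) \<Rightarrow> (real^'d \<Rightarrow> real^'d) \<Rightarrow> bool" where
  "has_weak_grad \<Omega> q g \<longleftrightarrow> (\<forall>\<phi> i. test_function \<Omega> \<phi> \<longrightarrow>
     (\<integral>x. q x * partial i \<phi> x \<partial>lebesgue_on \<Omega>) = - (\<integral>x. g x $ i * \<phi> x \<partial>lebesgue_on \<Omega>))"

definition has_weak_div :: "(real^'d) set \<Rightarrow> (real^'d \<Rightarrow> real^'d) \<Rightarrow> (real^'d \<Rightarrow> real) \<Rightarrow> bool" where
  "has_weak_div \<Omega> v g \<longleftrightarrow> (\<forall>\<phi>. test_function \<Omega> \<phi> \<longrightarrow>
     (\<integral>x. v x \<bullet> grad \<phi> x \<partial>lebesgue_on \<Omega>) = - (\<integral>x. g x * \<phi> x \<partial>lebesgue_on \<Omega>))"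

definition H1 :: "(real^'d) set \<Rightarrow> (real^'d \<Rightarrow> real) set" where
  "H1 \<Omega> = {q. L2 (lebesgue_on \<Omega>) q \<and> (\<exists>g. L2 (lebesgue_on \<Omega>) g \<and> has_weak_grad \<Omega> q g)}"

definition Hdiv :: "(real^'d) set \<Rightarrow> (real^'d \<Rightarrow> real^'d) set" where
  "Hdiv \<Omega> = {v. L2 (lebesgue_on \<Omega>) v \<and> (\<exists>g. L2 (lebesgue_on \<Omega>) g \<and> has_weak_div \<Omega> v g)}"

text \<open>\<open>has_trace \<Omega> q A g\<close>: \<open>g \<in> L\<^sup>2(A)\<close> is the trace of \<open>q \<in> H\<^sup>1(\<Omega>)\<close> on the surface \<open>A \<subseteq> closure \<Omega>\<close>,
  i.e. the continuous extension of restriction to \<open>A\<close> from the functions smooth up to the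
  boundary, which are dense in \<open>H\<^sup>1(\<Omega>)\<close>. It is unique up to surface null sets.\<close>

definition has_trace ::
    "(real^'d) set \<Rightarrow> (real^'d \<Rightarrow> real) \<Rightarrow> (real^'d) set \<Rightarrow> (real^'d \<Rightarrow> real) \<Rightarrow> bool" where
  "has_trace \<Omega> q A g \<longleftrightarrow>
     q \<in> H1 \<Omega> \<and> L2 (restrict_space surface A) g \<and>
     (\<exists>G w. L2 (lebesgue_on \<Omega>) G \<and> has_weak_grad \<Omega> q G \<and> (\<forall>n::nat. smooth (w n)) \<and>
        (\<lambda>n. \<integral>x. (w n x - q x)\<^sup>2 \<partial>lebesgue_on \<Omega>) \<longlonglongrightarrow> 0 \<and>
        (\<lambda>n. \<integral>x. (norm (grad (w n) x - G x))\<^sup>2 \<partial>lebesgue_on \<Omega>) \<longlonglongrightarrow> 0 \<and>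
        (\<lambda>n. \<integral>x. (w n x - g x)\<^sup>2 \<partial>restrict_space surface A) \<longlonglongrightarrow> 0)"

definition trace_on :: "(real^'d) set \<Rightarrow> (real^'d) set \<Rightarrow> (real^'d \<Rightarrow> real) \<Rightarrow> real^'d \<Rightarrow> real" where
  "trace_on \<Omega> A q = (SOME g. has_trace \<Omega> q A g)"

definition H_half :: "(real^'d) set \<Rightarrow> (real^'d) set \<Rightarrow> (real^'d \<Rightarrow> real) set" where
  "H_half \<Omega> \<Gamma> = {p. \<exists>q\<in>H1 \<Omega>. has_trace \<Omega> q \<Gamma> p}"


section \<open>Square roots of positive semidefinite matrices\<close>

definition psd_sqrt :: "real^'d^'d \<Rightarrow> real^'d^'d" where
  "psd_sqrt A = (THE B. transpose B = B \<and> (\<forall>x. 0 \<le> x \<bullet> (B *v x)) \<and> B ** B = A)"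


section \<open>Triangulations\<close>

definition simplicial_mesh :: "'a::euclidean_space set set \<Rightarrow> 'a set \<Rightarrow> bool" where
  "simplicial_mesh \<T> \<Omega> \<longleftrightarrow>
     triangulation \<T> \<and> (\<forall>T\<in>\<T>. int DIM('a) simplex T) \<and> \<Union>\<T> = closure \<Omega>"

definition facets :: "'a::euclidean_space set set \<Rightarrow> 'a set set" where
  "facets \<T> = {S. \<exists>T\<in>\<T>. S facet_of T}"

definition boundary_facets :: "'a::euclidean_space set set \<Rightarrow> 'a set \<Rightarrow> 'a set set" where
  "boundary_facets \<T> \<Omega> = {S \<in> facets \<T>. S \<subseteq> frontier \<Omega>}"

definition facets_on :: "'a::euclidean_space set set \<Rightarrow> 'a set \<Rightarrow> 'a set \<Rightarrow> 'a set set" where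
  "facets_on \<T> \<Omega> \<Gamma> = {S \<in> boundary_facets \<T> \<Omega>. S \<subseteq> closure \<Gamma>}"

definition barycenter :: "'a::euclidean_space set \<Rightarrow> 'a" where
  "barycenter S = (let V = {x. x extreme_point_of S} in (1 / real (card V)) *\<^sub>R \<Sum>V)"

definition element_interiors :: "'a::euclidean_space set set \<Rightarrow> 'a set" where
  "element_interiors \<T> = (\<Union>T\<in>\<T>. interior T)"

text \<open>Piecewise polynomials are represented by their values on the open elements, with value \<open>0\<close>
  elsewhere (one representative per class of a.e. equal functions). Their value at a point of a
  facet is the limit from the open elements. At relative interior points of boundary
  facets this is the value of the polynomial on the only adjacent element; at the
  barycenter of an interior facet the limit exists iff the two adjacent polynomials agree there.\<close>

definition facet_value ::
    "'a::euclidean_space set set \<Rightarrow> ('a \<Rightarrow> 'b::euclidean_space) \<Rightarrow> 'a \<Rightarrow> 'b" where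
  "facet_value \<T> q x = Lim (at x within element_interiors \<T>) q"

text \<open>The \<open>L\<^sup>2\<close>-projections onto elementwise and facetwise constants, i.e. the elementwise and
  facetwise mean values. The indicators select the open element or relatively open facet.\<close>

definition elem_proj ::
    "'a::euclidean_space set set \<Rightarrow> ('a \<Rightarrow> 'b::euclidean_space) \<Rightarrow> 'a \<Rightarrow> 'b" where
  "elem_proj \<T> f x = (\<Sum>T\<in>\<T>. indicator (interior T) x *\<^sub>R
     ((1 / measure lebesgue T) *\<^sub>R (LINT y:T|lebesgue. f y)))"

definition facet_mean :: "'a::euclidean_space set \<Rightarrow> ('a \<Rightarrow> real) \<Rightarrow> real" where
  "facet_mean S g = (1 / measure surface S) * (LINT y:S|surface. g y)"

definition facet_proj :: "'a::euclidean_space set set \<Rightarrow> ('a \<Rightarrow> real) \<Rightarrow> 'a \<Rightarrow> real" where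
  "facet_proj \<T> g x = (\<Sum>S\<in>facets \<T>. indicator (rel_interior S) x * facet_mean S g)"

definition broken_grad :: "(real^'d) set set \<Rightarrow> (real^'d \<Rightarrow> real) \<Rightarrow> real^'d \<Rightarrow> real^'d" where
  "broken_grad \<T> q x = indicator (element_interiors \<T>) x *\<^sub>R grad q x"


section \<open>Raviart--Thomas and Crouzeix--Raviart spaces\<close>

definition RT0 :: "(real^'d) set set \<Rightarrow> (real^'d) set \<Rightarrow> (real^'d \<Rightarrow> real^'d) set" where
  "RT0 \<T> \<Omega> = {v \<in> Hdiv \<Omega>.
     (\<forall>T\<in>\<T>. \<exists>a b. \<forall>x\<in>interior T. v x = a + b *\<^sub>R x) \<and>
     (\<forall>x. x \<notin> element_interiors \<T> \<longrightarrow> v x = 0)}"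

definition CR1 :: "(real^'d) set set \<Rightarrow> (real^'d) set \<Rightarrow> (real^'d \<Rightarrow> real) set" where
  "CR1 \<T> \<Omega> = {q.
     (\<forall>T\<in>\<T>. \<exists>a b. \<forall>x\<in>interior T. q x = a \<bullet> x + b) \<and>
     (\<forall>S\<in>facets \<T> - boundary_facets \<T> \<Omega>.
        \<exists>l. (q \<longlongrightarrow> l) (at (barycenter S) within element_interiors \<T>)) \<and>
     (\<forall>x. x \<notin> element_interiors \<T> \<longrightarrow> q x = 0)}"

definition CR_basis ::
    "(real^'d) set set \<Rightarrow> (real^'d) set \<Rightarrow> (real^'d) set \<Rightarrow> real^'d \<Rightarrow> real" where
  "CR_basis \<T> \<Omega> S = (THE \<phi>. \<phi> \<in> CR1 \<T> \<Omega> \<and>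
     (\<forall>S'\<in>facets \<T>. facet_value \<T> \<phi> (barycenter S') = (if S' = S then 1 else 0)))"

definition CR_interp ::
    "(real^'d) set set \<Rightarrow> (real^'d) set \<Rightarrow> (real^'d \<Rightarrow> real) \<Rightarrow> real^'d \<Rightarrow> real" where
  "CR_interp \<T> \<Omega> q x = (\<Sum>S\<in>facets \<T>. facet_mean S (trace_on \<Omega> S q) * CR_basis \<T> \<Omega> S x)"


section \<open>Discrete admissible sets and energies\<close>

definition K_star :: "(real^'d) set set \<Rightarrow> (real^'d) set \<Rightarrow> (real^'d) set \<Rightarrow>
    (real^'d \<Rightarrow> real) \<Rightarrow> (real^'d \<Rightarrow> real) \<Rightarrow> (real^'d \<Rightarrow> real) \<Rightarrow> (real^'d \<Rightarrow> real^'d) set" where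
  "K_star \<T> \<Omega> \<Gamma>C fh \<alpha>h \<beta>h = {v \<in> RT0 \<T> \<Omega>. has_weak_div \<Omega> v fh \<and>
     (\<forall>S\<in>facets_on \<T> \<Omega> \<Gamma>C. \<forall>x\<in>rel_interior S.
        \<alpha>h x \<le> facet_value \<T> v x \<bullet> outward_normal \<Omega> x \<and>
        facet_value \<T> v x \<bullet> outward_normal \<Omega> x \<le> \<beta>h x)}"

definition K_primal :: "(real^'d) set set \<Rightarrow> (real^'d) set \<Rightarrow> (real^'d) set \<Rightarrow>
    (real^'d \<Rightarrow> real) \<Rightarrow> (real^'d \<Rightarrow> real) set" where
  "K_primal \<T> \<Omega> \<Gamma>D pDh = {q \<in> CR1 \<T> \<Omega>. \<forall>S\<in>facets_on \<T> \<Omega> \<Gamma>D.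
     facet_value \<T> q (barycenter S) = facet_value \<T> pDh (barycenter S)}"

text \<open>Boundary integrals are taken over the closures of the two boundary parts, which are the
  unions of the corresponding closed facets; the relative boundaries of these parts carry no
  surface measure in the intended setting.\<close>

definition D_rt :: "(real^'d) set set \<Rightarrow> (real^'d) set \<Rightarrow> (real^'d) set \<Rightarrow>
    (real^'d \<Rightarrow> real^'d^'d) \<Rightarrow> (real^'d \<Rightarrow> real) \<Rightarrow> (real^'d \<Rightarrow> real^'d) \<Rightarrow> real" where
  "D_rt \<T> \<Omega> \<Gamma>D Kh pDh v =
     - (1/2) * (\<integral>x. (norm (matrix_inv (psd_sqrt (Kh x)) *v elem_proj \<T> v x))\<^sup>2 \<partial>lebesgue_on \<Omega>)
     - (LINT x:closure \<Gamma>D|surface. facet_value \<T> pDh x * (facet_value \<T> v x \<bullet> outward_normal \<Omega> x))"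

definition I_cr :: "(real^'d) set set \<Rightarrow> (real^'d) set \<Rightarrow> (real^'d) set \<Rightarrow>
    (real^'d \<Rightarrow> real^'d^'d) \<Rightarrow> (real^'d \<Rightarrow> real) \<Rightarrow> (real^'d \<Rightarrow> real) \<Rightarrow> (real^'d \<Rightarrow> real) \<Rightarrow>
    (real^'d \<Rightarrow> real) \<Rightarrow> real" where
  "I_cr \<T> \<Omega> \<Gamma>C Kh fh \<alpha>h \<beta>h q =
     (1/2) * (\<integral>x. (norm (psd_sqrt (Kh x) *v broken_grad \<T> q x))\<^sup>2 \<partial>lebesgue_on \<Omega>)
     - (\<integral>x. fh x * elem_proj \<T> q x \<partial>lebesgue_on \<Omega>)
     + (LINT x:closure \<Gamma>C|surface. \<beta>h x * max 0 (facet_proj \<T> (facet_value \<T> q) x))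
     - (LINT x:closure \<Gamma>C|surface. \<alpha>h x * max 0 (- facet_proj \<T> (facet_value \<T> q) x))"


section \<open>Errors and estimator\<close>

text \<open>\<open>I\<close> and \<open>D\<close> are the primal and dual energies, \<open>p\<close> and \<open>u\<close> their optimizers.\<close>

definition rho_I_sq :: "('q \<Rightarrow> real) \<Rightarrow> 'q \<Rightarrow> 'q \<Rightarrow> real" where
  "rho_I_sq I p q = I q - I p"

definition rho_mD_sq :: "('v \<Rightarrow> real) \<Rightarrow> 'v \<Rightarrow> 'v \<Rightarrow> real" where
  "rho_mD_sq D u v = - D v + D u"

definition rho_tot_sq :: "('q \<Rightarrow> real) \<Rightarrow> ('v \<Rightarrow> real) \<Rightarrow> 'q \<Rightarrow> 'v \<Rightarrow> 'q \<Rightarrow> 'v \<Rightarrow> real" where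
  "rho_tot_sq I D p u q v = rho_I_sq I p q + rho_mD_sq D u v"

definition eta_gap_sq :: "('q \<Rightarrow> real) \<Rightarrow> ('v \<Rightarrow> real) \<Rightarrow> 'q \<Rightarrow> 'v \<Rightarrow> real" where
  "eta_gap_sq I D q v = I q - D v"

end

theory Submission
  imports Defs "HOL-Computational_Algebra.Polynomial"
begin

text \<open>The sum of the two errors is the gap estimator plus \<open>D u - I p\<close>, where \<open>p\<close> is the primal minimizer and
  \<open>u\<close> the dual maximizer. The identity therefore says that the discrete problems have the same
  optimal value: it is strong duality.

  Both problems are finite dimensional. A Crouzeix-Raviart function is given by its values at the
  facet barycenters (\<open>CR1_rep\<close>), a Raviart-Thomas field by its coefficients on each element, and both
  energies are sums over elements and boundary facets (\<open>I_cr_eq\<close>, \<open>D_rt_eq\<close>). An admissible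
  field has continuous normal components, so integrating by parts on each element and summing
  leaves only boundary facets (\<open>discrete_green\<close>). With this formula the difference of the two
  energies becomes a sum of nonnegative terms: for each element the defect in Young's inequality for
  the gradient and the flux, and for each contact facet the defect in the complementarity relation
  between the facet value and the normal flux (\<open>duality_gap\<close>). This is weak duality.

  For the converse, Marini's formula \<open>- A (grad p) + (f / d) (x - x\<^sub>T)\<close>, with \<open>x\<^sub>T\<close> the barycenter of the
  element, turns the minimizer \<open>p\<close> into a Raviart-Thomas field whose flux through a facet is, up to
  sign, the derivative of the smooth part of the energy with respect to the value at this facet
  (\<open>energy_expansion\<close>). Changing a single facet value then shows that the field is admissible: on an
  interior facet the derivative vanishes, so the normal component is continuous; on a contact
  facet the one-sided derivatives give the bounds on the normal flux and the complementarity
  relation (\<open>marini_complementarity\<close>). The Young defects vanish by construction. The field thus closes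
  the gap, and the maximal value of the dual energy equals the minimal value of the primal energy.

  Passing from the spaces and measures to these finite sums takes two facts. The surface measure
  of a facet \<open>S\<close> of \<open>T\<close> is \<open>d |T| |grad|\<close>, with \<open>grad\<close> the gradient of the barycentric coordinate that vanishes on \<open>S\<close>
  (\<open>prism_measure\<close>, \<open>surface_measure_facet\<close>), so the coefficients of a Raviart-Thomas field give its fluxes
  through the facets. A piecewise Raviart-Thomas field has a given piecewise constant weak divergence
  iff it has this divergence on every element and no normal jumps (\<open>weak_div_iff\<close>). The second fact
  uses, in place of the divergence theorem on a simplex, the functional \<open>flux T S\<close> on test functions: it is
  defined by a volume integral over \<open>T\<close>, but as the limit of mean values over thin layers of \<open>T\<close> along \<open>S\<close>
  it depends only on the test function on \<open>S\<close> and takes the same value on both elements that share \<open>S\<close>.\<close>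

section \<open>Volumes of affine images\<close>

lemma bij_linear_measurable_inverse:
  fixes A :: "'a::euclidean_space \<Rightarrow> 'a"
  assumes "linear A" "bij A"
  shows "linear (inv A)" "A \<in> borel_measurable borel" "inv A \<in> borel_measurable borel"
proof -
  show l: "linear (inv A)"
    using assms by (simp add: inj_linear_imp_inv_linear bij_is_inj)
  show "A \<in> borel_measurable borel" "inv A \<in> borel_measurable borel"
    using assms(1) l by (auto intro!: borel_measurable_continuous_onI linear_continuous_on simp: linear_conv_bounded_linear)
qed

text \<open>The uniqueness argument for Haar measure: the image measure is invariant under translations, and
  evaluating the double integral of \<open>f (x + y) * g x\<close> with respect to it and Lebesgue measure in both orders
  shows that two translation invariant measures are proportional.\<close>

lemma distr_linear_proportional:
  fixes A :: "'a::euclidean_space \<Rightarrow> 'a"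
  assumes A: "linear A" "bij A"
  shows "\<exists>c>0. distr lborel borel A = density lborel (\<lambda>_. ennreal c)"
proof -
  define N where "N = distr lborel borel A"
  note [measurable] = bij_linear_measurable_inverse[OF A]
  have linv: "linear (inv A)" by (rule bij_linear_measurable_inverse[OF A])
  have AinvA: "A (inv A x) = x" "inv A (A x) = x" for x
    using A(2) by (auto simp: bij_is_surj surj_f_inv_f bij_is_inj)
  have sN[measurable_cong]: "sets N = sets borel" by (simp add: N_def)
  have emN: "emeasure N (A ` X) = emeasure lborel X" if "compact X" for X
  proof -
    have "compact (A ` X)" using that A(1) by (simp add: linear_continuous_on linear_conv_bounded_linear compact_continuous_image)
    then have "A ` X \<in> sets borel" by (simp add: borel_compact)
    then show ?thesis unfolding N_def using A(2)
      by (simp add: emeasure_distr inj_vimage_image_eq[OF bij_is_inj[OF A(2)]])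
  qed
  have "sigma_finite_measure N"
  proof
    let ?F = "range (\<lambda>n::nat. A ` cball 0 (real n))"
    have cm: "compact (A ` cball 0 (real n))" for n 
      using A(1) by (simp add: linear_continuous_on linear_conv_bounded_linear compact_continuous_image)
    have 1: "\<Union>?F = space N"
    proof -
      have "x \<in> \<Union>?F" for x
      proof -
        obtain n where "norm (inv A x) \<le> real n" using real_arch_simple by blast
        then have "inv A x \<in> cball 0 (real n)" by simp
        then have "A (inv A x) \<in> A ` cball 0 (real n)" by (rule imageI)
        then have "x \<in> A ` cball 0 (real n)" by (simp only: AinvA)
        then show ?thesis by blast
      qed
      then show ?thesis by (auto simp: N_def)
    qed
    have 2: "\<forall>a\<in>?F. emeasure N a \<noteq> \<infinity>"
      using emN[OF compact_cball] emeasure_lborel_cball_finite[of 0] by (auto simp: less_top)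
    have 3: "?F \<subseteq> sets N" using cm by (auto simp: sN borel_compact)
    show "\<exists>F. countable F \<and> F \<subseteq> sets N \<and> \<Union> F = space N \<and> (\<forall>a\<in>F. emeasure N a \<noteq> \<infinity>)"
      by (rule exI[of _ ?F], intro conjI 1 2 3 countable_image) simp
  qed
  then interpret N: sigma_finite_measure N .
  interpret pair_sigma_finite lborel N ..
  have nnN: "(\<integral>\<^sup>+x. f x \<partial>N) = (\<integral>\<^sup>+x. f (A x) \<partial>lborel)" if "f \<in> borel_measurable borel" for f
    using that unfolding N_def by (subst nn_integral_distr) auto
  have trans: "(\<integral>\<^sup>+x. f (t + x) \<partial>lborel) = (\<integral>\<^sup>+x. f x \<partial>lborel)"
    if [measurable]: "f \<in> borel_measurable borel" for f :: "'a \<Rightarrow> ennreal" and t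
    by (subst (2) lborel_distr_plus[of t, symmetric], subst nn_integral_distr) auto
  have neg: "(\<integral>\<^sup>+x. f (t - x) \<partial>lborel) = (\<integral>\<^sup>+x. f x \<partial>lborel)"
    if [measurable]: "f \<in> borel_measurable borel" for f :: "'a \<Rightarrow> ennreal" and t
  proof -
    have "lborel = distr lborel borel (\<lambda>x::'a. t - x)"
      using lborel_affine[of "-1" t] by (simp add: density_1)
    then have "(\<integral>\<^sup>+x. f x \<partial>lborel) = (\<integral>\<^sup>+x. f x \<partial>distr lborel borel (\<lambda>x::'a. t - x))" by simp
    then show ?thesis by (subst (asm) nn_integral_distr) auto
  qed
  have key: "(\<integral>\<^sup>+x. g x \<partial>lborel) * (\<integral>\<^sup>+x. f x \<partial>N) = (\<integral>\<^sup>+x. f x \<partial>lborel) * (\<integral>\<^sup>+x. g x \<partial>N)"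
    if [measurable]: "f \<in> borel_measurable borel" "g \<in> borel_measurable borel" for f g :: "'a \<Rightarrow> ennreal"
  proof -
    have t1: "(\<integral>\<^sup>+y. f (x + y) \<partial>N) = (\<integral>\<^sup>+y. f y \<partial>N)" for x
      using trans[of "\<lambda>z. f (A z)" "inv A x"] by (simp add: nnN linear_add[OF A(1)] AinvA)
    have t2: "(\<integral>\<^sup>+y. g (x - y) \<partial>N) = (\<integral>\<^sup>+y. g y \<partial>N)" for x
      using neg[of "\<lambda>z. g (A z)" "inv A x"] by (simp add: nnN linear_diff[OF A(1)] AinvA)
    \<comment> \<open>This substitution moves the shift from one factor to the other.\<close>
    have t3: "(\<integral>\<^sup>+x. f (x + y) * g x \<partial>lborel) = (\<integral>\<^sup>+x. f x * g (x - y) \<partial>lborel)" for y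
      using trans[of "\<lambda>x. f x * g (x - y)" y] by (simp add: add.commute)
    have "(\<integral>\<^sup>+x. g x \<partial>lborel) * (\<integral>\<^sup>+y. f y \<partial>N) = (\<integral>\<^sup>+x. g x * (\<integral>\<^sup>+y. f (x + y) \<partial>N) \<partial>lborel)"
      by (simp add: t1 nn_integral_multc)
    also have "\<dots> = (\<integral>\<^sup>+x. (\<integral>\<^sup>+y. f (x + y) * g x \<partial>N) \<partial>lborel)"
      by (intro nn_integral_cong) (simp add: nn_integral_cmult mult.commute)
    also have "\<dots> = (\<integral>\<^sup>+y. (\<integral>\<^sup>+x. f (x + y) * g x \<partial>lborel) \<partial>N)"
      by (rule Fubini'[symmetric]) measurable
    also have "\<dots> = (\<integral>\<^sup>+y. (\<integral>\<^sup>+x. f x * g (x - y) \<partial>lborel) \<partial>N)" by (simp add: t3)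
    also have "\<dots> = (\<integral>\<^sup>+x. (\<integral>\<^sup>+y. f x * g (x - y) \<partial>N) \<partial>lborel)"
      by (rule Fubini') measurable
    also have "\<dots> = (\<integral>\<^sup>+x. f x \<partial>lborel) * (\<integral>\<^sup>+x. g x \<partial>N)"
      by (simp add: nn_integral_cmult t2 nn_integral_multc)
    finally show ?thesis .
  qed
  define Q where "Q = cbox (0::'a) One"
  have Q1: "emeasure lborel Q = 1" 
    using emeasure_eq_ennreal_measure[of lborel Q] by (simp add: Q_def content_cbox' emeasure_lborel_cbox_eq)
  have NQ: "emeasure N (A ` Q) = 1" using emN[of Q] Q1 by (simp add: Q_def)
  have cQ: "compact (A ` Q)" unfolding Q_def using A(1)
    by (simp add: linear_continuous_on linear_conv_bounded_linear compact_continuous_image)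
  then have [measurable]: "A ` Q \<in> sets borel" by (simp add: borel_compact)
  have [measurable]: "Q \<in> sets borel" by (simp add: Q_def)
  have fin: "emeasure lborel (A ` Q) < \<infinity>" 
    using emeasure_compact_finite[OF cQ] by simp
  have "emeasure lborel (A ` Q) * emeasure N Q = 1"
    using key[of "indicator Q" "indicator (A ` Q)"] NQ Q1 by (simp add: sN)
  then have nz: "emeasure lborel (A ` Q) \<noteq> 0" by auto
  define m where "m = measure lborel (A ` Q)"
  have m: "emeasure lborel (A ` Q) = ennreal m" unfolding m_def
    using fin by (intro emeasure_eq_ennreal_measure) auto
  have mpos: "m > 0" using nz m by (metis ennreal_eq_0_iff linorder_not_less)
  have "N = density lborel (\<lambda>_. ennreal (1 / m))"
  proof (rule measure_eqI)
    fix X assume "X \<in> sets N"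
    then have [measurable]: "X \<in> sets borel" by (simp add: sN)
    have "ennreal m * emeasure N X = emeasure lborel X"
      using key[of "indicator X" "indicator (A ` Q)"] NQ m by (simp add: sN)
    then have "ennreal (1/m) * (ennreal m * emeasure N X) = ennreal (1/m) * emeasure lborel X" by simp
    then have "emeasure N X = ennreal (1/m) * emeasure lborel X"
      using mpos by (simp add: mult.assoc[symmetric] ennreal_mult''[symmetric])
    then show "emeasure N X = emeasure (density lborel (\<lambda>_. ennreal (1 / m))) X"
      by (simp add: emeasure_density_const)
  qed (simp add: sN)
  then show ?thesis using mpos unfolding N_def by (intro exI[of _ "1/m"]) auto
qed

lemma set_integral_one_lebesgue:
  "P \<in> sets lebesgue \<Longrightarrow> (LINT x:P|lebesgue. (1::real)) = measure lebesgue P"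
  by (simp add: set_lebesgue_integral_def)

text \<open>The absolute value of the determinant, as the volume of the image of the unit cube: with this
  definition it is multiplicative by the change of variables formula alone.\<close>

definition dilation :: "('a::euclidean_space \<Rightarrow> 'a) \<Rightarrow> real" where
  "dilation A = measure lebesgue (A ` cbox 0 One)"

lemma image_affine_borel:
  fixes A :: "'a::euclidean_space \<Rightarrow> 'a"
  assumes A: "linear A" "bij A" and P: "P \<in> sets borel"
  shows "(\<lambda>x. b + A x) ` P \<in> sets borel"
proof -
  note [measurable] = bij_linear_measurable_inverse[OF A]
  have "(\<lambda>x. b + A x) ` P = (\<lambda>y. inv A (y - b)) -` P \<inter> space borel"
    using A(2) by (auto simp: bij_is_inj image_iff) (metis A(2) add.commute bij_inv_eq_iff diff_add_cancel)
  also have "\<dots> \<in> sets borel" using P by measurable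
  finally show ?thesis .
qed

lemma affine_change_of_variables:
  fixes A :: "'a::euclidean_space \<Rightarrow> 'a" and \<psi> :: "'a \<Rightarrow> 'b::euclidean_space"
  assumes A: "linear A" "bij A" and P: "P \<in> sets borel" and \<psi>: "\<psi> \<in> borel_measurable borel"
  shows "(LINT x:(\<lambda>x. b + A x) ` P|lebesgue. \<psi> x) = dilation A *\<^sub>R (LINT x:P|lebesgue. \<psi> (b + A x))"
    and "dilation A > 0"
proof -
  note [measurable] = bij_linear_measurable_inverse[OF A] P
  obtain c where c: "c > 0" and eq: "distr lborel borel A = density lborel (\<lambda>_. ennreal c)"
    using distr_linear_proportional[OF A] by auto
  have gen: "(LINT x:(\<lambda>x. b + A x) ` P|lebesgue. \<psi> x) = (1/c) *\<^sub>R (LINT x:P|lebesgue. \<psi> (b + A x))"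
    if \<psi>[measurable]: "\<psi> \<in> borel_measurable borel" and P[measurable]: "P \<in> sets borel" for b P and \<psi> :: "'a \<Rightarrow> 'c::euclidean_space"
  proof -
    define h where "h x = indicator ((\<lambda>x. b + A x) ` P) (b + x) *\<^sub>R \<psi> (b + x)" for x
    have [measurable]: "(\<lambda>x. b + A x) ` P \<in> sets borel" using image_affine_borel[OF A P] .
    have [measurable]: "h \<in> borel_measurable borel" unfolding h_def by measurable
    have "(LINT x:(\<lambda>x. b + A x) ` P|lebesgue. \<psi> x) = (\<integral>x. indicator ((\<lambda>x. b + A x) ` P) x *\<^sub>R \<psi> x \<partial>lborel)"
      unfolding set_lebesgue_integral_def by (rule integral_completion) measurable
    also have "\<dots> = (\<integral>x. h x \<partial>lborel)"
      unfolding h_def by (subst (1) lborel_distr_plus[of b, symmetric], subst integral_distr) auto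
    also have "\<dots> = (1/c) *\<^sub>R (\<integral>x. h x \<partial>distr lborel borel A)"
      unfolding eq using c by (subst integral_density) auto
    also have "(\<integral>x. h x \<partial>distr lborel borel A) = (\<integral>x. h (A x) \<partial>lborel)"
      by (subst integral_distr) auto
    also have "(\<lambda>x. h (A x)) = (\<lambda>x. indicator P x *\<^sub>R \<psi> (b + A x))"
      using A(2) by (auto simp: h_def fun_eq_iff indicator_def bij_is_inj inj_eq)
    also have "(\<integral>x. indicator P x *\<^sub>R \<psi> (b + A x) \<partial>lborel) = (LINT x:P|lebesgue. \<psi> (b + A x))"
      unfolding set_lebesgue_integral_def by (rule integral_completion[symmetric]) measurable
    finally show ?thesis .
  qed
  have "dilation A = 1/c"
  proof -
    have [measurable]: "A ` cbox 0 One \<in> sets lebesgue"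
      using image_affine_borel[OF A, of "cbox 0 One" 0] by simp
    have "(LINT x:A ` cbox 0 One|lebesgue. (1::real)) = (1/c) * (LINT x:cbox 0 (One::'a)|lebesgue. 1)"
      using gen[of "\<lambda>_. 1::real" "cbox 0 One" 0] by simp
    moreover have "measure lebesgue (cbox 0 (One::'a)) = 1" by (simp add: content_cbox')
    ultimately show ?thesis unfolding dilation_def by (simp add: set_integral_one_lebesgue)
  qed
  then show "(LINT x:(\<lambda>x. b + A x) ` P|lebesgue. \<psi> x) = dilation A *\<^sub>R (LINT x:P|lebesgue. \<psi> (b + A x))" "dilation A > 0"
    using gen[OF \<psi> P] c by auto
qed

lemma measure_affine_image:
  fixes A :: "'a::euclidean_space \<Rightarrow> 'a"
  assumes A: "linear A" "bij A" and P: "P \<in> sets borel"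
  shows "measure lebesgue ((\<lambda>x. b + A x) ` P) = dilation A * measure lebesgue P"
proof -
  have [measurable]: "(\<lambda>x. b + A x) ` P \<in> sets lebesgue" "P \<in> sets lebesgue"
    using image_affine_borel[OF A P, of b] P by auto
  show ?thesis
    using affine_change_of_variables(1)[OF A P, of "\<lambda>_. 1::real" b]
    by (simp add: set_integral_one_lebesgue)
qed

lemma dilation_comp:
  fixes A B :: "'a::euclidean_space \<Rightarrow> 'a"
  assumes A: "linear A" "bij A" and B: "linear B" "bij B"
  shows "dilation (A \<circ> B) = dilation A * dilation B"
proof -
  have "B ` cbox 0 One \<in> sets borel" using image_affine_borel[OF B, of "cbox 0 One" 0] by simp
  then show ?thesis
    using measure_affine_image[OF A, of "B ` cbox 0 One" 0] by (simp add: dilation_def image_comp)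
qed

lemma dilation_id: "dilation (\<lambda>x. x) = 1" "dilation id = 1"
  by (simp_all add: dilation_def content_cbox')

lemma linear_rank_one_update: "linear (\<lambda>x::'a::euclidean_space. x + (n \<bullet> x) *\<^sub>R u)"
  by (auto intro!: linearI simp: inner_add_right algebra_simps)

text \<open>A shear along a vector orthogonal to \<open>n\<close> is conjugate to its inverse by the reflection in the
  hyperplane orthogonal to \<open>n\<close>, so its dilation is its own reciprocal.\<close>

lemma dilation_shear:
  fixes n u :: "'a::euclidean_space"
  assumes n: "norm n = 1" and u: "n \<bullet> u = 0"
  shows "dilation (\<lambda>x. x + (n \<bullet> x) *\<^sub>R u) = 1" "bij (\<lambda>x. x + (n \<bullet> x) *\<^sub>R u)"
proof -
  have nn: "n \<bullet> n = 1" using n by (simp add: dot_square_norm)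
  define S where "S v x = x + (n \<bullet> x) *\<^sub>R v" for v x
  define R where "R x = x + (n \<bullet> x) *\<^sub>R (-2 *\<^sub>R n)" for x
  have SS: "S v \<circ> S w = S (v + w)" if "n \<bullet> v = 0" "n \<bullet> w = 0" for v w
    using that by (auto simp: S_def fun_eq_iff inner_add_right algebra_simps)
  have S0: "S 0 = id" by (auto simp: S_def)
  have bS: "bij (S v)" if "n \<bullet> v = 0" for v
    by (rule o_bij[of "S (-v)"]) (use that in \<open>simp_all add: SS S0\<close>)
  have RR: "R \<circ> R = id"
    by (auto simp: R_def fun_eq_iff inner_add_right algebra_simps nn)
  have bR: "bij R" by (rule o_bij[of R]) (simp_all add: RR)
  have lS: "linear (S v)" for v unfolding S_def[abs_def] by (rule linear_rank_one_update)
  have lR: "linear R" unfolding R_def[abs_def] by (rule linear_rank_one_update)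
  have RSR: "R \<circ> (S u \<circ> R) = S (-u)"
    using u by (auto simp: R_def S_def fun_eq_iff inner_add_right algebra_simps nn)
  have d1: "dilation R * dilation R = 1"
    using dilation_comp[OF lR bR lR bR] by (simp add: RR dilation_id)
  have "dilation (S (-u)) = dilation R * (dilation (S u) * dilation R)"
    unfolding RSR[symmetric] using lS lR bR bS[OF u]
    by (subst dilation_comp; (subst dilation_comp)?; (simp add: linear_compose bij_comp)?)
  then have d2: "dilation (S (-u)) = dilation (S u)" using d1 by (simp add: algebra_simps)
  have "dilation (S (-u)) * dilation (S u) = 1"
    using dilation_comp[OF lS bS lS bS, of "-u" u] u by (simp add: SS S0 dilation_id)
  then have "dilation (S u) ^ 2 = 1" by (simp add: d2 power2_eq_square)
  moreover have "dilation (S u) > 0"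
    by (rule affine_change_of_variables(2)[OF lS bS[OF u], of "{}" "\<lambda>_. 0::real"]) auto
  ultimately have "dilation (S u) = 1" by (simp add: power2_eq_1_iff)
  then show "dilation (\<lambda>x. x + (n \<bullet> x) *\<^sub>R u) = 1" "bij (\<lambda>x. x + (n \<bullet> x) *\<^sub>R u)"
    using bS[OF u] by (simp_all add: S_def[abs_def])
qed

text \<open>Conjugation with an orthogonal map reduces the claim to a coordinate axis, along which a single side
  of the unit cube is scaled.\<close>

lemma dilation_stretch:
  fixes n :: "real^'d"
  assumes n: "norm n = 1" and "\<eta> \<noteq> 0"
  shows "dilation (\<lambda>x. x + (n \<bullet> x) *\<^sub>R ((\<eta> - 1) *\<^sub>R n)) = \<bar>\<eta>\<bar>"
    "bij (\<lambda>x. x + (n \<bullet> x) *\<^sub>R ((\<eta> - 1) *\<^sub>R n))"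
proof -
  define D where "D e t x = x + (e \<bullet> x) *\<^sub>R ((t - 1) *\<^sub>R e)" for e x :: "real^'d" and t :: real
  have DD: "D e t \<circ> D e s = D e (t * s)" if "norm e = 1" for e t s
    using that by (auto simp: D_def fun_eq_iff inner_add_right algebra_simps dot_square_norm)
  have D1: "D e 1 = id" for e by (auto simp: D_def)
  have lD: "linear (D e t)" for e t unfolding D_def[abs_def] by (rule linear_rank_one_update)
  have bD: "bij (D e \<eta>)" if "norm e = 1" for e
    by (rule o_bij[of "D e (1/\<eta>)"]) (use that assms(2) in \<open>simp_all add: DD D1\<close>)
  define e :: "real^'d" where "e = axis undefined 1"
  have e: "norm e = 1" "e \<in> Basis" by (simp_all add: e_def axis_in_Basis_iff)
  obtain Q where Q: "orthogonal_transformation Q" "Q e = n"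
    using orthogonal_transformation_exists_1[OF e(1) n] by blast
  have lQ: "linear Q" and bQ: "bij Q"
    using Q(1) by (simp_all add: orthogonal_transformation_linear orthogonal_transformation_bij)
  have iQ: "Q x \<bullet> Q y = x \<bullet> y" for x y using Q(1) by (simp add: orthogonal_transformation_def)
  have "D n \<eta> \<circ> Q = Q \<circ> D e \<eta>"
    unfolding D_def Q(2)[symmetric] by (auto simp: fun_eq_iff iQ linear_add[OF lQ] linear_scale[OF lQ])
  then have "dilation (D n \<eta>) * dilation Q = dilation Q * dilation (D e \<eta>)"
    by (simp only: dilation_comp[OF lD bD[OF n] lQ bQ, symmetric] dilation_comp[OF lQ bQ lD bD[OF e(1)], symmetric])
  moreover have "dilation Q > 0"
    by (rule affine_change_of_variables(2)[OF lQ bQ, of "{}" "\<lambda>_. 0::real"]) auto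
  ultimately have 1: "dilation (D n \<eta>) = dilation (D e \<eta>)"
    by (metis less_irrefl mult.commute mult_cancel_left)
  have De: "D e \<eta> = (\<lambda>x. \<Sum>k\<in>Basis. ((if k = e then \<eta> else 1) * (x \<bullet> k)) *\<^sub>R k)"
  proof
    fix x
    have "(\<Sum>k\<in>Basis. ((if k = e then \<eta> else 1) * (x \<bullet> k)) *\<^sub>R k)
        = (\<Sum>k\<in>Basis. (x \<bullet> k) *\<^sub>R k + (if k = e then ((\<eta> - 1) * (x \<bullet> k)) *\<^sub>R k else 0))"
      by (rule sum.cong) (auto simp: algebra_simps)
    also have "\<dots> = x + ((\<eta> - 1) * (x \<bullet> e)) *\<^sub>R e"
      using e by (simp add: sum.distrib euclidean_representation)
    finally show "D e \<eta> x = (\<Sum>k\<in>Basis. ((if k = e then \<eta> else 1) * (x \<bullet> k)) *\<^sub>R k)"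
      by (simp add: D_def inner_commute mult.commute)
  qed
  have "dilation (D e \<eta>) = \<bar>\<Prod>k\<in>Basis. (if k = e then \<eta> else 1)\<bar> * measure lebesgue (cbox (0::real^'d) One)"
    unfolding dilation_def De
    using content_image_stretch_interval[of "\<lambda>k. if k = e then \<eta> else 1" "0::real^'d" One]
    by (simp add: image_stretch_interval)
  also have "\<dots> = \<bar>\<eta>\<bar>" using e by (simp add: content_cbox')
  finally show "dilation (\<lambda>x. x + (n \<bullet> x) *\<^sub>R ((\<eta> - 1) *\<^sub>R n)) = \<bar>\<eta>\<bar>"
    "bij (\<lambda>x. x + (n \<bullet> x) *\<^sub>R ((\<eta> - 1) *\<^sub>R n))"
    using 1 bD[OF n] by (simp_all add: D_def[abs_def])
qed

text \<open>The map fixes the hyperplane orthogonal to \<open>n\<close> and sends \<open>n\<close> to \<open>w\<close>; it is a stretch along \<open>n\<close>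
  followed by a shear.\<close>

lemma dilation_rank_one_update:
  fixes n w :: "real^'d"
  assumes n: "norm n = 1" and w: "n \<bullet> w \<noteq> 0"
  shows "dilation (\<lambda>x. x + (n \<bullet> x) *\<^sub>R (w - n)) = \<bar>n \<bullet> w\<bar>" "bij (\<lambda>x. x + (n \<bullet> x) *\<^sub>R (w - n))"
proof -
  have nn: "n \<bullet> n = 1" using n by (simp add: dot_square_norm)
  define \<eta> where "\<eta> = n \<bullet> w"
  define u where "u = (1/\<eta>) *\<^sub>R w - n"
  have \<eta>: "\<eta> \<noteq> 0" using w by (simp add: \<eta>_def)
  have nu: "n \<bullet> u = 0" using \<eta> by (simp add: u_def inner_diff_right nn \<eta>_def)
  note s = dilation_shear[OF n nu] and t = dilation_stretch[OF n \<eta>]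
  have eq: "(\<lambda>x. x + (n \<bullet> x) *\<^sub>R u) \<circ> (\<lambda>x. x + (n \<bullet> x) *\<^sub>R ((\<eta> - 1) *\<^sub>R n)) = (\<lambda>x. x + (n \<bullet> x) *\<^sub>R (w - n))"
  proof
    fix x
    have "n \<bullet> (x + (n \<bullet> x) *\<^sub>R ((\<eta> - 1) *\<^sub>R n)) = \<eta> * (n \<bullet> x)"
      by (simp add: inner_add_right nn algebra_simps)
    then show "((\<lambda>x. x + (n \<bullet> x) *\<^sub>R u) \<circ> (\<lambda>x. x + (n \<bullet> x) *\<^sub>R ((\<eta> - 1) *\<^sub>R n))) x = x + (n \<bullet> x) *\<^sub>R (w - n)"
      using \<eta> by (simp add: u_def algebra_simps)
  qed
  show "bij (\<lambda>x. x + (n \<bullet> x) *\<^sub>R (w - n))" unfolding eq[symmetric] by (intro bij_comp s t)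
  show "dilation (\<lambda>x. x + (n \<bullet> x) *\<^sub>R (w - n)) = \<bar>n \<bullet> w\<bar>"
    unfolding eq[symmetric]
    using dilation_comp[OF linear_rank_one_update s(2) linear_rank_one_update t(2)]
    by (simp only: s t mult_1 \<eta>_def[symmetric])
qed

section \<open>Barycentric coordinates of a simplex\<close>

definition verts :: "'a::euclidean_space set \<Rightarrow> 'a set" where
  "verts T = {x. x extreme_point_of T}"

text \<open>Vertices and barycentric coordinates are indexed by the opposite facets, since the degrees of
  freedom of both finite element spaces belong to facets: \<open>opp T S\<close> is the vertex outside \<open>S\<close>, and \<open>bary T S\<close>
  is the affine function that is \<open>1\<close> there and \<open>0\<close> on \<open>S\<close>.\<close>

definition opp :: "'a::euclidean_space set \<Rightarrow> 'a set \<Rightarrow> 'a" where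
  "opp T S = (THE p. p \<in> verts T \<and> p \<notin> S)"

definition bary_grad :: "'a::euclidean_space set \<Rightarrow> 'a set \<Rightarrow> 'a" where
  "bary_grad T S = (SOME g. \<forall>v\<in>verts T - {opp T S}. 1 + g \<bullet> (v - opp T S) = 0)"

definition bary :: "'a::euclidean_space set \<Rightarrow> 'a set \<Rightarrow> 'a \<Rightarrow> real" where
  "bary T S x = 1 + bary_grad T S \<bullet> (x - opp T S)"

abbreviation full_simplex :: "'a::euclidean_space set \<Rightarrow> bool" where
  "full_simplex T \<equiv> int DIM('a) simplex T"

lemma bary_affine: "bary T S y = bary T S x + bary_grad T S \<bullet> (y - x)"
  by (simp add: bary_def inner_diff_right)

context
  fixes T :: "'a::euclidean_space set"
  assumes T: "full_simplex T"
begin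

lemma simplex_verts:
  shows "\<not> affine_dependent (verts T)" "T = convex hull (verts T)"
    "finite (verts T)" "card (verts T) = Suc DIM('a)" "affine hull (verts T) = UNIV"
proof -
  obtain V where V: "\<not> affine_dependent V" "int (card V) = int DIM('a) + 1" "T = convex hull V"
    using T unfolding simplex_def by auto
  have "verts T = V"
    unfolding verts_def V(3) using extreme_point_of_convex_hull_affine_independent[OF V(1)] by auto
  then show 1: "\<not> affine_dependent (verts T)" "T = convex hull (verts T)"
    "finite (verts T)" "card (verts T) = Suc DIM('a)"
    using V aff_independent_finite by auto
  show "affine hull (verts T) = UNIV" using affine_independent_span_eq 1 by blast
qed

lemma facet_iff: "S facet_of T \<longleftrightarrow> (\<exists>p\<in>verts T. S = convex hull (verts T - {p}))"
proof -
  have "2 \<le> card (verts T)" using simplex_verts(4) DIM_positive[where 'a='a] by linarith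
  then show ?thesis
    using facet_of_convex_hull_affine_independent_alt[OF simplex_verts(1), of S] simplex_verts(2) by auto
qed

lemma vertex_notin_opposite: "p \<in> verts T \<Longrightarrow> p \<notin> convex hull (verts T - {p})"
  using simplex_verts(1) convex_hull_subset_affine_hull unfolding affine_dependent_def by blast

lemma opp_eqI:
  assumes "p \<in> verts T" shows "opp T (convex hull (verts T - {p})) = p"
  unfolding opp_def
proof (rule the_equality)
  show "p \<in> verts T \<and> p \<notin> convex hull (verts T - {p})" using assms vertex_notin_opposite by auto
  show "q = p" if "q \<in> verts T \<and> q \<notin> convex hull (verts T - {p})" for q
    using that hull_inc[of q "verts T - {p}" convex] by auto
qed

lemma facet_opp:
  assumes "S facet_of T"
  shows "opp T S \<in> verts T" "opp T S \<notin> S" "S = convex hull (verts T - {opp T S})"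
    "verts S = verts T - {opp T S}"
proof -
  obtain p where p: "p \<in> verts T" "S = convex hull (verts T - {p})" using assms facet_iff by auto
  then have o: "opp T S = p" using opp_eqI by simp
  show 1: "opp T S \<in> verts T" "opp T S \<notin> S" "S = convex hull (verts T - {opp T S})"
    unfolding o using p vertex_notin_opposite[OF p(1)] by simp_all
  have "\<not> affine_dependent (verts T - {p})"
    by (meson Diff_subset affine_dependent_subset simplex_verts(1))
  from extreme_point_of_convex_hull_affine_independent[OF this]
  show "verts S = verts T - {opp T S}" unfolding verts_def[of S] o by (auto simp: p(2)[symmetric])
qed

lemma bij_betw_opp: "bij_betw (opp T) {S. S facet_of T} (verts T)"
proof (rule bij_betwI[where g="\<lambda>p. convex hull (verts T - {p})"])
  show "opp T \<in> {S. S facet_of T} \<rightarrow> verts T" using facet_opp(1) by blast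
  show "(\<lambda>p. convex hull (verts T - {p})) \<in> verts T \<rightarrow> {S. S facet_of T}"
    using facet_iff by blast
  show "convex hull (verts T - {opp T S}) = S" if "S \<in> {S. S facet_of T}" for S
    using that facet_opp(3)[of S] by simp
  show "opp T (convex hull (verts T - {p})) = p" if "p \<in> verts T" for p
    using that by (rule opp_eqI)
qed

lemma finite_facets: "finite {S. S facet_of T}" and card_facets: "card {S. S facet_of T} = Suc DIM('a)"
  using bij_betw_finite[OF bij_betw_opp] bij_betw_same_card[OF bij_betw_opp] simplex_verts by auto

lemma opp_inj: "S facet_of T \<Longrightarrow> S' facet_of T \<Longrightarrow> opp T S = opp T S' \<longleftrightarrow> S = S'"
  using bij_betw_opp unfolding bij_betw_def inj_on_def by auto

text \<open>The other vertices span a hyperplane that misses \<open>opp T S\<close>, so the choice in \<open>bary_grad\<close> is realised by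
  a normal vector of this hyperplane.\<close>

lemma bary_opp:
  assumes S: "S facet_of T" and S': "S' facet_of T"
  shows "bary T S (opp T S') = (if S' = S then 1 else 0)"
proof -
  let ?p = "opp T S"
  note f = facet_opp[OF S]
  have nin: "?p \<notin> affine hull (verts T - {?p})"
    using simplex_verts(1) f(1) unfolding affine_dependent_def by blast
  have "aff_dim (insert ?p (verts T - {?p})) = int DIM('a)"
    using simplex_verts(5) f(1) by (simp add: insert_absorb aff_dim_eq_full)
  then have "aff_dim (verts T - {?p}) = DIM('a) - 1"
    using aff_dim_insert[of ?p "verts T - {?p}"] nin by auto
  then obtain a b where ab: "affine hull (verts T - {?p}) = {x. a \<bullet> x = b}"
    using aff_dim_eq_hyperplane[of "verts T - {?p}"] by auto
  have ne: "a \<bullet> ?p \<noteq> b" using nin ab by auto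
  define c where "c = a \<bullet> ?p - b"
  have "\<exists>g. \<forall>v\<in>verts T - {?p}. 1 + g \<bullet> (v - ?p) = 0"
  proof (intro exI[of _ "(1 / c) *\<^sub>R a"] ballI)
    fix v assume "v \<in> verts T - {?p}"
    then have "a \<bullet> v = b" using ab hull_inc[of v "verts T - {?p}" affine] by auto
    then have "a \<bullet> (v - ?p) = - c" "c \<noteq> 0" using ne by (simp_all add: inner_diff_right c_def)
    then show "1 + ((1 / c) *\<^sub>R a) \<bullet> (v - ?p) = 0" by simp
  qed
  then have g: "\<forall>v\<in>verts T - {?p}. 1 + bary_grad T S \<bullet> (v - ?p) = 0"
    unfolding bary_grad_def by (rule someI_ex)
  show ?thesis
  proof (cases "S' = S")
    case False
    then have "opp T S' \<in> verts T - {?p}" using facet_opp(1)[OF S'] opp_inj[OF S S'] by auto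
    then show ?thesis using g False by (simp add: bary_def)
  qed (simp add: bary_def)
qed

text \<open>Affine functions commute with affine combinations, so a barycentric coordinate reads off a weight.\<close>

lemma bary_of_combination:
  assumes S: "S facet_of T" and u: "(\<Sum>R | R facet_of T. u R) = 1"
  shows "bary T S (\<Sum>R | R facet_of T. u R *\<^sub>R opp T R) = u S"
proof -
  let ?F = "{R. R facet_of T}"
  have "bary T S (\<Sum>R\<in>?F. u R *\<^sub>R opp T R) = (\<Sum>R\<in>?F. u R) + bary_grad T S \<bullet> (\<Sum>R\<in>?F. u R *\<^sub>R (opp T R - opp T S))"
    by (simp add: u bary_def inner_diff_right scaleR_right_diff_distrib sum_subtractf scaleR_left.sum[symmetric])
  also have "\<dots> = (\<Sum>R\<in>?F. u R * bary T S (opp T R))"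
    by (simp add: bary_def inner_sum_right sum.distrib[symmetric] algebra_simps)
  also have "\<dots> = (\<Sum>R\<in>?F. if R = S then u R else 0)"
    by (rule sum.cong) (use S bary_opp in auto)
  also have "\<dots> = u S" using S finite_facets by simp
  finally show ?thesis .
qed

lemma ex_combination: "\<exists>u. (\<Sum>R | R facet_of T. u R) = 1 \<and> x = (\<Sum>R | R facet_of T. u R *\<^sub>R opp T R)"
proof -
  have "x \<in> affine hull (verts T)" using simplex_verts by simp
  then obtain u where u: "sum u (verts T) = 1" "(\<Sum>v\<in>verts T. u v *\<^sub>R v) = x"
    unfolding affine_hull_finite[OF simplex_verts(3)] by auto
  then show ?thesis
    using sum.reindex_bij_betw[OF bij_betw_opp, of u] sum.reindex_bij_betw[OF bij_betw_opp, of "\<lambda>v. u v *\<^sub>R v"]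
    by (intro exI[of _ "u \<circ> opp T"]) simp
qed

lemma sum_bary: "(\<Sum>S | S facet_of T. bary T S x) = 1"
  and sum_bary_opp: "(\<Sum>S | S facet_of T. bary T S x *\<^sub>R opp T S) = x"
proof -
  obtain u where u: "(\<Sum>R | R facet_of T. u R) = 1" "x = (\<Sum>R | R facet_of T. u R *\<^sub>R opp T R)"
    using ex_combination by blast
  have b: "bary T S x = u S" if "S facet_of T" for S
    using bary_of_combination[OF that u(1)] u(2) by simp
  show "(\<Sum>S | S facet_of T. bary T S x) = 1" using b u(1) by simp
  have "(\<Sum>S | S facet_of T. bary T S x *\<^sub>R opp T S) = (\<Sum>S | S facet_of T. u S *\<^sub>R opp T S)"
    by (rule sum.cong) (use b in auto)
  then show "(\<Sum>S | S facet_of T. bary T S x *\<^sub>R opp T S) = x" using u(2) by simp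
qed

lemma affine_eq_sum_bary:
  "a \<bullet> x + b = (\<Sum>S | S facet_of T. bary T S x * (a \<bullet> opp T S + b))"
proof -
  have "(\<Sum>S | S facet_of T. bary T S x * (a \<bullet> opp T S + b))
      = a \<bullet> (\<Sum>S | S facet_of T. bary T S x *\<^sub>R opp T S) + b * (\<Sum>S | S facet_of T. bary T S x)"
    by (simp add: inner_sum_right distrib_left sum.distrib sum_distrib_left mult.commute)
  then show ?thesis by (simp add: sum_bary sum_bary_opp)
qed

lemma sum_bary_grad: "(\<Sum>S | S facet_of T. bary_grad T S) = 0"
proof -
  have "(\<Sum>S | S facet_of T. bary_grad T S) \<bullet> y = 0" for y
  proof -
    have "(\<Sum>S | S facet_of T. bary T S y) = (\<Sum>S | S facet_of T. bary T S 0 + bary_grad T S \<bullet> y)"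
      by (rule sum.cong) (simp_all add: bary_affine[of T _ y 0])
    then show ?thesis using sum_bary[of y] sum_bary[of 0] by (simp add: sum.distrib inner_sum_left)
  qed
  then show ?thesis using inner_eq_zero_iff by blast
qed

lemma sum_bary_grad_opp: "(\<Sum>S | S facet_of T. (bary_grad T S \<bullet> y) *\<^sub>R opp T S) = y"
proof -
  have "(\<Sum>S | S facet_of T. bary T S y *\<^sub>R opp T S)
      = (\<Sum>S | S facet_of T. bary T S 0 *\<^sub>R opp T S + (bary_grad T S \<bullet> y) *\<^sub>R opp T S)"
    by (rule sum.cong) (simp_all add: bary_affine[of T _ y 0] scaleR_left_distrib)
  then show ?thesis using sum_bary_opp[of y] sum_bary_opp[of 0] by (simp add: sum.distrib)
qed

lemma mem_simplex_iff: "x \<in> T \<longleftrightarrow> (\<forall>S. S facet_of T \<longrightarrow> 0 \<le> bary T S x)"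
proof
  assume "x \<in> T"
  then have "x \<in> convex hull (verts T)" using simplex_verts(2) by simp
  then obtain u where u: "\<forall>v\<in>verts T. 0 \<le> u v" "sum u (verts T) = 1" "(\<Sum>v\<in>verts T. u v *\<^sub>R v) = x"
    unfolding convex_hull_finite[OF simplex_verts(3)] by auto
  then have "bary T S x = u (opp T S)" if "S facet_of T" for S
    using bary_of_combination[OF that, of "u \<circ> opp T"]
      sum.reindex_bij_betw[OF bij_betw_opp, of u] sum.reindex_bij_betw[OF bij_betw_opp, of "\<lambda>v. u v *\<^sub>R v"]
    by simp
  then show "\<forall>S. S facet_of T \<longrightarrow> 0 \<le> bary T S x" using u(1) facet_opp by auto
next
  assume A: "\<forall>S. S facet_of T \<longrightarrow> 0 \<le> bary T S x"
  have "(\<Sum>S | S facet_of T. bary T S x *\<^sub>R opp T S) \<in> convex hull (verts T)"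
    by (rule convex_sum) (use A facet_opp sum_bary finite_facets hull_inc[of _ "verts T" convex] in auto)
  then show "x \<in> T" using simplex_verts(2) sum_bary_opp by simp
qed

lemma interior_simplex_iff: "x \<in> interior T \<longleftrightarrow> (\<forall>S. S facet_of T \<longrightarrow> 0 < bary T S x)"
proof -
  have i: "interior T = {y. \<exists>u. (\<forall>v\<in>verts T. 0 < u v) \<and> sum u (verts T) = 1 \<and> (\<Sum>v\<in>verts T. u v *\<^sub>R v) = y}"
    using interior_convex_hull_explicit_minimal[OF simplex_verts(1)] simplex_verts(2,4) by simp
  show ?thesis
  proof
    assume "x \<in> interior T"
    then obtain u where u: "\<forall>v\<in>verts T. 0 < u v" "sum u (verts T) = 1" "(\<Sum>v\<in>verts T. u v *\<^sub>R v) = x"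
      unfolding i by auto
    then have "bary T S x = u (opp T S)" if "S facet_of T" for S
      using bary_of_combination[OF that, of "u \<circ> opp T"]
        sum.reindex_bij_betw[OF bij_betw_opp, of u] sum.reindex_bij_betw[OF bij_betw_opp, of "\<lambda>v. u v *\<^sub>R v"]
      by simp
    then show "\<forall>S. S facet_of T \<longrightarrow> 0 < bary T S x" using u(1) facet_opp by auto
  next
    assume A: "\<forall>S. S facet_of T \<longrightarrow> 0 < bary T S x"
    have "open (\<Inter>S\<in>{S. S facet_of T}. {y. 0 < bary T S y})"
      unfolding bary_def using finite_facets by (intro open_INT ballI open_Collect_less continuous_intros) auto
    moreover have "(\<Inter>S\<in>{S. S facet_of T}. {y. 0 < bary T S y}) \<subseteq> T"
      using mem_simplex_iff by (auto intro: less_imp_le)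
    ultimately show "x \<in> interior T" using A by (intro interiorI) auto
  qed
qed

lemma mem_facet_iff:
  assumes S: "S facet_of T"
  shows "x \<in> S \<longleftrightarrow> x \<in> T \<and> bary T S x = 0"
proof
  assume x: "x \<in> S"
  have "S \<subseteq> T" using S by (auto simp: facet_of_def face_of_def)
  have "convex {y. bary T S y = 0}"
  proof -
    have "{y. bary T S y = 0} = {y. bary_grad T S \<bullet> y = bary_grad T S \<bullet> opp T S - 1}"
      by (auto simp: bary_def inner_diff_right)
    then show ?thesis by (simp add: convex_hyperplane)
  qed
  moreover have "verts T - {opp T S} \<subseteq> {y. bary T S y = 0}"
  proof
    fix v assume v: "v \<in> verts T - {opp T S}"
    then obtain S' where "S' facet_of T" "v = opp T S'" using bij_betw_opp by (auto simp: bij_betw_def)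
    then show "v \<in> {y. bary T S y = 0}" using bary_opp[OF S] v by auto
  qed
  ultimately have "S \<subseteq> {y. bary T S y = 0}"
    by (metis facet_opp(3)[OF S] hull_minimal)
  with x \<open>S \<subseteq> T\<close> show "x \<in> T \<and> bary T S x = 0" by auto
next
  assume A: "x \<in> T \<and> bary T S x = 0"
  let ?G = "{R. R facet_of T} - {S}"
  have s: "(\<Sum>R\<in>?G. bary T R x) = 1" "(\<Sum>R\<in>?G. bary T R x *\<^sub>R opp T R) = x"
    using sum_bary[of x] sum_bary_opp[of x] A S finite_facets by (auto simp: sum.remove[of _ S])
  have "(\<Sum>R\<in>?G. bary T R x *\<^sub>R opp T R) \<in> convex hull (verts T - {opp T S})"
  proof (rule convex_sum)
    fix R assume "R \<in> ?G"
    then have "opp T R \<in> verts T - {opp T S}" using facet_opp opp_inj[OF _ S] by auto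
    then show "opp T R \<in> convex hull (verts T - {opp T S})" by (rule hull_inc)
  qed (use s A mem_simplex_iff finite_facets in auto)
  then show "x \<in> S" using s facet_opp(3)[OF S] by simp
qed

lemma rel_interior_facet_iff:
  assumes S: "S facet_of T"
  shows "x \<in> rel_interior S \<longleftrightarrow> bary T S x = 0 \<and> (\<forall>R. R facet_of T \<longrightarrow> R \<noteq> S \<longrightarrow> 0 < bary T R x)"
proof -
  let ?G = "{R. R facet_of T} - {S}"
  let ?V = "verts T - {opp T S}"
  have bij: "bij_betw (opp T) ?G ?V"
    using bij_betw_opp S opp_inj by (auto simp: bij_betw_def inj_on_def)
  have ind: "\<not> affine_dependent ?V"
    by (meson Diff_subset affine_dependent_subset simplex_verts(1))
  have i: "rel_interior S = {y. \<exists>u. (\<forall>v\<in>?V. 0 < u v) \<and> sum u ?V = 1 \<and> (\<Sum>v\<in>?V. u v *\<^sub>R v) = y}"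
    using rel_interior_convex_hull_explicit[OF ind] facet_opp(3)[OF S] by simp
  show ?thesis
  proof
    assume "x \<in> rel_interior S"
    then obtain u where u: "\<forall>v\<in>?V. 0 < u v" "sum u ?V = 1" "(\<Sum>v\<in>?V. u v *\<^sub>R v) = x"
      unfolding i by auto
    define w where "w R = (if R = S then 0 else u (opp T R))" for R
    have "(\<Sum>R | R facet_of T. w R) = sum u ?V" "(\<Sum>R | R facet_of T. w R *\<^sub>R opp T R) = (\<Sum>v\<in>?V. u v *\<^sub>R v)"
      using S finite_facets sum.reindex_bij_betw[OF bij, of u] sum.reindex_bij_betw[OF bij, of "\<lambda>v. u v *\<^sub>R v"]
      by (simp_all add: sum.remove[of _ S] w_def)
    then have "bary T R x = w R" if "R facet_of T" for R
      using bary_of_combination[OF that, of w] u by simp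
    then show "bary T S x = 0 \<and> (\<forall>R. R facet_of T \<longrightarrow> R \<noteq> S \<longrightarrow> 0 < bary T R x)"
      using u(1) S bij by (auto simp: w_def bij_betw_def)
  next
    assume A: "bary T S x = 0 \<and> (\<forall>R. R facet_of T \<longrightarrow> R \<noteq> S \<longrightarrow> 0 < bary T R x)"
    define u where "u v = bary T (inv_into ?G (opp T) v) x" for v
    have uo: "u (opp T R) = bary T R x" if "R \<in> ?G" for R
      using bij that by (simp add: u_def bij_betw_def)
    have s: "(\<Sum>R\<in>?G. bary T R x) = 1" "(\<Sum>R\<in>?G. bary T R x *\<^sub>R opp T R) = x"
      using sum_bary[of x] sum_bary_opp[of x] A S finite_facets by (auto simp: sum.remove[of _ S])
    have "sum u ?V = 1" "(\<Sum>v\<in>?V. u v *\<^sub>R v) = x"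
      using s sum.reindex_bij_betw[OF bij, of u] sum.reindex_bij_betw[OF bij, of "\<lambda>v. u v *\<^sub>R v"] uo by auto
    moreover have "\<forall>v\<in>?V. 0 < u v"
    proof
      fix v assume "v \<in> ?V"
      then obtain R where "R \<in> ?G" "v = opp T R" using bij by (auto simp: bij_betw_def)
      then show "0 < u v" using uo A by auto
    qed
    ultimately show "x \<in> rel_interior S" unfolding i by auto
  qed
qed

lemma barycenter_simplex: "barycenter T = (1 / (real DIM('a) + 1)) *\<^sub>R (\<Sum>S | S facet_of T. opp T S)"
  using sum.reindex_bij_betw[OF bij_betw_opp, of "\<lambda>x. x"] simplex_verts(4)
  by (simp add: barycenter_def verts_def[symmetric] add.commute)

lemma barycenter_facet:
  assumes S: "S facet_of T"
  shows "barycenter S = (1 / real DIM('a)) *\<^sub>R (\<Sum>R\<in>{R. R facet_of T} - {S}. opp T R)"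
proof -
  have bij: "bij_betw (opp T) ({R. R facet_of T} - {S}) (verts S)"
    using bij_betw_opp S opp_inj facet_opp(4)[OF S] by (auto simp: bij_betw_def inj_on_def)
  have "card (verts S) = DIM('a)"
    using facet_opp[OF S] simplex_verts by simp
  then show ?thesis
    using sum.reindex_bij_betw[OF bij, of "\<lambda>x. x"] by (simp add: barycenter_def verts_def[symmetric])
qed

lemma affine_barycenter_simplex:
  "(real DIM('a) + 1) * (a \<bullet> barycenter T + b) = (\<Sum>S | S facet_of T. a \<bullet> opp T S + b)"
  by (simp add: barycenter_simplex inner_sum_right sum.distrib card_facets algebra_simps add_divide_distrib[symmetric])
    (simp add: field_simps)

lemma affine_barycenter_facet:
  assumes S: "S facet_of T"
  shows "real DIM('a) * (a \<bullet> barycenter S + b) = (\<Sum>R\<in>{R. R facet_of T} - {S}. a \<bullet> opp T R + b)"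
  using S by (simp add: barycenter_facet inner_sum_right sum.distrib card_Diff_singleton card_facets finite_facets algebra_simps)

lemma bary_barycenter_facet:
  assumes S: "S facet_of T" and R: "R facet_of T"
  shows "bary T R (barycenter S) = (if R = S then 0 else 1 / real DIM('a))"
proof -
  let ?u = "\<lambda>R. if R = S then 0 else 1 / real DIM('a)"
  have "(\<Sum>R | R facet_of T. ?u R) = 1"
    using S by (simp add: sum.remove[of _ S] finite_facets card_facets)
  moreover have "barycenter S = (\<Sum>R | R facet_of T. ?u R *\<^sub>R opp T R)"
    using S by (simp add: barycenter_facet sum.remove[of _ S] finite_facets scaleR_sum_right)
  ultimately show ?thesis using bary_of_combination[OF R, of ?u] by simp
qed

lemma barycenter_in_rel_interior: "S facet_of T \<Longrightarrow> barycenter S \<in> rel_interior S"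
  by (simp add: rel_interior_facet_iff bary_barycenter_facet)

lemma bary_grad_nonzero: "S facet_of T \<Longrightarrow> bary_grad T S \<noteq> 0"
  using bary_barycenter_facet[of S S] by (auto simp: bary_def)

lemma compact_full_simplex: "compact T" "convex T" "interior T \<noteq> {}"
proof -
  show "compact T" "convex T" using T compact_simplex convex_simplex by auto
  let ?u = "\<lambda>R::'a set. 1 / (real DIM('a) + 1)"
  have "(\<Sum>R | R facet_of T. ?u R) = 1" by (simp add: card_facets field_simps)
  from bary_of_combination[OF _ this] have "(\<Sum>R | R facet_of T. ?u R *\<^sub>R opp T R) \<in> interior T"
    by (simp add: interior_simplex_iff)
  then show "interior T \<noteq> {}" by auto
qed

end

lemma bary_barycenter_simplex:
  fixes T :: "'a::euclidean_space set"
  assumes T: "full_simplex T" and S: "S facet_of T"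
  shows "bary T S (barycenter T) = 1 / (real DIM('a) + 1)"
proof -
  let ?u = "\<lambda>R::'a set. 1 / (real DIM('a) + 1)"
  have "(\<Sum>R | R facet_of T. ?u R) = 1" by (simp add: card_facets[OF T] field_simps)
  moreover have "barycenter T = (\<Sum>R | R facet_of T. ?u R *\<^sub>R opp T R)"
    by (simp add: barycenter_simplex[OF T] scaleR_sum_right)
  ultimately show ?thesis using bary_of_combination[OF T S, of ?u] by simp
qed

section \<open>Mean values of affine functions\<close>

lemma measure_full_simplex_pos:
  fixes T :: "(real^'d) set"
  assumes "full_simplex T" shows "measure lebesgue T > 0"
proof -
  have "\<not> negligible T"
    using compact_full_simplex[OF assms] open_not_negligible[of "interior T"] interior_subset negligible_subset by blast
  then show ?thesis
    using compact_full_simplex(1)[OF assms] by (simp add: negligible_iff_measure zero_less_measure_iff lmeasurable_compact)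
qed

lemma set_integrable_continuous_compact:
  fixes f :: "'a::euclidean_space \<Rightarrow> 'b::euclidean_space"
  assumes "compact P" "continuous_on UNIV f"
  shows "set_integrable lebesgue P f"
proof -
  have "integrable lborel (\<lambda>x. indicator P x *\<^sub>R f x)"
    by (rule borel_integrable_compact) (use assms continuous_on_subset in auto)
  moreover have [measurable]: "f \<in> borel_measurable borel" "P \<in> sets borel"
    using assms by (auto intro: borel_measurable_continuous_onI borel_compact)
  ultimately show ?thesis unfolding set_integrable_def by (subst integrable_completion) auto
qed

lemma set_integral_sum:
  fixes f :: "'i \<Rightarrow> 'a \<Rightarrow> 'b::{banach, second_countable_topology}"
  assumes "\<And>i. i \<in> I \<Longrightarrow> set_integrable M A (f i)"
  shows "(LINT x:A|M. (\<Sum>i\<in>I. f i x)) = (\<Sum>i\<in>I. LINT x:A|M. f i x)"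
  using assms unfolding set_lebesgue_integral_def set_integrable_def scaleR_sum_right
  by (rule Bochner_Integration.integral_sum)

text \<open>An affine involution that maps a set of positive finite measure to itself has dilation \<open>1\<close>.\<close>

lemma integral_invariant_involution:
  fixes L :: "'a::euclidean_space \<Rightarrow> 'a" and \<psi> :: "'a \<Rightarrow> 'b::euclidean_space"
  assumes L: "linear L" and inv: "\<And>x. b + L (b + L x) = x"
    and P: "P \<in> sets borel" "measure lebesgue P > 0" "\<And>x. x \<in> P \<Longrightarrow> b + L x \<in> P"
    and \<psi>: "\<psi> \<in> borel_measurable borel"
  shows "(LINT x:P|lebesgue. \<psi> (b + L x)) = (LINT x:P|lebesgue. \<psi> x)"
proof -
  have "b + L b = 0" using inv[of 0] linear_0[OF L] by simp
  then have LL: "L (L x) = x" for x using inv[of x] linear_add[OF L, of b "L x"] by (simp add: add.assoc[symmetric])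
  have bL: "bij L" by (rule o_bij[of L]) (auto simp: LL)
  have im: "(\<lambda>x. b + L x) ` P = P"
    using P(3) inv by (auto simp: image_iff) metis
  have "dilation L = 1" using measure_affine_image[OF L bL P(1), of b] P(2) by (simp add: im)
  then show ?thesis using affine_change_of_variables(1)[OF L bL P(1) \<psi>, of b] by (simp add: im)
qed

context
  fixes T :: "(real^'d) set"
  assumes T: "full_simplex T"
begin

text \<open>Exchanging two vertices maps the simplex onto itself and exchanges their coordinates.\<close>

lemma integral_bary_eq:
  assumes S: "S facet_of T" and R: "R facet_of T"
  shows "(LINT x:T|lebesgue. bary T S x) = (LINT x:T|lebesgue. bary T R x)"
proof (cases "S = R")
  case False
  define e where "e = opp T R - opp T S"
  define L where "L y = y + ((bary_grad T S - bary_grad T R) \<bullet> y) *\<^sub>R e" for y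
  define b where "b = (bary T S 0 - bary T R 0) *\<^sub>R e"
  have L: "linear L" unfolding L_def[abs_def] by (rule linear_rank_one_update)
  have f: "b + L x = x + (bary T S x - bary T R x) *\<^sub>R e" for x
    by (simp add: b_def L_def bary_affine[of T _ x 0] algebra_simps inner_diff_left)
  have be: "bary T Q (x + t *\<^sub>R e) = bary T Q x + t * (bary T Q (opp T R) - bary T Q (opp T S))" for Q x t
    by (simp add: e_def bary_def inner_diff_right algebra_simps)
  have bQ: "bary T Q (b + L x) = (if Q = S then bary T R x else if Q = R then bary T S x else bary T Q x)"
    if "Q facet_of T" for Q x
    using that S R False by (simp add: f be bary_opp[OF T])
  have inv: "b + L (b + L x) = x" for x
    using S R False by (subst f) (simp add: bQ, simp add: f algebra_simps)
  have "(LINT x:T|lebesgue. bary T S (b + L x)) = (LINT x:T|lebesgue. bary T S x)"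
  proof (rule integral_invariant_involution[OF L inv])
    show "T \<in> sets borel" using compact_full_simplex(1)[OF T] borel_compact by blast
    show "measure lebesgue T > 0" by (rule measure_full_simplex_pos[OF T])
    show "b + L x \<in> T" if "x \<in> T" for x
      using that S R unfolding mem_simplex_iff[OF T] by (auto simp: bQ)
    show "bary T S \<in> borel_measurable borel"
      unfolding bary_def[abs_def] by (intro borel_measurable_continuous_onI continuous_intros)
  qed
  then show ?thesis using S by (simp add: bQ)
qed simp

text \<open>By symmetry all barycentric coordinates have the same mean value, so the mean value of an affine
  function is the average of its values at the vertices.\<close>

lemma integral_affine_simplex:
  "(LINT x:T|lebesgue. a \<bullet> x + b) = measure lebesgue T * (a \<bullet> barycenter T + b)"
proof -
  let ?F = "{S. S facet_of T}"
  have cb: "continuous_on UNIV (bary T S)" for S unfolding bary_def[abs_def] by (intro continuous_intros)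
  have ib: "set_integrable lebesgue T (\<lambda>x. bary T S x * c)" for S c
    by (intro set_integrable_continuous_compact continuous_intros cb compact_full_simplex[OF T])
  obtain S where S: "S facet_of T" using card_facets[OF T] by (metis card.empty empty_Collect_eq nat.distinct(1))
  define m where "m = (LINT x:T|lebesgue. bary T S x)"
  have m: "(LINT x:T|lebesgue. bary T R x) = m" if "R facet_of T" for R
    unfolding m_def by (rule integral_bary_eq[OF that S])
  have sum: "(LINT x:T|lebesgue. (\<Sum>R\<in>?F. bary T R x * c R)) = m * (\<Sum>R\<in>?F. c R)" for c
  proof -
    have "(LINT x:T|lebesgue. (\<Sum>R\<in>?F. bary T R x * c R)) = (\<Sum>R\<in>?F. LINT x:T|lebesgue. bary T R x * c R)"
      by (rule set_integral_sum[OF ib])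
    also have "\<dots> = (\<Sum>R\<in>?F. m * c R)" by (rule sum.cong) (simp_all add: m)
    finally show ?thesis by (simp add: sum_distrib_left)
  qed
  have "T \<in> sets lebesgue" using compact_full_simplex[OF T] lmeasurable_compact by blast
  then have "measure lebesgue T = m * (real CARD('d) + 1)"
    using sum[of "\<lambda>_. 1"] by (simp add: sum_bary[OF T] card_facets[OF T] set_integral_one_lebesgue add.commute)
  moreover have "(LINT x:T|lebesgue. a \<bullet> x + b) = m * (\<Sum>R\<in>?F. a \<bullet> opp T R + b)"
    unfolding sum[symmetric]
    by (intro arg_cong[where f="set_lebesgue_integral lebesgue T"] ext affine_eq_sum_bary[OF T])
  ultimately show ?thesis
    using affine_barycenter_simplex[OF T, of a b] by (simp add: mult.assoc)
qed

end

text \<open>The orthogonal projection onto the hyperplane of \<open>S\<close>, and the set of points within distance \<open>1/2\<close> of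
  this hyperplane that project to \<open>S\<close>, whose volume defines the measure of \<open>S\<close>.\<close>

definition foot :: "'a::euclidean_space set \<Rightarrow> 'a set \<Rightarrow> 'a \<Rightarrow> 'a" where
  "foot T S y = y - (bary T S y / (bary_grad T S \<bullet> bary_grad T S)) *\<^sub>R bary_grad T S"

definition prism :: "'a::euclidean_space set \<Rightarrow> 'a set \<Rightarrow> 'a set" where
  "prism T S = {y. \<bar>bary T S y\<bar> \<le> norm (bary_grad T S) / 2 \<and> foot T S y \<in> S}"

lemma continuous_on_bary[continuous_intros]: "continuous_on A (bary T S)"
  unfolding bary_def[abs_def] by (intro continuous_intros)

lemma continuous_on_foot[continuous_intros]: "continuous_on A (foot T S)"
  unfolding foot_def[abs_def] divide_inverse by (intro continuous_intros)

lemma bary_foot: 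
  "bary_grad T S \<noteq> 0 \<Longrightarrow> bary T S (foot T S y) = 0"
  by (simp add: foot_def bary_def inner_diff_right)

context
  fixes T S :: "(real^'d) set"
  assumes T: "full_simplex T" and S: "S facet_of T"
begin

lemma compact_facet: "compact S" "convex S"
proof -
  have "polytope S"
    using S T face_of_polytope_polytope simplex_imp_polytope unfolding facet_of_def by blast
  then show "compact S" "convex S" by (auto simp: polytope_imp_compact polytope_imp_convex)
qed

lemma compact_prism: "compact (prism T S)"
proof -
  let ?g = "bary_grad T S"
  have g: "?g \<noteq> 0" using bary_grad_nonzero[OF T S] .
  have "closed ({y. \<bar>bary T S y\<bar> \<le> norm ?g / 2} \<inter> foot T S -` S)"
    by (rule closed_Int[OF closed_Collect_le closed_vimage])
      (auto intro: continuous_on_foot continuous_on_bary continuous_on_rabs continuous_on_const compact_imp_closed compact_facet)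
  moreover obtain B where B: "\<And>x. x \<in> S \<Longrightarrow> norm x \<le> B"
    using compact_imp_bounded[OF compact_facet(1)] unfolding bounded_iff by auto
  have "norm y \<le> B + 1/2" if "y \<in> prism T S" for y
  proof -
    have eq: "y = foot T S y + (bary T S y / (?g \<bullet> ?g)) *\<^sub>R ?g" by (simp add: foot_def)
    have "norm y \<le> norm (foot T S y) + norm ((bary T S y / (?g \<bullet> ?g)) *\<^sub>R ?g)"
      by (subst (1) eq) (rule norm_triangle_ineq)
    also have "norm ((bary T S y / (?g \<bullet> ?g)) *\<^sub>R ?g) = \<bar>bary T S y\<bar> / norm ?g"
      using g by (simp add: dot_square_norm power2_eq_square)
    also have "\<dots> \<le> 1/2" using that g by (simp add: prism_def field_simps)
    finally show ?thesis using that B[of "foot T S y"] by (simp add: prism_def)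
  qed
  then have "bounded (prism T S)" by (auto simp: bounded_iff)
  moreover have "prism T S = {y. \<bar>bary T S y\<bar> \<le> norm ?g / 2} \<inter> foot T S -` S" by (auto simp: prism_def)
  ultimately show ?thesis by (simp add: compact_eq_bounded_closed)
qed

lemma opp_diff_orthogonal:
  "R facet_of T \<Longrightarrow> Q facet_of T \<Longrightarrow> R \<noteq> S \<Longrightarrow> Q \<noteq> S \<Longrightarrow> bary_grad T S \<bullet> (opp T R - opp T Q) = 0"
  using bary_opp[OF T S, of R] bary_opp[OF T S, of Q] bary_affine[of T S "opp T R" "opp T Q"] by simp

text \<open>The exchange of two vertices of \<open>S\<close>, extended to the prism as an affine map that leaves the
  direction orthogonal to \<open>S\<close> fixed.\<close>

lemma integral_bary_foot_eq:
  assumes R: "R facet_of T" "R \<noteq> S" and Q: "Q facet_of T" "Q \<noteq> S" and pos: "measure lebesgue (prism T S) > 0"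
  shows "(LINT y:prism T S|lebesgue. bary T R (foot T S y)) = (LINT y:prism T S|lebesgue. bary T Q (foot T S y))"
proof (cases "R = Q")
  case False
  let ?g = "bary_grad T S"
  have g: "?g \<noteq> 0" using bary_grad_nonzero[OF T S] .
  define e where "e = opp T Q - opp T R"
  have ge: "?g \<bullet> e = 0" unfolding e_def using opp_diff_orthogonal Q R by simp
  define G where "G = bary_grad T R - bary_grad T Q"
  define L where "L y = y + ((G - ((G \<bullet> ?g) / (?g \<bullet> ?g)) *\<^sub>R ?g) \<bullet> y) *\<^sub>R e" for y
  define b where "b = (bary T R (foot T S 0) - bary T Q (foot T S 0)) *\<^sub>R e"
  have L: "linear L" unfolding L_def[abs_def] by (rule linear_rank_one_update)
  have d: "foot T S x - foot T S 0 = x - ((?g \<bullet> x) / (?g \<bullet> ?g)) *\<^sub>R ?g" for x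
    by (simp add: foot_def bary_affine[of T S x 0] add_divide_distrib scaleR_left_distrib)
  have key: "bary T R (foot T S x) - bary T Q (foot T S x) = bary T R (foot T S 0) - bary T Q (foot T S 0)
     + (G - ((G \<bullet> ?g) / (?g \<bullet> ?g)) *\<^sub>R ?g) \<bullet> x" for x
  proof -
    have "bary T R (foot T S x) - bary T Q (foot T S x) = bary T R (foot T S 0) - bary T Q (foot T S 0)
       + G \<bullet> (foot T S x - foot T S 0)"
      using bary_affine[of T R "foot T S x" "foot T S 0"] bary_affine[of T Q "foot T S x" "foot T S 0"]
      by (simp add: G_def inner_diff_left)
    then show ?thesis unfolding d by (simp add: inner_diff_left inner_diff_right mult.commute)
  qed
  have f: "b + L x = x + (bary T R (foot T S x) - bary T Q (foot T S x)) *\<^sub>R e" for x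
    by (subst key) (simp add: b_def L_def scaleR_left_distrib)
  have bS: "bary T S (b + L x) = bary T S x" for x
    using ge by (simp add: f bary_affine[of T S "x + _" x])
  have ft: "foot T S (b + L x) = foot T S x + (bary T R (foot T S x) - bary T Q (foot T S x)) *\<^sub>R e" for x
    by (simp add: foot_def bS) (simp add: f foot_def)
  have be: "bary T P (x + t *\<^sub>R e) = bary T P x + t * (bary T P (opp T Q) - bary T P (opp T R))" for P x t
    by (simp add: e_def bary_def inner_diff_right algebra_simps)
  have bP: "bary T P (foot T S (b + L x)) = (if P = R then bary T Q (foot T S x) else if P = Q then bary T R (foot T S x) else bary T P (foot T S x))"
    if "P facet_of T" for P x
    using that R Q False by (simp add: ft be bary_opp[OF T])
  have inv: "b + L (b + L x) = x" for x
    using R Q False by (subst f) (simp add: bP, simp add: f algebra_simps)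
  have "(LINT x:prism T S|lebesgue. bary T R (foot T S (b + L x))) = (LINT x:prism T S|lebesgue. bary T R (foot T S x))"
  proof (rule integral_invariant_involution[OF L inv])
    show "prism T S \<in> sets borel" using compact_prism borel_compact by blast
    show "b + L x \<in> prism T S" if "x \<in> prism T S" for x
      using that R Q unfolding prism_def mem_facet_iff[OF T S] mem_simplex_iff[OF T] by (auto simp: bP bS S)
    show "(\<lambda>x. bary T R (foot T S x)) \<in> borel_measurable borel"
      by (intro borel_measurable_continuous_onI continuous_on_compose2[OF continuous_on_bary] continuous_intros) auto
  qed (rule pos)
  then show ?thesis using R by (simp add: bP)
qed simp

lemma integral_affine_foot:
  assumes pos: "measure lebesgue (prism T S) > 0"
  shows "(LINT y:prism T S|lebesgue. a \<bullet> foot T S y + b) = measure lebesgue (prism T S) * (a \<bullet> barycenter S + b)"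
proof -
  let ?F = "{R. R facet_of T} - {S}"
  have g: "bary_grad T S \<noteq> 0" using bary_grad_nonzero[OF T S] .
  have ib: "set_integrable lebesgue (prism T S) (\<lambda>y. bary T R (foot T S y) * c)" for R c
    by (intro set_integrable_continuous_compact continuous_intros continuous_on_compose2[OF continuous_on_bary] compact_prism) auto
  have "card ?F \<noteq> 0" using S by (simp add: card_Diff_singleton card_facets[OF T] finite_facets[OF T])
  then obtain R where R: "R facet_of T" "R \<noteq> S" by (metis (no_types, lifting) Diff_iff card.empty ex_in_conv mem_Collect_eq singletonI)
  define m where "m = (LINT x:prism T S|lebesgue. bary T R (foot T S x))"
  have m: "(LINT x:prism T S|lebesgue. bary T Q (foot T S x)) = m" if "Q \<in> ?F" for Q
    unfolding m_def using integral_bary_foot_eq[OF _ _ R pos] that by auto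
  have sum: "(LINT x:prism T S|lebesgue. (\<Sum>Q\<in>?F. bary T Q (foot T S x) * c Q)) = m * (\<Sum>Q\<in>?F. c Q)" for c
  proof -
    have "(LINT x:prism T S|lebesgue. (\<Sum>R\<in>?F. bary T R (foot T S x) * c R)) = (\<Sum>R\<in>?F. LINT x:prism T S|lebesgue. bary T R (foot T S x) * c R)"
      by (rule set_integral_sum[OF ib])
    also have "\<dots> = (\<Sum>R\<in>?F. m * c R)" by (rule sum.cong) (simp_all add: m)
    finally show ?thesis by (simp add: sum_distrib_left)
  qed
  have lin: "a \<bullet> foot T S x + b = (\<Sum>Q\<in>?F. bary T Q (foot T S x) * (a \<bullet> opp T Q + b))" for a b x
    using affine_eq_sum_bary[OF T, of a "foot T S x" b] S bary_foot[OF g]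
    by (simp add: sum.remove[of _ S] finite_facets[OF T])
  have "prism T S \<in> sets lebesgue" using compact_prism lmeasurable_compact by blast
  then have "measure lebesgue (prism T S) = m * real CARD('d)"
    using sum[of "\<lambda>_. 1"] lin[of 0 _ 1] S
    by (simp add: card_Diff_singleton card_facets[OF T] finite_facets[OF T] set_integral_one_lebesgue)
  moreover have "(LINT x:prism T S|lebesgue. a \<bullet> foot T S x + b) = m * (\<Sum>R\<in>?F. a \<bullet> opp T R + b)"
    unfolding sum[symmetric] by (intro arg_cong[where f="set_lebesgue_integral lebesgue (prism T S)"] ext lin)
  ultimately show ?thesis
    using affine_barycenter_facet[OF T S, of a b] by (simp add: mult.assoc)
qed

end

section \<open>The measure of a facet in terms of the volume of an element\<close>

lemma dilation_scaleR:
  fixes r :: real assumes "r > 0"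
  shows "dilation (\<lambda>x::'a::euclidean_space. r *\<^sub>R x) = r ^ DIM('a)" "bij (\<lambda>x::'a. r *\<^sub>R x)"
proof -
  show "dilation (\<lambda>x::'a. r *\<^sub>R x) = r ^ DIM('a)"
    using measure_lebesgue_affine[of r "0::'a" "cbox 0 One"] assms
    by (simp add: dilation_def content_cbox')
  show "bij (\<lambda>x::'a. r *\<^sub>R x)"
    by (rule o_bij[of "\<lambda>x. (1/r) *\<^sub>R x"]) (use assms in auto)
qed

text \<open>Any sequence that tends to \<open>1\<close> from below would serve.\<close>

definition shrink_factor :: "nat \<Rightarrow> real" where "shrink_factor n = 1 - 1 / (real n + 2)"

lemma shrink_factor: "0 < shrink_factor n" "shrink_factor n < 1" "shrink_factor \<longlonglongrightarrow> 1"
proof -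
  show "0 < shrink_factor n" "shrink_factor n < 1" by (auto simp: shrink_factor_def field_simps)
  have "(\<lambda>n. 1 / (real n + 2)) \<longlonglongrightarrow> 0" using LIMSEQ_ignore_initial_segment[OF lim_1_over_n, of 2] by (simp add: add.commute)
  then show "shrink_factor \<longlonglongrightarrow> 1" unfolding shrink_factor_def[abs_def] using tendsto_diff[OF tendsto_const] by fastforce
qed

definition shrink :: "'a::euclidean_space \<Rightarrow> real \<Rightarrow> 'a \<Rightarrow> 'a" where
  "shrink p r x = p + r *\<^sub>R (x - p)"

lemma shrink_eq: "shrink p r = (\<lambda>x. (p - r *\<^sub>R p) + r *\<^sub>R x)"
  by (auto simp: shrink_def fun_eq_iff algebra_simps)

lemma integral_shrink:
  fixes \<psi> :: "'a::euclidean_space \<Rightarrow> 'b::euclidean_space"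
  assumes "0 < r" "P \<in> sets borel" "\<psi> \<in> borel_measurable borel"
  shows "(LINT x:shrink p r ` P|lebesgue. \<psi> x) = r ^ DIM('a) *\<^sub>R (LINT x:P|lebesgue. \<psi> (shrink p r x))"
  using affine_change_of_variables(1)[OF linear_scaleR dilation_scaleR(2)[OF assms(1)] assms(2,3)]
  unfolding shrink_eq dilation_scaleR(1)[OF assms(1)] by blast

lemma measure_shrink:
  fixes P :: "'a::euclidean_space set"
  assumes "0 < r" "P \<in> sets borel"
  shows "measure lebesgue (shrink p r ` P) = r ^ DIM('a) * measure lebesgue P"
  using measure_affine_image[OF linear_scaleR dilation_scaleR(2)[OF assms(1)] assms(2)]
  unfolding shrink_eq dilation_scaleR(1)[OF assms(1)] by blast

lemma bary_shrink: "bary T S (shrink p r x) = bary T S p + r * (bary T S x - bary T S p)"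
  by (simp add: shrink_def bary_def inner_diff_right inner_add_right algebra_simps)

lemma bary_line: "bary T S (x + t *\<^sub>R (y - z)) = bary T S x + t * (bary T S y - bary T S z)"
  by (simp add: bary_def inner_diff_right inner_add_right algebra_simps)

lemma continuous_on_shrink[continuous_intros]: "continuous_on A (shrink p r)"
  unfolding shrink_def[abs_def] by (intro continuous_intros)

definition tilted :: "'a::euclidean_space set \<Rightarrow> 'a \<Rightarrow> 'a set" where
  "tilted S w = (\<lambda>(s, t). s + t *\<^sub>R w) ` (S \<times> {0..1::real})"

lemma compact_tilted: "compact S \<Longrightarrow> compact (tilted S w)"
  unfolding tilted_def by (intro compact_continuous_image compact_Times) (auto intro!: continuous_intros simp: split_beta)

context
  fixes T S :: "(real^'d) set"
  assumes T: "full_simplex T" and S: "S facet_of T"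
begin

text \<open>The rank one update that fixes directions in \<open>S\<close> and sends the unit normal to \<open>w\<close> carries the
  prism, up to a translation, to the tilted slab.\<close>

lemma measure_tilted:
  assumes w: "bary_grad T S \<bullet> w \<noteq> 0"
  shows "norm (bary_grad T S) * measure lebesgue (tilted S w) = \<bar>bary_grad T S \<bullet> w\<bar> * measure lebesgue (prism T S)"
proof -
  let ?g = "bary_grad T S"
  have g: "norm ?g > 0" using bary_grad_nonzero[OF T S] by simp
  define n where "n = ?g /\<^sub>R norm ?g"
  have n: "norm n = 1" using g by (simp add: n_def)
  have nw: "n \<bullet> w = (?g \<bullet> w) / norm ?g" by (simp add: n_def divide_inverse mult.commute)
  then have nw0: "n \<bullet> w \<noteq> 0" using w g by simp
  define M where "M x = x + (n \<bullet> x) *\<^sub>R (w - n)" for x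
  have lM: "linear M" unfolding M_def[abs_def] by (rule linear_rank_one_update)
  have dM: "dilation M = \<bar>n \<bullet> w\<bar>" "bij M"
    using dilation_rank_one_update[OF n nw0] unfolding M_def[abs_def] by auto
  define s0 where "s0 = barycenter S"
  have s0: "bary T S s0 = 0" unfolding s0_def using bary_barycenter_facet[OF T S S] by simp
  define b where "b = s0 - M s0 + (1/2) *\<^sub>R w"
  have ft: "foot T S y = y - (bary T S y / norm ?g) *\<^sub>R n" for y
    using g by (simp add: foot_def n_def dot_square_norm power2_eq_square divide_inverse)
  then have dec: "y = foot T S y + (bary T S y / norm ?g) *\<^sub>R n" for y by simp
  have nb: "n \<bullet> (y - s0) = bary T S y / norm ?g" for y
    using bary_affine[of T S y s0] s0 by (simp add: n_def divide_inverse mult.commute)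
  have bM: "b + M y = foot T S y + (bary T S y / norm ?g + 1/2) *\<^sub>R w" for y
  proof -
    have "b + M y = s0 + M (y - s0) + (1/2) *\<^sub>R w" by (simp add: b_def linear_diff[OF lM])
    also have "\<dots> = y + (bary T S y / norm ?g) *\<^sub>R (w - n) + (1/2) *\<^sub>R w" by (simp add: M_def nb)
    also have "\<dots> = foot T S y + (bary T S y / norm ?g) *\<^sub>R n + (bary T S y / norm ?g) *\<^sub>R (w - n) + (1/2) *\<^sub>R w"
      by (subst (1) dec) simp
    finally show ?thesis by (simp add: algebra_simps)
  qed
  have "(\<lambda>y. b + M y) ` prism T S = tilted S w"
  proof (intro set_eqI iffI)
    fix x assume "x \<in> (\<lambda>y. b + M y) ` prism T S"
    then obtain y where y: "y \<in> prism T S" "x = b + M y" by auto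
    have "\<bar>bary T S y / norm ?g\<bar> \<le> 1/2" using y(1) g by (simp add: prism_def field_simps)
    then have "bary T S y / norm ?g + 1/2 \<in> {0..1}" unfolding atLeastAtMost_iff by argo
    then show "x \<in> tilted S w" using y unfolding tilted_def bM prism_def by (auto intro!: image_eqI)
  next
    fix x assume "x \<in> tilted S w"
    then obtain s t where st: "s \<in> S" "0 \<le> t" "t \<le> 1" "x = s + t *\<^sub>R w" by (auto simp: tilted_def)
    define y where "y = s + (t - 1/2) *\<^sub>R n"
    have bs: "bary T S s = 0" using st(1) mem_facet_iff[OF T S] by simp
    have hy: "bary T S y = (t - 1/2) * norm ?g"
    proof -
      have "y - s = (t - 1/2) *\<^sub>R n" by (simp add: y_def)
      moreover have "?g \<bullet> n = norm ?g" using g by (simp add: n_def dot_square_norm power2_eq_square)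
      ultimately show ?thesis using bary_affine[of T S y s] bs by simp
    qed
    have fy: "foot T S y = s" using g by (simp add: ft hy) (simp add: y_def)
    have "\<bar>bary T S y\<bar> \<le> norm ?g / 2"
      unfolding hy abs_mult using st(2,3) g mult_right_mono[of "\<bar>t - 1/2\<bar>" "1/2" "norm ?g"] by (simp add: abs_if)
    then have "y \<in> prism T S" using st(1) by (simp add: prism_def fy)
    moreover have "x = b + M y" unfolding bM fy hy using g st(4) by simp
    ultimately show "x \<in> (\<lambda>y. b + M y) ` prism T S" by auto
  qed
  moreover have "prism T S \<in> sets borel" using compact_prism[OF T S] borel_compact by blast
  ultimately have "measure lebesgue (tilted S w) = \<bar>n \<bullet> w\<bar> * measure lebesgue (prism T S)"
    using measure_affine_image[OF lM dM(2), of "prism T S" b] by (simp add: dM)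
  then show ?thesis using g by (simp add: nw abs_divide)
qed

lemma shrink_simplex_subset: "0 \<le> r \<Longrightarrow> r \<le> 1 \<Longrightarrow> shrink (opp T S) r ` T \<subseteq> T"
proof
  fix x assume r: "0 \<le> r" "r \<le> 1" and "x \<in> shrink (opp T S) r ` T"
  then obtain y where y: "y \<in> T" "x = shrink (opp T S) r y" by auto
  show "x \<in> T" unfolding mem_simplex_iff[OF T]
  proof (intro allI impI)
    fix R assume R: "R facet_of T"
    have "bary T R x = (1 - r) * bary T R (opp T S) + r * bary T R y" by (simp add: y bary_shrink algebra_simps)
    then show "0 \<le> bary T R x" using r y R bary_opp[OF T R S] unfolding mem_simplex_iff[OF T] by simp
  qed
qed

text \<open>Shrinking towards a vertex cuts the simplex by a hyperplane parallel to the opposite facet; what is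
  removed is a layer along this facet.\<close>

lemma mem_shrink_simplex_iff:
  assumes "0 < r" "r \<le> 1"
  shows "x \<in> shrink (opp T S) r ` T \<longleftrightarrow> x \<in> T \<and> 1 - r \<le> bary T S x"
proof -
  let ?p = "opp T S"
  have inv: "shrink ?p r (shrink ?p (1/r) x) = x" for x using assms by (simp add: shrink_def)
  have "x \<in> shrink ?p r ` T \<longleftrightarrow> shrink ?p (1/r) x \<in> T"
    using assms by (auto simp: image_iff shrink_def) (metis inv shrink_def)
  also have "\<dots> \<longleftrightarrow> x \<in> T \<and> 1 - r \<le> bary T S x"
  proof -
    have "bary T S (shrink ?p (1/r) x) = (bary T S x - (1 - r)) / r"
      using assms by (simp add: bary_shrink bary_opp[OF T S S] field_simps)
    moreover have "bary T R (shrink ?p (1/r) x) = bary T R x / r" if "R facet_of T" "R \<noteq> S" for R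
      using that by (simp add: bary_shrink bary_opp[OF T that(1) S])
    ultimately have sgn: "0 \<le> bary T S (shrink ?p (1/r) x) \<longleftrightarrow> 1 - r \<le> bary T S x"
      "\<And>R. R facet_of T \<Longrightarrow> R \<noteq> S \<Longrightarrow> 0 \<le> bary T R (shrink ?p (1/r) x) \<longleftrightarrow> 0 \<le> bary T R x"
      using assms by (simp_all add: zero_le_divide_iff)
    have split: "y \<in> T \<longleftrightarrow> 0 \<le> bary T S y \<and> (\<forall>R. R facet_of T \<longrightarrow> R \<noteq> S \<longrightarrow> 0 \<le> bary T R y)" for y
      unfolding mem_simplex_iff[OF T] using S by blast
    have "1 - r \<le> bary T S x \<Longrightarrow> 0 \<le> bary T S x" using assms by linarith
    then show ?thesis unfolding split using sgn by blast
  qed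
  finally show ?thesis .
qed

text \<open>Moving parallel to the segment from \<open>opp T S\<close> to the barycenter of \<open>S\<close> decreases no coordinate other than
  the one of \<open>S\<close>.\<close>

lemma slide_to_facet:
  assumes x: "x \<in> T"
  shows "x - bary T S x *\<^sub>R (opp T S - barycenter S) \<in> S"
proof -
  let ?z = "x - bary T S x *\<^sub>R (opp T S - barycenter S)"
  have bz: "bary T R ?z = bary T R x - bary T S x * (bary T R (opp T S) - bary T R (barycenter S))" for R
    using bary_line[of T R x "- bary T S x"] by simp
  have pos: "0 \<le> bary T R x" if "R facet_of T" for R using x that unfolding mem_simplex_iff[OF T] by auto
  show ?thesis unfolding mem_facet_iff[OF T S] mem_simplex_iff[OF T]
  proof (intro conjI allI impI)
    show "bary T S ?z = 0" using S by (simp add: bz bary_opp[OF T] bary_barycenter_facet[OF T])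
    fix R assume R: "R facet_of T"
    show "0 \<le> bary T R ?z"
    proof (cases "R = S")
      case False
      have "0 \<le> bary T R x + bary T S x / real CARD('d)" using pos[OF R] pos[OF S] by simp
      then show ?thesis using R S False by (simp add: bz bary_opp[OF T] bary_barycenter_facet[OF T])
    qed (use S in \<open>simp add: bz bary_opp[OF T] bary_barycenter_facet[OF T]\<close>)
  qed
qed

text \<open>The layer of the simplex next to \<open>S\<close> lies between two tilted slabs whose volumes agree to
  first order in its thickness; this is the volume formula of a cone in differential form.\<close>

theorem prism_measure: "measure lebesgue (prism T S) = real CARD('d) * measure lebesgue T * norm (bary_grad T S)"
proof -
  let ?g = "bary_grad T S" and ?p = "opp T S"
  let ?d = "CARD('d)"
  have g: "norm ?g > 0" using bary_grad_nonzero[OF T S] by simp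
  define e where "e = ?p - barycenter S"
  have ge: "?g \<bullet> e = 1"
    using bary_affine[of T S ?p "barycenter S"] bary_opp[OF T S S] bary_barycenter_facet[OF T S S] by (simp add: e_def)
  define A where "A = measure lebesgue (prism T S) / norm ?g"
  have tilt: "measure lebesgue (tilted S (t *\<^sub>R e)) = \<bar>t\<bar> * A" if "t \<noteq> 0" for t
    using measure_tilted[of "t *\<^sub>R e"] that g ge by (simp add: A_def field_simps)
  define V where "V = measure lebesgue T"
  have cT: "compact T" using compact_full_simplex[OF T] by simp
  have cS: "compact S" by (rule compact_facet(1)[OF T S])
  have lm: "shrink ?p r ` P \<in> lmeasurable" if "compact P" for r P
    using that by (intro lmeasurable_compact compact_continuous_image continuous_on_shrink)
  have bl: "bary T R (z + c *\<^sub>R e) = bary T R z + c * (bary T R ?p - bary T R (barycenter S))" for R z c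
    unfolding e_def by (rule bary_line)
  have bounds: "(1 - r ^ ?d) * V \<le> (1 - r) * A \<and> r ^ (?d - 1) * (1 - r) * A \<le> (1 - r ^ ?d) * V"
    if r: "0 < r" "r < 1" for r
  proof -
    let ?Tr = "shrink ?p r ` T"
    have mTr: "measure lebesgue ?Tr = r ^ ?d * V"
      using measure_shrink[OF r(1) borel_compact[OF cT], of ?p] by (simp add: V_def del: measure_completion)
    have up: "T \<subseteq> ?Tr \<union> tilted S ((1 - r) *\<^sub>R e)"
    proof
      fix x assume x: "x \<in> T"
      show "x \<in> ?Tr \<union> tilted S ((1 - r) *\<^sub>R e)"
      proof (cases "1 - r \<le> bary T S x")
        case True
        then show ?thesis using x r mem_shrink_simplex_iff[of r x] by auto
      next
        case False
        define z where "z = x - bary T S x *\<^sub>R e"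
        have "z \<in> S" unfolding z_def e_def by (rule slide_to_facet[OF x])
        moreover have "0 \<le> bary T S x" using x S mem_simplex_iff[OF T] by blast
        then have "bary T S x / (1 - r) \<in> {0..1}" using False r by (simp add: field_simps)
        moreover have "x = z + (bary T S x / (1 - r)) *\<^sub>R ((1 - r) *\<^sub>R e)" using r by (simp add: z_def)
        ultimately have "x \<in> tilted S ((1 - r) *\<^sub>R e)"
          unfolding tilted_def by (intro image_eqI[where x="(z, bary T S x / (1 - r))"]) auto
        then show ?thesis by simp
      qed
    qed
    have lt: "tilted S w \<in> lmeasurable" for w using cS compact_tilted lmeasurable_compact by blast
    have "V \<le> measure lebesgue (?Tr \<union> tilted S ((1 - r) *\<^sub>R e))"
      unfolding V_def by (rule measure_mono_fmeasurable[OF up]) (use cT lm[OF cT] lt lmeasurable_compact in auto)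
    also have "\<dots> \<le> measure lebesgue ?Tr + measure lebesgue (tilted S ((1 - r) *\<^sub>R e))"
      by (rule measure_Un_le) (use lm[OF cT] lt in auto)
    finally have 1: "V \<le> r ^ ?d * V + (1 - r) * A" using mTr tilt[of "1 - r"] r by simp
    \<comment> \<open>The inner slab: a tilted slab over the shrunken copy of \<open>S\<close>, going down to \<open>S\<close>, of the same height.\<close>
    define w where "w = (- ((1 - r) / r)) *\<^sub>R e"
    let ?O = "shrink ?p r ` tilted S w"
    have mO: "measure lebesgue ?O = r ^ (?d - 1) * (1 - r) * A"
    proof -
      have "measure lebesgue ?O = r ^ ?d * (((1 - r) / r) * A)"
        using tilt[of "- ((1 - r) / r)"] r
        by (simp add: measure_shrink[OF r(1) borel_compact[OF compact_tilted[OF cS]]] w_def del: measure_completion)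
      moreover have "r ^ ?d = r ^ (?d - 1) * r" by (metis One_nat_def Suc_pred mult.commute power_Suc zero_less_card_finite)
      ultimately show ?thesis using r by simp
    qed
    have inO: "x \<in> T \<and> bary T S x \<le> 1 - r" if "x \<in> ?O" for x
    proof -
      obtain s t where st: "s \<in> S" "0 \<le> t" "t \<le> 1" "x = shrink ?p r (s + t *\<^sub>R w)" using \<open>x \<in> ?O\<close> by (auto simp: tilted_def)
      have sp: "bary T R s \<ge> 0" if "R facet_of T" for R using st(1) that unfolding mem_facet_iff[OF T S] mem_simplex_iff[OF T] by auto
      have s0: "bary T S s = 0" using st(1) mem_facet_iff[OF T S] by simp
      have bx: "bary T R x = bary T R ?p + r * (bary T R s - bary T R ?p) - t * (1 - r) * (bary T R ?p - bary T R (barycenter S))" for R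
      proof -
        have "s + t *\<^sub>R w = s + (- (t * ((1 - r) / r))) *\<^sub>R e" by (simp add: w_def)
        then have "bary T R (s + t *\<^sub>R w) = bary T R s - (t * ((1 - r) / r)) * (bary T R ?p - bary T R (barycenter S))"
          by (simp only: bl) simp
        then show ?thesis unfolding st(4) bary_shrink using r by (simp add: field_simps)
      qed
      have xS: "bary T S x = (1 - r) * (1 - t)"
        by (simp add: bx bary_opp[OF T S S] bary_barycenter_facet[OF T S S] s0 algebra_simps)
      have "x \<in> T" unfolding mem_simplex_iff[OF T]
      proof (intro allI impI)
        fix R assume R: "R facet_of T"
        show "0 \<le> bary T R x"
        proof (cases "R = S")
          case True then show ?thesis using xS r st by simp
        next
          case False
          then have "bary T R x = r * bary T R s + t * (1 - r) / real CARD('d)"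
            by (simp add: bx bary_opp[OF T R S] bary_barycenter_facet[OF T S R])
          then show ?thesis using sp[OF R] r st(2) by simp
        qed
      qed
      moreover have "(1 - r) * (1 - t) \<le> (1 - r) * 1" using r st by (intro mult_left_mono) auto
      ultimately show ?thesis using xS by simp
    qed
    have "?Tr \<inter> ?O \<subseteq> {x. ?g \<bullet> x = ?g \<bullet> ?p - r}"
    proof
      fix x assume "x \<in> ?Tr \<inter> ?O"
      then have "x \<in> ?Tr" "x \<in> ?O" by auto
      then have "bary T S x = 1 - r" using inO[of x] mem_shrink_simplex_iff[of r x] r by linarith
      then show "x \<in> {x. ?g \<bullet> x = ?g \<bullet> ?p - r}" by (simp add: bary_def inner_diff_right)
    qed
    then have negl: "negligible (?Tr \<inter> ?O)"
      using negligible_hyperplane[of ?g "?g \<bullet> ?p - r"] g negligible_subset by auto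
    have "measure lebesgue ?Tr + measure lebesgue ?O = measure lebesgue (?Tr \<union> ?O)"
      using measure_Un3[OF lm[OF cT] lm[OF compact_tilted[OF cS]], of r r] negligible_imp_measure0[OF negl] by simp
    also have "\<dots> \<le> V" unfolding V_def
      by (rule measure_mono_fmeasurable)
        (use inO shrink_simplex_subset[of r] r cT lm[OF cT] lm[OF compact_tilted[OF cS]] lmeasurable_compact in auto)
    finally have 2: "r ^ ?d * V + r ^ (?d - 1) * (1 - r) * A \<le> V" using mTr mO by simp
    show ?thesis using 1 2 by (simp add: algebra_simps)
  qed
  note r = shrink_factor(1,2) and rlim = shrink_factor(3)
  \<comment> \<open>Dividing by the thickness and letting it tend to \<open>0\<close> turns \<open>1 - r ^ d\<close> into its derivative \<open>d\<close>.\<close>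
  define G where "G n = (\<Sum>i<?d. shrink_factor n ^ i)" for n
  have geo: "1 - shrink_factor n ^ ?d = (1 - shrink_factor n) * G n" for n unfolding G_def by (rule one_diff_power_eq)
  have b: "G n * V \<le> A" "shrink_factor n ^ (?d - 1) * A \<le> G n * V" for n
    using bounds[OF r, of n] r[of n] unfolding geo by (simp_all add: mult.assoc mult.left_commute)
  have Glim: "(\<lambda>n. G n * V) \<longlonglongrightarrow> real ?d * V"
  proof -
    have "(\<lambda>n. \<Sum>i<?d. shrink_factor n ^ i) \<longlonglongrightarrow> (\<Sum>i<?d. 1 ^ i)" by (intro tendsto_intros rlim)
    then show ?thesis unfolding G_def by (intro tendsto_intros) simp
  qed
  have "(\<lambda>n. shrink_factor n ^ (?d - 1) * A) \<longlonglongrightarrow> 1 ^ (?d - 1) * A" by (intro tendsto_intros rlim)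
  then have "A \<le> real ?d * V" using LIMSEQ_le[OF _ Glim] b(2) by simp
  moreover have "real ?d * V \<le> A" using LIMSEQ_le_const2[OF Glim] b(1) by blast
  ultimately show ?thesis using g by (simp add: A_def V_def field_simps)
qed

end

section \<open>Surface measure on facets\<close>

definition hyperplane_sum_measure :: "'a::euclidean_space measure" where
  "hyperplane_sum_measure = measure_of UNIV (sets borel)
     (\<lambda>A. \<integral>\<^sup>+ H. emeasure (hyperplane_measure H) A \<partial>count_space hyperplanes)"

lemma surface_eq_completion: "surface = completion hyperplane_sum_measure"
  by (simp add: surface_def hyperplane_sum_measure_def)

lemma sets_hyperplane_sum_measure[simp, measurable_cong]: "sets hyperplane_sum_measure = sets borel"
  and space_hyperplane_sum_measure[simp]: "space hyperplane_sum_measure = UNIV"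
  unfolding hyperplane_sum_measure_def
  by (simp_all add: sets.sigma_sets_eq[of borel, simplified] subset_eq)

lemma sets_hyperplane_measure[simp, measurable_cong]: "sets (hyperplane_measure H) = sets borel"
  by (simp add: hyperplane_measure_def)

lemma emeasure_hyperplane_sum_measure:
  assumes "A \<in> sets borel"
  shows "emeasure hyperplane_sum_measure (A :: 'a::euclidean_space set)
    = (\<integral>\<^sup>+ H. emeasure (hyperplane_measure H) A \<partial>count_space hyperplanes)"
  unfolding hyperplane_sum_measure_def
proof (rule emeasure_measure_of_sigma[OF _ _ _ assms])
  show "sigma_algebra UNIV (sets (borel :: 'a measure))" using sets.sigma_algebra_axioms[of "borel :: 'a measure"] by simp
  let ?\<mu> = "\<lambda>A::'a set. \<integral>\<^sup>+ H. emeasure (hyperplane_measure H) A \<partial>count_space hyperplanes"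
  show "positive (sets borel) ?\<mu>" by (simp add: positive_def)
  show "countably_additive (sets borel) ?\<mu>"
    unfolding countably_additive_def
  proof (intro allI impI)
    fix A :: "nat \<Rightarrow> 'a set" assume A: "range A \<subseteq> sets borel" "disjoint_family A" "\<Union> (range A) \<in> sets borel"
    have "(\<Sum>i. ?\<mu> (A i)) = (\<integral>\<^sup>+ H. (\<Sum>i. emeasure (hyperplane_measure H) (A i)) \<partial>count_space hyperplanes)"
      by (rule nn_integral_suminf[symmetric]) simp
    also have "\<dots> = ?\<mu> (\<Union> (range A))"
      by (rule nn_integral_cong) (use A in \<open>simp add: suminf_emeasure\<close>)
    finally show "(\<Sum>i. ?\<mu> (A i)) = ?\<mu> (\<Union> (range A))" .
  qed
qed

lemma hyperplane_cases:
  assumes "H \<in> (hyperplanes :: 'a::euclidean_space set set)"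
  obtains a b where "a \<noteq> 0" "H = {x. a \<bullet> x = b}"
proof -
  have "affine H" "aff_dim H = int DIM('a) - 1" using assms by (auto simp: hyperplanes_def)
  moreover from this(2) obtain a b where "a \<noteq> 0 \<and> affine hull H = {x. a \<bullet> x = b}"
    using aff_dim_eq_hyperplane[of H] by (auto simp: of_nat_diff)
  moreover have "affine hull H = H" using \<open>affine H\<close> by (simp add: affine_hull_eq)
  ultimately show ?thesis using that by blast
qed

lemma hyperplane_in_hyperplanes: "a \<noteq> 0 \<Longrightarrow> {x::'a::euclidean_space. a \<bullet> x = b} \<in> hyperplanes"
  by (simp add: hyperplanes_def affine_hyperplane of_nat_diff)

lemma closest_point_hyperplane:
  fixes a :: "'a::euclidean_space"
  assumes a: "a \<noteq> 0"
  shows "closest_point {x. a \<bullet> x = b} y = y - ((a \<bullet> y - b) / (a \<bullet> a)) *\<^sub>R a"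
    "infdist y {x. a \<bullet> x = b} = \<bar>a \<bullet> y - b\<bar> / norm a"
proof -
  let ?H = "{x. a \<bullet> x = b}"
  define z where "z = y - ((a \<bullet> y - b) / (a \<bullet> a)) *\<^sub>R a"
  have z: "z \<in> ?H" using a by (simp add: z_def inner_diff_right)
  have min: "dist y z \<le> dist y w" if w: "w \<in> ?H" for w
  proof -
    have "y - z = ((a \<bullet> y - b) / (a \<bullet> a)) *\<^sub>R a" by (simp add: z_def)
    then have "(y - z) \<bullet> (z - w) = 0" using z w by (simp only:) (simp add: inner_diff_right)
    then have "(norm (y - w))\<^sup>2 = (norm (y - z))\<^sup>2 + (norm (z - w))\<^sup>2"
      using norm_add_Pythagorean[of "y - z" "z - w"] by (simp add: orthogonal_def)
    then have "(norm (y - z))\<^sup>2 \<le> (norm (y - w))\<^sup>2" by simp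
    then show ?thesis unfolding dist_norm by (rule power2_le_imp_le) simp
  qed
  show c: "closest_point ?H y = y - ((a \<bullet> y - b) / (a \<bullet> a)) *\<^sub>R a"
    unfolding z_def[symmetric]
    by (rule closest_point_unique[symmetric]) (use z min in \<open>auto simp: convex_hyperplane closed_hyperplane\<close>)
  have "infdist y ?H = dist y z"
    using setdist_closest_point[of ?H y] z closed_hyperplane[of a b] c by (auto simp: infdist_eq_setdist z_def)
  then show "infdist y ?H = \<bar>a \<bullet> y - b\<bar> / norm a"
    using a by (simp add: z_def dist_norm dot_square_norm power2_eq_square abs_mult)
qed

lemma closest_point_hyperplane_measurable[measurable]:
  "a \<noteq> 0 \<Longrightarrow> closest_point {x::'a::euclidean_space. a \<bullet> x = b} \<in> borel_measurable borel"
  by (subst ext[OF closest_point_hyperplane(1)]) simp_all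

lemma emeasure_hyperplane_measure:
  fixes a :: "'a::euclidean_space"
  fixes b :: real
  assumes a: "a \<noteq> 0" and A: "A \<in> sets borel"
  defines "H \<equiv> {x. a \<bullet> x = b}"
  shows "emeasure (hyperplane_measure H) A = emeasure lborel {y. infdist y H \<le> 1/2 \<and> closest_point H y \<in> A}"
proof -
  have [measurable]: "closest_point H \<in> borel_measurable borel" unfolding H_def by (rule closest_point_hyperplane_measurable[OF a])
  note A[measurable]
  define Q where "Q = {y. infdist y H \<le> 1/2}"
  have [measurable]: "Q \<in> sets borel"
    unfolding Q_def by (intro borel_closed closed_Collect_le continuous_intros)
  have "emeasure (hyperplane_measure H) A = emeasure (restrict_space lborel Q)
      (closest_point H -` A \<inter> space (restrict_space lborel Q))"
    unfolding hyperplane_measure_def Q_def[symmetric] by (rule emeasure_distr) (auto intro: measurable_restrict_space1)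
  also have "\<dots> = emeasure lborel (closest_point H -` A \<inter> space (restrict_space lborel Q))"
    by (rule emeasure_restrict_space) (auto simp: space_restrict_space)
  also have "closest_point H -` A \<inter> space (restrict_space lborel Q) = {y. infdist y H \<le> 1/2 \<and> closest_point H y \<in> A}"
    by (auto simp: space_restrict_space Q_def)
  finally show ?thesis .
qed

text \<open>A line through a point of the hyperplane outside \<open>K\<close> shows that the preimage of \<open>K\<close> under the
  orthogonal projection has no interior.\<close>

lemma hyperplane_measure_affine_null:
  fixes H K :: "'a::euclidean_space set"
  assumes H: "H \<in> hyperplanes" and K: "affine K" "\<not> H \<subseteq> K" and A: "A \<subseteq> K" "A \<in> sets borel"
  shows "emeasure (hyperplane_measure H) A = 0"
proof -
  obtain a b where a: "a \<noteq> 0" and Heq: "H = {x. a \<bullet> x = b}" using hyperplane_cases[OF H] .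
  have cp: "closest_point H y = y - ((a \<bullet> y - b) / (a \<bullet> a)) *\<^sub>R a" for y
    unfolding Heq by (rule closest_point_hyperplane(1)[OF a])
  obtain h where h: "h \<in> H" "h \<notin> K" using K by auto
  let ?W = "{y. closest_point H y \<in> K}"
  have comb: "closest_point H ((1 - t) *\<^sub>R x + t *\<^sub>R y) = (1 - t) *\<^sub>R closest_point H x + t *\<^sub>R closest_point H y" for x y t
  proof -
    have "(a \<bullet> ((1 - t) *\<^sub>R x + t *\<^sub>R y) - b) / (a \<bullet> a) = (1 - t) * ((a \<bullet> x - b) / (a \<bullet> a)) + t * ((a \<bullet> y - b) / (a \<bullet> a))"
      by (simp add: inner_add_right add_divide_distrib diff_divide_distrib algebra_simps)
    then show ?thesis unfolding cp by (simp add: algebra_simps)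
  qed
  have Kc: "(1 - t) *\<^sub>R x + t *\<^sub>R y \<in> K" if "x \<in> K" "y \<in> K" for x y t
    using K(1) that by (simp add: affine_alt)
  have "convex ?W" unfolding convex_alt using comb Kc by auto
  moreover have "interior ?W = {}"
  proof (rule ccontr)
    assume "interior ?W \<noteq> {}"
    then obtain y where y: "y \<in> interior ?W" by auto
    define v where "v = h - closest_point H y"
    have yH: "a \<bullet> closest_point H y = b" unfolding cp using a by (simp add: inner_diff_right)
    obtain e where e: "e > 0" "ball y e \<subseteq> ?W" using y mem_interior by blast
    define t where "t = e / (2 * (norm v + 1))"
    have nv: "0 < 2 * (norm v + 1)" by (simp add: add_nonneg_pos)
    have "e * norm v < e * (2 * (norm v + 1))" using e by (simp add: add_nonneg_pos)
    then have t: "t > 0" "t * norm v < e" using e nv by (simp_all add: t_def divide_simps)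
    have "y + t *\<^sub>R v \<in> ball y e" using t by (simp add: dist_norm)
    then have "y + t *\<^sub>R v \<in> ?W" using e(2) by blast
    moreover have "closest_point H (y + t *\<^sub>R v) = closest_point H y + t *\<^sub>R v"
    proof -
      have "a \<bullet> v = 0" using yH h unfolding v_def by (simp add: Heq inner_diff_right)
      then show ?thesis by (simp add: cp inner_add_right)
    qed
    ultimately have 1: "closest_point H y + t *\<^sub>R v \<in> K" by simp
    have 2: "closest_point H y \<in> K" using y interior_subset by auto
    have "(1 - 1/t) *\<^sub>R closest_point H y + (1/t) *\<^sub>R (closest_point H y + t *\<^sub>R v) = h"
      using t(1) by (simp add: v_def algebra_simps)
    then have "h \<in> K" using Kc[OF 2 1, of "1/t"] by simp
    then show False using h by simp
  qed
  ultimately have "negligible ?W" by (simp add: negligible_convex_interior)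
  then have "negligible {y. infdist y H \<le> 1/2 \<and> closest_point H y \<in> A}"
    by (rule negligible_subset) (use A in auto)
  then have "{y. infdist y H \<le> 1/2 \<and> closest_point H y \<in> A} \<in> null_sets lebesgue"
    by (simp add: negligible_iff_null_sets)
  moreover have "{y. infdist y H \<le> 1/2 \<and> closest_point H y \<in> A} \<in> sets borel"
  proof -
    have "{y. infdist y H \<le> 1/2} \<in> sets borel" by (intro borel_closed closed_Collect_le continuous_intros)
    moreover have "closest_point H -` A \<inter> space borel \<in> sets borel"
      unfolding Heq by (rule measurable_sets[OF closest_point_hyperplane_measurable[OF a] A(2)])
    ultimately have "{y. infdist y H \<le> 1/2} \<inter> (closest_point H -` A \<inter> space borel) \<in> sets borel" by blast
    moreover have "{y. infdist y H \<le> 1/2} \<inter> (closest_point H -` A \<inter> space borel) = {y. infdist y H \<le> 1/2 \<and> closest_point H y \<in> A}" by auto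
    ultimately show ?thesis by simp
  qed
  ultimately have "emeasure lborel {y. infdist y H \<le> 1/2 \<and> closest_point H y \<in> A} = 0"
    by (auto simp: null_sets_def)
  then show ?thesis unfolding Heq emeasure_hyperplane_measure[OF a A(2)] .
qed

lemma hyperplane_subset_imp_eq:
  assumes "H \<in> hyperplanes" "G \<in> hyperplanes" "H \<subseteq> G" "H \<noteq> {}"
  shows "H = G"
  using assms affine_dim_equal[of H G] by (auto simp: hyperplanes_def)

lemma hyperplane_nonempty:
  assumes "H \<in> (hyperplanes :: 'a::euclidean_space set set)" shows "H \<noteq> {}"
proof -
  obtain a b where a: "a \<noteq> 0" "H = {x. a \<bullet> x = b}" using hyperplane_cases[OF assms] .
  then have "(b / (a \<bullet> a)) *\<^sub>R a \<in> H" by simp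
  then show ?thesis by auto
qed

text \<open>Every other hyperplane meets \<open>H\<close> in a proper affine subspace, which it gives measure zero, so a
  single term of the sum survives.\<close>

lemma emeasure_hyperplane_sum_on_hyperplane:
  fixes H :: "'a::euclidean_space set"
  assumes H: "H \<in> hyperplanes" and A: "A \<subseteq> H" "A \<in> sets borel"
  shows "emeasure hyperplane_sum_measure A = emeasure (hyperplane_measure H) A"
proof -
  have "emeasure (hyperplane_measure G) A = emeasure (hyperplane_measure G) A * indicator {H} G"
    if "G \<in> hyperplanes" for G
  proof (cases "G = H")
    case False
    then have "\<not> G \<subseteq> H" using hyperplane_subset_imp_eq[OF that H] hyperplane_nonempty[OF that] by blast
    then have "emeasure (hyperplane_measure G) A = 0"
      using hyperplane_measure_affine_null[OF that _ _ A] H by (auto simp: hyperplanes_def)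
    then show ?thesis by simp
  qed simp
  then have "emeasure hyperplane_sum_measure A = (\<integral>\<^sup>+ G. emeasure (hyperplane_measure G) A * indicator {H} G \<partial>count_space hyperplanes)"
    unfolding emeasure_hyperplane_sum_measure[OF A(2)] by (intro nn_integral_cong) simp
  also have "\<dots> = emeasure (hyperplane_measure H) A"
    using H by (subst nn_integral_indicator_singleton) auto
  finally show ?thesis .
qed

lemma surface_null_affine:
  fixes A K :: "'a::euclidean_space set"
  assumes K: "affine K" "\<And>H. H \<in> hyperplanes \<Longrightarrow> \<not> H \<subseteq> K" and A: "A \<subseteq> K" "A \<in> sets borel"
  shows "A \<in> null_sets surface"
proof -
  have "emeasure hyperplane_sum_measure A = 0"
    unfolding emeasure_hyperplane_sum_measure[OF A(2)]
    using hyperplane_measure_affine_null[OF _ K(1) K(2) A] by (subst nn_integral_cong[where v="\<lambda>_. 0"]) auto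
  then have "A \<in> null_sets hyperplane_sum_measure" using A by (simp add: null_sets_def)
  then show ?thesis unfolding surface_eq_completion by (rule null_sets_completionI)
qed

context
  fixes T S :: "(real^'d) set"
  assumes T: "full_simplex T" and S: "S facet_of T"
begin

lemma zero_set_bary_hyperplane:
  "{x. bary T S x = 0} = {x. bary_grad T S \<bullet> x = bary_grad T S \<bullet> opp T S - 1}"
  "{x. bary T S x = 0} \<in> hyperplanes"
proof -
  show 1: "{x. bary T S x = 0} = {x. bary_grad T S \<bullet> x = bary_grad T S \<bullet> opp T S - 1}"
    by (auto simp: bary_def inner_diff_right)
  show "{x. bary T S x = 0} \<in> hyperplanes"
    unfolding 1 by (rule hyperplane_in_hyperplanes[OF bary_grad_nonzero[OF T S]])
qed

lemma closest_point_zero_set_bary: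
  "closest_point {x. bary T S x = 0} y = foot T S y"
  "infdist y {x. bary T S x = 0} \<le> 1/2 \<longleftrightarrow> \<bar>bary T S y\<bar> \<le> norm (bary_grad T S) / 2"
  unfolding zero_set_bary_hyperplane(1) closest_point_hyperplane[OF bary_grad_nonzero[OF T S]]
  using bary_grad_nonzero[OF T S]
  by (simp_all add: foot_def bary_def inner_diff_right field_simps)

lemma surface_integral_facet:
  fixes g :: "real^'d \<Rightarrow> real"
  assumes g[measurable]: "g \<in> borel_measurable borel"
  shows "(LINT x:S|surface. g x) = (LINT y:prism T S|lebesgue. g (foot T S y))"
proof -
  let ?H = "{x. bary T S x = 0}"
  define Q where "Q = {y. infdist y ?H \<le> 1/2}"
  have [measurable]: "S \<in> sets borel" using compact_facet[OF T S] borel_compact by blast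
  have [measurable]: "prism T S \<in> sets borel" using compact_prism[OF T S] borel_compact by blast
  have [measurable]: "foot T S \<in> borel_measurable borel" by (intro borel_measurable_continuous_onI continuous_on_foot)
  have [measurable]: "Q \<in> sets borel"
    unfolding Q_def by (intro borel_closed closed_Collect_le continuous_intros)
  have SH: "S \<subseteq> ?H" using mem_facet_iff[OF T S] by auto
  have cp: "closest_point ?H = foot T S" using closest_point_zero_set_bary(1) by auto
  have dens: "density hyperplane_sum_measure (indicator S) = density (hyperplane_measure ?H) (indicator S)"
  proof (rule measure_eqI)
    fix X :: "(real^'d) set" assume "X \<in> sets (density hyperplane_sum_measure (indicator S))"
    then have [measurable]: "X \<in> sets borel" by simp
    have eq: "indicator S x * indicator X x = (indicator (S \<inter> X) x :: ennreal)" for x by (simp add: indicator_def)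
    have "emeasure (density hyperplane_sum_measure (indicator S)) X = emeasure hyperplane_sum_measure (S \<inter> X)"
      by (subst emeasure_density) (auto simp: eq)
    also have "\<dots> = emeasure (hyperplane_measure ?H) (S \<inter> X)"
      using SH by (intro emeasure_hyperplane_sum_on_hyperplane zero_set_bary_hyperplane) auto
    also have "\<dots> = emeasure (density (hyperplane_measure ?H) (indicator S)) X"
      by (subst emeasure_density) (auto simp: eq)
    finally show "emeasure (density hyperplane_sum_measure (indicator S)) X = emeasure (density (hyperplane_measure ?H) (indicator S)) X" .
  qed simp
  have ie: "(indicator S :: real^'d \<Rightarrow> ennreal) = (\<lambda>x. ennreal (indicator S x))" by (auto simp: indicator_def)
  have "(LINT x:S|surface. g x) = (\<integral>x. indicator S x *\<^sub>R g x \<partial>hyperplane_sum_measure)"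
    unfolding set_lebesgue_integral_def surface_eq_completion by (rule integral_completion) measurable
  also have "\<dots> = (\<integral>x. g x \<partial>density hyperplane_sum_measure (indicator S))"
    unfolding ie by (rule integral_density[symmetric]) auto
  also have "\<dots> = (\<integral>x. indicator S x *\<^sub>R g x \<partial>hyperplane_measure ?H)"
    unfolding dens unfolding ie by (rule integral_density) auto
  also have "\<dots> = (\<integral>y. indicator S (foot T S y) *\<^sub>R g (foot T S y) \<partial>restrict_space lborel Q)"
    unfolding hyperplane_measure_def cp Q_def[symmetric] by (rule integral_distr) (auto intro: measurable_restrict_space1)
  also have "\<dots> = (\<integral>y. indicator Q y *\<^sub>R (indicator S (foot T S y) *\<^sub>R g (foot T S y)) \<partial>lborel)"
    by (rule integral_restrict_space) simp
  also have "\<dots> = (\<integral>y. indicator (prism T S) y *\<^sub>R g (foot T S y) \<partial>lborel)"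
  proof -
    have "y \<in> Q \<and> foot T S y \<in> S \<longleftrightarrow> y \<in> prism T S" for y
      unfolding Q_def prism_def mem_Collect_eq closest_point_zero_set_bary(2) ..
    then have "indicator Q y *\<^sub>R indicator S (foot T S y) *\<^sub>R g (foot T S y) = indicator (prism T S) y *\<^sub>R g (foot T S y)" for y
       by (cases "y \<in> Q"; cases "foot T S y \<in> S"; cases "y \<in> prism T S"; auto)
    then show ?thesis by (simp only:)
  qed
  also have "\<dots> = (LINT y:prism T S|lebesgue. g (foot T S y))"
    unfolding set_lebesgue_integral_def by (rule integral_completion[symmetric]) measurable
  finally show ?thesis .
qed

lemma emeasure_surface_facet_finite: "emeasure surface S < \<infinity>"
proof -
  let ?H = "{x. bary T S x = 0}"
  have S': "S \<in> sets borel" using compact_facet[OF T S] borel_compact by blast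
  have SH: "S \<subseteq> ?H" using mem_facet_iff[OF T S] by auto
  have "emeasure surface S = emeasure (hyperplane_measure ?H) S"
    unfolding surface_eq_completion using emeasure_hyperplane_sum_on_hyperplane[OF zero_set_bary_hyperplane(2) SH S'] S' by simp
  also have "\<dots> = emeasure lborel (prism T S)"
    unfolding zero_set_bary_hyperplane(1) emeasure_hyperplane_measure[OF bary_grad_nonzero[OF T S] S']
    unfolding zero_set_bary_hyperplane(1)[symmetric] closest_point_zero_set_bary prism_def ..
  also have "\<dots> < \<infinity>" using emeasure_compact_finite[OF compact_prism[OF T S]] by simp
  finally show ?thesis .
qed

lemma facet_sets_surface: "S \<in> sets surface"
  using borel_compact[OF compact_facet(1)[OF T S]] unfolding surface_eq_completion by auto

lemma surface_measure_facet:
  "measure surface S = real CARD('d) * measure lebesgue T * norm (bary_grad T S)"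
proof -
  have "measure surface S = (LINT x:S|surface. 1::real)"
    using facet_sets_surface by (simp add: set_lebesgue_integral_def)
  also have "\<dots> = (LINT y:prism T S|lebesgue. 1)" by (rule surface_integral_facet) simp
  also have "\<dots> = measure lebesgue (prism T S)"
    using compact_prism[OF T S] lmeasurable_compact by (intro set_integral_one_lebesgue) blast
  finally show ?thesis by (simp only: prism_measure[OF T S])
qed

lemma surface_measure_facet_pos: "measure surface S > 0"
  unfolding surface_measure_facet using measure_full_simplex_pos[OF T] bary_grad_nonzero[OF T S] by simp

lemma surface_integral_affine:
  "(LINT x:S|surface. a \<bullet> x + b) = measure surface S * (a \<bullet> barycenter S + b)"
proof -
  have "measure lebesgue (prism T S) = measure surface S" by (simp only: prism_measure[OF T S] surface_measure_facet)
  moreover have "(LINT x:S|surface. a \<bullet> x + b) = (LINT y:prism T S|lebesgue. a \<bullet> foot T S y + b)"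
    by (rule surface_integral_facet) simp
  ultimately show ?thesis using integral_affine_foot[OF T S, of a b] surface_measure_facet_pos by (simp del: measure_completion)
qed

text \<open>The relative boundary lies in intersections of two distinct hyperplanes, and such an intersection
  contains no hyperplane.\<close>

lemma relative_boundary_null: "S - rel_interior S \<in> null_sets surface"
proof -
  have sub: "S - rel_interior S \<subseteq> (\<Union>R\<in>{R. R facet_of T} - {S}. {x. bary T S x = 0} \<inter> {x. bary T R x = 0})"
  proof
    fix x assume x: "x \<in> S - rel_interior S"
    then have x0: "bary T S x = 0" and xp: "\<And>R. R facet_of T \<Longrightarrow> 0 \<le> bary T R x"
      using mem_facet_iff[OF T S, of x] mem_simplex_iff[OF T, of x] by auto
    moreover obtain R where R: "R facet_of T" "R \<noteq> S" "\<not> 0 < bary T R x"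
      using x x0 rel_interior_facet_iff[OF T S, of x] by auto
    ultimately have "bary T R x = 0" using xp[OF R(1)] by simp
    with R x0 show "x \<in> (\<Union>R\<in>{R. R facet_of T} - {S}. {x. bary T S x = 0} \<inter> {x. bary T R x = 0})" by auto
  qed
  have "{x. bary T S x = 0} \<inter> {x. bary T R x = 0} \<in> null_sets surface"
    if R: "R facet_of T" "R \<noteq> S" for R
  proof (rule surface_null_affine[OF _ _ subset_refl])
    have aff: "affine {x. bary T Q x = 0}" for Q
    proof -
      have "{x. bary T Q x = 0} = {x. bary_grad T Q \<bullet> x = bary_grad T Q \<bullet> opp T Q - 1}"
        by (auto simp: bary_def inner_diff_right)
      then show ?thesis by (simp add: affine_hyperplane)
    qed
    show "affine ({x. bary T S x = 0} \<inter> {x. bary T R x = 0})" by (intro affine_Int aff)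
    have cl: "closed {x. bary T Q x = 0}" for Q by (intro closed_Collect_eq continuous_intros)
    show "{x. bary T S x = 0} \<inter> {x. bary T R x = 0} \<in> sets borel" using cl by auto
    show "\<not> H \<subseteq> {x. bary T S x = 0} \<inter> {x. bary T R x = 0}" if H: "H \<in> hyperplanes" for H
    proof
      assume s: "H \<subseteq> {x. bary T S x = 0} \<inter> {x. bary T R x = 0}"
      then have "H = {x. bary T S x = 0}"
        using hyperplane_subset_imp_eq[OF H zero_set_bary_hyperplane(2)] hyperplane_nonempty[OF H] by auto
      moreover have "bary T S (barycenter S) = 0" "bary T R (barycenter S) \<noteq> 0"
        using bary_barycenter_facet[OF T S S] bary_barycenter_facet[OF T S R(1)] R(2) by auto
      ultimately show False using s by auto
    qed
  qed
  then have "(\<Union>R\<in>{R. R facet_of T} - {S}. {x. bary T S x = 0} \<inter> {x. bary T R x = 0}) \<in> null_sets surface"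
    by (intro null_sets.finite_UN) (use finite_facets[OF T] in auto)
  then show ?thesis unfolding surface_eq_completion by (rule null_sets_completion_subset[OF sub])
qed

end

section \<open>Smooth bump functions\<close>

text \<open>The derivative of such a function is again of this form, with another numerator and exponent, so
  smoothness follows by induction.\<close>

definition bump1 :: "real poly \<Rightarrow> nat \<Rightarrow> real \<Rightarrow> real" where
  "bump1 p n t = (if \<bar>t\<bar> < 1 then poly p t * exp (- 1 / (1 - t\<^sup>2)) / (1 - t\<^sup>2) ^ n else 0)"

definition bump1_deriv :: "real poly \<Rightarrow> nat \<Rightarrow> real poly" where
  "bump1_deriv p n = pderiv p * [:1, 0, -1:]\<^sup>2 + p * [:0, 2 * real n:] * [:1, 0, -1:] - p * [:0, 2:]"

lemma exp_neg_inverse_le: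
  fixes s :: real assumes "s > 0"
  shows "exp (- 1 / s) \<le> fact m * s ^ m"
proof -
  have "(\<Sum>n\<in>{m}. (1/s) ^ n /\<^sub>R fact n) \<le> (\<Sum>n. (1/s) ^ n /\<^sub>R fact n)"
    by (rule sum_le_suminf[OF sums_summable[OF exp_converges]]) (use assms in auto)
  then have "(1/s) ^ m / fact m \<le> exp (1/s)"
    using sums_unique[OF exp_converges, of "1/s"] by (simp add: divide_inverse mult.commute)
  then have "1 \<le> exp (1/s) * (fact m * s ^ m)" using assms by (simp add: power_divide field_simps)
  then have "exp (- 1/s) * 1 \<le> exp (- 1/s) * (exp (1/s) * (fact m * s ^ m))"
    by (intro mult_left_mono) auto
  also have "\<dots> = fact m * s ^ m" by (simp add: mult.assoc[symmetric] exp_add[symmetric])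
  finally show ?thesis by simp
qed

text \<open>A bound of second order at an end point of the support makes the difference quotients there tend
  to zero.\<close>

lemma bump1_quadratic_bound:
  assumes a: "\<bar>a\<bar> = 1"
  shows "\<exists>C. \<forall>t. \<bar>bump1 p n t\<bar> \<le> C * \<bar>t - a\<bar>\<^sup>2"
proof -
  have "continuous_on {-1..1} (poly p)" by (intro continuous_intros)
  then have "compact (poly p ` {-1..1})" by (rule compact_continuous_image) simp
  then obtain M where M: "\<And>t. t \<in> {-1..1} \<Longrightarrow> \<bar>poly p t\<bar> \<le> M"
    using compact_imp_bounded[of "poly p ` {-1..1}"] unfolding bounded_iff by force
  have M0: "M \<ge> 0" using M[of 0] by simp
  have "\<bar>bump1 p n t\<bar> \<le> (M * fact (n + 2) * 4) * \<bar>t - a\<bar>\<^sup>2" for t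
  proof (cases "\<bar>t\<bar> < 1")
    case True
    define s where "s = 1 - t\<^sup>2"
    have s: "s > 0" using True by (simp add: s_def abs_square_less_1)
    have s2: "s \<le> 2 * \<bar>t - a\<bar>"
    proof -
      have "a = 1 \<or> a = -1" using a by linarith
      moreover have "s = (1 - t) * (1 + t)" by (simp add: s_def power2_eq_square algebra_simps)
      moreover have "(1 - t) * (1 + t) \<le> (1 - t) * 2" by (rule mult_left_mono) (use True in linarith)+
      moreover have "(1 + t) * (1 - t) \<le> (1 + t) * 2" by (rule mult_left_mono) (use True in linarith)+
      ultimately show ?thesis using True by (auto simp: algebra_simps)
    qed
    have "exp (- 1 / s) / s ^ n \<le> (fact (n + 2) * s ^ (n + 2)) / s ^ n"
      using exp_neg_inverse_le[OF s, of "n + 2"] s by (intro divide_right_mono) auto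
    also have "\<dots> = fact (n + 2) * s\<^sup>2" using s by (simp add: power_add power2_eq_square)
    finally have e: "exp (- 1 / s) / s ^ n \<le> fact (n + 2) * s\<^sup>2" .
    have Mt: "\<bar>poly p t\<bar> \<le> M" by (rule M) (use True in \<open>simp add: abs_less_iff\<close>)
    have "\<bar>bump1 p n t\<bar> = \<bar>poly p t\<bar> * (exp (- 1 / s) / s ^ n)"
      using True s by (simp add: bump1_def s_def[symmetric] abs_mult)
    also have "\<dots> \<le> M * (fact (n + 2) * s\<^sup>2)"
      using Mt e s M0 by (intro mult_mono) auto
    also have "\<dots> \<le> M * (fact (n + 2) * (2 * \<bar>t - a\<bar>)\<^sup>2)"
      using s s2 M0 by (intro mult_left_mono power_mono) auto
    finally show ?thesis by (simp add: power_mult_distrib algebra_simps)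
  qed (use M0 in \<open>simp add: bump1_def\<close>)
  then show ?thesis by blast
qed

lemma DERIV_bump1: "(bump1 p n has_real_derivative bump1 (bump1_deriv p n) (n + 2) t) (at t)"
proof -
  consider "\<bar>t\<bar> < 1" | "\<bar>t\<bar> > 1" | "\<bar>t\<bar> = 1" by linarith
  then show ?thesis
  proof cases
    case 1
    define s where "s = 1 - t\<^sup>2"
    have s: "s > 0" using 1 by (simp add: s_def abs_square_less_1)
    then have tt: "t * t \<noteq> 1" by (auto simp: s_def power2_eq_square)
    have "((\<lambda>t. poly p t * exp (- 1 / (1 - t\<^sup>2)) / (1 - t\<^sup>2) ^ n) has_real_derivative
       ((poly (pderiv p) t * exp (- 1 / s) + poly p t * (exp (- 1 / s) * (- (2 * t) / s\<^sup>2))) * s ^ n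
         - poly p t * exp (- 1 / s) * (real n * s ^ (n - 1) * (- (2 * t)))) / (s ^ n * s ^ n)) (at t)"
      unfolding s_def using s tt
      by (auto intro!: derivative_eq_intros simp: s_def[symmetric] power2_eq_square)
    moreover have "((poly (pderiv p) t * exp (- 1 / s) + poly p t * (exp (- 1 / s) * (- (2 * t) / s\<^sup>2))) * s ^ n
         - poly p t * exp (- 1 / s) * (real n * s ^ (n - 1) * (- (2 * t)))) / (s ^ n * s ^ n)
       = bump1 (bump1_deriv p n) (n + 2) t"
    proof -
      have q: "poly (bump1_deriv p n) t = poly (pderiv p) t * s\<^sup>2 + 2 * real n * t * poly p t * s - 2 * t * poly p t"
        by (simp add: bump1_deriv_def s_def power2_eq_square algebra_simps)
      have sn: "real n * s ^ (n - 1) = real n * s ^ n / s" using s by (cases n) auto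
      have b: "bump1 (bump1_deriv p n) (n + 2) t = poly (bump1_deriv p n) t * exp (- 1 / s) / s ^ (n + 2)"
        using 1 by (simp add: bump1_def s_def)
      show ?thesis unfolding sn b q using s by (simp add: power_add field_simps power2_eq_square)
    qed
    ultimately have d: "((\<lambda>t. poly p t * exp (- 1 / (1 - t\<^sup>2)) / (1 - t\<^sup>2) ^ n) has_real_derivative bump1 (bump1_deriv p n) (n + 2) t) (at t)" by simp
    show ?thesis
      by (rule DERIV_cong_ev[THEN iffD2, OF refl _ refl d])
        (use 1 eventually_nhds_in_open[of "{-1<..<1}" t] in \<open>auto elim!: eventually_mono simp: bump1_def abs_less_iff\<close>)
  next
    case 2
    have "eventually (\<lambda>x. x \<in> {x. 1 < \<bar>x\<bar>}) (nhds t)"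
      by (rule eventually_nhds_in_open) (use 2 in \<open>auto intro!: open_Collect_less continuous_intros\<close>)
    then have "eventually (\<lambda>x. bump1 p n x = 0) (nhds t)" by (rule eventually_mono) (auto simp: bump1_def)
    then show ?thesis using 2 DERIV_cong_ev[of t t "bump1 p n" "\<lambda>_. 0" 0 0] by (simp add: bump1_def)
  next
    case 3
    obtain C where C: "\<And>x. \<bar>bump1 p n x\<bar> \<le> C * \<bar>x - t\<bar>\<^sup>2" using bump1_quadratic_bound[OF 3] by blast
    have z: "bump1 p n t = 0" "bump1 (bump1_deriv p n) (n + 2) t = 0" using 3 by (simp_all add: bump1_def)
    have "((\<lambda>x. bump1 p n x / (x - t)) \<longlongrightarrow> 0) (at t)"
    proof (rule Lim_null_comparison)
      show "eventually (\<lambda>x. norm (bump1 p n x / (x - t)) \<le> C * \<bar>x - t\<bar>) (at t)"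
        unfolding eventually_at_filter
        by (rule always_eventually) (use C in \<open>auto simp: abs_divide divide_le_eq power2_eq_square mult.assoc\<close>)
      show "((\<lambda>x. C * \<bar>x - t\<bar>) \<longlongrightarrow> 0) (at t)" by (auto intro!: tendsto_eq_intros)
    qed
    then show ?thesis unfolding z(2) by (simp add: has_field_derivative_iff z(1))
  qed
qed

definition bumps :: "real^'d \<Rightarrow> real \<Rightarrow> (real^'d \<Rightarrow> real) set" where
  "bumps c r = {\<lambda>x. \<kappa> * (\<Prod>i\<in>UNIV. bump1 (p i) (n i) ((x $ i - c $ i) / r)) | \<kappa> p n. True}"

lemma bumps_partial:
  fixes f :: "real^'d \<Rightarrow> real"
  assumes f: "f \<in> bumps c r"
  shows "f differentiable (at x)" "partial i f \<in> bumps c r"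
proof -
  obtain \<kappa> p n where f_eq: "f = (\<lambda>x. \<kappa> * (\<Prod>i\<in>UNIV. bump1 (p i) (n i) ((x $ i - c $ i) / r)))"
    using f by (auto simp: bumps_def)
  define p' where "p' j = bump1_deriv (p j) (n j)" for j
  define D where "D x h = \<kappa> * (\<Sum>j\<in>UNIV. (h $ j / r * bump1 (p' j) (n j + 2) ((x $ j - c $ j) / r))
       * (\<Prod>k\<in>UNIV - {j}. bump1 (p k) (n k) ((x $ k - c $ k) / r)))" for x h :: "real^'d"
  have D: "(f has_derivative D x) (at x)" for x
    unfolding f_eq D_def
  proof (intro has_derivative_mult_right has_derivative_prod)
    fix j
    have "((\<lambda>x::real^'d. x $ j - c $ j) has_derivative (\<lambda>h. h $ j)) (at x)"
      using has_derivative_diff[OF bounded_linear_imp_has_derivative[OF bounded_linear_vec_nth] has_derivative_const] by simp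
    then have "((\<lambda>x::real^'d. (x $ j - c $ j) / r) has_derivative (\<lambda>h. h $ j / r)) (at x)"
      unfolding divide_inverse by (rule has_derivative_mult_left)
    from has_derivative_compose[OF this DERIV_bump1[of "p j" "n j", THEN has_field_derivative_imp_has_derivative]]
    show "((\<lambda>x. bump1 (p j) (n j) ((x $ j - c $ j) / r)) has_derivative
        (\<lambda>y. y $ j / r * bump1 (p' j) (n j + 2) ((x $ j - c $ j) / r))) (at x)"
      by (simp add: p'_def mult.commute)
  qed
  show "f differentiable (at x)" using D unfolding differentiable_def by blast
  have "partial i f = (\<lambda>x. (\<kappa> / r) * (\<Prod>k\<in>UNIV. bump1 ((p(i := p' i)) k) ((n(i := n i + 2)) k) ((x $ k - c $ k) / r)))"
  proof
    fix x
    have "partial i f x = D x (axis i 1)" unfolding partial_def using frechet_derivative_at[OF D] by metis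
    also have "\<dots> = \<kappa> * (\<Sum>j\<in>UNIV. if j = i then (1 / r * bump1 (p' i) (n i + 2) ((x $ i - c $ i) / r))
       * (\<Prod>k\<in>UNIV - {i}. bump1 (p k) (n k) ((x $ k - c $ k) / r)) else 0)"
      unfolding D_def by (intro arg_cong2[where f="(*)"] sum.cong) (auto simp: axis_def)
    also have "\<dots> = (\<kappa> / r) * (\<Prod>k\<in>UNIV. bump1 ((p(i := p' i)) k) ((n(i := n i + 2)) k) ((x $ k - c $ k) / r))"
      by (subst prod.remove[of UNIV i]) simp_all
    finally show "partial i f x = (\<kappa> / r) * (\<Prod>k\<in>UNIV. bump1 ((p(i := p' i)) k) ((n(i := n i + 2)) k) ((x $ k - c $ k) / r))" .
  qed
  then show "partial i f \<in> bumps c r" unfolding bumps_def by blast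
qed

lemma bumps_smooth:
  assumes "f \<in> bumps c r" shows "smooth f"
proof -
  have "iter_partial is f \<in> bumps c r" for "is"
    by (induction "is") (use assms bumps_partial(2) in auto)
  then show ?thesis unfolding smooth_def using bumps_partial(1) by blast
qed

lemma ex_bump:
  fixes c :: "real^'d"
  assumes "open U" "c \<in> U"
  obtains \<phi> where "test_function U \<phi>" "\<And>x. 0 \<le> \<phi> x" "0 < \<phi> c"
proof -
  obtain r where r: "r > 0" "cball c (r * real CARD('d)) \<subseteq> U"
  proof -
    obtain e where e: "e > 0" "cball c e \<subseteq> U" using assms open_contains_cball by blast
    then show ?thesis by (intro that[of "e / real CARD('d)"]) auto
  qed
  define \<phi> where "\<phi> x = (\<Prod>i\<in>UNIV. bump1 1 0 ((x $ i - c $ i) / r))" for x :: "real^'d"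
  have "\<phi> \<in> bumps c r" unfolding bumps_def \<phi>_def[abs_def]
    by (rule CollectI, intro exI[of _ 1] exI[of _ "\<lambda>_. 1"] exI[of _ "\<lambda>_. 0"]) simp
  then have "smooth \<phi>" by (rule bumps_smooth)
  have "{x. \<phi> x \<noteq> 0} \<subseteq> cball c (r * real CARD('d))"
  proof
    fix x assume "x \<in> {x. \<phi> x \<noteq> 0}"
    then have "bump1 1 0 ((x $ i - c $ i) / r) \<noteq> 0" for i by (auto simp: \<phi>_def)
    then have "\<bar>(x $ i - c $ i) / r\<bar> < 1" for i by (metis bump1_def)
    then have "\<bar>(x - c) $ i\<bar> \<le> r" for i using r(1) by (simp add: abs_divide divide_less_eq less_imp_le)
    then have "norm (x - c) \<le> (\<Sum>i\<in>(UNIV::'d set). r)"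
      by (intro order_trans[OF norm_le_l1_cart] sum_mono)
    then show "x \<in> cball c (r * real CARD('d))" by (simp add: dist_norm norm_minus_commute mult.commute)
  qed
  then have cl: "closure {x. \<phi> x \<noteq> 0} \<subseteq> cball c (r * real CARD('d))" by (simp add: closure_minimal)
  then have "compact (closure {x. \<phi> x \<noteq> 0})"
    by (meson bounded_cball bounded_subset closed_closure compact_eq_bounded_closed)
  then have "test_function U \<phi>" unfolding test_function_def using \<open>smooth \<phi>\<close> cl r(2) by blast
  moreover have "0 \<le> \<phi> x" for x unfolding \<phi>_def by (intro prod_nonneg) (auto simp: bump1_def)
  moreover have "0 < \<phi> c" unfolding \<phi>_def by (intro prod_pos) (auto simp: bump1_def)
  ultimately show ?thesis by (rule that)
qed

lemma smooth_has_derivative: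
  assumes "smooth \<phi>"
  shows "(\<phi> has_derivative (\<lambda>h. grad \<phi> x \<bullet> h)) (at x)" "continuous_on UNIV (grad \<phi>)"
proof -
  have "iter_partial [] \<phi> differentiable (at x)" using assms smooth_def by blast
  then have d: "(\<phi> has_derivative frechet_derivative \<phi> (at x)) (at x)" by (simp add: frechet_derivative_works[symmetric])
  then have lin: "linear (frechet_derivative \<phi> (at x))" by (rule has_derivative_linear)
  have "frechet_derivative \<phi> (at x) h = grad \<phi> x \<bullet> h" for h
  proof -
    have "frechet_derivative \<phi> (at x) h = frechet_derivative \<phi> (at x) (\<Sum>i\<in>UNIV. h $ i *\<^sub>R axis i 1)"
      by (simp add: basis_expansion scalar_mult_eq_scaleR[symmetric])
    also have "\<dots> = (\<Sum>i\<in>UNIV. h $ i * frechet_derivative \<phi> (at x) (axis i 1))"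
      using lin by (simp add: linear_sum linear_scale)
    finally show ?thesis by (simp add: grad_def partial_def inner_vec_def mult.commute)
  qed
  then show "(\<phi> has_derivative (\<lambda>h. grad \<phi> x \<bullet> h)) (at x)" using d by (metis (no_types, lifting) ext)
  have "iter_partial [i] \<phi> differentiable (at x)" for i x using assms smooth_def by blast
  then have "continuous_on UNIV (partial i \<phi>)" for i
    by (simp add: continuous_at_imp_continuous_on differentiable_imp_continuous_within)
  then show "continuous_on UNIV (grad \<phi>)" unfolding grad_def[abs_def] by (intro continuous_on_vec_lambda) simp
qed

section \<open>Facet integrals as volume integrals\<close>

text \<open>Test functions will be composed with affine maps. Carrying the gradient along gives a class of
  functions for which this composition is immediate.\<close>

definition C1_gradient :: "('a::euclidean_space \<Rightarrow> real) \<Rightarrow> ('a \<Rightarrow> 'a) \<Rightarrow> bool" where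
  "C1_gradient \<phi> G \<longleftrightarrow> (\<forall>x. (\<phi> has_derivative (\<lambda>h. G x \<bullet> h)) (at x)) \<and> continuous_on UNIV G"

lemma smooth_C1_gradient: "smooth \<phi> \<Longrightarrow> C1_gradient \<phi> (grad \<phi>)"
  unfolding C1_gradient_def using smooth_has_derivative by blast

lemma C1_gradient_continuous: "C1_gradient \<phi> G \<Longrightarrow> continuous_on UNIV \<phi>"
  unfolding C1_gradient_def by (meson continuous_at_imp_continuous_on has_derivative_continuous)

lemma C1_gradient_diff: "C1_gradient \<phi> G \<Longrightarrow> C1_gradient \<psi> H \<Longrightarrow> C1_gradient (\<lambda>x. \<phi> x - \<psi> x) (\<lambda>x. G x - H x)"
  unfolding C1_gradient_def
proof (intro conjI allI)
  fix x
  assume A: "(\<forall>x. (\<phi> has_derivative (\<bullet>) (G x)) (at x)) \<and> continuous_on UNIV G"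
    "(\<forall>x. (\<psi> has_derivative (\<bullet>) (H x)) (at x)) \<and> continuous_on UNIV H"
  then have "((\<lambda>x. \<phi> x - \<psi> x) has_derivative (\<lambda>h. G x \<bullet> h - H x \<bullet> h)) (at x)"
    by (intro has_derivative_diff) auto
  moreover have "(\<lambda>h. G x \<bullet> h - H x \<bullet> h) = (\<bullet>) (G x - H x)" by (auto simp: inner_diff_left)
  ultimately show "((\<lambda>x. \<phi> x - \<psi> x) has_derivative (\<bullet>) (G x - H x)) (at x)" by simp
  show "continuous_on UNIV (\<lambda>x. G x - H x)" using A by (intro continuous_intros) auto
qed

lemma C1_gradient_rank_one_comp:
  assumes "C1_gradient \<phi> G"
  shows "C1_gradient (\<lambda>x. \<phi> (b + (x + (g \<bullet> x) *\<^sub>R u)))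
    (\<lambda>x. G (b + (x + (g \<bullet> x) *\<^sub>R u)) + (G (b + (x + (g \<bullet> x) *\<^sub>R u)) \<bullet> u) *\<^sub>R g)"
  unfolding C1_gradient_def
proof (intro conjI allI)
  fix x
  have "((\<lambda>x. b + (x + (g \<bullet> x) *\<^sub>R u)) has_derivative (\<lambda>h. h + (g \<bullet> h) *\<^sub>R u)) (at x)"
    by (auto intro!: derivative_eq_intros)
  from has_derivative_compose[OF this] assms
  have "((\<lambda>x. \<phi> (b + (x + (g \<bullet> x) *\<^sub>R u))) has_derivative (\<lambda>h. G (b + (x + (g \<bullet> x) *\<^sub>R u)) \<bullet> (h + (g \<bullet> h) *\<^sub>R u))) (at x)"
    unfolding C1_gradient_def by blast
  then show "((\<lambda>x. \<phi> (b + (x + (g \<bullet> x) *\<^sub>R u))) has_derivative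
      (\<bullet>) (G (b + (x + (g \<bullet> x) *\<^sub>R u)) + (G (b + (x + (g \<bullet> x) *\<^sub>R u)) \<bullet> u) *\<^sub>R g)) (at x)"
    by (rule has_derivative_eq_rhs) (auto simp: inner_add_right inner_add_left mult.commute)
next
  have "continuous_on UNIV G" using assms by (simp add: C1_gradient_def)
  then have "continuous_on UNIV (\<lambda>x. G (b + (x + (g \<bullet> x) *\<^sub>R u)))"
    by (rule continuous_on_compose2) (auto intro!: continuous_intros)
  then show "continuous_on UNIV (\<lambda>x. G (b + (x + (g \<bullet> x) *\<^sub>R u)) + (G (b + (x + (g \<bullet> x) *\<^sub>R u)) \<bullet> u) *\<^sub>R g)"
    by (intro continuous_intros)
qed

lemma C1_Lipschitz_on_compact_convex:
  assumes \<phi>: "C1_gradient \<phi> G" and P: "compact P" "convex P"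
  shows "\<exists>B\<ge>0. \<forall>x\<in>P. \<forall>y\<in>P. \<bar>\<phi> x - \<phi> y\<bar> \<le> B * norm (x - y)"
proof -
  have "continuous_on P G" using \<phi> continuous_on_subset unfolding C1_gradient_def by blast
  then have "bounded (G ` P)" using P compact_continuous_image compact_imp_bounded by blast
  then obtain B where B: "B > 0" "\<And>x. x \<in> P \<Longrightarrow> norm (G x) \<le> B" unfolding bounded_pos by auto
  have "\<bar>\<phi> x - \<phi> y\<bar> \<le> B * norm (x - y)" if "x \<in> P" "y \<in> P" for x y
  proof -
    have "norm (\<phi> x - \<phi> y) \<le> B * norm (x - y)"
    proof (rule differentiable_bound[OF P(2), where f'="\<lambda>z h. G z \<bullet> h"])
      fix z assume "z \<in> P"
      show "(\<phi> has_derivative (\<lambda>h. G z \<bullet> h)) (at z within P)"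
        using \<phi> unfolding C1_gradient_def by (blast intro: has_derivative_at_withinI)
      show "onorm ((\<bullet>) (G z)) \<le> B"
        using B(2)[OF \<open>z \<in> P\<close>] by (intro onorm_bound) (use B(1) in \<open>auto intro!: order_trans[OF Cauchy_Schwarz_ineq2] mult_right_mono\<close>)
    qed (use that in auto)
    then show ?thesis by simp
  qed
  then show ?thesis using B(1) by (intro exI[of _ B]) auto
qed

text \<open>The flux of \<open>\<phi> (x - opp T S)\<close> out of \<open>T\<close>, divided by the volume of \<open>T\<close> and written as the integral of
  the divergence. On the facets other than \<open>S\<close> the field is tangential, and on \<open>S\<close> its normal component is
  \<open>\<phi>\<close> times a constant, so this is a multiple of the integral of \<open>\<phi>\<close> over \<open>S\<close>. Since \<open>d |T|\<close> is the
  distance of \<open>opp T S\<close> to \<open>S\<close> times the area of \<open>S\<close>, it is \<open>d\<close> times the mean value of \<open>\<phi>\<close> on \<open>S\<close>.\<close>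

definition flux :: "(real^'d) set \<Rightarrow> (real^'d) set \<Rightarrow> (real^'d \<Rightarrow> real) \<Rightarrow> (real^'d \<Rightarrow> real^'d) \<Rightarrow> real" where
  "flux T S \<phi> G = (LINT x:T|lebesgue. G x \<bullet> (x - opp T S) + real CARD('d) * \<phi> x) / measure lebesgue T"

text \<open>The factor \<open>1 - r\<close> is the relative thickness of the layer between the shrunken simplex and \<open>S\<close>.\<close>

definition shell_mean :: "(real^'d) set \<Rightarrow> (real^'d) set \<Rightarrow> (real^'d \<Rightarrow> real) \<Rightarrow> real \<Rightarrow> real" where
  "shell_mean T S \<phi> r =
     ((LINT x:T|lebesgue. \<phi> x) - (LINT x:shrink (opp T S) r ` T|lebesgue. \<phi> x)) / (1 - r) / measure lebesgue T"

lemma set_integral_const_lebesgue: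
  "A \<in> sets lebesgue \<Longrightarrow> (LINT x:A|lebesgue. c) = c * measure lebesgue A" for c :: real
  by (simp add: set_lebesgue_integral_def)

context
  fixes T S :: "(real^'d) set"
  assumes T: "full_simplex T" and S: "S facet_of T"
begin

text \<open>Substituting the dilation with center \<open>opp T S\<close> turns the layer mean into a difference quotient of
  \<open>r ^ d * \<phi> (p + r *\<^sub>R (x - p))\<close> at \<open>r = 1\<close>, where \<open>p = opp T S\<close>; the derivative is the integrand of \<open>flux\<close>.\<close>

lemma flux_as_limit:
  assumes \<phi>: "C1_gradient \<phi> G"
  shows "(\<lambda>n. shell_mean T S \<phi> (shrink_factor n)) \<longlonglongrightarrow> flux T S \<phi> G"
proof -
  let ?p = "opp T S" and ?d = "CARD('d)"
  define h where "h r x = r ^ ?d * \<phi> (shrink ?p r x)" for r x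
  note c\<phi> = C1_gradient_continuous[OF \<phi>]
  have cG: "continuous_on UNIV G" using \<phi> by (simp add: C1_gradient_def)
  have cT: "compact T" "convex T" using compact_full_simplex[OF T] by auto
  have Tb: "T \<in> sets borel" using cT borel_compact by blast
  have pT: "?p \<in> T" using mem_simplex_iff[OF T] bary_opp[OF T _ S] by simp
  have ch: "continuous_on UNIV (h r)" for r
    unfolding h_def by (intro continuous_intros continuous_on_compose2[OF c\<phi>]) auto
  have \<phi>m: "\<phi> \<in> borel_measurable borel" using c\<phi> by (rule borel_measurable_continuous_onI)
  have h1: "h 1 x = \<phi> x" for x by (simp add: h_def shrink_def)
  define F where "F r x = (h 1 x - h r x) / (1 - r)" for r x
  have eq: "shell_mean T S \<phi> r = (LINT x:T|lebesgue. F r x) / measure lebesgue T" if r: "0 < r" "r < 1" for r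
  proof -
    have "(LINT x:T|lebesgue. \<phi> x) - (LINT x:shrink ?p r ` T|lebesgue. \<phi> x)
      = (LINT x:T|lebesgue. h 1 x) - (LINT x:T|lebesgue. h r x)"
      unfolding integral_shrink[OF r(1) Tb \<phi>m] h1 by (simp add: h_def)
    also have "\<dots> = (LINT x:T|lebesgue. h 1 x - h r x)"
      by (intro set_integral_diff(2)[symmetric] set_integrable_continuous_compact cT ch)
    finally show ?thesis unfolding shell_mean_def F_def by simp
  qed
  have hder: "((\<lambda>r. h r x) has_real_derivative (G x \<bullet> (x - ?p) + real ?d * \<phi> x)) (at 1)" for x
  proof -
    have 1: "((\<lambda>r. shrink ?p r x) has_derivative (\<lambda>t. t *\<^sub>R (x - ?p))) (at 1)"
      unfolding shrink_def by (auto intro!: derivative_eq_intros)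
    have s1: "shrink ?p 1 x = x" by (simp add: shrink_def)
    have "(\<phi> has_derivative (\<lambda>h. G x \<bullet> h)) (at (shrink ?p 1 x))" using \<phi> by (simp add: C1_gradient_def s1)
    from has_derivative_compose[OF 1 this]
    have 2: "((\<lambda>r. \<phi> (shrink ?p r x)) has_real_derivative (G x \<bullet> (x - ?p))) (at 1)"
      unfolding has_field_derivative_def by (rule has_derivative_eq_rhs) (auto simp: mult.commute)
    have "((\<lambda>r. h r x) has_real_derivative (real ?d * 1 ^ (?d - Suc 0) * \<phi> (shrink ?p 1 x) + (G x \<bullet> (x - ?p)) * 1 ^ ?d)) (at 1)"
      unfolding h_def by (rule DERIV_mult[OF DERIV_pow 2, simplified mult.commute[of "1 ^ _"]])
    then show ?thesis by (simp add: s1 add.commute)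
  qed
  have lim: "(\<lambda>n. F (shrink_factor n) x) \<longlonglongrightarrow> G x \<bullet> (x - ?p) + real ?d * \<phi> x" for x
  proof -
    have "((\<lambda>r. (h r x - h 1 x) / (r - 1)) \<longlongrightarrow> G x \<bullet> (x - ?p) + real ?d * \<phi> x) (at 1)"
      using hder[of x] by (simp add: has_field_derivative_iff)
    moreover have "filterlim shrink_factor (at 1) sequentially"
      unfolding filterlim_at using shrink_factor by (auto intro!: always_eventually) (metis less_irrefl)
    ultimately have "(\<lambda>n. (h (shrink_factor n) x - h 1 x) / (shrink_factor n - 1)) \<longlonglongrightarrow> G x \<bullet> (x - ?p) + real ?d * \<phi> x"
      by (rule filterlim_compose)
    moreover have "(h (shrink_factor n) x - h 1 x) / (shrink_factor n - 1) = F (shrink_factor n) x" for n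
      unfolding F_def by (metis minus_diff_eq minus_divide_divide)
    ultimately show ?thesis by simp
  qed
  obtain B where B: "B \<ge> 0" "\<And>x y. x \<in> T \<Longrightarrow> y \<in> T \<Longrightarrow> \<bar>\<phi> x - \<phi> y\<bar> \<le> B * norm (x - y)"
    using C1_Lipschitz_on_compact_convex[OF \<phi> cT] by blast
  obtain M where M: "\<And>x. x \<in> T \<Longrightarrow> \<bar>\<phi> x\<bar> \<le> M"
    using compact_imp_bounded[OF compact_continuous_image[OF continuous_on_subset[OF c\<phi>] cT(1)]] unfolding bounded_iff by auto
  obtain N where N: "\<And>x. x \<in> T \<Longrightarrow> norm (x - ?p) \<le> N"
  proof -
    have "compact ((\<lambda>x. x - ?p) ` T)" by (intro compact_continuous_image continuous_intros cT)
    then obtain N where "\<forall>y\<in>(\<lambda>x. x - ?p) ` T. norm y \<le> N" using compact_imp_bounded bounded_iff by blast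
    then show ?thesis by (intro that[of N]) auto
  qed
  have M0: "M \<ge> 0" and N0: "N \<ge> 0" using M[OF pT] N[OF pT] by (auto intro: order_trans)
  have bound: "\<bar>F r x\<bar> \<le> real ?d * M + B * N" if r: "0 < r" "r < 1" and x: "x \<in> T" for r x
  proof -
    have sT: "shrink ?p r x \<in> T" using shrink_simplex_subset[OF T S, of r] r x by auto
    have "h 1 x - h r x = (1 - r ^ ?d) * \<phi> x + r ^ ?d * (\<phi> x - \<phi> (shrink ?p r x))"
      by (simp add: h1) (simp add: h_def algebra_simps)
    then have "\<bar>h 1 x - h r x\<bar> \<le> \<bar>(1 - r ^ ?d) * \<phi> x\<bar> + \<bar>r ^ ?d * (\<phi> x - \<phi> (shrink ?p r x))\<bar>" by simp
    also have "\<bar>(1 - r ^ ?d) * \<phi> x\<bar> \<le> (real ?d * (1 - r)) * M"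
    proof -
      have "1 - r ^ ?d = (1 - r) * (\<Sum>i<?d. r ^ i)" by (rule one_diff_power_eq)
      moreover have "(\<Sum>i<?d. r ^ i) \<le> (\<Sum>i<?d. 1)" using r by (intro sum_mono power_le_one) auto
      ultimately have "1 - r ^ ?d \<le> (1 - r) * real ?d" using r by (simp add: mult_left_mono)
      moreover have "0 \<le> 1 - r ^ ?d" using r by (simp add: power_le_one)
      ultimately show ?thesis using M[OF x] unfolding abs_mult by (intro mult_mono) (auto simp: mult.commute)
    qed
    also have "\<bar>r ^ ?d * (\<phi> x - \<phi> (shrink ?p r x))\<bar> \<le> 1 * (B * ((1 - r) * N))"
    proof -
      have "norm (x - shrink ?p r x) = (1 - r) * norm (x - ?p)"
      proof -
        have "x - shrink ?p r x = (1 - r) *\<^sub>R (x - ?p)" by (simp add: shrink_def algebra_simps)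
        then show ?thesis using r by simp
      qed
      also have "\<dots> \<le> (1 - r) * N" using N[OF x] r by (intro mult_left_mono) auto
      finally have "B * norm (x - shrink ?p r x) \<le> B * ((1 - r) * N)" using B(1) by (rule mult_left_mono)
      then have "\<bar>\<phi> x - \<phi> (shrink ?p r x)\<bar> \<le> B * ((1 - r) * N)" using B(2)[OF x sT] by simp
      then show ?thesis unfolding abs_mult using r by (intro mult_mono) (auto simp: power_le_one)
    qed
    finally have "\<bar>h 1 x - h r x\<bar> \<le> (1 - r) * (real ?d * M + B * N)" by (simp add: algebra_simps)
    then show ?thesis unfolding F_def using r by (simp add: abs_divide divide_le_eq mult.commute)
  qed
  have "(\<lambda>n. LINT x:T|lebesgue. F (shrink_factor n) x) \<longlonglongrightarrow> (LINT x:T|lebesgue. G x \<bullet> (x - ?p) + real ?d * \<phi> x)"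
    unfolding set_lebesgue_integral_def
  proof (rule integral_dominated_convergence[where w="\<lambda>x. indicator T x * (real ?d * M + B * N)"])
    have Tl: "T \<in> sets lebesgue" using Tb by auto
    have mc: "f \<in> borel_measurable lebesgue" if "continuous_on UNIV f" for f :: "real^'d \<Rightarrow> real"
      by (rule measurable_completion) (simp add: borel_measurable_continuous_onI[OF that])
    show "(\<lambda>x. indicat_real T x *\<^sub>R (G x \<bullet> (x - ?p) + real ?d * \<phi> x)) \<in> borel_measurable lebesgue"
      by (intro borel_measurable_scaleR borel_measurable_indicator Tl mc continuous_intros cG c\<phi>)
    have "continuous_on UNIV (F r)" for r unfolding F_def divide_inverse by (intro continuous_intros ch)
    then show "(\<lambda>x. indicat_real T x *\<^sub>R F (shrink_factor n) x) \<in> borel_measurable lebesgue" for n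
      by (intro borel_measurable_scaleR borel_measurable_indicator Tl mc)
    have "set_integrable lebesgue T (\<lambda>x. real ?d * M + B * N)"
      by (rule set_integrable_continuous_compact) (use cT in auto)
    then show "integrable lebesgue (\<lambda>x. indicat_real T x * (real ?d * M + B * N))"
      unfolding set_integrable_def by simp
    show "AE x in lebesgue. (\<lambda>n. indicat_real T x *\<^sub>R F (shrink_factor n) x) \<longlonglongrightarrow> indicat_real T x *\<^sub>R (G x \<bullet> (x - ?p) + real ?d * \<phi> x)"
      by (intro always_eventually allI tendsto_intros lim)
    show "AE x in lebesgue. norm (indicat_real T x *\<^sub>R F (shrink_factor n) x) \<le> indicat_real T x * (real ?d * M + B * N)" for n
      by (intro always_eventually allI) (use bound[OF shrink_factor(1,2)] in \<open>auto simp: indicator_def\<close>)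
  qed
  then have "(\<lambda>n. (LINT x:T|lebesgue. F (shrink_factor n) x) / measure lebesgue T) \<longlonglongrightarrow> flux T S \<phi> G"
    unfolding flux_def by (intro tendsto_intros) (use measure_full_simplex_pos[OF T] in auto)
  then show ?thesis using eq[OF shrink_factor(1,2)] by simp
qed

lemma shell_integral:
  fixes \<phi> :: "real^'d \<Rightarrow> real"
  assumes r: "0 < r" "r < 1" and \<phi>: "continuous_on UNIV \<phi>"
  shows "(LINT x:T|lebesgue. \<phi> x) - (LINT x:shrink (opp T S) r ` T|lebesgue. \<phi> x)
    = (LINT x:T - shrink (opp T S) r ` T|lebesgue. \<phi> x)" (is "_ - (LINT x:?Tr|_. _) = _")
    "measure lebesgue (T - shrink (opp T S) r ` T) = (1 - r ^ CARD('d)) * measure lebesgue T"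
    "T - shrink (opp T S) r ` T \<in> lmeasurable"
proof -
  have cT: "compact T" using compact_full_simplex[OF T] by auto
  have cTr: "compact ?Tr" by (intro compact_continuous_image continuous_on_shrink cT)
  have sub: "?Tr \<subseteq> T" using shrink_simplex_subset[OF T S] r by simp
  have i: "set_integrable lebesgue T \<phi>" "set_integrable lebesgue ?Tr \<phi>"
    by (rule set_integrable_continuous_compact[OF cT \<phi>], rule set_integrable_continuous_compact[OF cTr \<phi>])
  show "T - ?Tr \<in> lmeasurable" using cT cTr by (intro fmeasurable.Diff lmeasurable_compact)
  have "set_integrable lebesgue (T - ?Tr) \<phi>"
    by (rule set_integrable_subset[OF i(1)]) (use \<open>T - ?Tr \<in> lmeasurable\<close> in auto)
  then have "(LINT x:?Tr \<union> (T - ?Tr)|lebesgue. \<phi> x) = (LINT x:?Tr|lebesgue. \<phi> x) + (LINT x:T - ?Tr|lebesgue. \<phi> x)"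
    by (intro set_integral_Un[OF _ i(2)]) blast
  moreover have "?Tr \<union> (T - ?Tr) = T" using sub by auto
  ultimately show "(LINT x:T|lebesgue. \<phi> x) - (LINT x:?Tr|lebesgue. \<phi> x) = (LINT x:T - ?Tr|lebesgue. \<phi> x)" by simp
  have "measure lebesgue (T - ?Tr) = measure lebesgue T - measure lebesgue ?Tr"
    by (rule measurable_measure_Diff) (use cT cTr sub lmeasurable_compact in auto)
  then show "measure lebesgue (T - ?Tr) = (1 - r ^ CARD('d)) * measure lebesgue T"
    using measure_shrink[OF r(1) borel_compact[OF cT], of "opp T S"] by (simp add: algebra_simps del: measure_completion)
qed

text \<open>A Lipschitz function that vanishes on \<open>S\<close> is of the order of the thickness on a layer along \<open>S\<close>.\<close>

theorem flux_eq_0: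
  assumes \<psi>: "C1_gradient \<psi> G" and zero: "\<And>x. x \<in> S \<Longrightarrow> \<psi> x = 0"
  shows "flux T S \<psi> G = 0"
proof -
  let ?p = "opp T S" and ?d = "CARD('d)"
  have cT: "compact T" "convex T" using compact_full_simplex[OF T] by auto
  obtain B where B: "B \<ge> 0" "\<And>x y. x \<in> T \<Longrightarrow> y \<in> T \<Longrightarrow> \<bar>\<psi> x - \<psi> y\<bar> \<le> B * norm (x - y)"
    using C1_Lipschitz_on_compact_convex[OF \<psi> cT] by blast
  define e where "e = opp T S - barycenter S"
  define C where "C = B * norm e"
  have C: "\<bar>\<psi> x\<bar> \<le> C * bary T S x" if x: "x \<in> T" for x
  proof -
    let ?z = "x - bary T S x *\<^sub>R e"
    have z: "?z \<in> S" unfolding e_def by (rule slide_to_facet[OF T S x])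
    then have "?z \<in> T" using mem_facet_iff[OF T S] by blast
    from B(2)[OF x this] show ?thesis using zero[OF z] x S mem_simplex_iff[OF T] by (simp add: C_def mult_ac)
  qed
  have C0: "C \<ge> 0" using B(1) by (simp add: C_def)
  have b: "\<bar>shell_mean T S \<psi> r\<bar> \<le> C * (1 - r ^ ?d)" if r: "0 < r" "r < 1" for r
  proof -
    let ?D = "T - shrink ?p r ` T"
    note sh = shell_integral[OF r C1_gradient_continuous[OF \<psi>]]
    have "\<bar>LINT x:?D|lebesgue. \<psi> x\<bar> \<le> (LINT x:?D|lebesgue. C * (1 - r))"
    proof -
      have i: "set_integrable lebesgue ?D \<psi>"
        by (rule set_integrable_subset[OF set_integrable_continuous_compact[OF cT(1) C1_gradient_continuous[OF \<psi>]]]) (use sh(3) in auto)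
      have i2: "set_integrable lebesgue ?D (\<lambda>x. C * (1 - r))"
        by (rule set_integrable_subset[OF set_integrable_continuous_compact[OF cT(1)]]) (use sh(3) in auto)
      have "\<bar>LINT x:?D|lebesgue. \<psi> x\<bar> \<le> (LINT x:?D|lebesgue. \<bar>\<psi> x\<bar>)"
        using set_integral_norm_bound[OF i] by simp
      also have "\<dots> \<le> (LINT x:?D|lebesgue. C * (1 - r))"
      proof (rule set_integral_mono[OF set_integrable_abs[OF i] i2])
        fix x assume x: "x \<in> ?D"
        then have "bary T S x \<le> 1 - r" using mem_shrink_simplex_iff[OF T S, of r x] r by auto
        then show "\<bar>\<psi> x\<bar> \<le> C * (1 - r)" using C[of x] x C0 by (auto intro: order_trans mult_left_mono)
      qed
      finally show ?thesis .
    qed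
    also have "\<dots> = C * (1 - r) * ((1 - r ^ ?d) * measure lebesgue T)"
      using sh(3) unfolding sh(2)[symmetric] by (simp only: set_integral_const_lebesgue[OF fmeasurableD])
    finally have "\<bar>LINT x:?D|lebesgue. \<psi> x\<bar> \<le> C * (1 - r ^ ?d) * ((1 - r) * measure lebesgue T)" by (simp add: mult_ac)
    then show ?thesis
      unfolding shell_mean_def sh(1) using r measure_full_simplex_pos[OF T] by (simp add: abs_divide divide_le_eq mult_ac)
  qed
  have "(\<lambda>n. C * (1 - shrink_factor n ^ ?d)) \<longlonglongrightarrow> C * (1 - 1 ^ ?d)" by (intro tendsto_intros shrink_factor)
  then have "(\<lambda>n. C * (1 - shrink_factor n ^ ?d)) \<longlonglongrightarrow> 0" by simp
  then have "(\<lambda>n. shell_mean T S \<psi> (shrink_factor n)) \<longlonglongrightarrow> 0"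
    by (rule Lim_null_comparison[rotated]) (use b[OF shrink_factor(1,2)] in \<open>auto intro!: always_eventually\<close>)
  then show ?thesis using flux_as_limit[OF \<psi>] LIMSEQ_unique by blast
qed

lemma flux_diff:
  assumes \<phi>: "C1_gradient \<phi> G" and \<psi>: "C1_gradient \<psi> H"
  shows "flux T S (\<lambda>x. \<phi> x - \<psi> x) (\<lambda>x. G x - H x) = flux T S \<phi> G - flux T S \<psi> H"
proof -
  have c: "continuous_on UNIV \<phi>" "continuous_on UNIV \<psi>" "continuous_on UNIV G" "continuous_on UNIV H"
    using \<phi> \<psi> C1_gradient_continuous by (auto simp: C1_gradient_def)
  have "(LINT x:T|lebesgue. G x \<bullet> (x - opp T S) + real CARD('d) * \<phi> x) - (LINT x:T|lebesgue. H x \<bullet> (x - opp T S) + real CARD('d) * \<psi> x)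
     = (LINT x:T|lebesgue. (G x - H x) \<bullet> (x - opp T S) + real CARD('d) * (\<phi> x - \<psi> x))"
    by (subst set_integral_diff(2)[symmetric])
      (auto intro!: set_integrable_continuous_compact compact_full_simplex[OF T] continuous_intros c
        simp: inner_diff_left algebra_simps)
  then show ?thesis unfolding flux_def diff_divide_distrib[symmetric] by simp
qed

lemma flux_cong_on_facet:
  assumes "C1_gradient \<phi> G" "C1_gradient \<psi> H" "\<And>x. x \<in> S \<Longrightarrow> \<phi> x = \<psi> x"
  shows "flux T S \<phi> G = flux T S \<psi> H"
  using flux_eq_0[OF C1_gradient_diff[OF assms(1,2)]] flux_diff[OF assms(1,2)] assms(3) by simp

end

section \<open>Facet integrals from both sides of a facet\<close>

lemma bary_other_simplex:
  assumes T: "full_simplex T" and S: "S facet_of T" and T': "full_simplex T'" and S': "S facet_of T'"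
  shows "bary T' S x = bary T' S (opp T S) * bary T S x"
proof -
  have *: "bary T' S x = (bary_grad T' S \<bullet> x) + (1 - bary_grad T' S \<bullet> opp T' S)" for x
    by (simp add: bary_def inner_diff_right)
  have "bary T' S x = (\<Sum>R | R facet_of T. bary T R x * bary T' S (opp T R))"
    unfolding * by (rule affine_eq_sum_bary[OF T])
  also have "\<dots> = (\<Sum>R | R facet_of T. if R = S then bary T S x * bary T' S (opp T S) else 0)"
  proof (rule sum.cong)
    fix R assume R: "R \<in> {R. R facet_of T}"
    have "bary T' S (opp T R) = 0" if "R \<noteq> S"
    proof -
      have "opp T R \<in> S"
        unfolding mem_facet_iff[OF T S] mem_simplex_iff[OF T] using R that S by (auto simp: bary_opp[OF T])
      then show ?thesis using mem_facet_iff[OF T' S'] by simp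
    qed
    then show "bary T R x * bary T' S (opp T R) = (if R = S then bary T S x * bary T' S (opp T S) else 0)" by simp
  qed simp
  also have "\<dots> = bary T' S (opp T S) * bary T S x" using S finite_facets[OF T] by simp
  finally show ?thesis .
qed

lemma bary_opp_other_nonzero:
  assumes T: "full_simplex T" and S: "S facet_of T" and T': "full_simplex T'" and S': "S facet_of T'"
  shows "bary T' S (opp T S) \<noteq> 0"
  using bary_other_simplex[OF assms, of "opp T' S"] bary_opp[OF T' S' S'] by auto

text \<open>The affine map that fixes the common facet and moves one opposite vertex to the other carries the
  layers of one simplex to those of the other. It changes the test function, but not on the facet.\<close>

theorem flux_glue:
  fixes T T' S :: "(real^'d) set"
  assumes T: "full_simplex T" and S: "S facet_of T" and T': "full_simplex T'" and S': "S facet_of T'"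
    and \<phi>: "C1_gradient \<phi> G"
  shows "flux T S \<phi> G = flux T' S \<phi> G"
proof -
  define p p' u g where "p = opp T S" and "p' = opp T' S" and "u = p' - p" and "g = bary_grad T S"
  define L where "L x = x + (g \<bullet> x) *\<^sub>R u" for x
  define b where "b = bary T S 0 *\<^sub>R u"
  define A where "A x = b + L x" for x
  have A: "A x = x + bary T S x *\<^sub>R u" for x
    by (simp add: A_def L_def b_def g_def bary_affine[of T S x 0] algebra_simps)
  have L: "linear L" unfolding L_def[abs_def] by (rule linear_rank_one_update)
  have gu: "1 + g \<bullet> u \<noteq> 0"
    using bary_opp_other_nonzero[OF T' S' T S] by (simp add: bary_def g_def u_def p_def p'_def)
  have "inj L" unfolding linear_injective_0[OF L]
  proof (intro allI impI)
    fix x assume "L x = 0"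
    then have x: "x = - (g \<bullet> x) *\<^sub>R u" by (simp add: L_def eq_neg_iff_add_eq_0)
    then have "g \<bullet> x = - (g \<bullet> x) * (g \<bullet> u)" by (metis inner_scaleR_right)
    then have "(g \<bullet> x) * (1 + g \<bullet> u) = 0" by (simp add: algebra_simps)
    then show "x = 0" using gu x by simp
  qed
  then have bL: "bij L" using linear_injective_imp_surjective[OF L] by (simp add: bij_def)
  have vT: "T = convex hull (insert p (verts S))"
    using simplex_verts(2)[OF T] facet_opp[OF T S] by (simp add: p_def insert_absorb)
  have vT': "T' = convex hull (insert p' (verts S))"
    using simplex_verts(2)[OF T'] facet_opp[OF T' S'] by (simp add: p'_def insert_absorb)
  have AS: "A s = s" if "s \<in> S" for s using that mem_facet_iff[OF T S] by (simp add: A)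
  have vS: "verts S \<subseteq> S" by (auto simp: verts_def extreme_point_of_def)
  have Ap: "A p = p'" using bary_opp[OF T S S] by (simp add: A p_def u_def)
  have AT: "A ` T = T'"
  proof -
    have "A ` (convex hull (insert p (verts S))) = (+) b ` (L ` (convex hull (insert p (verts S))))"
      by (auto simp: A_def image_image)
    also have "\<dots> = convex hull ((+) b ` (L ` (insert p (verts S))))"
      by (simp only: convex_hull_linear_image[OF L, symmetric] convex_hull_translation)
    also have "(+) b ` (L ` (insert p (verts S))) = A ` (insert p (verts S))" by (auto simp: A_def image_image)
    also have "A ` (insert p (verts S)) = insert p' (verts S)"
      using Ap AS vS by (auto simp: image_iff) (metis subsetD)
    finally show ?thesis using vT vT' by simp
  qed
  have Ash: "A ` (shrink p r ` T) = shrink p' r ` T'" for r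
  proof -
    have "A (shrink p r x) = shrink p' r (A x)" for x
      unfolding Ap[symmetric] by (simp add: A_def shrink_def linear_add[OF L] linear_scale[OF L] linear_diff[OF L])
    then show ?thesis unfolding AT[symmetric] image_image by simp
  qed
  have Tb: "T \<in> sets borel" using compact_full_simplex(1)[OF T] borel_compact by blast
  have \<phi>m: "\<phi> \<in> borel_measurable borel" using C1_gradient_continuous[OF \<phi>] by (rule borel_measurable_continuous_onI)
  note cov = affine_change_of_variables(1)[OF L bL _ \<phi>m, of _ b, folded A_def]
  have dpos: "dilation L > 0" by (rule affine_change_of_variables(2)[OF L bL Tb \<phi>m])
  define \<psi> where "\<psi> x = \<phi> (A x)" for x
  define H where "H x = G (A x) + (G (A x) \<bullet> u) *\<^sub>R g" for x
  have \<psi>: "C1_gradient \<psi> H"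
    using C1_gradient_rank_one_comp[OF \<phi>, of b g u] unfolding \<psi>_def[abs_def] H_def[abs_def] A_def L_def by simp
  have eq: "shell_mean T' S \<phi> r = shell_mean T S \<psi> r" if "0 < r" "r < 1" for r
  proof -
    have sb: "shrink p r ` T \<in> sets borel"
      by (intro borel_compact compact_continuous_image continuous_on_shrink compact_full_simplex(1)[OF T])
    have mT': "measure lebesgue T' = dilation L * measure lebesgue T"
      using measure_affine_image[OF L bL Tb, of b] unfolding A_def[symmetric] AT .
    have 1: "(LINT x:T'|lebesgue. \<phi> x) = dilation L * (LINT x:T|lebesgue. \<psi> x)"
      using cov[OF Tb] unfolding AT \<psi>_def by simp
    have 2: "(LINT x:shrink p' r ` T'|lebesgue. \<phi> x) = dilation L * (LINT x:shrink p r ` T|lebesgue. \<psi> x)"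
      using cov[OF sb] unfolding Ash \<psi>_def by simp
    show ?thesis
      unfolding shell_mean_def p_def[symmetric] p'_def[symmetric] 1 2 mT' using dpos
      by (simp add: right_diff_distrib[symmetric] divide_divide_eq_left mult.assoc mult.left_commute)
  qed
  have "(\<lambda>n. shell_mean T S \<psi> (shrink_factor n)) \<longlonglongrightarrow> flux T' S \<phi> G"
    using flux_as_limit[OF T' S' \<phi>] eq[OF shrink_factor(1,2)] by simp
  then have "flux T' S \<phi> G = flux T S \<psi> H"
    using flux_as_limit[OF T S \<psi>] LIMSEQ_unique by blast
  also have "\<dots> = flux T S \<phi> G"
    by (rule flux_cong_on_facet[OF T S \<psi> \<phi>]) (simp add: \<psi>_def AS)
  finally show ?thesis ..
qed

text \<open>Near \<open>x0\<close> the function is bounded below by a positive constant. The cone over a neighbourhood of \<open>x0\<close>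
  in \<open>S\<close> with apex \<open>opp T S\<close> takes a fixed share of the volume of every layer, so the layer means stay
  away from zero.\<close>

theorem flux_pos:
  fixes T S :: "(real^'d) set"
  assumes T: "full_simplex T" and S: "S facet_of T" and \<phi>: "C1_gradient \<phi> G"
    and nonneg: "\<And>x. 0 \<le> \<phi> x" and x0: "x0 \<in> S" "0 < \<phi> x0"
  shows "0 < flux T S \<phi> G"
proof -
  let ?p = "opp T S" and ?d = "CARD('d)"
  note c\<phi> = C1_gradient_continuous[OF \<phi>]
  define \<epsilon> where "\<epsilon> = \<phi> x0 / 2"
  have \<epsilon>: "\<epsilon> > 0" using x0 by (simp add: \<epsilon>_def)
  obtain \<delta> where \<delta>: "\<delta> > 0" "\<And>x. dist x x0 < 2 * \<delta> \<Longrightarrow> \<epsilon> \<le> \<phi> x"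
  proof -
    have "isCont \<phi> x0" using c\<phi> by (simp add: continuous_on_eq_continuous_at)
    then obtain d where d: "d > 0" "\<And>x. dist x x0 < d \<Longrightarrow> dist (\<phi> x) (\<phi> x0) < \<epsilon>"
      using \<epsilon> unfolding continuous_at_eps_delta by blast
    have "\<epsilon> \<le> \<phi> x" if "dist x x0 < d" for x using d(2)[OF that] unfolding dist_real_def \<epsilon>_def by linarith
    then show ?thesis using d(1) that[of "d/2"] by simp
  qed
  have cT: "compact T" "convex T" using compact_full_simplex[OF T] by auto
  have cS: "compact S" "convex S" using compact_facet[OF T S] by auto
  have pT: "?p \<in> T" using mem_simplex_iff[OF T] bary_opp[OF T _ S] by simp
  have ST: "S \<subseteq> T" using mem_facet_iff[OF T S] by auto
  define Z where "Z = S \<inter> cball x0 \<delta>"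
  have Z: "compact Z" "convex Z" "x0 \<in> Z" using cS x0 \<delta>(1) by (auto simp: Z_def intro: compact_Int convex_Int)
  \<comment> \<open>The cone: its layers are obtained by the same dilation as those of \<open>T\<close>.\<close>
  define C where "C = convex hull (insert ?p Z)"
  have cC: "compact C" unfolding C_def using Z by (intro compact_convex_hull) auto
  have Cb: "C \<in> sets borel" using cC borel_compact by blast
  have Cmem: "x \<in> C \<longleftrightarrow> (\<exists>s z. 0 \<le> s \<and> s \<le> 1 \<and> z \<in> Z \<and> x = ?p + s *\<^sub>R (z - ?p))" for x
  proof -
    have "x \<in> C \<longleftrightarrow> (\<exists>u\<ge>0. \<exists>v\<ge>0. \<exists>z. u + v = 1 \<and> z \<in> Z \<and> x = u *\<^sub>R ?p + v *\<^sub>R z)"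
      unfolding C_def convex_hull_insert[OF ex_in_conv[THEN iffD1, OF exI, OF Z(3)]] using Z(2) by (auto simp: hull_same)
    also have "\<dots> \<longleftrightarrow> (\<exists>s z. 0 \<le> s \<and> s \<le> 1 \<and> z \<in> Z \<and> x = ?p + s *\<^sub>R (z - ?p))"
    proof (safe, goal_cases)
      case (1 u v z) then show ?case by (intro exI[of _ v] exI[of _ z]) (auto simp: algebra_simps scaleR_left_distrib[symmetric])
    next
      case (2 s z) then show ?case by (intro exI[of _ "1 - s"] exI[of _ s] exI[of _ z] conjI) (auto simp: algebra_simps)
    qed
    finally show ?thesis .
  qed
  have CT: "C \<subseteq> T" unfolding C_def by (rule hull_minimal) (use pT ST cT in \<open>auto simp: Z_def\<close>)
  have Cpos: "measure lebesgue C > 0"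
  proof -
    have "S \<inter> ball x0 \<delta> \<noteq> {}" using x0 \<delta>(1) by auto
    then have "affine hull S = affine hull (S \<inter> ball x0 \<delta>)"
      using affine_hull_convex_Int_open[OF cS(2), of "ball x0 \<delta>"] by simp
    also have "\<dots> \<subseteq> affine hull C" unfolding C_def affine_hull_convex_hull by (rule hull_mono) (auto simp: Z_def)
    finally have "S \<subseteq> affine hull C" using hull_subset[of S affine] by blast
    moreover have "?p \<in> affine hull C" unfolding C_def affine_hull_convex_hull by (rule hull_inc) simp
    moreover have "verts T \<subseteq> insert ?p S" using facet_opp[OF T S] by (auto simp: verts_def extreme_point_of_def)
    ultimately have "verts T \<subseteq> affine hull C" by (meson insert_subset order_trans)
    then have "affine hull (verts T) \<subseteq> affine hull C" by (rule hull_minimal) (rule affine_affine_hull)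
    then have "affine hull C = UNIV" using simplex_verts(5)[OF T] by blast
    then have "interior C = rel_interior C" by (simp add: rel_interior_interior)
    moreover have "rel_interior C \<noteq> {}"
      unfolding C_def using rel_interior_eq_empty[OF convex_convex_hull, of "insert ?p Z"] by simp
    ultimately have "\<not> negligible (interior C)" by (intro open_not_negligible open_interior) simp
    then have "\<not> negligible C" using negligible_subset[OF _ interior_subset] by blast
    then show ?thesis using cC by (simp add: negligible_iff_measure zero_less_measure_iff lmeasurable_compact)
  qed
  obtain D where D: "\<And>z. z \<in> Z \<Longrightarrow> norm (z - ?p) \<le> D" "D > 0"
  proof -
    have "compact ((\<lambda>x. x - ?p) ` Z)" by (intro compact_continuous_image continuous_intros Z)
    then obtain N where "N > 0" "\<forall>y\<in>(\<lambda>x. x - ?p) ` Z. norm y \<le> N" using compact_imp_bounded bounded_pos by blast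
    then show ?thesis by (intro that[of N]) auto
  qed
  have bnd: "\<epsilon> * measure lebesgue C / measure lebesgue T \<le> shell_mean T S \<phi> r"
    if r: "0 < r" "r < 1" "(1 - r) * D < \<delta>" for r
  proof -
    let ?D = "T - shrink ?p r ` T" and ?E = "C - shrink ?p r ` C"
    have E: "x \<in> ?D \<and> \<epsilon> \<le> \<phi> x" if x: "x \<in> ?E" for x
    proof -
      obtain s z where sz: "0 \<le> s" "s \<le> 1" "z \<in> Z" "x = ?p + s *\<^sub>R (z - ?p)" using x Cmem by blast
      have sr: "s > r"
      proof (rule ccontr)
        assume "\<not> s > r"
        then have "?p + (s / r) *\<^sub>R (z - ?p) \<in> C" unfolding Cmem using sz r by (intro exI[of _ "s/r"] exI[of _ z]) (auto simp: field_simps)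
        moreover have "x = shrink ?p r (?p + (s / r) *\<^sub>R (z - ?p))" using r sz by (simp add: shrink_def)
        ultimately show False using x by blast
      qed
      have "bary T S z = 0" using sz(3) mem_facet_iff[OF T S] by (simp add: Z_def)
      then have "bary T S x = 1 - s" using bary_shrink[of T S ?p s z] bary_opp[OF T S S] by (simp add: shrink_def sz(4))
      then have "\<not> 1 - r \<le> bary T S x" using sr by simp
      then have "x \<notin> shrink ?p r ` T" using mem_shrink_simplex_iff[OF T S, of r x] r by simp
      then have "x \<in> ?D" using x CT by blast
      moreover have "\<epsilon> \<le> \<phi> x"
      proof (rule \<delta>(2))
        have "norm (x - z) = (1 - s) * norm (z - ?p)"
        proof -
          have "x - z = (- (1 - s)) *\<^sub>R (z - ?p)" by (simp add: sz(4) algebra_simps)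
          then show ?thesis using sz(2) by simp
        qed
        also have "\<dots> \<le> (1 - r) * D" using D(1)[OF sz(3)] sr sz r by (intro mult_mono) auto
        finally have "dist x z < \<delta>" using r(3) by (simp add: dist_norm)
        moreover have "dist z x0 \<le> \<delta>" using sz(3) by (simp add: Z_def dist_commute)
        ultimately show "dist x x0 < 2 * \<delta>" using dist_triangle[of x x0 z] by linarith
      qed
      ultimately show ?thesis by simp
    qed
    have sC: "shrink ?p r ` C \<subseteq> C"
    proof
      fix x assume "x \<in> shrink ?p r ` C"
      then obtain y where y: "y \<in> C" "x = shrink ?p r y" by blast
      then obtain s z where sz: "0 \<le> s" "s \<le> 1" "z \<in> Z" "y = ?p + s *\<^sub>R (z - ?p)" using Cmem by blast
      have "0 \<le> r * s" "r * s \<le> 1" "x = ?p + (r * s) *\<^sub>R (z - ?p)"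
        using r sz(1,2) by (simp_all add: y(2) sz(4) shrink_def mult_le_one)
      then show "x \<in> C" unfolding Cmem using sz(3) by blast
    qed
    have cCr: "compact (shrink ?p r ` C)" by (intro compact_continuous_image continuous_on_shrink cC)
    have El: "?E \<in> lmeasurable" using cC cCr by (intro fmeasurable.Diff lmeasurable_compact)
    have mE: "measure lebesgue ?E = (1 - r ^ ?d) * measure lebesgue C"
    proof -
      have "measure lebesgue ?E = measure lebesgue C - measure lebesgue (shrink ?p r ` C)"
        by (rule measurable_measure_Diff) (use cC cCr sC lmeasurable_compact in auto)
      then show ?thesis using measure_shrink[OF r(1) Cb, of ?p] by (simp add: algebra_simps del: measure_completion)
    qed
    note sh = shell_integral[OF T S r(1,2) c\<phi>]
    have i\<phi>: "set_integrable lebesgue ?D \<phi>"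
      by (rule set_integrable_subset[OF set_integrable_continuous_compact[OF cT(1) c\<phi>]]) (use sh(3) in auto)
    have i\<epsilon>: "set_integrable lebesgue ?E (\<lambda>x. \<epsilon>)"
      by (rule set_integrable_subset[OF set_integrable_continuous_compact[OF cC]]) (use El in auto)
    have "\<epsilon> * ((1 - r ^ ?d) * measure lebesgue C) = (LINT x:?E|lebesgue. \<epsilon>)"
      using El unfolding mE[symmetric] by (simp only: set_integral_const_lebesgue[OF fmeasurableD])
    also have "\<dots> \<le> (LINT x:?D|lebesgue. \<phi> x)"
      unfolding set_lebesgue_integral_def
      by (rule integral_mono[OF i\<epsilon>[unfolded set_integrable_def] i\<phi>[unfolded set_integrable_def]])
        (use E nonneg in \<open>auto simp: indicator_def\<close>)
    finally have 1: "\<epsilon> * ((1 - r ^ ?d) * measure lebesgue C) \<le> (LINT x:?D|lebesgue. \<phi> x)" .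
    have "r ^ ?d \<le> r ^ 1" using r by (intro power_decreasing) (auto simp: Suc_le_eq)
    then have "(1 - r) * (\<epsilon> * measure lebesgue C) \<le> (1 - r ^ ?d) * (\<epsilon> * measure lebesgue C)"
      using \<epsilon> by (intro mult_right_mono) auto
    then have "(1 - r) * (\<epsilon> * measure lebesgue C) \<le> (LINT x:?D|lebesgue. \<phi> x)" using 1 by (simp add: mult_ac)
    then have "\<epsilon> * measure lebesgue C \<le> (LINT x:?D|lebesgue. \<phi> x) / (1 - r)" using r by (simp add: le_divide_eq mult.commute)
    then show ?thesis unfolding shell_mean_def sh(1) by (rule divide_right_mono) simp
  qed
  have "(\<lambda>n. (1 - shrink_factor n) * D) \<longlonglongrightarrow> (1 - 1) * D" by (intro tendsto_intros shrink_factor)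
  then have "eventually (\<lambda>n. (1 - shrink_factor n) * D < \<delta>) sequentially"
    using \<delta>(1) order_tendstoD(2)[of _ "(1 - 1) * D"] by simp
  then have "eventually (\<lambda>n. \<epsilon> * measure lebesgue C / measure lebesgue T \<le> shell_mean T S \<phi> (shrink_factor n)) sequentially"
    by (rule eventually_mono) (use bnd[OF shrink_factor(1,2)] in auto)
  then have "\<epsilon> * measure lebesgue C / measure lebesgue T \<le> flux T S \<phi> G"
    by (rule tendsto_lowerbound[OF flux_as_limit[OF T S \<phi>]]) simp
  moreover have "\<epsilon> * measure lebesgue C / measure lebesgue T > 0"
    using \<epsilon> Cpos measure_full_simplex_pos[OF T] by simp
  ultimately show ?thesis by linarith
qed

section \<open>Raviart-Thomas fields on an element\<close>

text \<open>The coefficient of the basis field \<open>x - opp T S\<close>, see \<open>rt_decomposition\<close>. Since the outward normal on \<open>S\<close> is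
  a negative multiple of \<open>bary_grad T S\<close>, it is also the normal component on \<open>S\<close> up to a positive factor.\<close>

definition rt_coef :: "(real^'d) set \<Rightarrow> (real^'d) set \<Rightarrow> real^'d \<Rightarrow> real \<Rightarrow> real" where
  "rt_coef T S a b = - ((a + b *\<^sub>R barycenter S) \<bullet> bary_grad T S)"

context
  fixes T :: "(real^'d) set"
  assumes T: "full_simplex T"
begin

lemma normal_component_on_facet:
  assumes S: "S facet_of T" and x: "bary T S x = 0"
  shows "(a + b *\<^sub>R x) \<bullet> bary_grad T S = - rt_coef T S a b"
proof -
  have "bary_grad T S \<bullet> (x - barycenter S) = 0"
    using bary_affine[of T S x "barycenter S"] x bary_barycenter_facet[OF T S S] by simp
  then have "x \<bullet> bary_grad T S = barycenter S \<bullet> bary_grad T S" by (simp add: inner_diff_right inner_commute)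
  then show ?thesis by (simp add: rt_coef_def inner_add_left)
qed

lemma rt_coef_eq:
  assumes S: "S facet_of T"
  shows "rt_coef T S a b = - (bary_grad T S \<bullet> a) + b * bary T S 0"
proof -
  have "bary_grad T S \<bullet> barycenter S = - bary T S 0"
    using bary_affine[of T S "barycenter S" 0] bary_barycenter_facet[OF T S S] by simp
  then show ?thesis unfolding rt_coef_def inner_commute[of _ "bary_grad T S"] by (simp add: inner_add_right)
qed

lemma sum_rt_coef: "(\<Sum>S | S facet_of T. rt_coef T S a b) = b"
proof -
  have "(\<Sum>S | S facet_of T. rt_coef T S a b) = (\<Sum>S | S facet_of T. - (bary_grad T S \<bullet> a) + b * bary T S 0)"
    by (rule sum.cong) (simp_all add: rt_coef_eq)
  also have "\<dots> = - ((\<Sum>S | S facet_of T. bary_grad T S) \<bullet> a) + b * (\<Sum>S | S facet_of T. bary T S 0)"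
    by (simp add: sum.distrib sum_negf inner_sum_left sum_distrib_left sum_subtractf)
  finally show ?thesis by (simp add: sum_bary_grad[OF T] sum_bary[OF T])
qed

lemma rt_decomposition:
  "a + b *\<^sub>R x = (\<Sum>S | S facet_of T. rt_coef T S a b *\<^sub>R (x - opp T S))"
proof -
  have "(\<Sum>S | S facet_of T. rt_coef T S a b *\<^sub>R opp T S)
      = (\<Sum>S | S facet_of T. - ((bary_grad T S \<bullet> a) *\<^sub>R opp T S) + b *\<^sub>R (bary T S 0 *\<^sub>R opp T S))"
    by (rule sum.cong) (simp_all add: rt_coef_eq scaleR_left_distrib scaleR_left_diff_distrib)
  also have "\<dots> = - a"
    unfolding sum.distrib sum_negf scaleR_sum_right[symmetric] sum_bary_grad_opp[OF T] sum_bary_opp[OF T] by simp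
  finally show ?thesis
    by (simp add: scaleR_right_diff_distrib sum_subtractf scaleR_left.sum[symmetric] sum_rt_coef)
qed

lemma integral_rt_flux:
  assumes \<phi>: "C1_gradient \<phi> G"
  shows "(LINT x:T|lebesgue. (a + b *\<^sub>R x) \<bullet> G x) + real CARD('d) * b * (LINT x:T|lebesgue. \<phi> x)
    = measure lebesgue T * (\<Sum>S | S facet_of T. rt_coef T S a b * flux T S \<phi> G)"
proof -
  have c: "continuous_on UNIV \<phi>" "continuous_on UNIV G" using \<phi> C1_gradient_continuous by (auto simp: C1_gradient_def)
  have i: "set_integrable lebesgue T f" if "continuous_on UNIV f" for f :: "real^'d \<Rightarrow> real"
    using set_integrable_continuous_compact[OF compact_full_simplex(1)[OF T] that] .
  have "(LINT x:T|lebesgue. (a + b *\<^sub>R x) \<bullet> G x) + real CARD('d) * b * (LINT x:T|lebesgue. \<phi> x)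
    = (LINT x:T|lebesgue. (a + b *\<^sub>R x) \<bullet> G x + real CARD('d) * b * \<phi> x)"
    by (subst set_integral_add) (auto intro!: i continuous_intros c)
  also have "\<dots> = (LINT x:T|lebesgue. (\<Sum>S | S facet_of T. rt_coef T S a b * (G x \<bullet> (x - opp T S) + real CARD('d) * \<phi> x)))"
  proof (rule arg_cong[where f="set_lebesgue_integral lebesgue T"], rule ext)
    fix x
    have "(\<Sum>S | S facet_of T. rt_coef T S a b * (G x \<bullet> (x - opp T S) + real CARD('d) * \<phi> x))
      = (\<Sum>S | S facet_of T. rt_coef T S a b *\<^sub>R (x - opp T S)) \<bullet> G x + real CARD('d) * (\<Sum>S | S facet_of T. rt_coef T S a b) * \<phi> x"
      unfolding distrib_left sum.distrib inner_sum_left inner_scaleR_left sum_distrib_left sum_distrib_right inner_commute[of "G x"]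
      by (intro arg_cong2[where f="(+)"] sum.cong) auto
    then show "(a + b *\<^sub>R x) \<bullet> G x + real CARD('d) * b * \<phi> x
        = (\<Sum>S | S facet_of T. rt_coef T S a b * (G x \<bullet> (x - opp T S) + real CARD('d) * \<phi> x))"
      using rt_decomposition[of a b x] sum_rt_coef[of a b] by simp
  qed
  also have "\<dots> = (\<Sum>S | S facet_of T. rt_coef T S a b * (LINT x:T|lebesgue. G x \<bullet> (x - opp T S) + real CARD('d) * \<phi> x))"
    by (subst set_integral_sum) (auto intro!: i continuous_intros c)
  also have "\<dots> = (\<Sum>S | S facet_of T. rt_coef T S a b * (measure lebesgue T * flux T S \<phi> G))"
    by (rule sum.cong) (use measure_full_simplex_pos[OF T] in \<open>auto simp: flux_def\<close>)
  finally show ?thesis by (simp add: sum_distrib_left mult_ac)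
qed

text \<open>Integration by parts for a lowest order Raviart-Thomas field and an affine function, with
  midpoint quadrature, which is exact for both sides.\<close>

lemma discrete_integration_by_parts:
  "(a + b *\<^sub>R barycenter T) \<bullet> g + real CARD('d) * b * (g \<bullet> barycenter T + \<beta>)
    = real CARD('d) * (\<Sum>S | S facet_of T. rt_coef T S a b * (g \<bullet> barycenter S + \<beta>))"
proof -
  let ?F = "{S. S facet_of T}" and ?m = "barycenter T"
  have "real CARD('d) * (g \<bullet> barycenter S + \<beta>) = (?m - opp T S) \<bullet> g + real CARD('d) * (g \<bullet> ?m + \<beta>)" if S: "S facet_of T" for S
  proof -
    have "(real CARD('d) + 1) * (g \<bullet> ?m + \<beta>) = (g \<bullet> opp T S + \<beta>) + (\<Sum>R\<in>?F - {S}. g \<bullet> opp T R + \<beta>)"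
      using affine_barycenter_simplex[OF T, of g \<beta>] S finite_facets[OF T] by (simp add: sum.remove[of _ S])
    then show ?thesis using affine_barycenter_facet[OF T S, of g \<beta>] by (simp add: inner_diff_left inner_commute algebra_simps)
  qed
  then have "real CARD('d) * (\<Sum>S\<in>?F. rt_coef T S a b * (g \<bullet> barycenter S + \<beta>))
      = (\<Sum>S\<in>?F. rt_coef T S a b * ((?m - opp T S) \<bullet> g + real CARD('d) * (g \<bullet> ?m + \<beta>)))"
    unfolding sum_distrib_left by (intro sum.cong) (auto simp: mult.left_commute)
  also have "\<dots> = (\<Sum>S\<in>?F. rt_coef T S a b *\<^sub>R (?m - opp T S)) \<bullet> g + real CARD('d) * (\<Sum>S\<in>?F. rt_coef T S a b) * (g \<bullet> ?m + \<beta>)"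
    by (simp add: inner_sum_left sum_distrib_left sum_distrib_right sum.distrib[symmetric] algebra_simps)
  also have "\<dots> = (a + b *\<^sub>R ?m) \<bullet> g + real CARD('d) * b * (g \<bullet> ?m + \<beta>)"
    using rt_decomposition[of a b ?m] sum_rt_coef[of a b] by simp
  finally show ?thesis ..
qed

end

section \<open>Adjacency in a simplicial mesh\<close>

text \<open>Arbitrarily close to a boundary point there are open sets of points below the graph, and these do
  not meet the closure of the domain.\<close>

lemma lipschitz_boundary_interior_closure:
  fixes \<Omega> :: "'a::euclidean_space set"
  assumes "open \<Omega>" and lip: "lipschitz_boundary \<Omega>"
  shows "interior (closure \<Omega>) = \<Omega>"
proof
  show "\<Omega> \<subseteq> interior (closure \<Omega>)" using assms(1) by (simp add: closure_subset interior_maximal)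
  show "interior (closure \<Omega>) \<subseteq> \<Omega>"
  proof (rule ccontr)
    assume "\<not> interior (closure \<Omega>) \<subseteq> \<Omega>"
    then obtain x where x: "x \<in> interior (closure \<Omega>)" "x \<notin> \<Omega>" by auto
    then have "x \<in> frontier \<Omega>" using assms(1) interior_subset by (auto simp: frontier_def interior_open)
    then obtain e U L g where e: "norm e = 1" and U: "open U" "x \<in> U" and g: "L-lipschitz_on UNIV (g :: 'a \<Rightarrow> real)"
      and ep: "\<Omega> \<inter> U = {y \<in> U. g (y - (y \<bullet> e) *\<^sub>R e) < y \<bullet> e}"
      using lip unfolding lipschitz_boundary_def by blast
    have ee: "e \<bullet> e = 1" using e by (simp add: dot_square_norm)
    have gx: "x \<bullet> e \<le> g (x - (x \<bullet> e) *\<^sub>R e)" using ep x(2) U(2) by force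
    define h where "h y = g (y - (y \<bullet> e) *\<^sub>R e) - y \<bullet> e" for y
    have cg: "continuous_on UNIV g" using g by (rule lipschitz_on_continuous_on)
    have ch: "continuous_on UNIV h" unfolding h_def
      by (intro continuous_on_diff continuous_on_compose2[OF cg] continuous_intros) auto
    have "open (interior (closure \<Omega>) \<inter> U)" by (intro open_Int open_interior U)
    then obtain d where d: "d > 0" "ball x d \<subseteq> interior (closure \<Omega>) \<inter> U"
      using x U open_contains_ball by (metis IntI)
    define y where "y = x - (d/2) *\<^sub>R e"
    have y: "y \<in> ball x d" using d e by (simp add: y_def dist_norm)
    have "y - (y \<bullet> e) *\<^sub>R e = x - (x \<bullet> e) *\<^sub>R e" by (simp add: y_def inner_diff_left ee algebra_simps)
    then have hy: "h y > 0" using gx d by (simp add: h_def) (simp add: y_def inner_diff_left ee)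
    define W where "W = {z. 0 < h z} \<inter> U"
    have "open W" unfolding W_def using ch U by (intro open_Int open_Collect_less continuous_on_const)
    moreover have "y \<in> W" using hy y d by (auto simp: W_def)
    moreover have "y \<in> closure \<Omega>" using y d interior_subset by blast
    ultimately have "W \<inter> \<Omega> \<noteq> {}" by (metis Int_commute open_Int_closure_eq_empty emptyE IntI)
    then obtain z where z: "z \<in> \<Omega>" "z \<in> U" "0 < h z" by (auto simp: W_def)
    then have "z \<in> {y \<in> U. g (y - (y \<bullet> e) *\<^sub>R e) < y \<bullet> e}" using ep by blast
    then show False using z(3) by (simp add: h_def)
  qed
qed

text \<open>A small displacement in the direction \<open>\<nu> - \<nu>'\<close> leaves one half ball and enters the other.\<close>

lemma half_ball_normal_unique:
  fixes \<nu> \<nu>' x :: "'a::euclidean_space"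
  assumes n: "norm \<nu> = 1" "norm \<nu>' = 1"
    and e: "e > 0" "\<Omega> \<inter> ball x e = {y \<in> ball x e. (y - x) \<bullet> \<nu> < 0}"
    and e': "e' > 0" "\<Omega> \<inter> ball x e' = {y \<in> ball x e'. (y - x) \<bullet> \<nu>' < 0}"
  shows "\<nu>' = \<nu>"
proof (rule ccontr)
  assume ne: "\<nu>' \<noteq> \<nu>"
  have n1: "\<nu> \<bullet> \<nu> = 1" "\<nu>' \<bullet> \<nu>' = 1" using n by (simp_all add: dot_square_norm)
  have "0 < (\<nu> - \<nu>') \<bullet> (\<nu> - \<nu>')" using ne by simp
  then have c: "\<nu> \<bullet> \<nu>' < 1" by (simp add: inner_diff_left inner_diff_right n1 inner_commute)
  define u where "u = \<nu> - \<nu>'"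
  have u: "u \<bullet> \<nu> > 0" "u \<bullet> \<nu>' < 0" using c unfolding u_def inner_diff_left inner_commute[of \<nu>' \<nu>] n1 by simp_all
  have nu: "norm u > 0" using ne by (simp add: u_def)
  define t where "t = min e e' / (2 * norm u)"
  have t: "t > 0" "t * norm u < e" "t * norm u < e'" using e e' nu by (auto simp: t_def)
  define y where "y = x + t *\<^sub>R u"
  have "y \<in> ball x e" "y \<in> ball x e'" using t by (auto simp: y_def dist_norm)
  moreover have "(y - x) \<bullet> \<nu> > 0" "(y - x) \<bullet> \<nu>' < 0" using u t by (auto simp: y_def mult_pos_neg)
  ultimately show False using e(2) e'(2) by (metis (mono_tags, lifting) IntD1 IntI less_asym mem_Collect_eq)
qed

text \<open>Regularity of the domain excludes slits: a facet between two elements lies inside the domain.\<close>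

locale mesh =
  fixes \<T> :: "(real^'d) set set" and \<Omega> :: "(real^'d) set"
  assumes simplicial: "simplicial_mesh \<T> \<Omega>"
    and open_domain: "open \<Omega>"
    and regular_domain: "interior (closure \<Omega>) = \<Omega>"
begin

lemma finite_mesh: "finite \<T>"
  using simplicial by (auto simp: simplicial_mesh_def triangulation_def)

lemma full: "T \<in> \<T> \<Longrightarrow> full_simplex T"
  using simplicial by (auto simp: simplicial_mesh_def)

lemma union_eq: "\<Union>\<T> = closure \<Omega>"
  using simplicial by (auto simp: simplicial_mesh_def)

lemma Int_face_of: "T \<in> \<T> \<Longrightarrow> T' \<in> \<T> \<Longrightarrow> T \<inter> T' face_of T"
  using simplicial by (auto simp: simplicial_mesh_def triangulation_def)

lemma interior_subset_domain: "T \<in> \<T> \<Longrightarrow> interior T \<subseteq> \<Omega>"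
  using union_eq regular_domain by (metis Union_upper interior_mono)

text \<open>A face of \<open>T\<close> that contains an interior point of \<open>T\<close> is all of \<open>T\<close>, so \<open>T\<close> would be a face of \<open>T'\<close> of the same
  dimension.\<close>

lemma interior_point_unique:
  assumes T: "T \<in> \<T>" "T' \<in> \<T>" and x: "x \<in> interior T" "x \<in> T'"
  shows "T = T'"
proof -
  have xT: "x \<in> T" using x interior_subset by auto
  have conv: "convex T" "convex T'" using compact_full_simplex[OF full] T by auto
  have "interior T \<subseteq> rel_interior T" by (rule interior_subset_rel_interior)
  then have "T \<subseteq> T \<inter> T'"
    using subset_of_face_of[OF Int_face_of[OF T] subset_refl] x xT by blast
  then have "T \<inter> T' = T" by auto
  then have "T face_of T'" using Int_face_of[OF T(2,1)] by (simp add: Int_commute)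
  moreover have "aff_dim T = aff_dim T'" using aff_dim_simplex full T by metis
  ultimately show ?thesis using face_of_aff_dim_lt[OF conv(2), of T] by auto
qed

lemma facet_adjacent:
  assumes S: "S facet_of T0" "T0 \<in> \<T>" and T: "T \<in> \<T>" and x: "x \<in> rel_interior S" "x \<in> T"
  shows "S facet_of T"
proof -
  have S0: "S face_of T0" using S by (simp add: facet_of_def)
  have conv: "convex T" "convex T0" using compact_full_simplex[OF full] T S by auto
  have ST0: "S \<subseteq> T0" using S0 face_of_imp_subset by auto
  have "x \<in> T0 \<inter> T" using x ST0 rel_interior_subset by auto
  then have "S \<subseteq> T0 \<inter> T"
    using subset_of_face_of[OF Int_face_of[OF S(2) T] ST0] x by auto
  then have "S face_of T0 \<inter> T" using face_of_subset[OF S0] by auto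
  moreover have "T0 \<inter> T face_of T" using Int_face_of[OF T S(2)] by (simp add: Int_commute)
  ultimately have "S face_of T" by (rule face_of_trans)
  moreover have "aff_dim T = aff_dim T0" using aff_dim_simplex full T S by metis
  ultimately show ?thesis using S by (simp add: facet_of_def)
qed

lemma facet_point_unique:
  assumes S: "S facet_of T" "T \<in> \<T>" and S': "S' facet_of T'" "T' \<in> \<T>" and x: "x \<in> rel_interior S" "x \<in> S'"
  shows "S = S'"
proof -
  have "x \<in> T'" using S' x facet_of_imp_subset by blast
  then have ST': "S facet_of T'" using facet_adjacent[OF S S'(2) x(1)] by simp
  have "S \<subseteq> S'"
    using subset_of_face_of[OF facet_of_imp_face_of[OF S'(1)] facet_of_imp_subset[OF ST']] x by auto
  then have "S face_of S'" using face_of_subset[OF facet_of_imp_face_of[OF ST']] facet_of_imp_subset[OF S'(1)] by simp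
  moreover have "aff_dim S = aff_dim S'" using S' ST' by (simp add: facet_of_def)
  moreover have "convex S'" using compact_facet(2)[OF full[OF S'(2)] S'(1)] .
  ultimately show ?thesis using face_of_aff_dim_lt[of S' S] by fastforce
qed

text \<open>Near a relative interior point of a facet the mesh looks like the half spaces of the elements
  adjacent to this facet.\<close>

lemma facet_neighbourhood:
  assumes S: "S facet_of T0" "T0 \<in> \<T>" and x: "x \<in> rel_interior S"
  obtains e where "e > 0"
    "\<And>T y. T \<in> \<T> \<Longrightarrow> y \<in> ball x e \<Longrightarrow> y \<in> T \<Longrightarrow> S facet_of T"
    "\<And>T y. T \<in> \<T> \<Longrightarrow> S facet_of T \<Longrightarrow> y \<in> ball x e \<Longrightarrow> y \<in> T \<longleftrightarrow> 0 \<le> bary T S y"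
    "\<And>T y. T \<in> \<T> \<Longrightarrow> S facet_of T \<Longrightarrow> y \<in> ball x e \<Longrightarrow> y \<in> interior T \<longleftrightarrow> 0 < bary T S y"
    "\<And>T y R. T \<in> \<T> \<Longrightarrow> y \<in> ball x e \<Longrightarrow> R facet_of T \<Longrightarrow> y \<in> R \<Longrightarrow> R = S"
proof -
  define W1 where "W1 = (\<Inter>T\<in>{T\<in>\<T>. x \<notin> T}. - T)"
  define W2 where "W2 = (\<Inter>T\<in>{T\<in>\<T>. S facet_of T}. \<Inter>R\<in>{R. R facet_of T} - {S}. {y. 0 < bary T R y})"
  have "open W1" unfolding W1_def using finite_mesh
    by (intro open_INT ballI open_Compl compact_imp_closed compact_full_simplex(1) full) auto
  moreover have "open W2" unfolding W2_def using finite_mesh finite_facets[OF full]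
    by (intro open_INT ballI open_Collect_less continuous_on_bary continuous_on_const) auto
  ultimately have op: "open (W1 \<inter> W2)" by auto
  have "x \<in> W1 \<inter> W2"
    unfolding W1_def W2_def using x rel_interior_facet_iff[OF full] by auto
  then obtain e where e: "e > 0" "ball x e \<subseteq> W1 \<inter> W2" using op open_contains_ball by blast
  have 1: "S facet_of T" if "T \<in> \<T>" "y \<in> ball x e" "y \<in> T" for T y
  proof -
    have "x \<in> T" using e(2) that unfolding W1_def by blast
    then show ?thesis using facet_adjacent[OF S that(1) x] by simp
  qed
  have pos: "0 < bary T R y" if "T \<in> \<T>" "S facet_of T" "y \<in> ball x e" "R facet_of T" "R \<noteq> S" for T y R
    using e(2) that unfolding W2_def by blast
  show ?thesis
  proof (rule that[OF e(1) 1])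
    fix T y assume A: "T \<in> \<T>" "S facet_of T" "y \<in> ball x e"
    show "y \<in> T \<longleftrightarrow> 0 \<le> bary T S y" unfolding mem_simplex_iff[OF full[OF A(1)]]
      using pos[OF A] A(2) by (metis less_imp_le)
    show "y \<in> interior T \<longleftrightarrow> 0 < bary T S y" unfolding interior_simplex_iff[OF full[OF A(1)]]
      using pos[OF A] A(2) by metis
  next
    fix T y R assume A: "T \<in> \<T>" "y \<in> ball x e" "R facet_of T" "y \<in> R"
    have "y \<in> T" using A facet_of_imp_subset by blast
    then have ST: "S facet_of T" using 1 A by blast
    show "R = S"
    proof (rule ccontr)
      assume "R \<noteq> S"
      then have "0 < bary T R y" using pos[OF A(1) ST A(2,3)] by simp
      then show False using mem_facet_iff[OF full[OF A(1)] A(3)] A(4) by simp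
    qed
  qed auto
qed

text \<open>Moving along the gradient of the coordinate that vanishes on a facet leads to its interior
  side, moving against it leads to the other side.\<close>

lemma both_sides:
  assumes S: "S facet_of T" "T \<in> \<T>" and x: "x \<in> rel_interior S" and e: "e > 0"
  obtains y z where "y \<in> ball x e" "0 < bary T S y" "z \<in> ball x e" "bary T S z < 0"
proof -
  let ?g = "bary_grad T S"
  have g: "norm ?g > 0" using bary_grad_nonzero[OF full[OF S(2)] S(1)] by simp
  have b0: "bary T S x = 0" using x rel_interior_facet_iff[OF full[OF S(2)] S(1)] by simp
  define t where "t = e / (2 * norm ?g)"
  have t: "t > 0" "t * norm ?g < e" using e g by (auto simp: t_def)
  have "bary T S (x + s *\<^sub>R ?g) = s * (?g \<bullet> ?g)" for s
    using bary_affine[of T S "x + s *\<^sub>R ?g" x] b0 by simp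
  moreover have "0 < t * (?g \<bullet> ?g)" "- t * (?g \<bullet> ?g) < 0" using g t by auto
  ultimately have "0 < bary T S (x + t *\<^sub>R ?g)" "bary T S (x + (- t) *\<^sub>R ?g) < 0" by (simp_all only:)
  moreover have "x + t *\<^sub>R ?g \<in> ball x e" "x + (- t) *\<^sub>R ?g \<in> ball x e" using t by (auto simp: dist_norm)
  ultimately show ?thesis using that by blast
qed

lemma opposite_sides:
  assumes T: "T \<in> \<T>" "S facet_of T" and T': "T' \<in> \<T>" "S facet_of T'" and ne: "T \<noteq> T'"
  shows "bary T' S (opp T S) < 0"
proof -
  define x where "x = barycenter S"
  have x: "x \<in> rel_interior S" unfolding x_def by (rule barycenter_in_rel_interior[OF full[OF T(1)] T(2)])
  obtain e where e: "e > 0" and i: "\<And>T y. T \<in> \<T> \<Longrightarrow> S facet_of T \<Longrightarrow> y \<in> ball x e \<Longrightarrow> y \<in> interior T \<longleftrightarrow> 0 < bary T S y"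
    by (rule facet_neighbourhood[OF T(2,1) x]) blast
  obtain y where y: "y \<in> ball x e" "0 < bary T S y" using both_sides[OF T(2,1) x e] by blast
  have "\<not> 0 < bary T' S (opp T S)"
  proof
    assume "0 < bary T' S (opp T S)"
    then have "0 < bary T' S y"
      using bary_other_simplex[OF full[OF T(1)] T(2) full[OF T'(1)] T'(2), of y] y by simp
    then have "y \<in> interior T" "y \<in> interior T'" using i y T T' by auto
    then show False using interior_point_unique[OF T(1) T'(1)] ne interior_subset by blast
  qed
  moreover have "bary T' S (opp T S) \<noteq> 0"
    by (rule bary_opp_other_nonzero[OF full[OF T(1)] T(2) full[OF T'(1)] T'(2)])
  ultimately show ?thesis by linarith
qed

text \<open>The hyperplane of \<open>S\<close> has only two sides, and distinct elements with facet \<open>S\<close> lie on opposite ones.\<close>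

lemma at_most_two:
  assumes "T1 \<in> \<T>" "S facet_of T1" "T2 \<in> \<T>" "S facet_of T2" "T3 \<in> \<T>" "S facet_of T3"
    and "T1 \<noteq> T2" "T1 \<noteq> T3"
  shows "T2 = T3"
proof (rule ccontr)
  assume ne: "T2 \<noteq> T3"
  have "bary T2 S (opp T1 S) < 0" "bary T3 S (opp T1 S) < 0" "bary T3 S (opp T2 S) < 0"
    using opposite_sides assms ne by auto
  moreover have "bary T3 S (opp T1 S) = bary T3 S (opp T2 S) * bary T2 S (opp T1 S)"
    by (rule bary_other_simplex) (use assms full in auto)
  ultimately show False by (metis mult_neg_neg not_less_iff_gr_or_eq)
qed

text \<open>The two adjacent elements fill a ball around the point.\<close>

lemma interior_facetI:
  assumes T: "T \<in> \<T>" "S facet_of T" and T': "T' \<in> \<T>" "S facet_of T'" and ne: "T \<noteq> T'" and x: "x \<in> rel_interior S"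
  shows "x \<in> \<Omega>"
proof -
  obtain e where e: "e > 0" and i: "\<And>T y. T \<in> \<T> \<Longrightarrow> S facet_of T \<Longrightarrow> y \<in> ball x e \<Longrightarrow> y \<in> T \<longleftrightarrow> 0 \<le> bary T S y"
    by (rule facet_neighbourhood[OF T(2,1) x]) blast
  have "ball x e \<subseteq> closure \<Omega>"
  proof
    fix y assume y: "y \<in> ball x e"
    have "y \<in> T \<or> y \<in> T'"
    proof (cases "0 \<le> bary T S y")
      case False
      have "bary T' S y = bary T' S (opp T S) * bary T S y"
        by (rule bary_other_simplex[OF full[OF T(1)] T(2) full[OF T'(1)] T'(2)])
      then have "0 \<le> bary T' S y" using opposite_sides[OF T T' ne] False by (simp add: mult_nonpos_nonpos)
      then show ?thesis using i[OF T' y] by simp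
    qed (use i[OF T y] in simp)
    then show "y \<in> closure \<Omega>" using union_eq T T' by blast
  qed
  then have "x \<in> interior (closure \<Omega>)" using e by (auto simp: mem_interior)
  then show ?thesis by (simp add: regular_domain)
qed

text \<open>If a relative interior point of \<open>S\<close> were in the domain, a second element would have to cover the points
  beyond \<open>S\<close>.\<close>

lemma boundary_facetI:
  assumes T: "T \<in> \<T>" "S facet_of T" and uniq: "\<And>T'. T' \<in> \<T> \<Longrightarrow> S facet_of T' \<Longrightarrow> T' = T"
  shows "S \<subseteq> frontier \<Omega>"
proof -
  have "x \<notin> \<Omega>" if x: "x \<in> rel_interior S" for x
  proof
    assume "x \<in> \<Omega>"
    then obtain d where d: "d > 0" "ball x d \<subseteq> \<Omega>" using open_domain open_contains_ball by blast
    obtain e where e: "e > 0" and a: "\<And>T y. T \<in> \<T> \<Longrightarrow> y \<in> ball x e \<Longrightarrow> y \<in> T \<Longrightarrow> S facet_of T"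
      and i: "\<And>T y. T \<in> \<T> \<Longrightarrow> S facet_of T \<Longrightarrow> y \<in> ball x e \<Longrightarrow> y \<in> T \<longleftrightarrow> 0 \<le> bary T S y"
      by (rule facet_neighbourhood[OF T(2,1) x]) blast
    obtain z where z: "z \<in> ball x (min d e)" "bary T S z < 0"
      using both_sides[OF T(2,1) x, of "min d e"] d e by (metis min_less_iff_conj)
    then have "z \<in> \<Omega>" using d by auto
    then have "z \<in> closure \<Omega>" by (rule subsetD[OF closure_subset])
    then obtain T' where T': "T' \<in> \<T>" "z \<in> T'" using union_eq by blast
    then have "S facet_of T'" using a[of T' z] z by simp
    then have "T' = T" using uniq T' by blast
    then show False using i[OF T, of z] z T' by simp
  qed
  then have "rel_interior S \<subseteq> - \<Omega>" by auto
  then have "closure (rel_interior S) \<subseteq> - \<Omega>" using open_domain by (intro closure_minimal) auto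
  moreover have "S \<subseteq> closure (rel_interior S)"
    using convex_closure_rel_interior[OF compact_facet(2)[OF full[OF T(1)] T(2)]] closure_subset by auto
  moreover have "S \<subseteq> closure \<Omega>" using T facet_of_imp_subset union_eq by blast
  ultimately show ?thesis using open_domain by (auto simp: frontier_def interior_open)
qed

lemma boundary_facet_unique:
  assumes S: "S \<in> boundary_facets \<T> \<Omega>"
  obtains T where "T \<in> \<T>" "S facet_of T" "{T' \<in> \<T>. S facet_of T'} = {T}"
proof -
  obtain T where T: "T \<in> \<T>" "S facet_of T" using S by (auto simp: boundary_facets_def facets_def)
  have "T' = T" if "T' \<in> \<T>" "S facet_of T'" for T'
  proof (rule ccontr)
    assume "T' \<noteq> T"
    moreover have b: "barycenter S \<in> rel_interior S" by (rule barycenter_in_rel_interior[OF full[OF T(1)] T(2)])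
    ultimately have "barycenter S \<in> \<Omega>" using interior_facetI[OF that T] by blast
    moreover have "barycenter S \<in> frontier \<Omega>" using S b rel_interior_subset by (auto simp: boundary_facets_def)
    ultimately show False using open_domain by (auto simp: frontier_def interior_open)
  qed
  then show ?thesis using T that by blast
qed

lemma interior_facet_two:
  assumes S: "S \<in> facets \<T> - boundary_facets \<T> \<Omega>"
  obtains T T' where "T \<in> \<T>" "S facet_of T" "T' \<in> \<T>" "S facet_of T'" "T \<noteq> T'"
    "{T \<in> \<T>. S facet_of T} = {T, T'}"
proof -
  obtain T where T: "T \<in> \<T>" "S facet_of T" using S by (auto simp: facets_def)
  have "\<not> S \<subseteq> frontier \<Omega>" using S by (auto simp: boundary_facets_def)
  then obtain T' where T': "T' \<in> \<T>" "S facet_of T'" "T \<noteq> T'" using boundary_facetI[OF T] by blast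
  then have "{T \<in> \<T>. S facet_of T} = {T, T'}" using at_most_two[OF T T'(1,2) _ _ T'(3)] T by blast
  then show ?thesis using that T T' by blast
qed

lemma finite_facets_mesh: "finite (facets \<T>)"
proof -
  have "facets \<T> = (\<Union>T\<in>\<T>. {S. S facet_of T})" by (auto simp: facets_def)
  then show ?thesis using finite_mesh finite_facets[OF full] by auto
qed

lemma sum_mesh_facets:
  "(\<Sum>T\<in>\<T>. \<Sum>S | S facet_of T. f T S) = (\<Sum>S\<in>facets \<T>. \<Sum>T | T \<in> \<T> \<and> S facet_of T. f T S)"
proof -
  have "(\<Sum>T\<in>\<T>. \<Sum>S | S facet_of T. f T S) = (\<Sum>T\<in>\<T>. \<Sum>S | S \<in> facets \<T> \<and> S facet_of T. f T S)"
    by (intro sum.cong) (auto simp: facets_def)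
  also have "\<dots> = (\<Sum>S\<in>facets \<T>. \<Sum>T | T \<in> \<T> \<and> S facet_of T. f T S)"
    by (rule sum.swap_restrict[OF finite_mesh finite_facets_mesh])
  finally show ?thesis .
qed

section \<open>Facet values and normals\<close>

lemma at_within_nontrivial:
  assumes T: "T \<in> \<T>" "S facet_of T" and x: "x \<in> rel_interior S"
  shows "at x within interior T \<noteq> bot"
proof -
  have "x \<in> T" using x rel_interior_subset facet_of_imp_subset[OF T(2)] by blast
  then have "x \<in> closure (interior T)"
    using convex_closure_interior[OF compact_full_simplex(2,3)[OF full[OF T(1)]]] closure_subset by blast
  moreover have "x \<notin> interior T"
    using x rel_interior_facet_iff[OF full[OF T(1)] T(2)] interior_simplex_iff[OF full[OF T(1)], of x] T(2) by auto
  ultimately show ?thesis by (simp add: at_within_eq_bot_iff)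
qed

lemma tendsto_facet_value:
  assumes S: "S facet_of T0" "T0 \<in> \<T>" and x: "x \<in> rel_interior S"
    and f: "\<And>T. T \<in> \<T> \<Longrightarrow> S facet_of T \<Longrightarrow> isCont (f T) x \<and> f T x = l \<and> (\<forall>y\<in>interior T. q y = f T y)"
  shows "(q \<longlongrightarrow> l) (at x within element_interiors \<T>)"
proof -
  let ?A = "{T \<in> \<T>. S facet_of T}"
  obtain e where e: "e > 0" and a: "\<And>T y. T \<in> \<T> \<Longrightarrow> y \<in> ball x e \<Longrightarrow> y \<in> T \<Longrightarrow> S facet_of T"
    by (rule facet_neighbourhood[OF S x]) blast
  have lim: "(q \<longlongrightarrow> l) (at x within interior T)" if "T \<in> ?A" for T
  proof -
    have "(f T \<longlongrightarrow> l) (at x within interior T)"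
      using f that by (metis (mono_tags, lifting) continuous_within isCont_def mem_Collect_eq tendsto_within_subset top_greatest)
    then show ?thesis
      by (rule Lim_transform_within[OF _ zero_less_one]) (use f that in auto)
  qed
  have "at x within (element_interiors \<T>) = at x within (\<Union>T\<in>?A. interior T)"
  proof (rule at_within_nhd)
    show "x \<in> ball x e" using e by simp
    show "element_interiors \<T> \<inter> ball x e - {x} = (\<Union>T\<in>?A. interior T) \<inter> ball x e - {x}"
      unfolding element_interiors_def using a interior_subset by blast
  qed simp
  moreover have "finite ?A" using finite_mesh by simp
  then have "(q \<longlongrightarrow> l) (at x within (\<Union>T\<in>?A. interior T))"
  proof -
    have "finite B \<Longrightarrow> B \<subseteq> ?A \<Longrightarrow> (q \<longlongrightarrow> l) (at x within (\<Union>T\<in>B. interior T))" for B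
      by (induction rule: finite_induct) (auto simp: lim Lim_within_Un)
    then show ?thesis using \<open>finite ?A\<close> by blast
  qed
  ultimately show ?thesis by simp
qed

lemma tendsto_facet_value_unique:
  fixes q f :: "real^'d \<Rightarrow> 'b::euclidean_space"
  assumes T: "T \<in> \<T>" "S facet_of T" and x: "x \<in> rel_interior S"
    and l: "(q \<longlongrightarrow> l) (at x within element_interiors \<T>)"
    and f: "isCont f x" "\<And>y. y \<in> interior T \<Longrightarrow> q y = f y"
  shows "l = f x"
proof -
  have 1: "(q \<longlongrightarrow> l) (at x within interior T)"
    by (rule tendsto_within_subset[OF l]) (use T in \<open>auto simp: element_interiors_def\<close>)
  have "(f \<longlongrightarrow> f x) (at x within interior T)" using f(1) by (meson isCont_def tendsto_within_subset top_greatest)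
  then have 2: "(q \<longlongrightarrow> f x) (at x within interior T)"
    by (rule Lim_transform_within[OF _ zero_less_one]) (use f(2) in auto)
  show ?thesis by (rule tendsto_unique[OF at_within_nontrivial[OF T x] 1 2])
qed

lemma facet_value_eq:
  assumes S: "S facet_of T0" "T0 \<in> \<T>" and x: "x \<in> rel_interior S"
    and f: "\<And>T. T \<in> \<T> \<Longrightarrow> S facet_of T \<Longrightarrow> isCont (f T) x \<and> f T x = l \<and> (\<forall>y\<in>interior T. q y = f T y)"
  shows "facet_value \<T> q x = l"
  unfolding facet_value_def
proof (rule tendsto_Lim[OF _ tendsto_facet_value[OF S x f]])
  have "interior T0 \<subseteq> element_interiors \<T>" using S(2) by (auto simp: element_interiors_def)
  then have "at x within interior T0 \<le> at x within element_interiors \<T>" by (rule at_le)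
  then show "at x within element_interiors \<T> \<noteq> bot"
    using at_within_nontrivial[OF S(2,1) x] by (metis bot_unique)
qed

lemma facet_value_boundary:
  assumes S: "{T' \<in> \<T>. S facet_of T'} = {T}" and x: "x \<in> rel_interior S"
    and f: "isCont f x" "\<And>y. y \<in> interior T \<Longrightarrow> q y = f y"
  shows "facet_value \<T> q x = f x"
proof (rule facet_value_eq[OF _ _ x, where f="\<lambda>_. f"])
  show "S facet_of T" "T \<in> \<T>" using S by auto
  show "isCont f x \<and> f x = f x \<and> (\<forall>y\<in>interior T'. q y = f y)" if "T' \<in> \<T>" "S facet_of T'" for T'
  proof -
    have "T' = T" using that S by blast
    then show ?thesis using f by simp
  qed
qed

lemma outward_normal_facet:
  assumes S: "S \<in> boundary_facets \<T> \<Omega>" and T: "T \<in> \<T>" "S facet_of T" and x: "x \<in> rel_interior S"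
  shows "outward_normal \<Omega> x = - (bary_grad T S /\<^sub>R norm (bary_grad T S))"
proof -
  let ?g = "bary_grad T S"
  define \<nu> where "\<nu> = - (?g /\<^sub>R norm ?g)"
  have g: "norm ?g > 0" using bary_grad_nonzero[OF full[OF T(1)] T(2)] by simp
  have n: "norm \<nu> = 1" using g by (simp add: \<nu>_def)
  obtain T0 where "{T' \<in> \<T>. S facet_of T'} = {T0}" by (rule boundary_facet_unique[OF S])
  then have only: "T' = T" if "T' \<in> \<T>" "S facet_of T'" for T' using that T by auto
  have b0: "bary T S x = 0" using x rel_interior_facet_iff[OF full[OF T(1)] T(2)] by simp
  obtain e where e: "e > 0" and a: "\<And>T y. T \<in> \<T> \<Longrightarrow> y \<in> ball x e \<Longrightarrow> y \<in> T \<Longrightarrow> S facet_of T"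
    and m: "\<And>T y. T \<in> \<T> \<Longrightarrow> S facet_of T \<Longrightarrow> y \<in> ball x e \<Longrightarrow> y \<in> T \<longleftrightarrow> 0 \<le> bary T S y"
    and i: "\<And>T y. T \<in> \<T> \<Longrightarrow> S facet_of T \<Longrightarrow> y \<in> ball x e \<Longrightarrow> y \<in> interior T \<longleftrightarrow> 0 < bary T S y"
    by (rule facet_neighbourhood[OF T(2,1) x]) blast
  have half: "\<Omega> \<inter> ball x e = {y \<in> ball x e. (y - x) \<bullet> \<nu> < 0}"
  proof -
    have sgn: "(y - x) \<bullet> \<nu> < 0 \<longleftrightarrow> 0 < bary T S y" for y
      using bary_affine[of T S y x] b0 g by (simp add: \<nu>_def inner_commute divide_inverse[symmetric] zero_less_mult_iff)
    have "y \<in> \<Omega> \<longleftrightarrow> 0 < bary T S y" if y: "y \<in> ball x e" for y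
    proof
      assume y\<Omega>: "y \<in> \<Omega>"
      then obtain T' where "T' \<in> \<T>" "y \<in> T'" using union_eq closure_subset by blast
      then have yT: "y \<in> T" using a[OF _ y] only by blast
      then have "0 \<le> bary T S y" using m[OF T y] by simp
      moreover have "bary T S y \<noteq> 0"
      proof
        assume "bary T S y = 0"
        then have "y \<in> S" using mem_facet_iff[OF full[OF T(1)] T(2)] yT by simp
        then have "y \<in> frontier \<Omega>" using S by (auto simp: boundary_facets_def)
        then show False using y\<Omega> open_domain by (auto simp: frontier_def interior_open)
      qed
      ultimately show "0 < bary T S y" by simp
    next
      assume "0 < bary T S y"
      then show "y \<in> \<Omega>" using i[OF T y] interior_subset_domain[OF T(1)] by blast
    qed
    then show ?thesis using sgn by blast
  qed
  show ?thesis unfolding outward_normal_def \<nu>_def[symmetric]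
  proof (rule the_equality)
    show "norm \<nu> = 1 \<and> (\<exists>\<epsilon>>0. \<Omega> \<inter> ball x \<epsilon> = {y \<in> ball x \<epsilon>. (y - x) \<bullet> \<nu> < 0})" using n e half by blast
    show "\<nu>' = \<nu>" if "norm \<nu>' = 1 \<and> (\<exists>\<epsilon>>0. \<Omega> \<inter> ball x \<epsilon> = {y \<in> ball x \<epsilon>. (y - x) \<bullet> \<nu>' < 0})" for \<nu>'
      using that half_ball_normal_unique[OF n _ e half] by blast
  qed
qed

end

section \<open>Integrals over the domain and over parts of the boundary\<close>

lemma completion_integral_AE_cong:
  fixes f g :: "'a \<Rightarrow> 'b::{banach, second_countable_topology}"
  assumes f: "integrable (completion M) f" and ae: "AE x in completion M. f x = g x"
  shows "integrable (completion M) g" "(\<integral>x. g x \<partial>completion M) = (\<integral>x. f x \<partial>completion M)"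
proof -
  have fm: "f \<in> borel_measurable (completion M)" using f by simp
  have gm: "g \<in> borel_measurable (completion M)"
  proof (rule measurableI)
    fix A :: "'b set" assume A: "A \<in> sets borel"
    show "g -` A \<inter> space (completion M) \<in> sets (completion M)"
    proof (rule completion.in_sets_AE)
      show "f -` A \<inter> space (completion M) \<in> sets (completion M)" by (rule measurable_sets[OF fm A])
      show "AE x in completion M. x \<in> f -` A \<inter> space (completion M) \<longleftrightarrow> x \<in> g -` A \<inter> space (completion M)"
        using ae by (rule AE_mp) auto
    qed auto
  qed simp
  show "integrable (completion M) g" using integrable_cong_AE_imp[OF f gm] ae by (auto elim: AE_mp)
  show "(\<integral>x. g x \<partial>completion M) = (\<integral>x. f x \<partial>completion M)"
    by (rule integral_cong_AE[OF gm fm]) (use ae in \<open>auto elim: AE_mp\<close>)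
qed

lemma test_function_facts:
  assumes "test_function U \<phi>"
  shows "C1_gradient \<phi> (grad \<phi>)" "x \<notin> U \<Longrightarrow> \<phi> x = 0"
proof -
  show "C1_gradient \<phi> (grad \<phi>)" using assms smooth_C1_gradient by (auto simp: test_function_def)
  show "\<phi> x = 0" if "x \<notin> U"
  proof (rule ccontr)
    assume "\<phi> x \<noteq> 0"
    then have "x \<in> closure {x. \<phi> x \<noteq> 0}" using subsetD[OF closure_subset, of x "{x. \<phi> x \<noteq> 0}"] by simp
    then show False using assms that by (auto simp: test_function_def)
  qed
qed

lemma test_function_mono: "test_function U \<phi> \<Longrightarrow> U \<subseteq> V \<Longrightarrow> test_function V \<phi>"
  by (auto simp: test_function_def)

lemma integral_bump_pos:
  fixes \<phi> :: "real^'d \<Rightarrow> real"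
  assumes T: "full_simplex T" and c: "continuous_on UNIV \<phi>" and nn: "\<And>x. 0 \<le> \<phi> x" and z: "z \<in> interior T" "0 < \<phi> z"
  shows "0 < (LINT x:T|lebesgue. \<phi> x)"
proof -
  have i: "integrable lebesgue (\<lambda>x. indicator T x *\<^sub>R \<phi> x)"
    using set_integrable_continuous_compact[OF compact_full_simplex(1)[OF T] c] by (simp add: set_integrable_def)
  have nonneg: "0 \<le> (LINT x:T|lebesgue. \<phi> x)"
    unfolding set_lebesgue_integral_def by (rule Bochner_Integration.integral_nonneg) (use nn in \<open>auto simp: indicator_def\<close>)
  moreover have "(LINT x:T|lebesgue. \<phi> x) \<noteq> 0"
  proof
    assume "(LINT x:T|lebesgue. \<phi> x) = 0"
    then have "AE x in lebesgue. indicator T x *\<^sub>R \<phi> x = 0"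
      unfolding set_lebesgue_integral_def
      by (subst (asm) integral_nonneg_eq_0_iff_AE[OF i]) (use nn in \<open>auto simp: indicator_def\<close>)
    then have "{x. \<not> indicator T x *\<^sub>R \<phi> x = 0} \<in> null_sets lebesgue"
      by (simp add: completion.AE_iff_null_sets)
    then have "negligible {x. \<not> indicator T x *\<^sub>R \<phi> x = 0}" by (simp add: negligible_iff_null_sets)
    moreover have "{x. 0 < \<phi> x} \<inter> interior T \<subseteq> {x. \<not> indicator T x *\<^sub>R \<phi> x = 0}"
      using interior_subset by (auto simp: indicator_def)
    ultimately have "negligible ({x. 0 < \<phi> x} \<inter> interior T)" using negligible_subset by blast
    moreover have "open ({x. 0 < \<phi> x} \<inter> interior T)"
      by (intro open_Int open_interior open_Collect_less continuous_on_const c)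
    ultimately show False using open_not_negligible z by blast
  qed
  ultimately show ?thesis by linarith
qed

lemma set_integrable_surface_affine:
  fixes T S :: "(real^'d) set"
  assumes T: "full_simplex T" and S: "S facet_of T"
  shows "set_integrable surface S (\<lambda>x. a \<bullet> x + b)"
proof -
  have "compact ((\<lambda>x. a \<bullet> x + b) ` S)" by (intro compact_continuous_image continuous_intros compact_facet(1)[OF T S])
  then obtain B where B: "\<forall>y\<in>(\<lambda>x. a \<bullet> x + b) ` S. norm y \<le> B" using compact_imp_bounded bounded_iff by blast
  have "(\<lambda>x. a \<bullet> x + b) \<in> borel_measurable (completion hyperplane_sum_measure)"
    by (rule measurable_completion) simp
  then show ?thesis unfolding set_integrable_def
    using facet_sets_surface[OF T S] emeasure_surface_facet_finite[OF T S] B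
    by (intro integrableI_bounded_set_indicator[where B=B]) (auto simp: surface_eq_completion)
qed

context mesh
begin

text \<open>Together with the null set \<open>skeleton\<close> below, this reduces all integrals to the open elements and
  the relatively open facets, where the piecewise polynomials and the data have simple formulas.\<close>

lemma element_boundaries_negligible: "negligible (\<Union>T\<in>\<T>. T - interior T)"
proof (rule negligible_Union)
  show "finite ((\<lambda>T. T - interior T) ` \<T>)" using finite_mesh by simp
  fix N assume "N \<in> (\<lambda>T. T - interior T) ` \<T>"
  then obtain T where T: "T \<in> \<T>" "N = T - interior T" by auto
  have "N \<subseteq> frontier T" using T(2) closure_subset by (auto simp: frontier_def)
  then show "negligible N"
    using negligible_convex_frontier[OF compact_full_simplex(2)[OF full[OF T(1)]]] negligible_subset by blast
qed

lemma integral_elementwise: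
  fixes h :: "real^'d \<Rightarrow> 'b::euclidean_space"
  assumes h: "\<And>T y. T \<in> \<T> \<Longrightarrow> y \<in> interior T \<Longrightarrow> h y = f T y"
    and c: "\<And>T. T \<in> \<T> \<Longrightarrow> continuous_on UNIV (f T)"
  shows "integrable (lebesgue_on \<Omega>) h"
    "(\<integral>x. h x \<partial>lebesgue_on \<Omega>) = (\<Sum>T\<in>\<T>. LINT x:T|lebesgue. f T x)"
proof -
  have \<Omega>l: "\<Omega> \<inter> space lebesgue \<in> sets lebesgue" using open_domain by simp
  have i: "set_integrable lebesgue T (f T)" if "T \<in> \<T>" for T
    by (rule set_integrable_continuous_compact[OF compact_full_simplex(1)[OF full[OF that]] c[OF that]])
  define H where "H x = (\<Sum>T\<in>\<T>. indicator T x *\<^sub>R f T x)" for x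
  have H: "integrable lebesgue H" "(\<integral>x. H x \<partial>lebesgue) = (\<Sum>T\<in>\<T>. LINT x:T|lebesgue. f T x)"
    using i unfolding H_def set_integrable_def set_lebesgue_integral_def
    by (auto intro!: Bochner_Integration.integrable_sum Bochner_Integration.integral_sum)
  have ae: "AE x in lebesgue. H x = indicator \<Omega> x *\<^sub>R h x"
  proof (rule AE_I'[of "\<Union>T\<in>\<T>. T - interior T"])
    show "(\<Union>T\<in>\<T>. T - interior T) \<in> null_sets lebesgue"
      using element_boundaries_negligible by (simp add: negligible_iff_null_sets)
    have "H x = indicator \<Omega> x *\<^sub>R h x" if x: "x \<notin> (\<Union>T\<in>\<T>. T - interior T)" for x
    proof (cases "x \<in> \<Omega>")
      case True
      then have "x \<in> \<Union>\<T>" unfolding union_eq by (rule subsetD[OF closure_subset])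
      then obtain T where T: "T \<in> \<T>" "x \<in> T" by blast
      then have xi: "x \<in> interior T" using x by blast
      have "x \<notin> T'" if "T' \<in> \<T>" "T' \<noteq> T" for T'
        using interior_point_unique[OF T(1) that(1) xi] that(2) by blast
      then have "H x = (\<Sum>T'\<in>\<T>. if T' = T then f T x else 0)"
        unfolding H_def using T by (intro sum.cong refl) simp
      also have "\<dots> = h x" using T(1) xi h finite_mesh by simp
      finally show ?thesis using True by simp
    next
      case False
      have "x \<notin> T" if "T \<in> \<T>" for T using x that interior_subset_domain[OF that] False by blast
      then show ?thesis using False by (simp add: H_def)
    qed
    then show "{x \<in> space lebesgue. H x \<noteq> indicator \<Omega> x *\<^sub>R h x} \<subseteq> (\<Union>T\<in>\<T>. T - interior T)" by blast
  qed
  show "integrable (lebesgue_on \<Omega>) h"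
    unfolding integrable_restrict_space[OF \<Omega>l] by (rule completion_integral_AE_cong(1)[OF H(1) ae])
  show "(\<integral>x. h x \<partial>lebesgue_on \<Omega>) = (\<Sum>T\<in>\<T>. LINT x:T|lebesgue. f T x)"
    unfolding integral_restrict_space[OF \<Omega>l] completion_integral_AE_cong(2)[OF H(1) ae] by (rule H(2))
qed

definition skeleton :: "(real^'d) set" where
  "skeleton = (\<Union>S\<in>facets \<T>. S - rel_interior S)"

lemma skeleton_null: "skeleton \<in> null_sets surface"
  unfolding skeleton_def
  by (rule null_sets.finite_UN[OF finite_facets_mesh])
    (use relative_boundary_null full in \<open>auto simp: facets_def\<close>)

lemma facets_on_subset: "facets_on \<T> \<Omega> X \<subseteq> boundary_facets \<T> \<Omega>" "finite (facets_on \<T> \<Omega> X)"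
  using finite_facets_mesh by (auto simp: facets_on_def boundary_facets_def elim: rev_finite_subset)

text \<open>Here it matters that \<open>X\<close> is relatively open. Near a relative interior point of a boundary facet \<open>S\<close> the
  boundary of the domain is contained in \<open>S\<close>. If \<open>S\<close> lies in the closure of \<open>Y\<close>, then \<open>X\<close> does not meet \<open>S\<close>, so this
  point is not in the closure of \<open>X\<close>.\<close>

lemma closure_part_cases:
  assumes X: "openin (top_of_set (frontier \<Omega>)) X" and Y: "Y \<subseteq> frontier \<Omega>" "X \<inter> Y = {}"
    and sep: "\<And>S. S \<in> boundary_facets \<T> \<Omega> \<Longrightarrow> S \<subseteq> closure X \<or> S \<subseteq> closure Y"
    and x: "x \<in> closure X" "x \<notin> skeleton"
  shows "\<exists>S\<in>facets_on \<T> \<Omega> X. x \<in> rel_interior S"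
proof -
  have Xf: "X \<subseteq> frontier \<Omega>" using X openin_subset by fastforce
  then have xf: "x \<in> frontier \<Omega>" using x(1) closure_minimal[of X "frontier \<Omega>"] by auto
  then have "x \<in> closure \<Omega>" "x \<notin> \<Omega>" using open_domain by (auto simp: frontier_def interior_open)
  then obtain T where T: "T \<in> \<T>" "x \<in> T" using union_eq by blast
  have "x \<notin> interior T" using interior_subset_domain[OF T(1)] \<open>x \<notin> \<Omega>\<close> by blast
  then obtain S where S: "S facet_of T" "\<not> 0 < bary T S x" using interior_simplex_iff[OF full[OF T(1)]] by blast
  then have "bary T S x = 0" using T mem_simplex_iff[OF full[OF T(1)]] by (metis less_eq_real_def)
  then have "x \<in> S" using mem_facet_iff[OF full[OF T(1)] S(1)] T by simp
  then have xS: "x \<in> rel_interior S" using x(2) T S by (auto simp: skeleton_def facets_def)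
  have only: "T' = T" if "T' \<in> \<T>" "S facet_of T'" for T'
    using interior_facetI[OF that T(1) S(1) _ xS] \<open>x \<notin> \<Omega>\<close> by blast
  have bf: "S \<in> boundary_facets \<T> \<Omega>"
    using boundary_facetI[OF T(1) S(1) only] T S by (auto simp: boundary_facets_def facets_def)
  have "S \<subseteq> closure X"
  proof (rule ccontr)
    assume "\<not> S \<subseteq> closure X"
    then have SY: "S \<subseteq> closure Y" using sep[OF bf] by blast
    have XY: "X \<inter> closure Y = {}"
    proof -
      obtain U where U: "open U" "X = frontier \<Omega> \<inter> U" using X by (auto simp: openin_open)
      have "U \<inter> Y = {}" using U Y by blast
      then have "U \<inter> closure Y = {}" using open_Int_closure_eq_empty[OF U(1)] by blast
      then show ?thesis using U by blast
    qed
    obtain e where e: "e > 0" and a: "\<And>T y. T \<in> \<T> \<Longrightarrow> y \<in> ball x e \<Longrightarrow> y \<in> T \<Longrightarrow> S facet_of T"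
      and i: "\<And>T y. T \<in> \<T> \<Longrightarrow> S facet_of T \<Longrightarrow> y \<in> ball x e \<Longrightarrow> y \<in> interior T \<longleftrightarrow> 0 < bary T S y"
      by (rule facet_neighbourhood[OF S(1) T(1) xS]) blast
    have "y \<in> S" if y: "y \<in> ball x e" "y \<in> frontier \<Omega>" for y
    proof -
      have "y \<in> closure \<Omega>" "y \<notin> \<Omega>" using y open_domain by (auto simp: frontier_def interior_open)
      then obtain T' where T': "T' \<in> \<T>" "y \<in> T'" using union_eq by blast
      then have yT: "y \<in> T" using a[OF T'(1) y(1) T'(2)] only by blast
      have "y \<notin> interior T" using interior_subset_domain[OF T(1)] \<open>y \<notin> \<Omega>\<close> by blast
      then have "\<not> 0 < bary T S y" using i[OF T(1) S(1) y(1)] by simp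
      then have "bary T S y = 0" using yT S(1) mem_simplex_iff[OF full[OF T(1)]] by (metis less_eq_real_def)
      then show "y \<in> S" using mem_facet_iff[OF full[OF T(1)] S(1)] yT by simp
    qed
    then have "ball x e \<inter> X = {}" using Xf SY XY by blast
    then have "ball x e \<inter> closure X = {}" using open_Int_closure_eq_empty[OF open_ball] by blast
    moreover have "x \<in> ball x e" using e by simp
    ultimately show False using x(1) by blast
  qed
  then show ?thesis using bf xS by (auto simp: facets_on_def)
qed

lemma surface_integral_part:
  assumes X: "openin (top_of_set (frontier \<Omega>)) X" and Y: "Y \<subseteq> frontier \<Omega>" "X \<inter> Y = {}"
    and sep: "\<And>S. S \<in> boundary_facets \<T> \<Omega> \<Longrightarrow> S \<subseteq> closure X \<or> S \<subseteq> closure Y"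
    and h: "\<And>S x. S \<in> facets_on \<T> \<Omega> X \<Longrightarrow> x \<in> rel_interior S \<Longrightarrow> h x = a S \<bullet> x + b S"
  shows "(LINT x:closure X|surface. h x)
    = (\<Sum>S\<in>facets_on \<T> \<Omega> X. measure surface S * (a S \<bullet> barycenter S + b S))"
proof -
  let ?B = "facets_on \<T> \<Omega> X"
  have facet: "\<exists>T\<in>\<T>. S facet_of T" if "S \<in> ?B" for S
    using that by (auto simp: facets_on_def boundary_facets_def facets_def)
  have i: "integrable surface (\<lambda>x. indicator S x *\<^sub>R (a S \<bullet> x + b S))" if "S \<in> ?B" for S
    using facet[OF that] set_integrable_surface_affine[OF full] unfolding set_integrable_def by blast
  define H where "H x = (\<Sum>S\<in>?B. indicator S x *\<^sub>R (a S \<bullet> x + b S))" for x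
  have H: "integrable surface H" unfolding H_def using i by (rule Bochner_Integration.integrable_sum)
  have H2: "(\<integral>x. H x \<partial>surface) = (\<Sum>S\<in>?B. measure surface S * (a S \<bullet> barycenter S + b S))"
  proof -
    have "(\<integral>x. H x \<partial>surface) = (\<Sum>S\<in>?B. \<integral>x. indicator S x *\<^sub>R (a S \<bullet> x + b S) \<partial>surface)"
      unfolding H_def using i by (rule Bochner_Integration.integral_sum)
    also have "\<dots> = (\<Sum>S\<in>?B. measure surface S * (a S \<bullet> barycenter S + b S))"
    proof (rule sum.cong[OF refl])
      fix S assume "S \<in> ?B"
      then obtain T where "T \<in> \<T>" "S facet_of T" using facet by blast
      then show "(\<integral>x. indicator S x *\<^sub>R (a S \<bullet> x + b S) \<partial>surface) = measure surface S * (a S \<bullet> barycenter S + b S)"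
        using surface_integral_affine[OF full, of T S "a S" "b S"] by (simp add: set_lebesgue_integral_def)
    qed
    finally show ?thesis .
  qed
  have ae: "AE x in surface. H x = indicator (closure X) x *\<^sub>R h x"
  proof (rule AE_I'[OF skeleton_null])
    have "H x = indicator (closure X) x *\<^sub>R h x" if x: "x \<notin> skeleton" for x
    proof (cases "x \<in> closure X")
      case True
      then obtain S where S: "S \<in> ?B" "x \<in> rel_interior S" using closure_part_cases[OF X Y sep _ x] by blast
      obtain T where T: "T \<in> \<T>" "S facet_of T" using facet[OF S(1)] by blast
      have "S' = S" if "S' \<in> ?B" "x \<in> S'" for S'
        using facet[OF that(1)] facet_point_unique[OF T(2,1) _ _ S(2) that(2)] by blast
      then have "H x = (\<Sum>S'\<in>?B. if S' = S then a S \<bullet> x + b S else 0)"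
        unfolding H_def using S(2) rel_interior_subset by (intro sum.cong) (auto simp: indicator_def)
      also have "\<dots> = h x" using S h facets_on_subset(2) by simp
      finally show ?thesis using True by simp
    next
      case False
      then have "x \<notin> S" if "S \<in> ?B" for S using that by (auto simp: facets_on_def)
      then show ?thesis using False by (simp add: H_def)
    qed
    then show "{x \<in> space surface. H x \<noteq> indicator (closure X) x *\<^sub>R h x} \<subseteq> skeleton" by blast
  qed
  show ?thesis
    using completion_integral_AE_cong(2)[OF H[unfolded surface_eq_completion] ae[unfolded surface_eq_completion]] H2
    by (simp add: set_lebesgue_integral_def surface_eq_completion)
qed

section \<open>Weak divergence of piecewise Raviart-Thomas fields\<close>

text \<open>Up to the factor \<open>d\<close>, the sum of the fluxes out of the adjacent elements through \<open>S\<close>: the jump of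
  the normal component on an interior facet, the flux out of the domain on a boundary facet.\<close>

definition facet_jump :: "((real^'d) set \<Rightarrow> real^'d) \<Rightarrow> ((real^'d) set \<Rightarrow> real) \<Rightarrow> (real^'d) set \<Rightarrow> real" where
  "facet_jump a b S = (\<Sum>T | T \<in> \<T> \<and> S facet_of T. measure lebesgue T * rt_coef T S (a T) (b T))"

text \<open>Every facet contributes the sum over its adjacent elements of their fluxes, weighted with the
  functional \<open>flux\<close>, which has the same value for all of them and vanishes on boundary facets.\<close>

lemma weak_div_defect:
  assumes v: "\<And>T y. T \<in> \<T> \<Longrightarrow> y \<in> interior T \<Longrightarrow> v y = a T + b T *\<^sub>R y"
    and g: "\<And>T y. T \<in> \<T> \<Longrightarrow> y \<in> interior T \<Longrightarrow> g y = \<gamma> T"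
    and \<phi>: "test_function \<Omega> \<phi>"
  shows "(\<integral>x. v x \<bullet> grad \<phi> x \<partial>lebesgue_on \<Omega>) + (\<integral>x. g x * \<phi> x \<partial>lebesgue_on \<Omega>)
    = (\<Sum>T\<in>\<T>. (\<gamma> T - real CARD('d) * b T) * (LINT x:T|lebesgue. \<phi> x))
      + (\<Sum>S\<in>facets \<T> - boundary_facets \<T> \<Omega>. facet_jump a b S * flux (SOME T. T \<in> \<T> \<and> S facet_of T) S \<phi> (grad \<phi>))"
proof -
  note C1 = test_function_facts(1)[OF \<phi>]
  have c: "continuous_on UNIV \<phi>" "continuous_on UNIV (grad \<phi>)" using C1 C1_gradient_continuous by (auto simp: C1_gradient_def)
  define F where "F S = flux (SOME T. T \<in> \<T> \<and> S facet_of T) S \<phi> (grad \<phi>)" for S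
  have F: "flux T S \<phi> (grad \<phi>) = F S" if "T \<in> \<T>" "S facet_of T" for T S
  proof -
    have "(SOME T. T \<in> \<T> \<and> S facet_of T) \<in> \<T> \<and> S facet_of (SOME T. T \<in> \<T> \<and> S facet_of T)"
      by (rule someI[of _ T]) (use that in simp)
    then show ?thesis unfolding F_def using that by (intro flux_glue C1 full) auto
  qed
  have F0: "F S = 0" if S: "S \<in> boundary_facets \<T> \<Omega>" for S
  proof -
    obtain T where T: "T \<in> \<T>" "S facet_of T" using S by (auto simp: boundary_facets_def facets_def)
    have "flux T S \<phi> (grad \<phi>) = 0"
    proof (rule flux_eq_0[OF full[OF T(1)] T(2) C1])
      fix x assume "x \<in> S"
      then have "x \<notin> \<Omega>" using S open_domain by (auto simp: boundary_facets_def frontier_def interior_open)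
      then show "\<phi> x = 0" by (rule test_function_facts(2)[OF \<phi>])
    qed
    then show ?thesis using F[OF T] by simp
  qed
  have 1: "(\<integral>x. v x \<bullet> grad \<phi> x \<partial>lebesgue_on \<Omega>) = (\<Sum>T\<in>\<T>. LINT x:T|lebesgue. (a T + b T *\<^sub>R x) \<bullet> grad \<phi> x)"
    by (rule integral_elementwise(2)) (auto simp: v intro!: continuous_intros c)
  have 2: "(\<integral>x. g x * \<phi> x \<partial>lebesgue_on \<Omega>) = (\<Sum>T\<in>\<T>. \<gamma> T * (LINT x:T|lebesgue. \<phi> x))"
    by (subst integral_elementwise(2)[where f="\<lambda>T x. \<gamma> T * \<phi> x"]) (auto simp: g intro!: continuous_intros c)
  have "(\<integral>x. v x \<bullet> grad \<phi> x \<partial>lebesgue_on \<Omega>) + (\<integral>x. g x * \<phi> x \<partial>lebesgue_on \<Omega>)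
    = (\<Sum>T\<in>\<T>. (\<gamma> T - real CARD('d) * b T) * (LINT x:T|lebesgue. \<phi> x)
        + (\<Sum>S | S facet_of T. measure lebesgue T * rt_coef T S (a T) (b T) * flux T S \<phi> (grad \<phi>)))"
    unfolding 1 2 sum.distrib[symmetric]
  proof (rule sum.cong[OF refl])
    fix T assume "T \<in> \<T>"
    from integral_rt_flux[OF full[OF this] C1, of "a T" "b T"]
    show "(LINT x:T|lebesgue. (a T + b T *\<^sub>R x) \<bullet> grad \<phi> x) + \<gamma> T * (LINT x:T|lebesgue. \<phi> x)
      = (\<gamma> T - real CARD('d) * b T) * (LINT x:T|lebesgue. \<phi> x)
        + (\<Sum>S | S facet_of T. measure lebesgue T * rt_coef T S (a T) (b T) * flux T S \<phi> (grad \<phi>))"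
      by (simp add: left_diff_distrib sum_distrib_left mult.assoc)
  qed
  also have "\<dots> = (\<Sum>T\<in>\<T>. (\<gamma> T - real CARD('d) * b T) * (LINT x:T|lebesgue. \<phi> x))
      + (\<Sum>T\<in>\<T>. \<Sum>S | S facet_of T. measure lebesgue T * rt_coef T S (a T) (b T) * F S)"
    unfolding sum.distrib by (intro arg_cong2[where f="(+)"] refl sum.cong) (auto simp: F)
  also have "(\<Sum>T\<in>\<T>. \<Sum>S | S facet_of T. measure lebesgue T * rt_coef T S (a T) (b T) * F S)
      = (\<Sum>S\<in>facets \<T>. facet_jump a b S * F S)"
    unfolding sum_mesh_facets by (simp add: facet_jump_def sum_distrib_right)
  also have "\<dots> = (\<Sum>S\<in>facets \<T> - boundary_facets \<T> \<Omega>. facet_jump a b S * F S)"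
    by (rule sum.mono_neutral_right) (use finite_facets_mesh F0 in auto)
  finally show ?thesis unfolding F_def .
qed

text \<open>A bump function supported in one element isolates the divergence on this element. A bump function
  supported near the barycenter of an interior facet then isolates the jump across this facet, with
  a positive factor by \<open>flux_pos\<close>.\<close>

theorem weak_div_iff:
  assumes v: "\<And>T y. T \<in> \<T> \<Longrightarrow> y \<in> interior T \<Longrightarrow> v y = a T + b T *\<^sub>R y"
    and g: "\<And>T y. T \<in> \<T> \<Longrightarrow> y \<in> interior T \<Longrightarrow> g y = \<gamma> T"
  shows "has_weak_div \<Omega> v g \<longleftrightarrow>
    (\<forall>T\<in>\<T>. real CARD('d) * b T = \<gamma> T) \<and> (\<forall>S\<in>facets \<T> - boundary_facets \<T> \<Omega>. facet_jump a b S = 0)"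
proof
  assume A: "(\<forall>T\<in>\<T>. real CARD('d) * b T = \<gamma> T) \<and> (\<forall>S\<in>facets \<T> - boundary_facets \<T> \<Omega>. facet_jump a b S = 0)"
  show "has_weak_div \<Omega> v g" unfolding has_weak_div_def
  proof (intro allI impI)
    fix \<phi> assume \<phi>: "test_function \<Omega> \<phi>"
    from A weak_div_defect[where v=v and a=a and b=b and g=g and \<gamma>=\<gamma>, OF v g \<phi>]
    show "(\<integral>x. v x \<bullet> grad \<phi> x \<partial>lebesgue_on \<Omega>) = - (\<integral>x. g x * \<phi> x \<partial>lebesgue_on \<Omega>)" by simp
  qed
next
  assume w: "has_weak_div \<Omega> v g"
  have zero: "(\<Sum>T\<in>\<T>. (\<gamma> T - real CARD('d) * b T) * (LINT x:T|lebesgue. \<phi> x))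
      + (\<Sum>S\<in>facets \<T> - boundary_facets \<T> \<Omega>. facet_jump a b S * flux (SOME T. T \<in> \<T> \<and> S facet_of T) S \<phi> (grad \<phi>)) = 0"
    if "test_function \<Omega> \<phi>" for \<phi>
    using weak_div_defect[where v=v and a=a and b=b and g=g and \<gamma>=\<gamma>, OF v g that] w that unfolding has_weak_div_def by simp
  have some: "(SOME T. T \<in> \<T> \<and> S facet_of T) \<in> \<T>" "S facet_of (SOME T. T \<in> \<T> \<and> S facet_of T)" if "S \<in> facets \<T>" for S
  proof -
    have "\<exists>T. T \<in> \<T> \<and> S facet_of T" using that by (auto simp: facets_def)
    from someI_ex[OF this] show "(SOME T. T \<in> \<T> \<and> S facet_of T) \<in> \<T>" "S facet_of (SOME T. T \<in> \<T> \<and> S facet_of T)" by auto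
  qed
  have div: "real CARD('d) * b T = \<gamma> T" if T: "T \<in> \<T>" for T
  proof -
    obtain z where z: "z \<in> interior T" using compact_full_simplex(3)[OF full[OF T]] by blast
    obtain \<phi> where \<phi>: "test_function (interior T) \<phi>" "\<And>x. 0 \<le> \<phi> x" "0 < \<phi> z" using ex_bump[OF open_interior z] by blast
    note \<phi>\<Omega> = test_function_mono[OF \<phi>(1) interior_subset_domain[OF T]]
    note C1 = test_function_facts(1)[OF \<phi>(1)]
    have "flux T' S \<phi> (grad \<phi>) = 0" if "T' \<in> \<T>" "S facet_of T'" for T' S
    proof (rule flux_eq_0[OF full[OF that(1)] that(2) C1], rule test_function_facts(2)[OF \<phi>(1)])
      fix x assume x: "x \<in> S"
      show "x \<notin> interior T"
      proof
        assume xi: "x \<in> interior T"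
        have "x \<in> T'" using x facet_of_imp_subset[OF that(2)] by blast
        then have "T = T'" by (rule interior_point_unique[OF T that(1) xi])
        then show False using xi x that interior_simplex_iff[OF full[OF T], of x] mem_facet_iff[OF full[OF T], of S x] by auto
      qed
    qed
    then have f0: "(\<Sum>S\<in>facets \<T> - boundary_facets \<T> \<Omega>. facet_jump a b S * flux (SOME T. T \<in> \<T> \<and> S facet_of T) S \<phi> (grad \<phi>)) = 0"
      using some by (intro sum.neutral) auto
    have "(LINT x:T'|lebesgue. \<phi> x) = 0" if "T' \<in> \<T>" "T' \<noteq> T" for T'
    proof -
      have "indicator T' x *\<^sub>R \<phi> x = 0" for x
        using interior_point_unique[OF T that(1), of x] that(2) test_function_facts(2)[OF \<phi>(1), of x] by (auto simp: indicator_def)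
      then show ?thesis unfolding set_lebesgue_integral_def by (simp only: integral_zero)
    qed
    then have "(\<Sum>T'\<in>\<T>. (\<gamma> T' - real CARD('d) * b T') * (LINT x:T'|lebesgue. \<phi> x))
        = (\<Sum>T'\<in>\<T>. if T' = T then (\<gamma> T - real CARD('d) * b T) * (LINT x:T|lebesgue. \<phi> x) else 0)"
      by (intro sum.cong) auto
    also have "\<dots> = (\<gamma> T - real CARD('d) * b T) * (LINT x:T|lebesgue. \<phi> x)" using T finite_mesh by simp
    finally have "(\<gamma> T - real CARD('d) * b T) * (LINT x:T|lebesgue. \<phi> x) = 0" using zero[OF \<phi>\<Omega>] f0 by simp
    then show ?thesis using integral_bump_pos[OF full[OF T] C1_gradient_continuous[OF C1] \<phi>(2) z \<phi>(3)] by simp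
  qed
  have jump: "facet_jump a b S = 0" if S: "S \<in> facets \<T> - boundary_facets \<T> \<Omega>" for S
  proof -
    obtain T T' where T: "T \<in> \<T>" "S facet_of T" "T' \<in> \<T>" "S facet_of T'" "T \<noteq> T'" by (rule interior_facet_two[OF S])
    define x where "x = barycenter S"
    have x: "x \<in> rel_interior S" unfolding x_def by (rule barycenter_in_rel_interior[OF full[OF T(1)] T(2)])
    then have xS: "x \<in> S" using rel_interior_subset by blast
    have x\<Omega>: "x \<in> \<Omega>" by (rule interior_facetI[OF T x])
    obtain e where e: "e > 0" and r: "\<And>T y R. T \<in> \<T> \<Longrightarrow> y \<in> ball x e \<Longrightarrow> R facet_of T \<Longrightarrow> y \<in> R \<Longrightarrow> R = S"
      by (rule facet_neighbourhood[OF T(2,1) x]) blast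
    obtain \<phi> where \<phi>: "test_function (\<Omega> \<inter> ball x e) \<phi>" "\<And>x. 0 \<le> \<phi> x" "0 < \<phi> x"
      using ex_bump[of "\<Omega> \<inter> ball x e" x] open_domain x\<Omega> e by auto
    note \<phi>\<Omega> = test_function_mono[OF \<phi>(1) Int_lower1]
    note C1 = test_function_facts(1)[OF \<phi>(1)]
    let ?F = "\<lambda>R. flux (SOME T. T \<in> \<T> \<and> R facet_of T) R \<phi> (grad \<phi>)"
    have F0: "?F R = 0" if R: "R \<in> facets \<T>" "R \<noteq> S" for R
    proof (rule flux_eq_0[OF full[OF some(1)[OF R(1)]] some(2)[OF R(1)] C1], rule test_function_facts(2)[OF \<phi>(1)])
      fix y assume "y \<in> R"
      then show "y \<notin> \<Omega> \<inter> ball x e" using r[OF some(1)[OF R(1)] _ some(2)[OF R(1)]] R(2) by blast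
    qed
    have "(\<Sum>R\<in>facets \<T> - boundary_facets \<T> \<Omega>. facet_jump a b R * ?F R)
        = (\<Sum>R\<in>facets \<T> - boundary_facets \<T> \<Omega>. if R = S then facet_jump a b S * ?F S else 0)"
      by (rule sum.cong) (use F0 in auto)
    also have "\<dots> = facet_jump a b S * ?F S" using S finite_facets_mesh by simp
    finally have "facet_jump a b S * ?F S = 0" using zero[OF \<phi>\<Omega>] div by simp
    moreover have "?F S > 0"
      by (rule flux_pos[OF full[OF some(1)] some(2) C1 \<phi>(2) xS \<phi>(3)]) (use S in auto)
    ultimately show ?thesis by simp
  qed
  show "(\<forall>T\<in>\<T>. real CARD('d) * b T = \<gamma> T) \<and> (\<forall>S\<in>facets \<T> - boundary_facets \<T> \<Omega>. facet_jump a b S = 0)"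
    using div jump by blast
qed

end

section \<open>Square roots of positive definite matrices\<close>

text \<open>A maximizer of the quadratic form on the unit sphere of \<open>V\<close>. Subtracting the maximal value \<open>l\<close> gives a
  form that is nonpositive on \<open>V\<close> and vanishes at \<open>v\<close>, so its first variation at \<open>v\<close> vanishes as well.\<close>

lemma symmetric_eigenvector:
  fixes f :: "'a::euclidean_space \<Rightarrow> 'a"
  assumes f: "linear f" and sym: "\<And>x y. f x \<bullet> y = x \<bullet> f y"
    and V: "subspace V" "\<And>x. x \<in> V \<Longrightarrow> f x \<in> V" "V \<noteq> {0}"
  shows "\<exists>v\<in>V. norm v = 1 \<and> f v = (v \<bullet> f v) *\<^sub>R v"
proof -
  let ?K = "V \<inter> sphere 0 1"
  have cf: "continuous_on UNIV f" using f by (simp add: linear_continuous_on linear_conv_bounded_linear)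
  have "compact ?K" using V(1) by (simp add: closed_Int_compact closed_subspace)
  moreover obtain z where z: "z \<in> V" "z \<noteq> 0" using V(1,3) subspace_0 by blast
  then have "z /\<^sub>R norm z \<in> ?K" using V(1) by (simp add: subspace_scale)
  then have "?K \<noteq> {}" by blast
  moreover have "continuous_on ?K (\<lambda>x. x \<bullet> f x)" by (intro continuous_intros continuous_on_subset[OF cf]) auto
  ultimately obtain v where v: "v \<in> ?K" "\<And>y. y \<in> ?K \<Longrightarrow> y \<bullet> f y \<le> v \<bullet> f v"
    using continuous_attains_sup[of ?K "\<lambda>x. x \<bullet> f x"] by blast
  have nv: "norm v = 1" "v \<in> V" and vv: "v \<bullet> v = 1" using v(1) by (auto simp: dot_square_norm)
  define l where "l = v \<bullet> f v"
  define g where "g x = f x - l *\<^sub>R x" for x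
  have g: "linear g" unfolding g_def[abs_def] using f by (auto intro!: linearI simp: linear_add linear_scale algebra_simps)
  have gs: "g x \<bullet> y = x \<bullet> g y" for x y using sym by (simp add: g_def inner_diff_left inner_diff_right)
  have le: "x \<bullet> g x \<le> 0" if "x \<in> V" for x
  proof (cases "x = 0")
    case False
    let ?y = "x /\<^sub>R norm x"
    have "?y \<in> ?K" using that V(1) False by (simp add: subspace_scale)
    then have "?y \<bullet> f ?y \<le> l" unfolding l_def by (rule v(2))
    moreover have "?y \<bullet> f ?y = (x \<bullet> f x) / (norm x)\<^sup>2" by (simp add: linear_scale[OF f] divide_inverse power2_eq_square)
    ultimately have "x \<bullet> f x \<le> l * (norm x)\<^sup>2" using False by (simp add: divide_le_eq)
    then show ?thesis by (simp add: g_def inner_diff_right dot_square_norm)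
  qed simp
  have gv: "v \<bullet> g v = 0" using vv by (simp add: g_def inner_diff_right l_def)
  have "y \<bullet> g v = 0" if y: "y \<in> V" for y
  proof (rule ccontr)
    assume ne: "y \<bullet> g v \<noteq> 0"
    define a b where "a = y \<bullet> g v" and "b = y \<bullet> g y"
    have q: "2 * t * a + t\<^sup>2 * b \<le> 0" for t
    proof -
      have "v + t *\<^sub>R y \<in> V" using nv y V(1) by (simp add: subspace_add subspace_scale)
      from le[OF this] show ?thesis
        using gv gs[of v y]
        by (simp add: linear_add[OF g] linear_scale[OF g] inner_add_left inner_add_right inner_commute a_def b_def power2_eq_square algebra_simps)
    qed
    have b0: "b \<le> 0" unfolding b_def by (rule le[OF y])
    \<comment> \<open>The choice \<open>t = a / c\<close> makes the linear term of the inequality \<open>q\<close> dominate the quadratic one.\<close>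
    define c where "c = 1 - b"
    have c: "c > 0" "2 * c + b > 0" using b0 by (simp_all add: c_def)
    define t where "t = a / c"
    have "2 * t * a + t\<^sup>2 * b = a\<^sup>2 * (2 * c + b) / c\<^sup>2"
      using c(1) by (simp add: t_def power2_eq_square field_simps)
    also have "\<dots> > 0" using c ne by (intro divide_pos_pos mult_pos_pos) (auto simp: a_def)
    finally show False using q[of t] by simp
  qed
  moreover have "g v \<in> V" unfolding g_def using V nv by (simp add: subspace_diff subspace_scale)
  ultimately have "g v = 0" by (metis inner_eq_zero_iff)
  then show ?thesis using nv by (intro bexI[of _ v]) (auto simp: g_def l_def)
qed

lemma symmetric_eigenbasis:
  fixes f :: "'a::euclidean_space \<Rightarrow> 'a"
  assumes f: "linear f" and sym: "\<And>x y. f x \<bullet> y = x \<bullet> f y"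
    and V: "subspace V" "\<And>x. x \<in> V \<Longrightarrow> f x \<in> V"
  shows "\<exists>E. finite E \<and> E \<subseteq> V \<and> (\<forall>v\<in>E. norm v = 1 \<and> f v = (v \<bullet> f v) *\<^sub>R v)
    \<and> (\<forall>x\<in>V. x = (\<Sum>v\<in>E. (v \<bullet> x) *\<^sub>R v))"
  using V
proof (induction "dim V" arbitrary: V rule: less_induct)
  case less
  show ?case
  proof (cases "V = {0}")
    case True
    then show ?thesis by (intro exI[of _ "{}"]) auto
  next
    case False
    obtain v where v: "v \<in> V" "norm v = 1" "f v = (v \<bullet> f v) *\<^sub>R v"
      using symmetric_eigenvector[OF f sym less.prems False] by blast
    have vv: "v \<bullet> v = 1" using v(2) by (simp add: dot_square_norm)
    define W where "W = V \<inter> {y. v \<bullet> y = 0}"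
    have sW: "subspace W" unfolding W_def by (rule subspace_inter[OF less.prems(1) subspace_hyperplane])
    have fW: "f x \<in> W" if "x \<in> W" for x
    proof -
      have "v \<bullet> f x = ((v \<bullet> f v) *\<^sub>R v) \<bullet> x" using sym[of v x] v(3) by simp
      then show ?thesis using that less.prems(2) by (simp add: W_def)
    qed
    have "v \<notin> W" "W \<subseteq> V" using vv by (auto simp: W_def)
    then have "W \<subset> V" using v(1) by blast
    then have "dim W < dim V" using dim_psubset[of W V] sW less.prems(1) by (simp add: span_eq_iff[THEN iffD2])
    from less.hyps[OF this sW fW] obtain E where E: "finite E" "E \<subseteq> W"
      "\<forall>v\<in>E. norm v = 1 \<and> f v = (v \<bullet> f v) *\<^sub>R v" "\<forall>x\<in>W. x = (\<Sum>v\<in>E. (v \<bullet> x) *\<^sub>R v)" by blast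
    have vE: "v \<notin> E" using E(2) vv by (auto simp: W_def)
    have "x = (\<Sum>w\<in>insert v E. (w \<bullet> x) *\<^sub>R w)" if x: "x \<in> V" for x
    proof -
      define y where "y = x - (v \<bullet> x) *\<^sub>R v"
      have "y \<in> W" using x v(1) less.prems(1) vv by (simp add: y_def W_def subspace_diff subspace_scale inner_diff_right)
      then have "y = (\<Sum>w\<in>E. (w \<bullet> y) *\<^sub>R w)" using E(4) by blast
      also have "\<dots> = (\<Sum>w\<in>E. (w \<bullet> x) *\<^sub>R w)"
        using E(2) by (intro sum.cong) (auto simp: y_def W_def inner_diff_right inner_commute)
      finally show ?thesis using vE E(1) by (simp add: y_def algebra_simps)
    qed
    then show ?thesis using E v by (intro exI[of _ "insert v E"]) (auto simp: W_def)
  qed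
qed

lemma symmetric_matrix_inner:
  fixes A :: "real^'d^'d"
  assumes "transpose A = A" shows "(A *v x) \<bullet> y = x \<bullet> (A *v y)"
  using assms by (metis dot_lmul_matrix transpose_matrix_vector)

text \<open>The root acts on each eigenvector \<open>v\<close> as multiplication by \<open>s v\<close>. Any other root \<open>C\<close> does the same:
  \<open>w = C v - s v\<close> satisfies \<open>C w = - s w\<close>, which for positive semidefinite \<open>C\<close> and \<open>s > 0\<close> forces \<open>w = 0\<close>.\<close>

theorem psd_sqrt_properties:
  fixes A :: "real^'d^'d"
  assumes sym: "transpose A = A" and pos: "\<And>x. x \<noteq> 0 \<Longrightarrow> 0 < x \<bullet> (A *v x)"
  shows "transpose (psd_sqrt A) = psd_sqrt A" "psd_sqrt A ** psd_sqrt A = A" "invertible (psd_sqrt A)"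
proof -
  obtain E where E: "finite E" "\<forall>v\<in>E. norm v = 1 \<and> A *v v = (v \<bullet> (A *v v)) *\<^sub>R v"
    and rep: "\<And>x. x = (\<Sum>v\<in>E. (v \<bullet> x) *\<^sub>R v)"
    using symmetric_eigenbasis[of "(*v) A" UNIV] symmetric_matrix_inner[OF sym] by auto
  define s where "s v = sqrt (v \<bullet> (A *v v))" for v
  have s: "s v > 0" "A *v v = (s v)\<^sup>2 *\<^sub>R v" if "v \<in> E" for v
  proof -
    have "v \<noteq> 0" using E(2) that by auto
    then have "0 < v \<bullet> (A *v v)" by (rule pos)
    then show "s v > 0" "A *v v = (s v)\<^sup>2 *\<^sub>R v" using E(2) that by (auto simp: s_def)
  qed
  define b where "b x = (\<Sum>v\<in>E. (s v * (v \<bullet> x)) *\<^sub>R v)" for x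
  have lb: "linear b" unfolding b_def[abs_def]
    by (auto intro!: linearI simp: inner_add_right scaleR_left_distrib distrib_left sum.distrib scaleR_sum_right mult.left_commute)
  have b_iff: "C *v x = b x" if C: "\<And>v. v \<in> E \<Longrightarrow> C *v v = s v *\<^sub>R v" for C x
  proof -
    have "C *v x = C *v (\<Sum>v\<in>E. (v \<bullet> x) *\<^sub>R v)" using rep[of x] by simp
    also have "\<dots> = (\<Sum>v\<in>E. (v \<bullet> x) *\<^sub>R (C *v v))"
      by (simp add: matrix_vector_mult_scaleR linear_sum[OF matrix_vector_mul_linear])
    also have "\<dots> = b x" unfolding b_def by (rule sum.cong) (simp_all add: C)
    finally show ?thesis .
  qed
  have root: "C *v v = s v *\<^sub>R v" if C: "transpose C = C" "\<forall>x. 0 \<le> x \<bullet> (C *v x)" "C ** C = A" and v: "v \<in> E" for C v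
  proof -
    define w where "w = C *v v - s v *\<^sub>R v"
    have "C *v (C *v v) = (s v)\<^sup>2 *\<^sub>R v" using C(3) s(2)[OF v] by (simp add: matrix_vector_mul_assoc)
    then have "C *v w = - s v *\<^sub>R w"
      by (simp add: w_def matrix_vector_mult_diff_distrib matrix_vector_mult_scaleR algebra_simps power2_eq_square)
    then have "w \<bullet> (C *v w) = - (s v * (w \<bullet> w))" by simp
    then have "s v * (w \<bullet> w) \<le> 0" using C(2)[rule_format, of w] by simp
    then have "w \<bullet> w \<le> 0" using s(1)[OF v] by (simp add: mult_le_0_iff)
    then have "w \<bullet> w = 0" using inner_ge_zero[of w] by (rule order_antisym)
    then have "w = 0" by (simp only: inner_eq_zero_iff)
    then show ?thesis by (simp add: w_def)
  qed
  define B where "B = matrix b"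
  have Bb: "B *v x = b x" for x unfolding B_def by (rule fun_cong[OF matrix_vector_mul(2)[OF lb]])
  have bs: "b x \<bullet> y = x \<bullet> b y" for x y
    by (simp add: b_def inner_sum_left inner_sum_right inner_commute mult_ac)
  have tB: "transpose B = B"
  proof -
    have "x \<bullet> (transpose B *v y) = x \<bullet> (B *v y)" for x y
      using bs[of y x] by (metis Bb dot_lmul_matrix inner_commute transpose_matrix_vector)
    then have "transpose B *v y = B *v y" for y by (metis vector_eq_ldot)
    then show ?thesis by (simp add: matrix_eq)
  qed
  have pB: "0 \<le> x \<bullet> (B *v x)" for x
    unfolding Bb b_def inner_sum_right using s(1)
    by (intro sum_nonneg) (simp add: inner_commute mult.assoc less_imp_le)
  have ev: "b v = s v *\<^sub>R v" if v: "v \<in> E" for v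
  proof -
    have "s w * (w \<bullet> v) = s v * (w \<bullet> v)" if w: "w \<in> E" for w
    proof -
      have "(s w)\<^sup>2 * (w \<bullet> v) = (s v)\<^sup>2 * (w \<bullet> v)"
        using symmetric_matrix_inner[OF sym, of w v] s(2)[OF w] s(2)[OF v] by simp
      then show ?thesis using s(1)[OF w] s(1)[OF v] by (auto simp: power2_eq_iff)
    qed
    then have "b v = (\<Sum>w\<in>E. s v *\<^sub>R ((w \<bullet> v) *\<^sub>R w))" unfolding b_def by (intro sum.cong) auto
    also have "\<dots> = s v *\<^sub>R (\<Sum>w\<in>E. (w \<bullet> v) *\<^sub>R w)" by (simp only: scaleR_sum_right)
    also have "(\<Sum>w\<in>E. (w \<bullet> v) *\<^sub>R w) = v" by (rule rep[symmetric])
    finally show ?thesis .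
  qed
  have BB: "B ** B = A"
  proof -
    have "(B ** B) *v x = A *v x" for x
    proof -
      have "(B ** B) *v x = b (b x)" by (simp add: matrix_vector_mul_assoc[symmetric] Bb)
      also have "\<dots> = (\<Sum>v\<in>E. (s v * (v \<bullet> x)) *\<^sub>R b v)"
        by (subst (2) b_def) (simp add: linear_sum[OF lb] linear_scale[OF lb])
      also have "\<dots> = (\<Sum>v\<in>E. (v \<bullet> x) *\<^sub>R (A *v v))"
        by (rule sum.cong) (simp_all add: ev s(2) power2_eq_square mult_ac)
      also have "\<dots> = A *v (\<Sum>v\<in>E. (v \<bullet> x) *\<^sub>R v)"
        by (simp add: matrix_vector_mult_scaleR linear_sum[OF matrix_vector_mul_linear])
      also have "\<dots> = A *v x" using rep[of x] by simp
      finally show ?thesis .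
    qed
    then show ?thesis by (simp add: matrix_eq)
  qed
  have "psd_sqrt A = B" unfolding psd_sqrt_def
  proof (rule the_equality)
    show "transpose B = B \<and> (\<forall>x. 0 \<le> x \<bullet> (B *v x)) \<and> B ** B = A" using tB pB BB by blast
    fix C assume "transpose C = C \<and> (\<forall>x. 0 \<le> x \<bullet> (C *v x)) \<and> C ** C = A"
    then have "C *v x = B *v x" for x unfolding Bb using b_iff[OF root] by blast
    then show "C = B" by (simp add: matrix_eq)
  qed
  moreover have "invertible B"
  proof -
    have "inj ((*v) B)"
    proof (rule linear_injective_0[THEN iffD2, OF matrix_vector_mul_linear], intro allI impI)
      fix x assume "B *v x = 0"
      then have "A *v x = 0" using BB by (metis matrix_vector_mul_assoc matrix_vector_mult_0_right)
      then show "x = 0" using pos[of x] by auto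
    qed
    then show ?thesis using matrix_left_invertible_injective invertible_left_inverse by blast
  qed
  ultimately show "transpose (psd_sqrt A) = psd_sqrt A" "psd_sqrt A ** psd_sqrt A = A" "invertible (psd_sqrt A)"
    using tB BB by auto
qed

text \<open>The inequality and its equality case come from expanding the square of \<open>B g + B\<^sup>-\<^sup>1 w\<close>, whose cross
  term is \<open>g \<bullet> w\<close>.\<close>

lemma psd_sqrt_young:
  fixes A :: "real^'d^'d"
  assumes sym: "transpose A = A" and pos: "\<And>x. x \<noteq> 0 \<Longrightarrow> 0 < x \<bullet> (A *v x)"
  defines "B \<equiv> psd_sqrt A"
  shows "(norm (B *v g))\<^sup>2 = g \<bullet> (A *v g)"
    and "- 2 * (g \<bullet> w) \<le> (norm (B *v g))\<^sup>2 + (norm (matrix_inv B *v w))\<^sup>2"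
    and "w = - (A *v g) \<Longrightarrow> (norm (B *v g))\<^sup>2 + (norm (matrix_inv B *v w))\<^sup>2 = - 2 * (g \<bullet> w)"
proof -
  note B = psd_sqrt_properties[OF sym pos, folded B_def]
  have inv: "B ** matrix_inv B = mat 1" "matrix_inv B ** B = mat 1"
    using B(3) someI_ex[of "\<lambda>A'. B ** A' = mat 1 \<and> A' ** B = mat 1"] by (auto simp: invertible_def matrix_inv_def)
  show "(norm (B *v g))\<^sup>2 = g \<bullet> (A *v g)"
    using symmetric_matrix_inner[OF B(1), of g "B *v g"] B(2)
    by (simp add: dot_square_norm[symmetric] matrix_vector_mul_assoc)
  have cross: "(B *v g) \<bullet> (matrix_inv B *v w) = g \<bullet> w"
    using symmetric_matrix_inner[OF B(1), of g "matrix_inv B *v w"] inv(1) by (simp add: matrix_vector_mul_assoc)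
  have sq: "(norm (B *v g + matrix_inv B *v w))\<^sup>2 = (norm (B *v g))\<^sup>2 + (norm (matrix_inv B *v w))\<^sup>2 + 2 * (g \<bullet> w)"
    unfolding dot_square_norm[symmetric] using cross by (simp add: inner_add_left inner_add_right inner_commute)
  show "- 2 * (g \<bullet> w) \<le> (norm (B *v g))\<^sup>2 + (norm (matrix_inv B *v w))\<^sup>2"
    using sq zero_le_power2[of "norm (B *v g + matrix_inv B *v w)"] by linarith
  show "(norm (B *v g))\<^sup>2 + (norm (matrix_inv B *v w))\<^sup>2 = - 2 * (g \<bullet> w)" if w: "w = - (A *v g)"
  proof -
    have "matrix_inv B *v (A *v g) = (matrix_inv B ** B) *v (B *v g)"
      using B(2) by (metis matrix_vector_mul_assoc)
    also have "\<dots> = B *v g" by (simp add: inv(2))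
    finally have "matrix_inv B *v w = - (B *v g)"
      unfolding w using matrix_vector_mult_diff_distrib[of "matrix_inv B" 0 "A *v g"] by simp
    then show ?thesis using sq by simp
  qed
qed

context mesh
begin

lemma sum_indicator_interior:
  fixes f :: "(real^'d) set \<Rightarrow> 'b::real_vector"
  assumes "T \<in> \<T>" "x \<in> interior T"
  shows "(\<Sum>T'\<in>\<T>. indicator (interior T') x *\<^sub>R f T') = f T"
proof -
  have "x \<notin> interior T'" if "T' \<in> \<T>" "T' \<noteq> T" for T'
    using interior_point_unique[OF assms(1) that(1) assms(2)] that(2) interior_subset by blast
  then have "(\<Sum>T'\<in>\<T>. indicator (interior T') x *\<^sub>R f T') = (\<Sum>T'\<in>\<T>. if T' = T then f T else 0)"
    using assms by (intro sum.cong refl) simp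
  then show ?thesis using assms finite_mesh by simp
qed

lemma elem_proj_interior:
  assumes T: "T \<in> \<T>" and x: "x \<in> interior T"
  shows "elem_proj \<T> f x = (1 / measure lebesgue T) *\<^sub>R (LINT y:T|lebesgue. f y)"
  unfolding elem_proj_def by (rule sum_indicator_interior[OF T x])

text \<open>Polarization turns the upper bound on the quadratic form into a bound on the entries, which makes \<open>K\<close>
  integrable; symmetry and the lower bound then pass to the mean value.\<close>

lemma mean_symmetric_positive:
  fixes K :: "real^'d \<Rightarrow> real^'d^'d"
  assumes T: "T \<in> \<T>" and K: "K \<in> borel_measurable (lebesgue_on \<Omega>)"
      "\<forall>x\<in>\<Omega>. transpose (K x) = K x" "0 < k0"
      "\<forall>x\<in>\<Omega>. \<forall>\<xi>. k0 * (norm \<xi>)\<^sup>2 \<le> \<xi> \<bullet> (K x *v \<xi>) \<and> \<xi> \<bullet> (K x *v \<xi>) \<le> k1 * (norm \<xi>)\<^sup>2"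
  defines "A \<equiv> (1 / measure lebesgue T) *\<^sub>R (LINT y:T|lebesgue. K y)"
  shows "transpose A = A" "\<And>\<xi>. \<xi> \<noteq> 0 \<Longrightarrow> 0 < \<xi> \<bullet> (A *v \<xi>)"
proof -
  have \<Omega>l: "\<Omega> \<inter> space lebesgue \<in> sets lebesgue" using open_domain by simp
  have mT: "measure lebesgue T > 0" by (rule measure_full_simplex_pos[OF full[OF T]])
  have cT: "compact T" using compact_full_simplex[OF full[OF T]] by simp
  have KT: "x \<in> \<Omega>" if "x \<in> interior T" for x using that interior_subset_domain[OF T] by blast
  have entry: "\<xi> \<bullet> (M *v \<zeta>) = (\<Sum>i\<in>UNIV. \<Sum>j\<in>UNIV. \<xi> $ i * \<zeta> $ j * M $ i $ j)" for \<xi> \<zeta> and M :: "real^'d^'d"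
    by (simp add: inner_vec_def matrix_vector_mult_def sum_distrib_left mult_ac)
  have ax: "axis i 1 \<bullet> (M *v axis j 1) = M $ i $ j" for i j and M :: "real^'d^'d"
    by (simp add: inner_axis' matrix_vector_mult_basis column_def)
  have bnd: "norm (K x) \<le> real CARD('d) * (real CARD('d) * k1)" if x: "x \<in> \<Omega>" for x
  proof -
    have sy: "K x $ i $ j = K x $ j $ i" for i j
    proof -
      have "transpose (K x) $ i $ j = K x $ j $ i" by (simp add: transpose_def)
      then show ?thesis using K(2) x by simp
    qed
    have q: "0 \<le> \<xi> \<bullet> (K x *v \<xi>)" "\<xi> \<bullet> (K x *v \<xi>) \<le> k1 * (norm \<xi>)\<^sup>2" for \<xi>
      using K(3,4) x by (auto intro: order_trans[of 0 "k0 * (norm \<xi>)\<^sup>2"])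
    have e: "\<bar>K x $ i $ j\<bar> \<le> k1" for i j
    proof (cases "i = j")
      case True
      then show ?thesis using q[of "axis i 1"] by (simp add: ax)
    next
      case False
      have n: "(norm (axis i 1 + c *\<^sub>R axis j (1::real)))\<^sup>2 = 1 + c\<^sup>2" for c
        unfolding dot_square_norm[symmetric] using False
        by (simp add: inner_add_left inner_add_right inner_axis_axis power2_eq_square)
      have v: "(axis i 1 + c *\<^sub>R axis j 1) \<bullet> (K x *v (axis i 1 + c *\<^sub>R axis j 1))
        = K x $ i $ i + 2 * c * (K x $ i $ j) + c\<^sup>2 * (K x $ j $ j)" for c
        by (simp add: matrix_vector_right_distrib matrix_vector_mult_scaleR inner_add_left inner_add_right ax sy[of j i] power2_eq_square algebra_simps)
      have "0 \<le> K x $ i $ i" "0 \<le> K x $ j $ j" using q(1)[of "axis i 1"] q(1)[of "axis j 1"] by (simp_all add: ax)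
      then show ?thesis using q(2)[of "axis i 1 + 1 *\<^sub>R axis j 1"] q(2)[of "axis i 1 + (-1) *\<^sub>R axis j 1"]
        unfolding n v by simp
    qed
    have "norm (K x) \<le> (\<Sum>i\<in>UNIV. norm (K x $ i))" unfolding norm_vec_def[of "K x"] by (rule L2_set_le_sum) simp
    also have "\<dots> \<le> (\<Sum>i\<in>(UNIV::'d set). \<Sum>j\<in>(UNIV::'d set). k1)"
      by (intro sum_mono order_trans[OF norm_le_l1_cart]) (use e in auto)
    finally show ?thesis by simp
  qed
  define F where "F y = indicator (interior T) y *\<^sub>R K y" for y
  have "(\<lambda>y. indicator \<Omega> y *\<^sub>R K y) \<in> borel_measurable lebesgue"
    using K(1) by (simp add: borel_measurable_restrict_space_iff[OF \<Omega>l])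
  from borel_measurable_scaleR[OF borel_measurable_indicator this]
  have "(\<lambda>y. indicator (interior T) y *\<^sub>R (indicator \<Omega> y *\<^sub>R K y)) \<in> borel_measurable lebesgue"
    by simp
  moreover have "(\<lambda>y. indicator (interior T) y *\<^sub>R (indicator \<Omega> y *\<^sub>R K y)) = F"
    using KT by (auto simp: F_def fun_eq_iff indicator_def)
  ultimately have Fm: "F \<in> borel_measurable lebesgue" by simp
  have iF: "integrable lebesgue F"
  proof -
    have "integrable lebesgue (\<lambda>y. indicator T y *\<^sub>R F y)"
    proof (rule integrableI_bounded_set_indicator[OF _ Fm])
      show "T \<in> sets lebesgue" "emeasure lebesgue T < \<infinity>" using lmeasurable_compact[OF cT] by (auto simp: fmeasurable_def)
      show "AE y in lebesgue. y \<in> T \<longrightarrow> norm (F y) \<le> real CARD('d) * (real CARD('d) * \<bar>k1\<bar>)"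
      proof (intro always_eventually allI impI)
        fix y
        show "norm (F y) \<le> real CARD('d) * (real CARD('d) * \<bar>k1\<bar>)"
        proof (cases "y \<in> interior T")
          case True
          have "real CARD('d) * (real CARD('d) * k1) \<le> real CARD('d) * (real CARD('d) * \<bar>k1\<bar>)"
            by (intro mult_left_mono) auto
          with bnd[OF KT[OF True]] have "norm (K y) \<le> real CARD('d) * (real CARD('d) * \<bar>k1\<bar>)" by (rule order_trans)
          then show ?thesis using True by (simp add: F_def)
        qed (simp add: F_def)
      qed
    qed
    moreover have "(\<lambda>y. indicator T y *\<^sub>R F y) = F" using interior_subset by (auto simp: F_def fun_eq_iff indicator_def)
    ultimately show ?thesis by simp
  qed
  have ae: "AE y in lebesgue. F y = indicator T y *\<^sub>R K y"
  proof (rule AE_I'[of "T - interior T"])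
    have "T - interior T \<subseteq> (\<Union>T\<in>\<T>. T - interior T)" using T by blast
    then have "negligible (T - interior T)" using element_boundaries_negligible negligible_subset by blast
    then show "T - interior T \<in> null_sets lebesgue" by (simp add: negligible_iff_null_sets)
    show "{y \<in> space lebesgue. F y \<noteq> indicator T y *\<^sub>R K y} \<subseteq> T - interior T"
      using interior_subset by (auto simp: F_def indicator_def)
  qed
  have AF: "A = (1 / measure lebesgue T) *\<^sub>R (\<integral>y. F y \<partial>lebesgue)"
    unfolding A_def set_lebesgue_integral_def using completion_integral_AE_cong(2)[OF iF ae] by simp
  have bl: "bounded_linear (\<lambda>M::real^'d^'d. \<xi> \<bullet> (M *v \<zeta>))" for \<xi> \<zeta>
    unfolding linear_conv_bounded_linear[symmetric]
    by (rule linearI) (simp_all add: matrix_vector_mult_add_rdistrib inner_add_right scaleR_matrix_vector_assoc[symmetric])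
  have comm: "\<xi> \<bullet> (A *v \<zeta>) = (1 / measure lebesgue T) * (\<integral>y. \<xi> \<bullet> (F y *v \<zeta>) \<partial>lebesgue)" for \<xi> \<zeta>
    unfolding AF integral_bounded_linear[OF bl iF]
    by (simp add: scaleR_matrix_vector_assoc[symmetric])
  have Fs: "\<xi> \<bullet> (F y *v \<zeta>) = \<zeta> \<bullet> (F y *v \<xi>)" for \<xi> \<zeta> y
  proof (cases "y \<in> interior T")
    case True
    then show ?thesis using symmetric_matrix_inner[of "K y" \<zeta> \<xi>] K(2) KT[OF True] by (simp add: F_def inner_commute)
  qed (simp add: F_def)
  have "A $ i $ j = A $ j $ i" for i j
    using comm[of "axis i 1" "axis j 1"] comm[of "axis j 1" "axis i 1"] Fs[of "axis i 1" _ "axis j 1"] by (simp add: ax)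
  then show "transpose A = A" by (simp add: transpose_def vec_eq_iff)
  show "0 < \<xi> \<bullet> (A *v \<xi>)" if \<xi>: "\<xi> \<noteq> 0" for \<xi>
  proof -
    have iT: "interior T \<in> lmeasurable" using cT by (simp add: compact_imp_bounded bounded_subset[OF _ interior_subset] lmeasurable_open)
    have mi: "measure lebesgue (interior T) > 0"
    proof -
      have "\<not> negligible (interior T)" using compact_full_simplex(3)[OF full[OF T]] open_not_negligible by blast
      then show ?thesis using iT by (simp add: negligible_iff_measure zero_less_measure_iff)
    qed
    have "0 < k0 * (norm \<xi>)\<^sup>2 * measure lebesgue (interior T)" using K(3) \<xi> mi by simp
    also have "\<dots> = (\<integral>y. indicator (interior T) y * (k0 * (norm \<xi>)\<^sup>2) \<partial>lebesgue)" using iT by simp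
    also have "\<dots> \<le> (\<integral>y. \<xi> \<bullet> (F y *v \<xi>) \<partial>lebesgue)"
    proof (rule integral_mono)
      show "integrable lebesgue (\<lambda>y. indicat_real (interior T) y * (k0 * (norm \<xi>)\<^sup>2))"
        using iT by (auto simp: fmeasurable_def intro!: integrable_mult_left integrable_real_indicator)
      show "integrable lebesgue (\<lambda>y. \<xi> \<bullet> (F y *v \<xi>))" by (rule integrable_bounded_linear[OF bl iF])
      show "indicat_real (interior T) y * (k0 * (norm \<xi>)\<^sup>2) \<le> \<xi> \<bullet> (F y *v \<xi>)" for y
        using K(4) KT[of y] by (cases "y \<in> interior T") (auto simp: F_def)
    qed
    finally show ?thesis unfolding comm using mT by simp
  qed
qed

end

section \<open>Crouzeix-Raviart functions and their facet values\<close>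

text \<open>The function \<open>1 - d * bary T S x\<close> is \<open>1\<close> on \<open>S\<close> and \<open>0\<close> at the barycenters of the other facets.\<close>

lemma affine_from_facet_values:
  fixes T :: "(real^'d) set"
  assumes T: "full_simplex T"
  shows "g \<bullet> x + c = (\<Sum>S | S facet_of T. (g \<bullet> barycenter S + c) * (1 - real CARD('d) * bary T S x))"
proof -
  let ?F = "{S. S facet_of T}" and ?d = "real CARD('d)"
  define q where "q y = g \<bullet> y + c" for y
  define Q where "Q = (\<Sum>S\<in>?F. q (opp T S))"
  have v: "q (opp T S) = Q - ?d * q (barycenter S)" if "S \<in> ?F" for S
    using affine_barycenter_facet[OF T, of S g c] that finite_facets[OF T] by (simp add: Q_def q_def sum.remove[of _ S])
  have "Q = (\<Sum>S\<in>?F. Q - ?d * q (barycenter S))" unfolding Q_def by (rule sum.cong) (use v in \<open>auto simp: Q_def\<close>)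
  also have "\<dots> = (?d + 1) * Q - ?d * (\<Sum>S\<in>?F. q (barycenter S))"
    by (simp add: sum_subtractf card_facets[OF T] sum_distrib_left algebra_simps)
  finally have "?d * (\<Sum>S\<in>?F. q (barycenter S)) = ?d * Q" by (simp add: algebra_simps)
  then have Q: "(\<Sum>S\<in>?F. q (barycenter S)) = Q" by simp
  have "g \<bullet> x + c = (\<Sum>S\<in>?F. bary T S x * q (opp T S))" unfolding q_def by (rule affine_eq_sum_bary[OF T])
  also have "\<dots> = (\<Sum>S\<in>?F. bary T S x * Q - ?d * (q (barycenter S) * bary T S x))"
  proof (rule sum.cong[OF refl])
    fix S assume S: "S \<in> ?F"
    show "bary T S x * q (opp T S) = bary T S x * Q - ?d * (q (barycenter S) * bary T S x)"
      unfolding v[OF S] by (simp add: algebra_simps)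
  qed
  also have "\<dots> = Q - ?d * (\<Sum>S\<in>?F. q (barycenter S) * bary T S x)"
    by (simp add: sum_subtractf sum_distrib_right[symmetric] sum_distrib_left[symmetric] sum_bary[OF T])
  also have "\<dots> = (\<Sum>S\<in>?F. q (barycenter S) * (1 - ?d * bary T S x))"
    unfolding Q[symmetric] by (simp add: right_diff_distrib sum_subtractf sum_distrib_left mult_ac)
  finally show ?thesis by (simp add: q_def)
qed

context mesh
begin

definition elem :: "(real^'d) set \<Rightarrow> (real^'d) set" where
  "elem S = (SOME T. T \<in> \<T> \<and> S facet_of T)"

lemma elem: "S \<in> facets \<T> \<Longrightarrow> elem S \<in> \<T> \<and> S facet_of elem S"
  unfolding elem_def facets_def by (rule someI_ex) blast

lemma boundary_elem:
  assumes "S \<in> boundary_facets \<T> \<Omega>"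
  shows "{T \<in> \<T>. S facet_of T} = {elem S}" "elem S \<in> \<T>" "S facet_of elem S" "S \<in> facets \<T>"
proof -
  show S: "S \<in> facets \<T>" using assms by (simp add: boundary_facets_def)
  show "elem S \<in> \<T>" "S facet_of elem S" using elem[OF S] by auto
  obtain T where "{T \<in> \<T>. S facet_of T} = {T}" by (rule boundary_facet_unique[OF assms])
  then show "{T \<in> \<T>. S facet_of T} = {elem S}" using elem[OF S] by auto
qed

text \<open>The same facet value is required from every adjacent element, which expresses continuity at the
  barycenters of interior facets.\<close>

definition cr_rep :: "(real^'d \<Rightarrow> real) \<Rightarrow> ((real^'d) set \<Rightarrow> real^'d) \<Rightarrow> ((real^'d) set \<Rightarrow> real)
    \<Rightarrow> ((real^'d) set \<Rightarrow> real) \<Rightarrow> bool" where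
  "cr_rep q g c \<xi> \<longleftrightarrow> (\<forall>T\<in>\<T>. (\<forall>x\<in>interior T. q x = g T \<bullet> x + c T)
     \<and> (\<forall>S. S facet_of T \<longrightarrow> g T \<bullet> barycenter S + c T = \<xi> S))"

definition cr_grad :: "((real^'d) set \<Rightarrow> real) \<Rightarrow> (real^'d) set \<Rightarrow> real^'d" where
  "cr_grad \<xi> T = - (real CARD('d) *\<^sub>R (\<Sum>S | S facet_of T. \<xi> S *\<^sub>R bary_grad T S))"

definition cr_off :: "((real^'d) set \<Rightarrow> real) \<Rightarrow> (real^'d) set \<Rightarrow> real" where
  "cr_off \<xi> T = (\<Sum>S | S facet_of T. \<xi> S * (1 - real CARD('d) * bary T S 0))"

definition cr_fun :: "((real^'d) set \<Rightarrow> real) \<Rightarrow> real^'d \<Rightarrow> real" where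
  "cr_fun \<xi> x = (\<Sum>T\<in>\<T>. indicator (interior T) x * (cr_grad \<xi> T \<bullet> x + cr_off \<xi> T))"

lemma cr_affine: "cr_grad \<xi> T \<bullet> x + cr_off \<xi> T = (\<Sum>S | S facet_of T. \<xi> S * (1 - real CARD('d) * bary T S x))"
proof -
  have "(\<Sum>S | S facet_of T. \<xi> S * (1 - real CARD('d) * bary T S x))
      = (\<Sum>S | S facet_of T. \<xi> S * (1 - real CARD('d) * bary T S 0) - real CARD('d) * (\<xi> S * (bary_grad T S \<bullet> x)))"
    by (rule sum.cong) (simp_all add: bary_affine[of T _ x 0] algebra_simps)
  then show ?thesis
    by (simp add: cr_grad_def cr_off_def sum_subtractf inner_sum_left sum_distrib_left)
qed

lemma cr_rep_cr_fun: "cr_rep (cr_fun \<xi>) (cr_grad \<xi>) (cr_off \<xi>) \<xi>"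
  unfolding cr_rep_def
proof (intro ballI conjI allI impI)
  fix T assume T: "T \<in> \<T>"
  show "cr_fun \<xi> x = cr_grad \<xi> T \<bullet> x + cr_off \<xi> T" if "x \<in> interior T" for x
    using sum_indicator_interior[OF T that, of "\<lambda>T. cr_grad \<xi> T \<bullet> x + cr_off \<xi> T"] by (simp add: cr_fun_def)
  show "cr_grad \<xi> T \<bullet> barycenter S + cr_off \<xi> T = \<xi> S" if S: "S facet_of T" for S
  proof -
    have "cr_grad \<xi> T \<bullet> barycenter S + cr_off \<xi> T = (\<Sum>R | R facet_of T. if R = S then \<xi> S else 0)"
      unfolding cr_affine by (rule sum.cong) (auto simp: bary_barycenter_facet[OF full[OF T] S])
    then show ?thesis using S finite_facets[OF full[OF T]] by simp
  qed
qed

lemma cr_rep_unique: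
  assumes q: "cr_rep q g c \<xi>" and T: "T \<in> \<T>"
  shows "g T = cr_grad \<xi> T" "c T = cr_off \<xi> T"
proof -
  have eq: "g T \<bullet> x + c T = cr_grad \<xi> T \<bullet> x + cr_off \<xi> T" for x
    unfolding cr_affine affine_from_facet_values[OF full[OF T], of "g T" x "c T"]
    by (rule sum.cong) (use q T in \<open>auto simp: cr_rep_def\<close>)
  from eq[of 0] show c: "c T = cr_off \<xi> T" by simp
  have "g T \<bullet> x = cr_grad \<xi> T \<bullet> x" for x using eq[of x] c by simp
  then show "g T = cr_grad \<xi> T" by (metis vector_eq_rdot)
qed

lemma cr_rep_cr: "cr_rep q g c \<xi> \<Longrightarrow> cr_rep q (cr_grad \<xi>) (cr_off \<xi>) \<xi>"
proof -
  assume q: "cr_rep q g c \<xi>"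
  have "\<forall>T\<in>\<T>. g T = cr_grad \<xi> T \<and> c T = cr_off \<xi> T" using cr_rep_unique[OF q] by simp
  with q show "cr_rep q (cr_grad \<xi>) (cr_off \<xi>) \<xi>" unfolding cr_rep_def by simp
qed

lemma isCont_affine: "isCont (\<lambda>x. a \<bullet> x + b) x" for a :: "real^'d" and b :: real
  by (intro continuous_intros)

lemma isCont_rt: "isCont (\<lambda>x. a + b *\<^sub>R x) x" for a :: "real^'d" and b :: real
  by (intro continuous_intros)

lemma cr_rep_facet_value:
  assumes q: "cr_rep q g c \<xi>" and S: "S \<in> facets \<T>"
  shows "(q \<longlongrightarrow> \<xi> S) (at (barycenter S) within element_interiors \<T>)"
    "facet_value \<T> q (barycenter S) = \<xi> S"
proof -
  obtain T where T: "T \<in> \<T>" "S facet_of T" using S by (auto simp: facets_def)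
  note b = barycenter_in_rel_interior[OF full[OF T(1)] T(2)]
  have f: "isCont (\<lambda>x. g T \<bullet> x + c T) (barycenter S) \<and> g T \<bullet> barycenter S + c T = \<xi> S
      \<and> (\<forall>y\<in>interior T. q y = g T \<bullet> y + c T)" if "T \<in> \<T>" "S facet_of T" for T
    using q that by (auto simp: cr_rep_def isCont_affine)
  show "(q \<longlongrightarrow> \<xi> S) (at (barycenter S) within element_interiors \<T>)"
    by (rule tendsto_facet_value[OF T(2,1) b, where f="\<lambda>T x. g T \<bullet> x + c T"]) (rule f)
  show "facet_value \<T> q (barycenter S) = \<xi> S"
    by (rule facet_value_eq[OF T(2,1) b, where f="\<lambda>T x. g T \<bullet> x + c T"]) (rule f)
qed

lemma cr_fun_CR1: "cr_fun \<xi> \<in> CR1 \<T> \<Omega>"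
  unfolding CR1_def
proof (intro CollectI conjI ballI allI impI)
  fix T assume "T \<in> \<T>"
  then have "\<forall>x\<in>interior T. cr_fun \<xi> x = cr_grad \<xi> T \<bullet> x + cr_off \<xi> T"
    using cr_rep_cr_fun[of \<xi>] unfolding cr_rep_def by blast
  then show "\<exists>a b. \<forall>x\<in>interior T. cr_fun \<xi> x = a \<bullet> x + b" by blast
next
  fix S assume "S \<in> facets \<T> - boundary_facets \<T> \<Omega>"
  then show "\<exists>l. (cr_fun \<xi> \<longlongrightarrow> l) (at (barycenter S) within element_interiors \<T>)"
    using cr_rep_facet_value(1)[OF cr_rep_cr_fun] by blast
next
  fix x assume "x \<notin> element_interiors \<T>"
  then show "cr_fun \<xi> x = 0" unfolding cr_fun_def element_interiors_def by (intro sum.neutral) auto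
qed

lemma CR1_rep:
  assumes q: "q \<in> CR1 \<T> \<Omega>"
  shows "\<exists>\<xi>. cr_rep q (cr_grad \<xi>) (cr_off \<xi>) \<xi>"
proof -
  have "\<forall>T\<in>\<T>. \<exists>a b. \<forall>x\<in>interior T. q x = a \<bullet> x + b" using q by (simp add: CR1_def)
  then obtain g c where gc: "\<And>T x. T \<in> \<T> \<Longrightarrow> x \<in> interior T \<Longrightarrow> q x = g T \<bullet> x + c T" by metis
  have "\<exists>l. \<forall>T. T \<in> \<T> \<longrightarrow> S facet_of T \<longrightarrow> g T \<bullet> barycenter S + c T = l" for S
  proof (cases "S \<in> facets \<T>")
    case S: True
    show ?thesis
    proof (cases "S \<in> boundary_facets \<T> \<Omega>")
      case True
      have "T = elem S" if "T \<in> \<T>" "S facet_of T" for T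
      proof -
        have "T \<in> {T \<in> \<T>. S facet_of T}" using that by simp
        then show ?thesis unfolding boundary_elem(1)[OF True] by simp
      qed
      then show ?thesis by metis
    next
      case False
      then obtain l where l: "(q \<longlongrightarrow> l) (at (barycenter S) within element_interiors \<T>)"
      proof -
        have "\<forall>S\<in>facets \<T> - boundary_facets \<T> \<Omega>. \<exists>l. (q \<longlongrightarrow> l) (at (barycenter S) within element_interiors \<T>)"
          using q unfolding CR1_def by blast
        moreover have "S \<in> facets \<T> - boundary_facets \<T> \<Omega>" using S False by simp
        ultimately have "\<exists>l. (q \<longlongrightarrow> l) (at (barycenter S) within element_interiors \<T>)" by (rule bspec)
        then show ?thesis using that by blast
      qed
      have "g T \<bullet> barycenter S + c T = l" if T: "T \<in> \<T>" "S facet_of T" for T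
        by (rule tendsto_facet_value_unique[OF T barycenter_in_rel_interior[OF full[OF T(1)] T(2)] l isCont_affine, symmetric])
          (rule gc[OF T(1)])
      then show ?thesis by blast
    qed
  qed (auto simp: facets_def)
  then obtain \<xi> where "\<And>S T. T \<in> \<T> \<Longrightarrow> S facet_of T \<Longrightarrow> g T \<bullet> barycenter S + c T = \<xi> S" by metis
  then have "cr_rep q g c \<xi>" using gc by (auto simp: cr_rep_def)
  then show ?thesis using cr_rep_cr by blast
qed

lemma CR_basis_eq:
  assumes S: "S \<in> facets \<T>"
  shows "CR_basis \<T> \<Omega> S = cr_fun (\<lambda>R. if R = S then 1 else 0)"
  unfolding CR_basis_def
proof (rule the_equality)
  let ?\<delta> = "\<lambda>R. if R = S then 1 else (0::real)"
  show "cr_fun ?\<delta> \<in> CR1 \<T> \<Omega> \<and> (\<forall>S'\<in>facets \<T>. facet_value \<T> (cr_fun ?\<delta>) (barycenter S') = (if S' = S then 1 else 0))"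
    using cr_fun_CR1 cr_rep_facet_value(2)[OF cr_rep_cr_fun] by simp
  fix \<phi> assume \<phi>: "\<phi> \<in> CR1 \<T> \<Omega> \<and> (\<forall>S'\<in>facets \<T>. facet_value \<T> \<phi> (barycenter S') = (if S' = S then 1 else 0))"
  then obtain \<xi> where \<xi>: "cr_rep \<phi> (cr_grad \<xi>) (cr_off \<xi>) \<xi>" using CR1_rep by blast
  have e: "\<xi> R = ?\<delta> R" if "R \<in> facets \<T>" for R using cr_rep_facet_value(2)[OF \<xi> that] \<phi> that by simp
  show "\<phi> = cr_fun ?\<delta>"
  proof
    fix x
    show "\<phi> x = cr_fun ?\<delta> x"
    proof (cases "x \<in> element_interiors \<T>")
      case True
      then obtain T where T: "T \<in> \<T>" "x \<in> interior T" by (auto simp: element_interiors_def)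
      have "\<phi> x = cr_grad \<xi> T \<bullet> x + cr_off \<xi> T" using \<xi> T by (simp add: cr_rep_def)
      also have "\<dots> = cr_grad ?\<delta> T \<bullet> x + cr_off ?\<delta> T"
        unfolding cr_affine
      proof (rule sum.cong[OF refl])
        fix R assume "R \<in> {S. S facet_of T}"
        then have "R \<in> facets \<T>" using T by (auto simp: facets_def)
        from e[OF this] show "\<xi> R * (1 - real CARD('d) * bary T R x) = ?\<delta> R * (1 - real CARD('d) * bary T R x)"
          by (simp only:)
      qed
      also have "\<dots> = cr_fun ?\<delta> x" using cr_rep_cr_fun[of ?\<delta>] T by (simp add: cr_rep_def)
      finally show ?thesis .
    next
      case False
      then show ?thesis using \<phi> cr_fun_CR1[of ?\<delta>] by (simp add: CR1_def)
    qed
  qed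
qed

lemma CR_interp_rep:
  obtains \<xi> where "cr_rep (CR_interp \<T> \<Omega> q) (cr_grad \<xi>) (cr_off \<xi>) \<xi>"
proof -
  define \<xi> where "\<xi> S = facet_mean S (trace_on \<Omega> S q)" for S
  have "CR_interp \<T> \<Omega> q x = cr_grad \<xi> T \<bullet> x + cr_off \<xi> T" if T: "T \<in> \<T>" "x \<in> interior T" for T x
  proof -
    have "CR_interp \<T> \<Omega> q x = (\<Sum>R\<in>facets \<T>. \<xi> R * (\<Sum>S | S facet_of T. (if S = R then 1 else 0) * (1 - real CARD('d) * bary T S x)))"
      unfolding CR_interp_def \<xi>_def
    proof (rule sum.cong[OF refl])
      fix R assume R: "R \<in> facets \<T>"
      have "cr_fun (\<lambda>S. if S = R then 1 else 0) x = (\<Sum>S | S facet_of T. (if S = R then 1 else 0) * (1 - real CARD('d) * bary T S x))"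
        unfolding cr_affine[symmetric] using cr_rep_cr_fun T by (simp add: cr_rep_def)
      then show "facet_mean R (trace_on \<Omega> R q) * CR_basis \<T> \<Omega> R x
        = facet_mean R (trace_on \<Omega> R q) * (\<Sum>S | S facet_of T. (if S = R then 1 else 0) * (1 - real CARD('d) * bary T S x))"
        by (simp only: CR_basis_eq[OF R])
    qed
    also have "\<dots> = (\<Sum>S | S facet_of T. \<Sum>R\<in>facets \<T>. \<xi> R * ((if S = R then 1 else 0) * (1 - real CARD('d) * bary T S x)))"
      unfolding sum_distrib_left by (rule sum.swap)
    also have "\<dots> = (\<Sum>S | S facet_of T. \<xi> S * (1 - real CARD('d) * bary T S x))"
    proof (rule sum.cong[OF refl])
      fix S assume "S \<in> {S. S facet_of T}"
      then have S: "S \<in> facets \<T>" using T by (auto simp: facets_def)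
      have "(\<Sum>R\<in>facets \<T>. \<xi> R * ((if S = R then 1 else 0) * (1 - real CARD('d) * bary T S x)))
        = (\<Sum>R\<in>facets \<T>. if R = S then \<xi> S * (1 - real CARD('d) * bary T S x) else 0)"
        by (rule sum.cong) auto
      then show "(\<Sum>R\<in>facets \<T>. \<xi> R * ((if S = R then 1 else 0) * (1 - real CARD('d) * bary T S x))) = \<xi> S * (1 - real CARD('d) * bary T S x)"
        using S finite_facets_mesh by simp
    qed
    finally show ?thesis by (simp only: cr_affine)
  qed
  then have "cr_rep (CR_interp \<T> \<Omega> q) (cr_grad \<xi>) (cr_off \<xi>) \<xi>"
    using cr_rep_cr_fun[of \<xi>] by (auto simp: cr_rep_def)
  then show ?thesis by (rule that)
qed

section \<open>Elementwise and facetwise means\<close>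

lemma element_integral_cong:
  fixes h f :: "real^'d \<Rightarrow> 'b::euclidean_space"
  assumes T: "T \<in> \<T>" and h: "\<And>x. x \<in> interior T \<Longrightarrow> h x = f x" and f: "continuous_on UNIV f"
  shows "(LINT x:T|lebesgue. h x) = (LINT x:T|lebesgue. f x)"
proof -
  have "integrable lebesgue (\<lambda>x. indicator T x *\<^sub>R f x)"
    using set_integrable_continuous_compact[OF compact_full_simplex(1)[OF full[OF T]] f] by (simp add: set_integrable_def)
  moreover have "AE x in lebesgue. indicator T x *\<^sub>R f x = indicator T x *\<^sub>R h x"
  proof (rule AE_I'[of "T - interior T"])
    have "T - interior T \<subseteq> (\<Union>T\<in>\<T>. T - interior T)" using T by blast
    then have "negligible (T - interior T)" using element_boundaries_negligible negligible_subset by blast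
    then show "T - interior T \<in> null_sets lebesgue" by (simp add: negligible_iff_null_sets)
    show "{x \<in> space lebesgue. indicator T x *\<^sub>R f x \<noteq> indicator T x *\<^sub>R h x} \<subseteq> T - interior T"
      using h by (auto simp: indicator_def)
  qed
  ultimately show ?thesis unfolding set_lebesgue_integral_def by (rule completion_integral_AE_cong(2))
qed

lemma elem_proj_affine:
  assumes T: "T \<in> \<T>" and q: "\<And>x. x \<in> interior T \<Longrightarrow> q x = g \<bullet> x + c" and x: "x \<in> interior T"
  shows "elem_proj \<T> q x = g \<bullet> barycenter T + c"
proof -
  have "(LINT x:T|lebesgue. q x) = (LINT x:T|lebesgue. g \<bullet> x + c)"
    by (rule element_integral_cong[OF T q]) (auto intro!: continuous_intros)
  then show ?thesis
    using measure_full_simplex_pos[OF full[OF T]]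
    by (simp add: elem_proj_interior[OF T x] integral_affine_simplex[OF full[OF T]])
qed

lemma elem_proj_rt:
  assumes T: "T \<in> \<T>" and v: "\<And>x. x \<in> interior T \<Longrightarrow> v x = a + b *\<^sub>R x" and x: "x \<in> interior T"
  shows "elem_proj \<T> v x = a + b *\<^sub>R barycenter T"
proof -
  have c: "continuous_on UNIV (\<lambda>x. a + b *\<^sub>R x)" by (intro continuous_intros)
  have "(LINT x:T|lebesgue. v x) = (LINT x:T|lebesgue. a + b *\<^sub>R x)"
    by (rule element_integral_cong[OF T v c])
  also have "\<dots> = measure lebesgue T *\<^sub>R (a + b *\<^sub>R barycenter T)"
  proof (rule vector_eq_rdot[THEN iffD1], intro allI)
    fix z
    have "(LINT x:T|lebesgue. a + b *\<^sub>R x) \<bullet> z = (LINT x:T|lebesgue. (b *\<^sub>R z) \<bullet> x + a \<bullet> z)"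
    proof -
      have i: "integrable lebesgue (\<lambda>x. indicator T x *\<^sub>R (a + b *\<^sub>R x))"
        using set_integrable_continuous_compact[OF compact_full_simplex(1)[OF full[OF T]] c] by (simp add: set_integrable_def)
      have "(LINT x:T|lebesgue. a + b *\<^sub>R x) \<bullet> z = (\<integral>x. (indicator T x *\<^sub>R (a + b *\<^sub>R x)) \<bullet> z \<partial>lebesgue)"
        unfolding set_lebesgue_integral_def by (rule integral_inner_left[symmetric]) (use i in blast)
      also have "\<dots> = (LINT x:T|lebesgue. (b *\<^sub>R z) \<bullet> x + a \<bullet> z)"
        unfolding set_lebesgue_integral_def by (rule arg_cong[where f="integral\<^sup>L lebesgue"]) (auto simp: inner_add_left inner_commute algebra_simps)
      finally show ?thesis .
    qed
    also have "\<dots> = measure lebesgue T * ((b *\<^sub>R z) \<bullet> barycenter T + a \<bullet> z)"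
      by (rule integral_affine_simplex[OF full[OF T]])
    finally show "(LINT x:T|lebesgue. a + b *\<^sub>R x) \<bullet> z = (measure lebesgue T *\<^sub>R (a + b *\<^sub>R barycenter T)) \<bullet> z"
      by (simp add: inner_add_left inner_commute[of z])
  qed
  finally show ?thesis
    using measure_full_simplex_pos[OF full[OF T]] by (simp add: elem_proj_interior[OF T x])
qed

lemma broken_grad_affine:
  assumes T: "T \<in> \<T>" and q: "\<And>x. x \<in> interior T \<Longrightarrow> q x = g \<bullet> x + c" and x: "x \<in> interior T"
  shows "broken_grad \<T> q x = g"
proof -
  have "((\<lambda>x. g \<bullet> x + c) has_derivative (\<lambda>h. g \<bullet> h)) (at x)" by (auto intro!: derivative_eq_intros)
  then have "(q has_derivative (\<lambda>h. g \<bullet> h)) (at x)"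
    by (rule has_derivative_transform_within_open[OF _ open_interior x]) (simp add: q)
  then have "frechet_derivative q (at x) = (\<lambda>h. g \<bullet> h)" using frechet_derivative_at by metis
  then have "grad q x = g" by (simp add: grad_def partial_def inner_axis vec_eq_iff)
  moreover have "x \<in> element_interiors \<T>" using T x by (auto simp: element_interiors_def)
  ultimately show ?thesis by (simp add: broken_grad_def)
qed

lemma facet_proj_rel_interior:
  assumes S: "S \<in> facets \<T>" and x: "x \<in> rel_interior S"
  shows "facet_proj \<T> f x = facet_mean S f"
proof -
  have uniq: "S' = S" if S': "S' \<in> facets \<T>" "x \<in> rel_interior S'" for S'
  proof -
    obtain T where "T \<in> \<T>" "S facet_of T" using S by (auto simp: facets_def)
    moreover obtain T' where "T' \<in> \<T>" "S' facet_of T'" using S'(1) by (auto simp: facets_def)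
    moreover have "x \<in> S'" by (rule subsetD[OF rel_interior_subset S'(2)])
    ultimately show ?thesis using facet_point_unique[of S T S' T' x] x by simp
  qed
  have "facet_proj \<T> f x = (\<Sum>S'\<in>facets \<T>. if S' = S then facet_mean S f else 0)"
    unfolding facet_proj_def
  proof (rule sum.cong[OF refl])
    fix S' assume S': "S' \<in> facets \<T>"
    show "indicator (rel_interior S') x * facet_mean S' f = (if S' = S then facet_mean S f else 0)"
    proof (cases "S' = S")
      case False
      then have "x \<notin> rel_interior S'" using uniq[OF S'] by blast
      then show ?thesis using False by simp
    qed (use x in simp)
  qed
  then show ?thesis using S finite_facets_mesh by simp
qed

lemma facet_mean_affine:
  assumes T: "T \<in> \<T>" "S facet_of T" and h: "\<And>x. x \<in> rel_interior S \<Longrightarrow> h x = g \<bullet> x + c"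
  shows "facet_mean S h = g \<bullet> barycenter S + c"
proof -
  have i: "integrable surface (\<lambda>x. indicator S x *\<^sub>R (g \<bullet> x + c))"
    using set_integrable_surface_affine[OF full[OF T(1)] T(2)] by (simp add: set_integrable_def)
  have ae: "AE x in surface. indicator S x *\<^sub>R (g \<bullet> x + c) = indicator S x *\<^sub>R h x"
    by (rule AE_I'[OF relative_boundary_null[OF full[OF T(1)] T(2)]]) (use h in \<open>auto simp: indicator_def\<close>)
  have "(LINT x:S|surface. h x) = (LINT x:S|surface. g \<bullet> x + c)"
    using completion_integral_AE_cong(2)[OF i[unfolded surface_eq_completion] ae[unfolded surface_eq_completion]]
    by (simp add: set_lebesgue_integral_def surface_eq_completion)
  then show ?thesis
    using surface_integral_affine[OF full[OF T(1)] T(2)] surface_measure_facet_pos[OF full[OF T(1)] T(2)]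
    by (simp add: facet_mean_def)
qed

lemma facet_mean_facet_value:
  assumes q: "cr_rep q g c \<xi>" and S: "S \<in> boundary_facets \<T> \<Omega>"
  shows "facet_mean S (facet_value \<T> q) = \<xi> S"
proof -
  note e = boundary_elem[OF S]
  have "facet_value \<T> q x = g (elem S) \<bullet> x + c (elem S)" if "x \<in> rel_interior S" for x
    by (rule facet_value_boundary[OF e(1) that isCont_affine]) (use q e in \<open>auto simp: cr_rep_def\<close>)
  then show ?thesis using facet_mean_affine[OF e(2,3)] q e by (simp add: cr_rep_def)
qed

lemma normal_flux_boundary:
  assumes S: "S \<in> boundary_facets \<T> \<Omega>" and x: "x \<in> rel_interior S"
    and v: "\<And>T y. T \<in> \<T> \<Longrightarrow> y \<in> interior T \<Longrightarrow> v y = a T + b T *\<^sub>R y"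
  shows "measure surface S * (facet_value \<T> v x \<bullet> outward_normal \<Omega> x) = real CARD('d) * facet_jump a b S"
proof -
  note e = boundary_elem[OF S]
  let ?T = "elem S"
  let ?g = "bary_grad ?T S"
  have g: "norm ?g > 0" using bary_grad_nonzero[OF full[OF e(2)] e(3)] by simp
  have fv: "facet_value \<T> v x = a ?T + b ?T *\<^sub>R x"
    by (rule facet_value_boundary[OF e(1) x isCont_rt]) (rule v[OF e(2)])
  have b0: "bary ?T S x = 0" using x rel_interior_facet_iff[OF full[OF e(2)] e(3)] by simp
  have "facet_value \<T> v x \<bullet> outward_normal \<Omega> x = rt_coef ?T S (a ?T) (b ?T) / norm ?g"
    unfolding fv outward_normal_facet[OF S e(2,3) x]
    using normal_component_on_facet[OF full[OF e(2)] e(3) b0, of "a ?T" "b ?T"] by (simp add: divide_inverse mult.commute)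
  moreover have "facet_jump a b S = measure lebesgue ?T * rt_coef ?T S (a ?T) (b ?T)"
    unfolding facet_jump_def e(1) by simp
  ultimately show ?thesis using g by (simp add: surface_measure_facet[OF full[OF e(2)] e(3)])
qed

end

section \<open>The discrete problems in coordinates\<close>

lemma one_sided_slope_nonneg:
  fixes k Q \<epsilon> :: real
  assumes "\<epsilon> > 0" and q: "\<And>t. 0 < t \<Longrightarrow> t < \<epsilon> \<Longrightarrow> 0 \<le> t * k + t\<^sup>2 * Q"
  shows "0 \<le> k"
proof (rule ccontr)
  assume "\<not> 0 \<le> k"
  then have k: "k < 0" by simp
  define t where "t = min (\<epsilon> / 2) (- k / (2 * (\<bar>Q\<bar> + 1)))"
  have "0 < - k / (2 * (\<bar>Q\<bar> + 1))" using k by (intro divide_pos_pos) auto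
  then have t: "0 < t" "t < \<epsilon>" unfolding t_def using assms(1) by linarith+
  have "t * (\<bar>Q\<bar> + 1) \<le> (- k / (2 * (\<bar>Q\<bar> + 1))) * (\<bar>Q\<bar> + 1)" by (intro mult_right_mono) (auto simp: t_def)
  also have "\<dots> = - k / 2" by (simp add: field_simps)
  finally have "t * (\<bar>Q\<bar> + 1) \<le> - k / 2" .
  moreover have "t * Q \<le> t * (\<bar>Q\<bar> + 1)" using t by (intro mult_left_mono) auto
  ultimately have "t * Q \<le> - k / 2" by linarith
  then have "k + t * Q < 0" using k by simp
  then have "t * (k + t * Q) < 0" using t by (simp add: mult_pos_neg)
  then show False using q[OF t] by (simp add: power2_eq_square algebra_simps)
qed

text \<open>\<open>A\<close>, \<open>\<gamma>\<close>, \<open>\<alpha>\<^sub>S\<close>, \<open>\<beta>\<^sub>S\<close> and \<open>\<pi>\<close> are the elementwise and facetwise constants behind the discrete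
  data.\<close>

locale discrete_problem = mesh \<T> \<Omega> for \<T> :: "(real^'d) set set" and \<Omega> +
  fixes \<Gamma>D \<Gamma>C :: "(real^'d) set"
    and Kh :: "real^'d \<Rightarrow> real^'d^'d" and fh \<alpha>h \<beta>h pDh :: "real^'d \<Rightarrow> real"
    and A :: "(real^'d) set \<Rightarrow> real^'d^'d" and \<gamma> \<alpha>\<^sub>S \<beta>\<^sub>S \<pi> :: "(real^'d) set \<Rightarrow> real"
  assumes parts: "openin (top_of_set (frontier \<Omega>)) \<Gamma>D" "openin (top_of_set (frontier \<Omega>)) \<Gamma>C" "\<Gamma>D \<inter> \<Gamma>C = {}"
    and separated: "\<forall>S\<in>boundary_facets \<T> \<Omega>. (S \<subseteq> closure \<Gamma>D) \<noteq> (S \<subseteq> closure \<Gamma>C)"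
    and Kh: "\<And>T x. T \<in> \<T> \<Longrightarrow> x \<in> interior T \<Longrightarrow> Kh x = A T"
    and A_sym: "\<And>T. T \<in> \<T> \<Longrightarrow> transpose (A T) = A T"
    and A_pos: "\<And>T x. T \<in> \<T> \<Longrightarrow> x \<noteq> 0 \<Longrightarrow> 0 < x \<bullet> (A T *v x)"
    and fh: "\<And>T x. T \<in> \<T> \<Longrightarrow> x \<in> interior T \<Longrightarrow> fh x = \<gamma> T"
    and \<alpha>h: "\<And>S x. S \<in> facets \<T> \<Longrightarrow> x \<in> rel_interior S \<Longrightarrow> \<alpha>h x = \<alpha>\<^sub>S S"
    and \<beta>h: "\<And>S x. S \<in> facets \<T> \<Longrightarrow> x \<in> rel_interior S \<Longrightarrow> \<beta>h x = \<beta>\<^sub>S S"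
    and pDh: "cr_rep pDh (cr_grad \<pi>) (cr_off \<pi>) \<pi>"
begin

abbreviation "FD \<equiv> facets_on \<T> \<Omega> \<Gamma>D"
abbreviation "FC \<equiv> facets_on \<T> \<Omega> \<Gamma>C"
abbreviation "vol T \<equiv> measure lebesgue T"
abbreviation "area S \<equiv> measure surface S"

lemma boundary_facets_partition: "boundary_facets \<T> \<Omega> = FD \<union> FC" "FD \<inter> FC = {}"
  using separated by (auto simp: facets_on_def)

lemma parts_subset: "\<Gamma>D \<subseteq> frontier \<Omega>" "\<Gamma>C \<subseteq> frontier \<Omega>"
  using parts openin_subset by fastforce+

lemma sep: "S \<in> boundary_facets \<T> \<Omega> \<Longrightarrow> S \<subseteq> closure \<Gamma>D \<or> S \<subseteq> closure \<Gamma>C"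
  "S \<in> boundary_facets \<T> \<Omega> \<Longrightarrow> S \<subseteq> closure \<Gamma>C \<or> S \<subseteq> closure \<Gamma>D"
  using separated by blast+

lemma boundary_of_part: "S \<in> FD \<Longrightarrow> S \<in> boundary_facets \<T> \<Omega>" "S \<in> FC \<Longrightarrow> S \<in> boundary_facets \<T> \<Omega>"
  by (auto simp: facets_on_def)

lemma area_pos: "S \<in> boundary_facets \<T> \<Omega> \<Longrightarrow> area S > 0"
  using surface_measure_facet_pos[OF full] boundary_elem by blast

lemma young:
  assumes T: "T \<in> \<T>"
  shows "(norm (psd_sqrt (A T) *v g))\<^sup>2 = g \<bullet> (A T *v g)"
    and "- 2 * (g \<bullet> w) \<le> (norm (psd_sqrt (A T) *v g))\<^sup>2 + (norm (matrix_inv (psd_sqrt (A T)) *v w))\<^sup>2"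
    and "w = - (A T *v g) \<Longrightarrow>
      (norm (psd_sqrt (A T) *v g))\<^sup>2 + (norm (matrix_inv (psd_sqrt (A T)) *v w))\<^sup>2 = - 2 * (g \<bullet> w)"
proof -
  show "(norm (psd_sqrt (A T) *v g))\<^sup>2 = g \<bullet> (A T *v g)"
    by (rule psd_sqrt_young(1)) (use A_sym[OF T] A_pos[OF T] in auto)
  show "- 2 * (g \<bullet> w) \<le> (norm (psd_sqrt (A T) *v g))\<^sup>2 + (norm (matrix_inv (psd_sqrt (A T)) *v w))\<^sup>2"
    by (rule psd_sqrt_young(2)) (use A_sym[OF T] A_pos[OF T] in auto)
  show "(norm (psd_sqrt (A T) *v g))\<^sup>2 + (norm (matrix_inv (psd_sqrt (A T)) *v w))\<^sup>2 = - 2 * (g \<bullet> w)"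
    if "w = - (A T *v g)"
    by (rule psd_sqrt_young(3)) (use A_sym[OF T] A_pos[OF T] that in auto)
qed

definition local_energy :: "(real^'d) set \<Rightarrow> ((real^'d) set \<Rightarrow> real) \<Rightarrow> real" where
  "local_energy T \<xi> = vol T * ((1/2) * (norm (psd_sqrt (A T) *v cr_grad \<xi> T))\<^sup>2
      - \<gamma> T * (cr_grad \<xi> T \<bullet> barycenter T + cr_off \<xi> T))"

definition obstacle_energy :: "(real^'d) set \<Rightarrow> real \<Rightarrow> real" where
  "obstacle_energy S t = area S * (\<beta>\<^sub>S S * max 0 t - \<alpha>\<^sub>S S * max 0 (- t))"

definition primal_energy :: "((real^'d) set \<Rightarrow> real) \<Rightarrow> real" where
  "primal_energy \<xi> = (\<Sum>T\<in>\<T>. local_energy T \<xi>) + (\<Sum>S\<in>FC. obstacle_energy S (\<xi> S))"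

lemma set_integral_const_element: "T \<in> \<T> \<Longrightarrow> (LINT x:T|lebesgue. c) = c * vol T" for c :: real
  using set_integral_const_lebesgue lmeasurable_compact[OF compact_full_simplex(1)[OF full]] by blast

lemma I_cr_eq:
  assumes q: "cr_rep q (cr_grad \<xi>) (cr_off \<xi>) \<xi>"
  shows "I_cr \<T> \<Omega> \<Gamma>C Kh fh \<alpha>h \<beta>h q = primal_energy \<xi>"
proof -
  have qi: "q x = cr_grad \<xi> T \<bullet> x + cr_off \<xi> T" if "T \<in> \<T>" "x \<in> interior T" for T x
    using q that by (simp add: cr_rep_def)
  have 1: "(\<integral>x. (norm (psd_sqrt (Kh x) *v broken_grad \<T> q x))\<^sup>2 \<partial>lebesgue_on \<Omega>)
      = (\<Sum>T\<in>\<T>. (norm (psd_sqrt (A T) *v cr_grad \<xi> T))\<^sup>2 * vol T)"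
    by (subst integral_elementwise(2)[where f="\<lambda>T x. (norm (psd_sqrt (A T) *v cr_grad \<xi> T))\<^sup>2"])
      (auto simp: Kh broken_grad_affine[OF _ qi] set_integral_const_element)
  have 2: "(\<integral>x. fh x * elem_proj \<T> q x \<partial>lebesgue_on \<Omega>)
      = (\<Sum>T\<in>\<T>. (\<gamma> T * (cr_grad \<xi> T \<bullet> barycenter T + cr_off \<xi> T)) * vol T)"
    by (subst integral_elementwise(2)[where f="\<lambda>T x. \<gamma> T * (cr_grad \<xi> T \<bullet> barycenter T + cr_off \<xi> T)"])
      (auto simp: fh elem_proj_affine[OF _ qi] set_integral_const_element mult_ac)
  have fp: "facet_proj \<T> (facet_value \<T> q) x = \<xi> S" if "S \<in> FC" "x \<in> rel_interior S" for S x
    using facet_proj_rel_interior[OF _ that(2)] facet_mean_facet_value[OF q] boundary_of_part(2)[OF that(1)]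
    by (simp add: boundary_facets_def)
  have FCf: "S \<in> facets \<T>" if "S \<in> FC" for S using that by (auto simp: facets_on_def boundary_facets_def)
  note part = surface_integral_part[OF parts(2) parts_subset(1) _ sep(2), of _ "\<lambda>_. 0"]
  have DC: "\<Gamma>C \<inter> \<Gamma>D = {}" using parts(3) by blast
  have 3: "(LINT x:closure \<Gamma>C|surface. \<beta>h x * max 0 (facet_proj \<T> (facet_value \<T> q) x))
      = (\<Sum>S\<in>FC. area S * (\<beta>\<^sub>S S * max 0 (\<xi> S)))"
    using part[OF DC, of "\<lambda>x. \<beta>h x * max 0 (facet_proj \<T> (facet_value \<T> q) x)" "\<lambda>S. \<beta>\<^sub>S S * max 0 (\<xi> S)"] fp \<beta>h FCf by simp
  have 4: "(LINT x:closure \<Gamma>C|surface. \<alpha>h x * max 0 (- facet_proj \<T> (facet_value \<T> q) x))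
      = (\<Sum>S\<in>FC. area S * (\<alpha>\<^sub>S S * max 0 (- \<xi> S)))"
    using part[OF DC, of "\<lambda>x. \<alpha>h x * max 0 (- facet_proj \<T> (facet_value \<T> q) x)" "\<lambda>S. \<alpha>\<^sub>S S * max 0 (- \<xi> S)"] fp \<alpha>h FCf by simp
  show ?thesis
    unfolding I_cr_def 1 2 3 4 primal_energy_def local_energy_def obstacle_energy_def
    by (simp add: sum_subtractf sum_distrib_left right_diff_distrib mult_ac)
qed

lemma K_primal_iff:
  assumes q: "cr_rep q (cr_grad \<xi>) (cr_off \<xi>) \<xi>" and "q \<in> CR1 \<T> \<Omega>"
  shows "q \<in> K_primal \<T> \<Omega> \<Gamma>D pDh \<longleftrightarrow> (\<forall>S\<in>FD. \<xi> S = \<pi> S)"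
proof -
  have "facet_value \<T> q (barycenter S) = \<xi> S" "facet_value \<T> pDh (barycenter S) = \<pi> S" if "S \<in> FD" for S
    using cr_rep_facet_value(2)[OF q] cr_rep_facet_value(2)[OF pDh] that by (auto simp: facets_on_def boundary_facets_def)
  then show ?thesis using assms(2) by (simp add: K_primal_def)
qed

definition is_rt :: "(real^'d \<Rightarrow> real^'d) \<Rightarrow> ((real^'d) set \<Rightarrow> real^'d) \<Rightarrow> ((real^'d) set \<Rightarrow> real) \<Rightarrow> bool" where
  "is_rt v a b \<longleftrightarrow> (\<forall>T\<in>\<T>. \<forall>x\<in>interior T. v x = a T + b T *\<^sub>R x)"

text \<open>On a boundary facet this is the total flux out of the domain, by \<open>normal_flux_boundary\<close>.\<close>

abbreviation "outflow a b S \<equiv> real CARD('d) * facet_jump a b S"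

definition dual_energy :: "((real^'d) set \<Rightarrow> real^'d) \<Rightarrow> ((real^'d) set \<Rightarrow> real) \<Rightarrow> real" where
  "dual_energy a b = - (1/2) * (\<Sum>T\<in>\<T>. vol T * (norm (matrix_inv (psd_sqrt (A T)) *v (a T + b T *\<^sub>R barycenter T)))\<^sup>2)
     - (\<Sum>S\<in>FD. \<pi> S * outflow a b S)"

lemma D_rt_eq:
  assumes v: "is_rt v a b"
  shows "D_rt \<T> \<Omega> \<Gamma>D Kh pDh v = dual_energy a b"
proof -
  have vi: "v x = a T + b T *\<^sub>R x" if "T \<in> \<T>" "x \<in> interior T" for T x
    using v that by (simp add: is_rt_def)
  have 1: "(\<integral>x. (norm (matrix_inv (psd_sqrt (Kh x)) *v elem_proj \<T> v x))\<^sup>2 \<partial>lebesgue_on \<Omega>)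
      = (\<Sum>T\<in>\<T>. (norm (matrix_inv (psd_sqrt (A T)) *v (a T + b T *\<^sub>R barycenter T)))\<^sup>2 * vol T)"
    by (subst integral_elementwise(2)[where f="\<lambda>T x. (norm (matrix_inv (psd_sqrt (A T)) *v (a T + b T *\<^sub>R barycenter T)))\<^sup>2"])
      (auto simp: Kh elem_proj_rt[OF _ vi] set_integral_const_element)
  define \<nu> where "\<nu> S = outflow a b S / area S" for S
  have pv: "facet_value \<T> pDh x * (facet_value \<T> v x \<bullet> outward_normal \<Omega> x)
      = (\<nu> S *\<^sub>R cr_grad \<pi> (elem S)) \<bullet> x + \<nu> S * cr_off \<pi> (elem S)" if "S \<in> FD" "x \<in> rel_interior S" for S x
  proof -
    have S: "S \<in> boundary_facets \<T> \<Omega>" using that(1) boundary_of_part by blast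
    note e = boundary_elem[OF S]
    have "facet_value \<T> v x \<bullet> outward_normal \<Omega> x = \<nu> S"
      using normal_flux_boundary[OF S that(2) vi] area_pos[OF S] by (simp add: \<nu>_def field_simps)
    moreover have "facet_value \<T> pDh x = cr_grad \<pi> (elem S) \<bullet> x + cr_off \<pi> (elem S)"
      by (rule facet_value_boundary[OF e(1) that(2) isCont_affine]) (use pDh e in \<open>auto simp: cr_rep_def\<close>)
    ultimately show ?thesis by (simp add: algebra_simps)
  qed
  have "(LINT x:closure \<Gamma>D|surface. facet_value \<T> pDh x * (facet_value \<T> v x \<bullet> outward_normal \<Omega> x))
      = (\<Sum>S\<in>FD. area S * ((\<nu> S *\<^sub>R cr_grad \<pi> (elem S)) \<bullet> barycenter S + \<nu> S * cr_off \<pi> (elem S)))"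
    by (rule surface_integral_part[OF parts(1) parts_subset(2) parts(3) sep(1) pv])
  also have "\<dots> = (\<Sum>S\<in>FD. \<pi> S * outflow a b S)"
  proof (rule sum.cong[OF refl])
    fix S assume "S \<in> FD"
    then have S: "S \<in> boundary_facets \<T> \<Omega>" using boundary_of_part by blast
    have "cr_grad \<pi> (elem S) \<bullet> barycenter S + cr_off \<pi> (elem S) = \<pi> S"
      using pDh boundary_elem[OF S] by (simp add: cr_rep_def)
    then have "(\<nu> S *\<^sub>R cr_grad \<pi> (elem S)) \<bullet> barycenter S + \<nu> S * cr_off \<pi> (elem S) = \<nu> S * \<pi> S"
      by (simp add: distrib_left[symmetric])
    then show "area S * ((\<nu> S *\<^sub>R cr_grad \<pi> (elem S)) \<bullet> barycenter S + \<nu> S * cr_off \<pi> (elem S)) = \<pi> S * outflow a b S"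
      using area_pos[OF S] by (simp add: \<nu>_def)
  qed
  finally show ?thesis
    unfolding D_rt_def 1 dual_energy_def by (simp add: sum_distrib_left mult_ac)
qed

definition dual_feasible :: "((real^'d) set \<Rightarrow> real^'d) \<Rightarrow> ((real^'d) set \<Rightarrow> real) \<Rightarrow> bool" where
  "dual_feasible a b \<longleftrightarrow> (\<forall>T\<in>\<T>. real CARD('d) * b T = \<gamma> T)
     \<and> (\<forall>S\<in>facets \<T> - boundary_facets \<T> \<Omega>. facet_jump a b S = 0)
     \<and> (\<forall>S\<in>FC. area S * \<alpha>\<^sub>S S \<le> outflow a b S \<and> outflow a b S \<le> area S * \<beta>\<^sub>S S)"

lemma L2_fh: "L2 (lebesgue_on \<Omega>) fh"
  unfolding L2_def
proof
  have "integrable (lebesgue_on \<Omega>) fh" by (rule integral_elementwise(1)[where f="\<lambda>T x. \<gamma> T"]) (auto simp: fh)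
  then show "fh \<in> borel_measurable (lebesgue_on \<Omega>)" by simp
  show "integrable (lebesgue_on \<Omega>) (\<lambda>x. (norm (fh x))\<^sup>2)"
    by (rule integral_elementwise(1)[where f="\<lambda>T x. (norm (\<gamma> T))\<^sup>2"]) (auto simp: fh)
qed

lemma K_star_iff:
  assumes v: "is_rt v a b" and zero: "\<And>x. x \<notin> element_interiors \<T> \<Longrightarrow> v x = 0"
  shows "v \<in> K_star \<T> \<Omega> \<Gamma>C fh \<alpha>h \<beta>h \<longleftrightarrow> dual_feasible a b"
proof -
  have vi: "v x = a T + b T *\<^sub>R x" if "T \<in> \<T>" "x \<in> interior T" for T x
    using v that by (simp add: is_rt_def)
  have L2v: "L2 (lebesgue_on \<Omega>) v"
    unfolding L2_def
  proof
    have "integrable (lebesgue_on \<Omega>) v"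
      by (rule integral_elementwise(1)[where f="\<lambda>T x. a T + b T *\<^sub>R x"]) (auto simp: vi intro!: continuous_intros)
    then show "v \<in> borel_measurable (lebesgue_on \<Omega>)" by simp
    show "integrable (lebesgue_on \<Omega>) (\<lambda>x. (norm (v x))\<^sup>2)"
      by (rule integral_elementwise(1)[where f="\<lambda>T x. (norm (a T + b T *\<^sub>R x))\<^sup>2"]) (auto simp: vi intro!: continuous_intros)
  qed
  have RT: "has_weak_div \<Omega> v fh \<Longrightarrow> v \<in> RT0 \<T> \<Omega>"
    unfolding RT0_def Hdiv_def using L2v L2_fh vi zero by blast
  have wd: "has_weak_div \<Omega> v fh \<longleftrightarrow> (\<forall>T\<in>\<T>. real CARD('d) * b T = \<gamma> T)
     \<and> (\<forall>S\<in>facets \<T> - boundary_facets \<T> \<Omega>. facet_jump a b S = 0)"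
    by (rule weak_div_iff[OF vi fh])
  have nf: "(\<forall>x\<in>rel_interior S. \<alpha>h x \<le> facet_value \<T> v x \<bullet> outward_normal \<Omega> x \<and> facet_value \<T> v x \<bullet> outward_normal \<Omega> x \<le> \<beta>h x)
      \<longleftrightarrow> area S * \<alpha>\<^sub>S S \<le> outflow a b S \<and> outflow a b S \<le> area S * \<beta>\<^sub>S S" if "S \<in> FC" for S
  proof -
    have S: "S \<in> boundary_facets \<T> \<Omega>" using that boundary_of_part by blast
    note e = boundary_elem[OF S]
    have "\<alpha>h x \<le> facet_value \<T> v x \<bullet> outward_normal \<Omega> x \<and> facet_value \<T> v x \<bullet> outward_normal \<Omega> x \<le> \<beta>h x
       \<longleftrightarrow> area S * \<alpha>\<^sub>S S \<le> outflow a b S \<and> outflow a b S \<le> area S * \<beta>\<^sub>S S" if x: "x \<in> rel_interior S" for x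
    proof -
      have n: "area S * (facet_value \<T> v x \<bullet> outward_normal \<Omega> x) = outflow a b S"
        by (rule normal_flux_boundary[OF S x]) (rule vi)
      show ?thesis unfolding \<alpha>h[OF e(4) x] \<beta>h[OF e(4) x] n[symmetric] using area_pos[OF S] by simp
    qed
    then show ?thesis using barycenter_in_rel_interior[OF full[OF e(2)] e(3)] by blast
  qed
  show ?thesis unfolding K_star_def dual_feasible_def using RT wd nf by blast
qed

lemma K_star_rep:
  assumes "v \<in> K_star \<T> \<Omega> \<Gamma>C fh \<alpha>h \<beta>h"
  shows "\<exists>a b. is_rt v a b \<and> dual_feasible a b"
proof -
  have rt: "v \<in> RT0 \<T> \<Omega>" using assms by (simp add: K_star_def)
  then have "\<forall>T\<in>\<T>. \<exists>a b. \<forall>x\<in>interior T. v x = a + b *\<^sub>R x" by (simp add: RT0_def)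
  then obtain a b where "\<forall>T\<in>\<T>. \<forall>x\<in>interior T. v x = a T + b T *\<^sub>R x" by metis
  then have v: "is_rt v a b" by (simp add: is_rt_def)
  moreover have "\<And>x. x \<notin> element_interiors \<T> \<Longrightarrow> v x = 0" using rt by (simp add: RT0_def)
  ultimately show ?thesis using K_star_iff[OF v] assms by blast
qed

section \<open>Weak duality\<close>

text \<open>The contributions of an interior facet from its two sides cancel, because its facet value is common
  to both and the normal component of an admissible field has no jump.\<close>

lemma discrete_green:
  assumes ab: "dual_feasible a b"
  shows "(\<Sum>T\<in>\<T>. vol T * ((a T + b T *\<^sub>R barycenter T) \<bullet> cr_grad \<xi> T + \<gamma> T * (cr_grad \<xi> T \<bullet> barycenter T + cr_off \<xi> T)))
    = (\<Sum>S\<in>FD. \<xi> S * outflow a b S) + (\<Sum>S\<in>FC. \<xi> S * outflow a b S)"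
proof -
  let ?d = "real CARD('d)"
  have val: "cr_grad \<xi> T \<bullet> barycenter S + cr_off \<xi> T = \<xi> S" if "T \<in> \<T>" "S facet_of T" for T S
    using cr_rep_cr_fun[of \<xi>] that by (simp add: cr_rep_def)
  have "(\<Sum>T\<in>\<T>. vol T * ((a T + b T *\<^sub>R barycenter T) \<bullet> cr_grad \<xi> T + \<gamma> T * (cr_grad \<xi> T \<bullet> barycenter T + cr_off \<xi> T)))
    = (\<Sum>T\<in>\<T>. \<Sum>S | S facet_of T. ?d * (vol T * rt_coef T S (a T) (b T) * \<xi> S))"
  proof (rule sum.cong[OF refl])
    fix T assume T: "T \<in> \<T>"
    have "?d * b T = \<gamma> T" using ab T by (simp add: dual_feasible_def)
    then have "(a T + b T *\<^sub>R barycenter T) \<bullet> cr_grad \<xi> T + \<gamma> T * (cr_grad \<xi> T \<bullet> barycenter T + cr_off \<xi> T)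
      = ?d * (\<Sum>S | S facet_of T. rt_coef T S (a T) (b T) * (cr_grad \<xi> T \<bullet> barycenter S + cr_off \<xi> T))"
      using discrete_integration_by_parts[OF full[OF T], of "a T" "b T" "cr_grad \<xi> T" "cr_off \<xi> T"] by simp
    also have "\<dots> = ?d * (\<Sum>S | S facet_of T. rt_coef T S (a T) (b T) * \<xi> S)"
      by (intro arg_cong[where f="(*) ?d"] sum.cong refl) (simp add: val[OF T])
    finally show "vol T * ((a T + b T *\<^sub>R barycenter T) \<bullet> cr_grad \<xi> T + \<gamma> T * (cr_grad \<xi> T \<bullet> barycenter T + cr_off \<xi> T))
      = (\<Sum>S | S facet_of T. ?d * (vol T * rt_coef T S (a T) (b T) * \<xi> S))"
      by (simp add: sum_distrib_left mult_ac)
  qed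
  also have "\<dots> = (\<Sum>S\<in>facets \<T>. \<xi> S * outflow a b S)"
    unfolding sum_mesh_facets facet_jump_def by (simp add: sum_distrib_left mult_ac)
  also have "\<dots> = (\<Sum>S\<in>boundary_facets \<T> \<Omega>. \<xi> S * outflow a b S)"
    by (rule sum.mono_neutral_right[OF finite_facets_mesh]) (use ab in \<open>auto simp: boundary_facets_def dual_feasible_def\<close>)
  also have "\<dots> = (\<Sum>S\<in>FD. \<xi> S * outflow a b S) + (\<Sum>S\<in>FC. \<xi> S * outflow a b S)"
    unfolding boundary_facets_partition(1)
    by (rule sum.union_disjoint) (use facets_on_subset(2) boundary_facets_partition(2) in auto)
  finally show ?thesis .
qed

text \<open>By \<open>discrete_green\<close>, the terms with the load and with the Dirichlet values in the two energies
  combine to the cross terms between gradient and flux, and to the fluxes through contact facets.\<close>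

lemma duality_gap:
  assumes ab: "dual_feasible a b" and \<xi>: "\<forall>S\<in>FD. \<xi> S = \<pi> S"
  shows "primal_energy \<xi> - dual_energy a b
    = (\<Sum>T\<in>\<T>. vol T * ((1/2) * ((norm (psd_sqrt (A T) *v cr_grad \<xi> T))\<^sup>2
          + (norm (matrix_inv (psd_sqrt (A T)) *v (a T + b T *\<^sub>R barycenter T)))\<^sup>2)
          + cr_grad \<xi> T \<bullet> (a T + b T *\<^sub>R barycenter T)))
      + (\<Sum>S\<in>FC. obstacle_energy S (\<xi> S) - \<xi> S * outflow a b S)"
proof -
  define E1 where "E1 T = (norm (psd_sqrt (A T) *v cr_grad \<xi> T))\<^sup>2" for T
  define E2 where "E2 T = (norm (matrix_inv (psd_sqrt (A T)) *v (a T + b T *\<^sub>R barycenter T)))\<^sup>2" for T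
  define m where "m T = \<gamma> T * (cr_grad \<xi> T \<bullet> barycenter T + cr_off \<xi> T)" for T
  define w where "w T = cr_grad \<xi> T \<bullet> (a T + b T *\<^sub>R barycenter T)" for T
  have g: "(\<Sum>T\<in>\<T>. vol T * (w T + m T)) = (\<Sum>S\<in>FD. \<xi> S * outflow a b S) + (\<Sum>S\<in>FC. \<xi> S * outflow a b S)"
    unfolding discrete_green[OF ab, symmetric] w_def m_def by (simp add: inner_commute)
  have D: "(\<Sum>S\<in>FD. \<pi> S * outflow a b S) = (\<Sum>S\<in>FD. \<xi> S * outflow a b S)"
    by (rule sum.cong) (use \<xi> in auto)
  have "(\<Sum>T\<in>\<T>. vol T * ((1/2) * (E1 T + E2 T) + w T))
    = (\<Sum>T\<in>\<T>. vol T * ((1/2) * E1 T - m T)) + (1/2) * (\<Sum>T\<in>\<T>. vol T * E2 T) + (\<Sum>T\<in>\<T>. vol T * (w T + m T))"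
    unfolding sum_distrib_left sum.distrib[symmetric] by (rule sum.cong) (simp_all add: algebra_simps)
  then show ?thesis
    unfolding primal_energy_def local_energy_def dual_energy_def E1_def[symmetric] E2_def[symmetric] m_def[symmetric] w_def[symmetric] D
    using g by (simp add: sum_subtractf)
qed

text \<open>Young's inequality on the elements; on a contact facet the obstacle energy is the maximum of
  \<open>\<xi> S * j\<close> over the fluxes \<open>j\<close> between the two bounds.\<close>

lemma weak_duality:
  assumes ab: "dual_feasible a b" and \<xi>: "\<forall>S\<in>FD. \<xi> S = \<pi> S"
  shows "dual_energy a b \<le> primal_energy \<xi>"
proof -
  have "0 \<le> vol T * ((1/2) * ((norm (psd_sqrt (A T) *v cr_grad \<xi> T))\<^sup>2
          + (norm (matrix_inv (psd_sqrt (A T)) *v (a T + b T *\<^sub>R barycenter T)))\<^sup>2)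
          + cr_grad \<xi> T \<bullet> (a T + b T *\<^sub>R barycenter T))" if T: "T \<in> \<T>" for T
  proof (rule mult_nonneg_nonneg)
    show "0 \<le> (1/2) * ((norm (psd_sqrt (A T) *v cr_grad \<xi> T))\<^sup>2
          + (norm (matrix_inv (psd_sqrt (A T)) *v (a T + b T *\<^sub>R barycenter T)))\<^sup>2)
          + cr_grad \<xi> T \<bullet> (a T + b T *\<^sub>R barycenter T)"
    proof -
      have *: "- 2 * z \<le> y \<Longrightarrow> 0 \<le> (1/2) * y + z" for y z :: real by linarith
      show ?thesis by (rule *) (rule young(2)[OF T])
    qed
  qed simp
  moreover have "0 \<le> obstacle_energy S (\<xi> S) - \<xi> S * outflow a b S" if S: "S \<in> FC" for S
  proof -
    have J: "area S * \<alpha>\<^sub>S S \<le> outflow a b S" "outflow a b S \<le> area S * \<beta>\<^sub>S S"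
      using ab S by (auto simp: dual_feasible_def)
    show ?thesis
    proof (cases "0 \<le> \<xi> S")
      case True
      then show ?thesis using mult_right_mono[OF J(2) True] by (simp add: obstacle_energy_def mult_ac)
    next
      case False
      then show ?thesis using mult_right_mono_neg[OF J(1), of "\<xi> S"] by (simp add: obstacle_energy_def mult_ac)
    qed
  qed
  ultimately have "0 \<le> primal_energy \<xi> - dual_energy a b"
    unfolding duality_gap[OF ab \<xi>] by (intro add_nonneg_nonneg sum_nonneg) auto
  then show ?thesis by simp
qed

section \<open>Strong duality by reconstruction of the flux\<close>

text \<open>Marini's reconstruction: the field with divergence \<open>\<gamma> T\<close> whose value at the barycenter of \<open>T\<close> is
  \<open>- A T *v cr_grad \<xi> T\<close>, so that Young's inequality holds with equality.\<close>

definition marini_slope :: "(real^'d) set \<Rightarrow> real" where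
  "marini_slope T = \<gamma> T / real CARD('d)"

definition marini_const :: "((real^'d) set \<Rightarrow> real) \<Rightarrow> (real^'d) set \<Rightarrow> real^'d" where
  "marini_const \<xi> T = - (A T *v cr_grad \<xi> T) - marini_slope T *\<^sub>R barycenter T"

text \<open>The right hand side is, per unit volume, minus the derivative of \<open>local_energy T\<close> with respect to the value
  at \<open>S\<close>: the gradient changes by \<open>- d * bary_grad T S\<close> and the mean value by \<open>1 / (d + 1)\<close>.\<close>

lemma marini_coef:
  assumes T: "T \<in> \<T>" "S facet_of T"
  shows "real CARD('d) * rt_coef T S (marini_const \<xi> T) (marini_slope T)
    = real CARD('d) * (bary_grad T S \<bullet> (A T *v cr_grad \<xi> T)) + \<gamma> T / (real CARD('d) + 1)"
proof -
  let ?d = "real CARD('d)"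
  have "bary T S (barycenter T) = 1 / (?d + 1)" using bary_barycenter_simplex[OF full[OF T(1)] T(2)] by simp
  then have "bary_grad T S \<bullet> (barycenter S - barycenter T) = - 1 / (?d + 1)"
    using bary_affine[of T S "barycenter S" "barycenter T"] bary_barycenter_facet[OF full[OF T(1)] T(2,2)] by simp
  moreover have "rt_coef T S (marini_const \<xi> T) (marini_slope T)
      = bary_grad T S \<bullet> (A T *v cr_grad \<xi> T) - marini_slope T * (bary_grad T S \<bullet> (barycenter S - barycenter T))"
    unfolding rt_coef_def marini_const_def inner_commute[of _ "bary_grad T S"]
    by (simp add: inner_diff_right inner_add_right algebra_simps)
  ultimately have "rt_coef T S (marini_const \<xi> T) (marini_slope T)
      = bary_grad T S \<bullet> (A T *v cr_grad \<xi> T) + marini_slope T / (?d + 1)" by simp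
  moreover have "?d * (marini_slope T / (?d + 1)) = \<gamma> T / (?d + 1)" by (simp add: marini_slope_def)
  ultimately show ?thesis by (simp only: distrib_left)
qed

definition bump_at :: "((real^'d) set \<Rightarrow> real) \<Rightarrow> (real^'d) set \<Rightarrow> real \<Rightarrow> (real^'d) set \<Rightarrow> real" where
  "bump_at \<xi> R t S = \<xi> S + (if S = R then t else 0)"

lemma energy_expansion:
  assumes R: "R \<in> facets \<T>"
  shows "\<exists>Q. \<forall>t. (\<Sum>T\<in>\<T>. local_energy T (bump_at \<xi> R t)) - (\<Sum>T\<in>\<T>. local_energy T \<xi>)
    = - t * outflow (marini_const \<xi>) marini_slope R + t\<^sup>2 * Q"
proof -
  let ?d = "real CARD('d)"
  define h where "h T = (if R facet_of T then - (?d *\<^sub>R bary_grad T R) else 0)" for T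
  define k where "k T = (if R facet_of T then 1 / (?d + 1) else 0)" for T
  have cg: "cr_grad (bump_at \<xi> R t) T = cr_grad \<xi> T + t *\<^sub>R h T" if T: "T \<in> \<T>" for T t
  proof -
    have "(\<Sum>S | S facet_of T. bump_at \<xi> R t S *\<^sub>R bary_grad T S)
      = (\<Sum>S | S facet_of T. \<xi> S *\<^sub>R bary_grad T S + (if S = R then t *\<^sub>R bary_grad T R else 0))"
      by (rule sum.cong) (auto simp: bump_at_def scaleR_left_distrib)
    also have "\<dots> = (\<Sum>S | S facet_of T. \<xi> S *\<^sub>R bary_grad T S) + (if R facet_of T then t *\<^sub>R bary_grad T R else 0)"
      using finite_facets[OF full[OF T]] by (simp add: sum.distrib)
    finally show ?thesis by (simp add: cr_grad_def h_def scaleR_right_distrib)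
  qed
  have bm: "bary T S (barycenter T) = 1 / (?d + 1)" if T: "T \<in> \<T>" "S facet_of T" for T S
    using bary_barycenter_simplex[OF full[OF T(1)] T(2)] by simp
  have mean: "cr_grad \<zeta> T \<bullet> barycenter T + cr_off \<zeta> T = (\<Sum>S | S facet_of T. \<zeta> S / (?d + 1))" if T: "T \<in> \<T>" for T \<zeta>
    unfolding cr_affine by (rule sum.cong) (use T bm in \<open>auto simp: field_simps\<close>)
  have cm: "cr_grad (bump_at \<xi> R t) T \<bullet> barycenter T + cr_off (bump_at \<xi> R t) T
      = cr_grad \<xi> T \<bullet> barycenter T + cr_off \<xi> T + t * k T" if T: "T \<in> \<T>" for T t
  proof -
    have "(\<Sum>S | S facet_of T. bump_at \<xi> R t S / (?d + 1)) = (\<Sum>S | S facet_of T. \<xi> S / (?d + 1) + (if S = R then t / (?d + 1) else 0))"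
      by (rule sum.cong) (auto simp: bump_at_def add_divide_distrib)
    also have "\<dots> = (\<Sum>S | S facet_of T. \<xi> S / (?d + 1)) + t * k T"
      using finite_facets[OF full[OF T]] by (simp add: sum.distrib k_def)
    finally show ?thesis unfolding mean[OF T] .
  qed
  define Q where "Q = (\<Sum>T\<in>\<T>. vol T * ((1/2) * (h T \<bullet> (A T *v h T))))"
  have loc: "local_energy T (bump_at \<xi> R t) - local_energy T \<xi>
    = t * (vol T * (h T \<bullet> (A T *v cr_grad \<xi> T) - \<gamma> T * k T)) + t\<^sup>2 * (vol T * ((1/2) * (h T \<bullet> (A T *v h T))))"
    if T: "T \<in> \<T>" for T t
  proof -
    have s: "cr_grad \<xi> T \<bullet> (A T *v h T) = h T \<bullet> (A T *v cr_grad \<xi> T)"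
      using symmetric_matrix_inner[OF A_sym[OF T], of "cr_grad \<xi> T" "h T"] by (simp add: inner_commute)
    have "(norm (psd_sqrt (A T) *v (cr_grad \<xi> T + t *\<^sub>R h T)))\<^sup>2
      = cr_grad \<xi> T \<bullet> (A T *v cr_grad \<xi> T) + 2 * t * (h T \<bullet> (A T *v cr_grad \<xi> T)) + t\<^sup>2 * (h T \<bullet> (A T *v h T))"
      unfolding young(1)[OF T]
      by (simp add: matrix_vector_right_distrib matrix_vector_mult_scaleR inner_add_left inner_add_right s power2_eq_square algebra_simps)
    then show ?thesis
      unfolding local_energy_def cm[OF T] unfolding cg[OF T] young(1)[OF T, of "cr_grad \<xi> T"]
      by (simp add: algebra_simps)
  qed
  have "(\<Sum>T\<in>\<T>. vol T * (h T \<bullet> (A T *v cr_grad \<xi> T) - \<gamma> T * k T))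
     = (\<Sum>T\<in>\<T>. if R facet_of T then - (vol T * (?d * rt_coef T R (marini_const \<xi> T) (marini_slope T))) else 0)"
    by (rule sum.cong) (auto simp: marini_coef h_def k_def algebra_simps)
  also have "\<dots> = - outflow (marini_const \<xi>) marini_slope R"
    unfolding facet_jump_def using finite_mesh
    by (simp add: sum.inter_filter[symmetric] sum_negf sum_distrib_left mult_ac)
  finally have lin: "(\<Sum>T\<in>\<T>. vol T * (h T \<bullet> (A T *v cr_grad \<xi> T) - \<gamma> T * k T)) = - outflow (marini_const \<xi>) marini_slope R" .
  show ?thesis
  proof (intro exI[of _ Q] allI)
    fix t
    have "(\<Sum>T\<in>\<T>. local_energy T (bump_at \<xi> R t)) - (\<Sum>T\<in>\<T>. local_energy T \<xi>)
      = (\<Sum>T\<in>\<T>. t * (vol T * (h T \<bullet> (A T *v cr_grad \<xi> T) - \<gamma> T * k T)) + t\<^sup>2 * (vol T * ((1/2) * (h T \<bullet> (A T *v h T)))))"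
      unfolding sum_subtractf[symmetric] by (rule sum.cong) (simp_all add: loc)
    also have "\<dots> = t * (- outflow (marini_const \<xi>) marini_slope R) + t\<^sup>2 * Q"
      unfolding sum.distrib Q_def sum_distrib_left[symmetric] lin ..
    finally show "(\<Sum>T\<in>\<T>. local_energy T (bump_at \<xi> R t)) - (\<Sum>T\<in>\<T>. local_energy T \<xi>)
      = - t * outflow (marini_const \<xi>) marini_slope R + t\<^sup>2 * Q" by simp
  qed
qed

context
  fixes \<xi>
  assumes min: "\<And>\<zeta>. \<forall>S\<in>FD. \<zeta> S = \<pi> S \<Longrightarrow> primal_energy \<xi> \<le> primal_energy \<zeta>"
    and \<xi>D: "\<forall>S\<in>FD. \<xi> S = \<pi> S"
begin

lemma variation:
  assumes R: "R \<in> facets \<T>" "R \<notin> FD"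
  shows "\<exists>Q. \<forall>t. 0 \<le> - t * outflow (marini_const \<xi>) marini_slope R + t\<^sup>2 * Q
    + (if R \<in> FC then obstacle_energy R (\<xi> R + t) - obstacle_energy R (\<xi> R) else 0)"
proof -
  obtain Q where Q: "\<And>t. (\<Sum>T\<in>\<T>. local_energy T (bump_at \<xi> R t)) - (\<Sum>T\<in>\<T>. local_energy T \<xi>)
    = - t * outflow (marini_const \<xi>) marini_slope R + t\<^sup>2 * Q"
    using energy_expansion[OF R(1), of \<xi>] by blast
  have O: "(\<Sum>S\<in>FC. obstacle_energy S (bump_at \<xi> R t S)) - (\<Sum>S\<in>FC. obstacle_energy S (\<xi> S))
      = (if R \<in> FC then obstacle_energy R (\<xi> R + t) - obstacle_energy R (\<xi> R) else 0)" for t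
  proof -
    have "(\<Sum>S\<in>FC. obstacle_energy S (bump_at \<xi> R t S)) - (\<Sum>S\<in>FC. obstacle_energy S (\<xi> S))
      = (\<Sum>S\<in>FC. if S = R then obstacle_energy R (\<xi> R + t) - obstacle_energy R (\<xi> R) else 0)"
      unfolding sum_subtractf[symmetric] by (rule sum.cong) (auto simp: bump_at_def)
    then show ?thesis using facets_on_subset(2) by simp
  qed
  have m: "primal_energy \<xi> \<le> primal_energy (bump_at \<xi> R t)" for t
    by (rule min) (use \<xi>D R(2) in \<open>auto simp: bump_at_def\<close>)
  have "0 \<le> - t * outflow (marini_const \<xi>) marini_slope R + t\<^sup>2 * Q
    + (if R \<in> FC then obstacle_energy R (\<xi> R + t) - obstacle_energy R (\<xi> R) else 0)" for t
    unfolding O[of t, symmetric] Q[of t, symmetric] using m[of t] unfolding primal_energy_def by linarith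
  then show ?thesis by blast
qed

text \<open>On an interior facet, variations of both signs are compared with the same smooth energy.\<close>

lemma marini_continuous:
  assumes R: "R \<in> facets \<T> - boundary_facets \<T> \<Omega>"
  shows "facet_jump (marini_const \<xi>) marini_slope R = 0"
proof -
  let ?J = "outflow (marini_const \<xi>) marini_slope R"
  have nR: "R \<notin> FD" "R \<notin> FC" using R boundary_of_part by blast+
  have "\<exists>Q. \<forall>t. 0 \<le> - t * ?J + t\<^sup>2 * Q" using variation[OF _ nR(1)] R nR(2) by simp
  then obtain Q where Q: "\<And>t. 0 \<le> - t * ?J + t\<^sup>2 * Q" by blast
  have "0 \<le> - ?J" by (rule one_sided_slope_nonneg[of 1 _ Q]) (use Q in auto)
  moreover have "0 \<le> ?J"
  proof (rule one_sided_slope_nonneg[of 1 _ Q])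
    show "0 \<le> t * ?J + t\<^sup>2 * Q" for t using Q[of "-t"] by simp
  qed simp
  ultimately show ?thesis by simp
qed

text \<open>The obstacle energy is piecewise linear, with slope \<open>lo\<close> for negative and \<open>up\<close> for positive values.
  Minimality under variations of the value at \<open>R\<close> forces the flux to be this slope on either side of \<open>0\<close>, and
  to lie between the two slopes at \<open>0\<close>.\<close>

lemma marini_complementarity:
  assumes R: "R \<in> FC" and le: "\<alpha>\<^sub>S R \<le> \<beta>\<^sub>S R"
  defines "J \<equiv> outflow (marini_const \<xi>) marini_slope R"
  shows "area R * \<alpha>\<^sub>S R \<le> J" "J \<le> area R * \<beta>\<^sub>S R" "obstacle_energy R (\<xi> R) = \<xi> R * J"
proof -
  have bR: "R \<in> boundary_facets \<T> \<Omega>" by (rule boundary_of_part(2)[OF R])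
  have "R \<in> facets \<T>" "R \<notin> FD" using bR R boundary_facets_partition(2) by (auto simp: boundary_facets_def)
  from variation[OF this] obtain Q where
    Q: "\<And>t. 0 \<le> - t * J + t\<^sup>2 * Q + (obstacle_energy R (\<xi> R + t) - obstacle_energy R (\<xi> R))"
    using R unfolding J_def by auto
  have ab: "area R * \<alpha>\<^sub>S R \<le> area R * \<beta>\<^sub>S R" using le area_pos[OF bR] by simp
  define up where "up = area R * \<beta>\<^sub>S R"
  define lo where "lo = area R * \<alpha>\<^sub>S R"
  have oe: "obstacle_energy R t = (if 0 \<le> t then up * t else lo * t)" for t
    by (simp add: obstacle_energy_def up_def lo_def max_def)
  have right: "J \<le> up" if c: "0 \<le> \<xi> R"
  proof -
    have "0 \<le> up - J"
    proof (rule one_sided_slope_nonneg[of 1 _ Q])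
      fix t :: real assume "0 < t"
      then show "0 \<le> t * (up - J) + t\<^sup>2 * Q" using Q[of t] c by (simp add: oe algebra_simps)
    qed simp
    then show ?thesis by simp
  qed
  have left: "lo \<le> J" if c: "\<xi> R \<le> 0"
  proof -
    have "0 \<le> J - lo"
    proof (rule one_sided_slope_nonneg[of 1 _ Q])
      fix t :: real assume "0 < t"
      then show "0 \<le> t * (J - lo) + t\<^sup>2 * Q" using Q[of "-t"] c by (cases "\<xi> R = 0") (auto simp: oe algebra_simps)
    qed simp
    then show ?thesis by simp
  qed
  have pos: "J = up" if c: "0 < \<xi> R"
  proof (rule antisym)
    show "J \<le> up" using right c by simp
    have "0 \<le> J - up"
    proof (rule one_sided_slope_nonneg[of "\<xi> R" _ Q])
      fix t :: real assume "0 < t" "t < \<xi> R"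
      then show "0 \<le> t * (J - up) + t\<^sup>2 * Q" using Q[of "-t"] c by (simp add: oe algebra_simps)
    qed (rule c)
    then show "up \<le> J" by simp
  qed
  have neg: "J = lo" if c: "\<xi> R < 0"
  proof (rule antisym)
    show "lo \<le> J" using left c by simp
    have "0 \<le> lo - J"
    proof (rule one_sided_slope_nonneg[of "- \<xi> R" _ Q])
      fix t :: real assume "0 < t" "t < - \<xi> R"
      then show "0 \<le> t * (lo - J) + t\<^sup>2 * Q" using Q[of t] c by (simp add: oe algebra_simps)
    qed (use c in simp)
    then show "J \<le> lo" by simp
  qed
  have lu: "lo \<le> up" using ab by (simp add: lo_def up_def)
  consider "\<xi> R < 0" | "\<xi> R = 0" | "0 < \<xi> R" by linarith
  then have "lo \<le> J \<and> J \<le> up \<and> obstacle_energy R (\<xi> R) = \<xi> R * J"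
    using left right pos neg lu by cases (auto simp: oe)
  then show "area R * \<alpha>\<^sub>S R \<le> J" "J \<le> area R * \<beta>\<^sub>S R" "obstacle_energy R (\<xi> R) = \<xi> R * J"
    by (simp_all add: lo_def up_def)
qed

lemma marini_optimal:
  assumes le: "\<forall>S\<in>FC. \<alpha>\<^sub>S S \<le> \<beta>\<^sub>S S"
  shows "dual_feasible (marini_const \<xi>) marini_slope"
    "dual_energy (marini_const \<xi>) marini_slope = primal_energy \<xi>"
proof -
  show f: "dual_feasible (marini_const \<xi>) marini_slope"
    unfolding dual_feasible_def using marini_continuous marini_complementarity(1,2) le
    by (auto simp: marini_slope_def)
  have young: "(1/2) * ((norm (psd_sqrt (A T) *v cr_grad \<xi> T))\<^sup>2
          + (norm (matrix_inv (psd_sqrt (A T)) *v (marini_const \<xi> T + marini_slope T *\<^sub>R barycenter T)))\<^sup>2)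
          + cr_grad \<xi> T \<bullet> (marini_const \<xi> T + marini_slope T *\<^sub>R barycenter T) = 0" if T: "T \<in> \<T>" for T
    using young(3)[OF T, of "marini_const \<xi> T + marini_slope T *\<^sub>R barycenter T" "cr_grad \<xi> T"]
    by (simp add: marini_const_def)
  have "primal_energy \<xi> - dual_energy (marini_const \<xi>) marini_slope = 0"
    unfolding duality_gap[OF f \<xi>D] using young marini_complementarity(3) le by simp
  then show "dual_energy (marini_const \<xi>) marini_slope = primal_energy \<xi>" by simp
qed

end

theorem strong_duality:
  assumes p: "p \<in> K_primal \<T> \<Omega> \<Gamma>D pDh"
      "\<And>q. q \<in> K_primal \<T> \<Omega> \<Gamma>D pDh \<Longrightarrow> I_cr \<T> \<Omega> \<Gamma>C Kh fh \<alpha>h \<beta>h p \<le> I_cr \<T> \<Omega> \<Gamma>C Kh fh \<alpha>h \<beta>h q"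
    and u: "u \<in> K_star \<T> \<Omega> \<Gamma>C fh \<alpha>h \<beta>h"
      "\<And>v. v \<in> K_star \<T> \<Omega> \<Gamma>C fh \<alpha>h \<beta>h \<Longrightarrow> D_rt \<T> \<Omega> \<Gamma>D Kh pDh v \<le> D_rt \<T> \<Omega> \<Gamma>D Kh pDh u"
  shows "I_cr \<T> \<Omega> \<Gamma>C Kh fh \<alpha>h \<beta>h p = D_rt \<T> \<Omega> \<Gamma>D Kh pDh u"
proof -
  have "p \<in> CR1 \<T> \<Omega>" using p(1) by (simp add: K_primal_def)
  then obtain \<xi> where \<xi>: "cr_rep p (cr_grad \<xi>) (cr_off \<xi>) \<xi>" using CR1_rep by blast
  have \<xi>D: "\<forall>S\<in>FD. \<xi> S = \<pi> S" using K_primal_iff[OF \<xi> \<open>p \<in> CR1 \<T> \<Omega>\<close>] p(1) by blast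
  have min: "primal_energy \<xi> \<le> primal_energy \<zeta>" if "\<forall>S\<in>FD. \<zeta> S = \<pi> S" for \<zeta>
  proof -
    have "cr_fun \<zeta> \<in> K_primal \<T> \<Omega> \<Gamma>D pDh" using K_primal_iff[OF cr_rep_cr_fun cr_fun_CR1] that by blast
    from p(2)[OF this] show ?thesis unfolding I_cr_eq[OF \<xi>] I_cr_eq[OF cr_rep_cr_fun] .
  qed
  obtain a b where ab: "is_rt u a b" "dual_feasible a b" using K_star_rep[OF u(1)] by blast
  \<comment> \<open>The bounds on each contact facet are consistent, since the admissible field \<open>u\<close> satisfies them.\<close>
  have le: "\<forall>S\<in>FC. \<alpha>\<^sub>S S \<le> \<beta>\<^sub>S S"
  proof
    fix S assume S: "S \<in> FC"
    then have "area S * \<alpha>\<^sub>S S \<le> area S * \<beta>\<^sub>S S" using ab(2) unfolding dual_feasible_def by (meson order_trans)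
    then show "\<alpha>\<^sub>S S \<le> \<beta>\<^sub>S S" using area_pos[OF boundary_of_part(2)[OF S]] by simp
  qed
  have m: "dual_feasible (marini_const \<xi>) marini_slope"
    "dual_energy (marini_const \<xi>) marini_slope = primal_energy \<xi>"
    by (rule marini_optimal[OF _ \<xi>D le], rule min, assumption)+
  define w where "w x = (\<Sum>T\<in>\<T>. indicator (interior T) x *\<^sub>R (marini_const \<xi> T + marini_slope T *\<^sub>R x))" for x
  have w: "is_rt w (marini_const \<xi>) marini_slope"
    unfolding is_rt_def w_def by (intro ballI) (rule sum_indicator_interior)
  have w0: "w x = 0" if "x \<notin> element_interiors \<T>" for x
    unfolding w_def using that by (intro sum.neutral) (auto simp: element_interiors_def)
  have "w \<in> K_star \<T> \<Omega> \<Gamma>C fh \<alpha>h \<beta>h" using K_star_iff[OF w w0] m(1) by blast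
  from u(2)[OF this] have "primal_energy \<xi> \<le> dual_energy a b"
    unfolding D_rt_eq[OF w] D_rt_eq[OF ab(1)] m(2) .
  moreover have "dual_energy a b \<le> primal_energy \<xi>" by (rule weak_duality[OF ab(2) \<xi>D])
  ultimately show ?thesis unfolding I_cr_eq[OF \<xi>] D_rt_eq[OF ab(1)] by simp
qed

end

section \<open>The gap identity\<close>

theorem theorem6p3:
  fixes \<Omega> \<Gamma>D \<Gamma>C :: "(real^'d) set"
    and f p_D p_hat \<alpha> \<beta> :: "real^'d \<Rightarrow> real"
    and K :: "real^'d \<Rightarrow> real^'d^'d"
    and k0 k1 :: real
    and \<T> :: "(real^'d) set set"
    and Kh :: "real^'d \<Rightarrow> real^'d^'d"
    and fh \<alpha>h \<beta>h pDh :: "real^'d \<Rightarrow> real"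
    and I_h :: "(real^'d \<Rightarrow> real) \<Rightarrow> real"
    and D_h :: "(real^'d \<Rightarrow> real^'d) \<Rightarrow> real"
    and K_h_primal :: "(real^'d \<Rightarrow> real) set"
    and K_h_star :: "(real^'d \<Rightarrow> real^'d) set"
    and p_cr :: "real^'d \<Rightarrow> real"
    and u_rt :: "real^'d \<Rightarrow> real^'d"
  assumes dim: "CARD('d) \<in> {2, 3}"
    and domain: "polyhedral_lipschitz_domain \<Omega>"
    and boundary: "frontier \<Omega> = closure \<Gamma>D \<union> closure \<Gamma>C"
      "openin (top_of_set (frontier \<Omega>)) \<Gamma>D" "openin (top_of_set (frontier \<Omega>)) \<Gamma>C"
      "\<Gamma>D \<inter> \<Gamma>C = {}"
    and f: "L2 (lebesgue_on \<Omega>) f"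
    and p_D: "p_D \<in> H_half \<Omega> \<Gamma>D"
    and K: "K \<in> borel_measurable (lebesgue_on \<Omega>)"
      "\<forall>x\<in>\<Omega>. transpose (K x) = K x"
      "0 < k0" "k0 < k1"
      "\<forall>x\<in>\<Omega>. \<forall>\<xi>. k0 * (norm \<xi>)\<^sup>2 \<le> \<xi> \<bullet> (K x *v \<xi>) \<and> \<xi> \<bullet> (K x *v \<xi>) \<le> k1 * (norm \<xi>)\<^sup>2"
    and obstacles: "L2 (restrict_space surface \<Gamma>C) \<alpha>" "L2 (restrict_space surface \<Gamma>C) \<beta>"
      "AE x in restrict_space surface \<Gamma>C. \<alpha> x \<le> \<beta> x"
    and compatibility: "\<Gamma>D = {} \<Longrightarrow>
      (LINT x:\<Gamma>C|surface. \<alpha> x) \<le> (LINT x:\<Omega>|lebesgue. f x) \<and>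
      (LINT x:\<Omega>|lebesgue. f x) \<le> (LINT x:\<Gamma>C|surface. \<beta> x)"
    and mesh: "simplicial_mesh \<T> \<Omega>"
      "\<forall>S\<in>boundary_facets \<T> \<Omega>. (S \<subseteq> closure \<Gamma>D) \<noteq> (S \<subseteq> closure \<Gamma>C)"
    and p_hat: "p_hat \<in> H1 \<Omega>" "has_trace \<Omega> p_hat \<Gamma>D p_D"
    and discrete_data: "Kh = elem_proj \<T> K" "fh = elem_proj \<T> f"
      "\<alpha>h = facet_proj \<T> \<alpha>" "\<beta>h = facet_proj \<T> \<beta>" "pDh = CR_interp \<T> \<Omega> p_hat"
    and energies: "I_h = I_cr \<T> \<Omega> \<Gamma>C Kh fh \<alpha>h \<beta>h" "D_h = D_rt \<T> \<Omega> \<Gamma>D Kh pDh"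
    and admissible: "K_h_primal = K_primal \<T> \<Omega> \<Gamma>D pDh"
      "K_h_star = K_star \<T> \<Omega> \<Gamma>C fh \<alpha>h \<beta>h"
    and nonempty: "K_h_star \<noteq> {}"
    and minimizer: "p_cr \<in> K_h_primal" "\<forall>q\<in>K_h_primal. I_h p_cr \<le> I_h q"
    and maximizer: "u_rt \<in> K_h_star" "\<forall>v\<in>K_h_star. D_h v \<le> D_h u_rt"
  shows "\<forall>q\<in>K_h_primal. \<forall>v\<in>K_h_star.
    rho_tot_sq I_h D_h p_cr u_rt q v = eta_gap_sq I_h D_h q v"
proof -
  have op: "open \<Omega>" and lip: "lipschitz_boundary \<Omega>" using domain by (auto simp: polyhedral_lipschitz_domain_def)
  interpret mesh \<T> \<Omega>
    by unfold_locales (use mesh(1) op lipschitz_boundary_interior_closure[OF op lip] in auto)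
  obtain \<pi> where \<pi>: "cr_rep pDh (cr_grad \<pi>) (cr_off \<pi>) \<pi>"
    using CR_interp_rep[of p_hat] discrete_data(5) by auto
  interpret discrete_problem \<T> \<Omega> \<Gamma>D \<Gamma>C Kh fh \<alpha>h \<beta>h pDh
    "\<lambda>T. (1 / measure lebesgue T) *\<^sub>R (LINT y:T|lebesgue. K y)"
    "\<lambda>T. (1 / measure lebesgue T) *\<^sub>R (LINT y:T|lebesgue. f y)"
    "\<lambda>S. facet_mean S \<alpha>" "\<lambda>S. facet_mean S \<beta>" \<pi>
  proof
    show "openin (top_of_set (frontier \<Omega>)) \<Gamma>D" "openin (top_of_set (frontier \<Omega>)) \<Gamma>C" "\<Gamma>D \<inter> \<Gamma>C = {}"
      by (rule boundary)+
    show "\<forall>S\<in>boundary_facets \<T> \<Omega>. (S \<subseteq> closure \<Gamma>D) \<noteq> (S \<subseteq> closure \<Gamma>C)" by (rule mesh(2))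
    show "cr_rep pDh (cr_grad \<pi>) (cr_off \<pi>) \<pi>" by (rule \<pi>)
  qed (simp_all add: discrete_data(1-4) elem_proj_interior facet_proj_rel_interior
      mean_symmetric_positive[OF _ K(1,2,3,5)])
  have "I_h p_cr = D_h u_rt"
    unfolding energies
    by (rule strong_duality) (use minimizer maximizer in \<open>auto simp: energies admissible\<close>)
  then show ?thesis by (simp add: rho_tot_sq_def rho_I_sq_def rho_mD_sq_def eta_gap_sq_def)
qed

end
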